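(* Let $b\in\mathbb{R}^3$, $\alpha>0$, $\varepsilon>0$, $y\in\mathcal{S}(\mathbb{R}^3)$, and let $(Y,\mu)$ be the solution of the coupled Itô stochastic differential equation $$dY_t = -\mu_t\wedge(b\,dt+\varepsilon\,dW_t)-\alpha\,\mu_t\wedge\big(\mu_t\wedge(b\,dt+\varepsilon\,dW_t)\big),\qquad \mu_t=\frac{Y_t}{|Y_t|},\qquad Y_0=y.$$ Then $\displaystyle\lim_{t\to\infty}\mu_t\cdot b=|b|$ almost surely.
   Context: $|\cdot|$ is the Euclidean norm, $\cdot$ the scalar product and $\wedge$ the vector (cross) product on $\mathbb{R}^3$; $\mathcal{S}(\mathbb{R}^3)=\{u\in\mathbb{R}^3: |u|=1\}$. $W$ is a standard $\mathbb{R}^3$-valued Brownian motion on a probability space $(\Omega,\mathcal{A},\mathbb{P})$, with natural filtration $\mathbb{F}=(\mathcal{F}_t)_{t\ge0}$ augmented with the $\mathbb{P}$-null sets. For $x\in\mathbb{R}^3$, $L(x)$ is the antisymmetric $3\times3$ matrix with $L(x)v=x\wedge v$ for all $v\in\mathbb{R}^3$; for an adapted process $H$, $\int_0^t H_s\wedge dW_s$ means the Itô integral $\int_0^t L(H_s)\,dW_s$. $(Y,\mu)$ denotes the unique strong solution of the system. *)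

theory Defs
  imports "HOL-Probability.Probability"
begin

text \<open>Processes have type \<^typ>\<open>real \<Rightarrow> 'a \<Rightarrow> 'b\<close>; only their values at times \<open>t \<ge> 0\<close> matter.\<close>

section \<open>Brownian motion and its augmented natural filtration\<close>

text \<open>The density below is that of the centred Gaussian law with covariance \<open>(t - s) I\<close>.\<close>

locale brownian_motion = prob_space M
  for M :: "'a measure" +
  fixes W :: "real \<Rightarrow> 'a \<Rightarrow> real ^ 'n"
  assumes W_measurable: "\<And>t. 0 \<le> t \<Longrightarrow> W t \<in> borel_measurable M"
    and W_zero: "AE \<omega> in M. W 0 \<omega> = 0"
    and W_continuous: "AE \<omega> in M. continuous_on {0..} (\<lambda>t. W t \<omega>)"
    and W_gaussian_increments: "\<And>s t. 0 \<le> s \<Longrightarrow> s < t \<Longrightarrow>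
      distributed M lborel (\<lambda>\<omega>. W t \<omega> - W s \<omega>)
        (\<lambda>x. ennreal (\<Prod>i\<in>UNIV. normal_density 0 (sqrt (t - s)) (x $ i)))"
    and W_indep_increments: "\<And>(\<tau> :: nat \<Rightarrow> real) n. mono \<tau> \<Longrightarrow> 0 \<le> \<tau> 0 \<Longrightarrow>
      indep_vars (\<lambda>_. borel) (\<lambda>k \<omega>. W (\<tau> (Suc k)) \<omega> - W (\<tau> k) \<omega>) {..<n}"

definition augmented_filtration ::
    "'a measure \<Rightarrow> (real \<Rightarrow> 'a \<Rightarrow> 'b :: topological_space) \<Rightarrow> real \<Rightarrow> 'a measure" where
  "augmented_filtration M W t = sigma (space M)
     ({W s -` A \<inter> space M | s A. 0 \<le> s \<and> s \<le> t \<and> A \<in> sets borel} \<union> null_sets M)"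

lemma filtration_augmented_filtration:
  "filtration (space M) (augmented_filtration M W)"
proof
  have sub: "{W s -` A \<inter> space M | s A. 0 \<le> s \<and> s \<le> t \<and> A \<in> sets borel} \<union> null_sets M
      \<subseteq> Pow (space M)" for t
    using sets.sets_into_space by (fastforce simp: null_sets_def)
  show "space (augmented_filtration M W t) = space M" for t
    by (simp add: augmented_filtration_def space_measure_of[OF sub])
  show "sets (augmented_filtration M W s) \<subseteq> sets (augmented_filtration M W t)"
    if "s \<le> t" for s t
    unfolding augmented_filtration_def sets_measure_of[OF sub]
    using that by (intro sigma_sets_mono') (auto intro: order_trans)
qed

definition adapted :: "(real \<Rightarrow> 'a measure) \<Rightarrow> (real \<Rightarrow> 'a \<Rightarrow> 'b :: topological_space) \<Rightarrow> bool" where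
  "adapted F X \<longleftrightarrow> (\<forall>t\<ge>0. X t \<in> borel_measurable (F t))"


section \<open>The It\^o integral of matrix-valued processes\<close>

text \<open>The data \<open>n, \<tau>, \<xi>\<close> stand for the bounded simple process
  \<open>\<Sum>k<n. \<xi>\<^sub>k 1\<^bsub>(\<tau>\<^sub>k, \<tau>\<^sub>k\<^sub>+\<^sub>1]\<^esub>\<close> on \<open>[0, T]\<close>.\<close>

definition simple_integrand ::
    "(real \<Rightarrow> 'a measure) \<Rightarrow> real \<Rightarrow> nat \<Rightarrow> (nat \<Rightarrow> real) \<Rightarrow>
     (nat \<Rightarrow> 'a \<Rightarrow> real ^ 'm ^ 'n) \<Rightarrow> bool" where
  "simple_integrand F T n \<tau> \<xi> \<longleftrightarrow>
     \<tau> 0 = 0 \<and> \<tau> n = T \<and> (\<forall>k<n. \<tau> k \<le> \<tau> (Suc k)) \<and>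
     (\<forall>k<n. \<xi> k \<in> borel_measurable (F (\<tau> k)) \<and>
            (\<exists>B. \<forall>\<omega>\<in>space (F (\<tau> k)). norm (\<xi> k \<omega>) \<le> B))"

definition simple_process ::
    "nat \<Rightarrow> (nat \<Rightarrow> real) \<Rightarrow> (nat \<Rightarrow> 'a \<Rightarrow> real ^ 'm ^ 'n) \<Rightarrow> real \<Rightarrow> 'a \<Rightarrow> real ^ 'm ^ 'n" where
  "simple_process n \<tau> \<xi> s \<omega> = (\<Sum>k<n. indicator {\<tau> k<..\<tau> (Suc k)} s *\<^sub>R \<xi> k \<omega>)"

definition simple_ito_integral ::
    "(real \<Rightarrow> 'a \<Rightarrow> real ^ 'm) \<Rightarrow> nat \<Rightarrow> (nat \<Rightarrow> real) \<Rightarrow> (nat \<Rightarrow> 'a \<Rightarrow> real ^ 'm ^ 'n) \<Rightarrow>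
     'a \<Rightarrow> real ^ 'n" where
  "simple_ito_integral W n \<tau> \<xi> \<omega> = (\<Sum>k<n. \<xi> k \<omega> *v (W (\<tau> (Suc k)) \<omega> - W (\<tau> k) \<omega>))"

text \<open>\<open>has_ito_integral M F W T H I\<close>: the random vector \<open>I\<close> is a version of
  \<open>\<integral>\<^sub>0\<^sup>T H\<^sub>s dW\<^sub>s\<close>, for \<open>H\<close> jointly measurable, adapted and square integrable on
  \<open>[0, T] \<times> \<Omega>\<close>.  The integral is the \<open>L\<^sup>2\<close>-limit of the integrals of simple processes that
  converge to \<open>H\<close> in \<open>L\<^sup>2\<close>; by the It\^o isometry it is unique up to null sets.
  The norm on matrices is the Frobenius norm.\<close>

definition has_ito_integral ::
    "'a measure \<Rightarrow> (real \<Rightarrow> 'a measure) \<Rightarrow> (real \<Rightarrow> 'a \<Rightarrow> real ^ 'm) \<Rightarrow> real \<Rightarrow>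
     (real \<Rightarrow> 'a \<Rightarrow> real ^ 'm ^ 'n) \<Rightarrow> ('a \<Rightarrow> real ^ 'n) \<Rightarrow> bool" where
  "has_ito_integral M F W T H I \<longleftrightarrow>
     (\<lambda>(s, \<omega>). H s \<omega>) \<in> borel_measurable (restrict_space borel {0..T} \<Otimes>\<^sub>M M) \<and>
     adapted F H \<and>
     (\<integral>\<^sup>+\<omega>. (\<integral>\<^sup>+s\<in>{0..T}. ennreal ((norm (H s \<omega>))\<^sup>2) \<partial>lborel) \<partial>M) < \<infinity> \<and>
     I \<in> borel_measurable M \<and>
     (\<exists>n \<tau> \<xi>.
        (\<forall>j :: nat. simple_integrand F T (n j) (\<tau> j) (\<xi> j)) \<and>
        (\<lambda>j. \<integral>\<^sup>+\<omega>. (\<integral>\<^sup>+s\<in>{0..T}.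
            ennreal ((norm (simple_process (n j) (\<tau> j) (\<xi> j) s \<omega> - H s \<omega>))\<^sup>2) \<partial>lborel) \<partial>M)
          \<longlonglongrightarrow> 0 \<and>
        (\<lambda>j. \<integral>\<^sup>+\<omega>.
            ennreal ((norm (simple_ito_integral W (n j) (\<tau> j) (\<xi> j) \<omega> - I \<omega>))\<^sup>2) \<partial>M)
          \<longlonglongrightarrow> 0)"


section \<open>The stochastic differential equation\<close>

definition cross_matrix :: "real ^ 3 \<Rightarrow> real ^ 3 ^ 3" where
  "cross_matrix x = matrix (cross3 x)"

lemma cross_matrix_mult [simp]: "cross_matrix x *v v = cross3 x v"
  by (simp add: cross_matrix_def matrix_vector_mult_def matrix_def vec_eq_iff forall_3 sum_3 axis_def
      cross3_def algebra_simps)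

lemma transpose_cross_matrix: "transpose (cross_matrix x) = - cross_matrix x"
  by (simp add: cross_matrix_def transpose_def matrix_def vec_eq_iff forall_3 axis_def cross3_def)

text \<open>Strong solutions of
    \<open>dY = - \<mu> \<times> (b dt + \<epsilon> dW) - \<alpha> \<mu> \<times> (\<mu> \<times> (b dt + \<epsilon> dW))\<close>, \<open>\<mu> = Y / |Y|\<close>, \<open>Y\<^sub>0 = y\<close>,
  that is, continuous processes \<open>Y\<close> adapted to the augmented filtration of \<open>W\<close> that satisfy
  the equation in integrated form.  Here \<open>I\<close> and \<open>J\<close> are \<open>\<integral>\<^sub>0\<^sup>t \<mu> \<times> dW\<close> and
  \<open>\<integral>\<^sub>0\<^sup>t \<mu> \<times> (\<mu> \<times> dW)\<close>.  Since \<open>\<mu>\<close> is only meaningful where \<open>Y\<close> does not vanish (division by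
  zero yields zero here), the state space is \<open>\<real>\<^sup>3\<close> without the origin.\<close>

definition strong_solution ::
    "'a measure \<Rightarrow> (real \<Rightarrow> 'a \<Rightarrow> real ^ 3) \<Rightarrow> real ^ 3 \<Rightarrow> real \<Rightarrow> real \<Rightarrow> real ^ 3 \<Rightarrow>
     (real \<Rightarrow> 'a \<Rightarrow> real ^ 3) \<Rightarrow> (real \<Rightarrow> 'a \<Rightarrow> real ^ 3) \<Rightarrow> bool" where
  "strong_solution M W b \<alpha> \<epsilon> y Y \<mu> \<longleftrightarrow>
     adapted (augmented_filtration M W) Y \<and>
     (\<forall>\<omega>\<in>space M. continuous_on {0..} (\<lambda>t. Y t \<omega>)) \<and>
     (AE \<omega> in M. \<forall>t\<ge>0. Y t \<omega> \<noteq> 0) \<and>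
     (\<forall>\<omega>\<in>space M. \<forall>t\<ge>0. \<mu> t \<omega> = Y t \<omega> /\<^sub>R norm (Y t \<omega>)) \<and>
     (AE \<omega> in M. Y 0 \<omega> = y) \<and>
     (\<forall>t\<ge>0. \<exists>I J.
        has_ito_integral M (augmented_filtration M W) W t (\<lambda>s \<omega>. cross_matrix (\<mu> s \<omega>)) I \<and>
        has_ito_integral M (augmented_filtration M W) W t
          (\<lambda>s \<omega>. cross_matrix (\<mu> s \<omega>) ** cross_matrix (\<mu> s \<omega>)) J \<and>
        (AE \<omega> in M. Y t \<omega> = y
           - ((LINT s:{0..t}|lborel. cross3 (\<mu> s \<omega>) b) + \<epsilon> *\<^sub>R I \<omega>)
           - \<alpha> *\<^sub>R ((LINT s:{0..t}|lborel. cross3 (\<mu> s \<omega>) (cross3 (\<mu> s \<omega>) b)) + \<epsilon> *\<^sub>R J \<omega>)))"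

end

theory Submission imports Defs
begin

text \<open>
  The idea. Write \<open>R\<^sub>t = sqrt (1 + rate * t)\<close> with \<open>rate = 2 \<epsilon>\<^sup>2 (1 + \<alpha>\<^sup>2)\<close>. Since the drift and
  the noise in the equation are orthogonal to \<open>Y\<close>, the process \<open>|Y|\<^sup>2\<close> has no martingale part and grows
  at the rate of the trace of the quadratic variation of \<open>Y\<close>, which is constant: \<open>|Y\<^sub>t| = R\<^sub>t\<close> almost surely. Assume
  \<open>b \<noteq> 0\<close> and put \<open>e = b / |b|\<close>, \<open>\<zeta> = Y \<bullet> e\<close>, \<open>k = \<alpha> |b|\<close>, \<open>\<sigma>2 = rate / 2\<close>. Then \<open>\<zeta>\<close> is a scalar
  diffusion with drift \<open>k (1 - z\<^sup>2)\<close> and quadratic variation rate \<open>\<sigma>2 (1 - z\<^sup>2)\<close>, where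
  \<open>z = \<zeta> / R = \<mu> \<bullet> e\<close>. As \<open>R\<close> only grows like the square root of time, the drift pushes \<open>z\<close> to \<open>1\<close>,
  and the noise in \<open>z\<close> dies out.

  This is made precise by the Lyapunov function
  \<open>V(t, x) = (R\<^sub>t - x)\<^sup>3 / (R\<^sub>t + x + C)\<^sup>2 + K / R\<^sub>t\<close>. With \<open>C = 3 \<sigma>2 / k\<close> and a suitable \<open>K\<close>, the generator
  maps it to a nonpositive function from some time on (\<open>lyapunov_pq\<close>, \<open>generator_V_nonpos\<close>), so
  \<open>V(t, \<zeta>\<^sub>t)\<close> is a nonnegative supermartingale (\<open>V_supermartingale\<close>) and almost surely bounded, by the
  maximal inequality (\<open>V_maximal\<close>). But \<open>V(t, \<zeta>\<^sub>t) \<ge> R\<^sub>t (1 - z)\<^sup>3 / (2 + C)\<^sup>2\<close>, and \<open>R\<^sub>t\<close> tends to infinity;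
  hence \<open>z\<close> tends to \<open>1\<close>, and \<open>\<mu> \<bullet> b = |b| z\<close> to \<open>|b|\<close>.

  It\^o's formula is not used as such. In its place stands an elementary criterion: if
  \<open>f(t) \<le> f(s) + o(t - s)\<close>, uniformly for \<open>s < t\<close>, then \<open>f\<close> does not increase (\<open>le_of_small_increments\<close>).
  It is applied to expectations, for which one-step estimates with an error of order
  \<open>(t - s)\<^bsup>3/2\<^esup>\<close> suffice. These follow from a Taylor expansion together with three properties of the
  It\^o integral over \<open>(s, t]\<close> (\<open>noise_exists\<close>): it is orthogonal to the past, it
  satisfies the isometry with weights that are measurable at time \<open>s\<close>, and its fourth moment is
  \<open>O((t - s)\<^sup>2)\<close>. All three are proved for elementary integrands, from the independence of the Brownian
  increments from the past, and extended by approximation. The norm of \<open>Y\<close> is obtained in the same way: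
  for \<open>Z = |Y|\<^sup>2 - 1 - rate * t\<close> the expectation of \<open>1 - cos (l Z\<^sub>t)\<close> does not increase, hence vanishes.
\<close>

section \<open>Independence of the Brownian increments from the past\<close>

lemma Int_stable_vimage: "Int_stable {X -` A \<inter> S | A. A \<in> sets N}"
proof (rule Int_stableI)
  fix C D assume "C \<in> {X -` A \<inter> S | A. A \<in> sets N}" "D \<in> {X -` A \<inter> S | A. A \<in> sets N}"
  then obtain A B where "A \<in> sets N" "C = X -` A \<inter> S" "B \<in> sets N" "D = X -` B \<inter> S" by auto
  then show "C \<inter> D \<in> {X -` A \<inter> S | A. A \<in> sets N}" by (intro CollectI exI[of _ "A \<inter> B"]) auto
qed

lemma prod_Basis_vec: "(\<Prod>b\<in>Basis. f b) = (\<Prod>i\<in>UNIV. f (axis i (1::real) :: real^'n))"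
proof -
  have *: "(Basis :: (real^'n) set) = range (\<lambda>i. axis i 1)" by (auto simp: Basis_vec_def)
  have **: "inj (\<lambda>i. axis i (1::real) :: real^'n)" by (auto simp: inj_on_def axis_eq_axis)
  show ?thesis unfolding * prod.reindex[OF **] by simp
qed

context brownian_motion begin

text \<open>The augmented natural filtration of \<open>W\<close>.\<close>

abbreviation F :: "real \<Rightarrow> 'a measure" where
  "F \<equiv> augmented_filtration M W"

lemma F_generator_subset:
  "{W s -` A \<inter> space M | s A. 0 \<le> s \<and> s \<le> t \<and> A \<in> sets borel} \<union> null_sets M \<subseteq> sets M"
  using W_measurable by (auto intro: measurable_sets)

lemma space_F [simp]: "space (F t) = space M"
  using filtration_augmented_filtration[of M W] by (simp add: filtration_def)

lemma sets_F: "sets (F t) = sigma_sets (space M)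
    ({W s -` A \<inter> space M | s A. 0 \<le> s \<and> s \<le> t \<and> A \<in> sets borel} \<union> null_sets M)"
  unfolding augmented_filtration_def
  using F_generator_subset[of t] sets.space_closed by (intro sets_measure_of) fast

lemma sets_F_subset: "sets (F t) \<subseteq> sets M"
  unfolding sets_F using F_generator_subset[of t] by (rule sets.sigma_sets_subset)

lemma sets_F_mono: "s \<le> t \<Longrightarrow> sets (F s) \<subseteq> sets (F t)"
  using filtration_augmented_filtration[of M W] by (simp add: filtration_def)

lemma measurable_F_mono: "X \<in> measurable (F s) N \<Longrightarrow> s \<le> t \<Longrightarrow> X \<in> measurable (F t) N"
  using sets_F_mono[of s t] by (auto simp: measurable_def)

lemma measurable_F_imp: "X \<in> measurable (F s) N \<Longrightarrow> X \<in> measurable M N"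
  using sets_F_subset[of s] by (auto simp: measurable_def)

lemma W_adapted: "0 \<le> s \<Longrightarrow> s \<le> t \<Longrightarrow> W s \<in> borel_measurable (F t)"
  by (rule measurableI) (auto simp: sets_F intro!: sigma_sets.Basic)

text \<open>The values of \<open>W\<close> at finitely many times up to \<open>a\<close> are partial sums of the increments between
  consecutive such times, up to the null set where \<open>W 0\<close> does not vanish.\<close>

lemma indep_past_finite:
  assumes S: "finite S" "S \<subseteq> {0..a}" and ab: "0 \<le> a" "a \<le> b"
    and A: "\<And>s. A s \<in> sets borel" and B: "B \<in> sets borel"
  shows "prob ({\<omega>\<in>space M. \<forall>s\<in>S. W s \<omega> \<in> A s} \<inter> ((\<lambda>\<omega>. W b \<omega> - W a \<omega>) -` B \<inter> space M))
    = prob {\<omega>\<in>space M. \<forall>s\<in>S. W s \<omega> \<in> A s} * prob ((\<lambda>\<omega>. W b \<omega> - W a \<omega>) -` B \<inter> space M)"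
proof -
  define l where "l = sorted_list_of_set S"
  define m where "m = length l"
  have l: "sorted l" "set l = S" using S by (auto simp: l_def)
  \<comment> \<open>The partition \<open>0, l ! 0, ..., l ! (m - 1), a, b\<close>; the last increment, with index \<open>m + 1\<close>, is that over \<open>[a, b]\<close>.\<close>
  define \<tau> where "\<tau> k = (if k = 0 then 0 else if k \<le> m then l ! (k - 1) else if k = Suc m then a else b)" for k
  have lr: "l ! i \<in> {0..a}" if "i < m" for i using that S l m_def nth_mem[of i l] by auto
  have "mono \<tau>"
    unfolding mono_iff_le_Suc
  proof
    fix k
    show "\<tau> k \<le> \<tau> (Suc k)"
      using lr[of 0] lr[of "k-1"] ab sorted_nth_mono[OF l(1), of "k-1" k]
      by (auto simp: \<tau>_def m_def)
  qed
  moreover have "0 \<le> \<tau> 0" by (simp add: \<tau>_def)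
  ultimately have ind: "indep_vars (\<lambda>_. borel) (\<lambda>k \<omega>. W (\<tau> (Suc k)) \<omega> - W (\<tau> k) \<omega>) {..<m+2}"
    by (rule W_indep_increments)
  define X where "X k \<omega> = W (\<tau> (Suc k)) \<omega> - W (\<tau> k) \<omega>" for k \<omega>
  define C where "C = {f \<in> space (Pi\<^sub>M {..<Suc m} (\<lambda>_. borel :: (real^'n) measure)). \<forall>k\<in>{..<m}. (\<Sum>j<Suc k. f j) \<in> A (l ! k)}"
  have tel: "(\<Sum>j<k. X j \<omega>) = W (\<tau> k) \<omega> - W 0 \<omega>" for k \<omega>
    unfolding X_def by (subst sum_lessThan_telescope) (simp add: \<tau>_def)
  have Cm: "C \<in> sets (Pi\<^sub>M {..<Suc m} (\<lambda>_. borel))"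
    unfolding C_def
  proof (rule sets.sets_Collect_finite_All, goal_cases)
    case (1 k)
    have "(\<lambda>f. \<Sum>j<Suc k. f j) \<in> borel_measurable (Pi\<^sub>M {..<Suc m} (\<lambda>_. borel :: (real^'n) measure))"
    proof (rule borel_measurable_sum)
      fix i assume "i \<in> {..<Suc k}"
      then show "(\<lambda>f. f i) \<in> borel_measurable (Pi\<^sub>M {..<Suc m} (\<lambda>_. borel :: (real^'n) measure))"
        using 1 by (intro measurable_component_singleton) auto
    qed
    from measurable_sets[OF this A[of "l ! k"]] show ?case
      by (simp add: vimage_def Int_def conj_commute)
  qed auto
  have iv: "indep_var (Pi\<^sub>M {..<Suc m} (\<lambda>_. borel)) (\<lambda>\<omega>. restrict (\<lambda>i. X i \<omega>) {..<Suc m})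
     (Pi\<^sub>M {Suc m} (\<lambda>_. borel)) (\<lambda>\<omega>. restrict (\<lambda>i. X i \<omega>) {Suc m})"
    using ind unfolding X_def by (rule indep_var_restrict) auto
  define D where "D = {f \<in> space (Pi\<^sub>M {Suc m} (\<lambda>_. borel :: (real^'n) measure)). f (Suc m) \<in> B}"
  have Dm: "D \<in> sets (Pi\<^sub>M {Suc m} (\<lambda>_. borel))"
  proof -
    have "(\<lambda>f. f (Suc m)) \<in> borel_measurable (Pi\<^sub>M {Suc m} (\<lambda>_. borel))"
      by (intro measurable_component_singleton) auto
    from measurable_sets[OF this B] show ?thesis
      by (simp add: D_def vimage_def Int_def conj_commute)
  qed
  let ?C = "(\<lambda>\<omega>. restrict (\<lambda>i. X i \<omega>) {..<Suc m}) -` C \<inter> space M"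
  let ?D = "(\<lambda>\<omega>. restrict (\<lambda>i. X i \<omega>) {Suc m}) -` D \<inter> space M"
  have Ceq: "?C = {\<omega>\<in>space M. \<forall>k<m. W (l!k) \<omega> - W 0 \<omega> \<in> A (l!k)}"
    by (auto simp: C_def space_PiM tel \<tau>_def simp del: sum.lessThan_Suc)
  have Deq: "?D = (\<lambda>\<omega>. W b \<omega> - W a \<omega>) -` B \<inter> space M"
    by (auto simp: D_def space_PiM X_def \<tau>_def)
  have ms: "?C \<in> sets M" "?D \<in> sets M"
    using measurable_sets[OF indep_var_rv1[OF iv] Cm] measurable_sets[OF indep_var_rv2[OF iv] Dm] by auto
  have "prob ((\<lambda>\<omega>. (restrict (\<lambda>i. X i \<omega>) {..<Suc m}, restrict (\<lambda>i. X i \<omega>) {Suc m})) -` (C \<times> D) \<inter> space M)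
     = prob ?C * prob ?D"
    using iv Cm Dm by (rule indep_varD)
  also have "(\<lambda>\<omega>. (restrict (\<lambda>i. X i \<omega>) {..<Suc m}, restrict (\<lambda>i. X i \<omega>) {Suc m})) -` (C \<times> D) \<inter> space M
     = ?C \<inter> ?D" by auto
  finally have P: "prob (?C \<inter> ?D) = prob ?C * prob ?D" .
  let ?E = "{\<omega>\<in>space M. \<forall>s\<in>S. W s \<omega> \<in> A s}"
  have [measurable]: "W s \<in> borel_measurable M" if "s \<in> S" for s using that S W_measurable by auto
  have Em: "?E \<in> sets M"
    by (rule sets.sets_Collect_finite_All) (use S A in auto)
  have ae: "AE \<omega> in M. \<omega> \<in> ?E \<longleftrightarrow> \<omega> \<in> ?C"
    using W_zero AE_space
  proof eventually_elim
    case (elim \<omega>)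
    then show ?case unfolding Ceq using l(2) by (auto simp: m_def set_conv_nth)
  qed
  have "prob (?E \<inter> ?D) = prob (?C \<inter> ?D)"
    using ae by (intro measure_eq_AE) (use Em ms in auto)
  moreover have "prob ?E = prob ?C"
    using ae by (intro measure_eq_AE) (use Em ms in auto)
  ultimately show ?thesis using P Deq by simp
qed

text \<open>The events that agree, up to a null set, with an event that restricts finitely many values of \<open>W\<close>
  on \<open>[0, a]\<close> form an intersection-stable family. It contains the generators of \<open>F a\<close>, including the
  null sets.\<close>

lemma indep_past:
  assumes "0 \<le> a" "a \<le> b"
  shows "indep_set (sets (F a)) {(\<lambda>\<omega>. W b \<omega> - W a \<omega>) -` B \<inter> space M | B. B \<in> sets borel}"
proof -
  define cyl where "cyl S A = {\<omega>\<in>space M. \<forall>s\<in>S. W s \<omega> \<in> A s}" for S and A :: "real \<Rightarrow> (real^'n) set"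
  define G where "G = {E \<in> sets M. \<exists>S A. finite S \<and> S \<subseteq> {0..a} \<and> (\<forall>s. A s \<in> sets borel) \<and>
     (AE \<omega> in M. \<omega> \<in> E \<longleftrightarrow> \<omega> \<in> cyl S A)}"
  define V where "V = {(\<lambda>\<omega>. W b \<omega> - W a \<omega>) -` B \<inter> space M | B. B \<in> sets borel}"
  have [measurable]: "W a \<in> borel_measurable M" "W b \<in> borel_measurable M" using assms W_measurable by auto
  have rv: "(\<lambda>\<omega>. W b \<omega> - W a \<omega>) \<in> borel_measurable M" by measurable
  have Vm: "V \<subseteq> sets M" using measurable_sets[OF rv] by (auto simp: V_def)
  have cylm: "cyl S A \<in> sets M" if "finite S" "S \<subseteq> {0..a}" "\<forall>s. A s \<in> sets borel" for S A
  proof -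
    have [measurable]: "W s \<in> borel_measurable M" if "s \<in> S" for s using that \<open>S \<subseteq> {0..a}\<close> W_measurable by auto
    show ?thesis unfolding cyl_def by (rule sets.sets_Collect_finite_All) (use that in auto)
  qed
  have "indep_set G V"
    unfolding indep_sets2_eq
  proof (intro conjI ballI)
    show "G \<subseteq> events" by (auto simp: G_def)
    show "V \<subseteq> events" by (rule Vm)
    fix E D assume "E \<in> G" "D \<in> V"
    then obtain S A B where E: "E \<in> sets M" "finite S" "S \<subseteq> {0..a}" "\<forall>s. A s \<in> sets borel"
      "AE \<omega> in M. \<omega> \<in> E \<longleftrightarrow> \<omega> \<in> cyl S A" and B: "B \<in> sets borel" "D = (\<lambda>\<omega>. W b \<omega> - W a \<omega>) -` B \<inter> space M"
      by (auto simp: G_def V_def)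
    have "prob (cyl S A \<inter> D) = prob (cyl S A) * prob D"
      using indep_past_finite[OF E(2,3) assms _ B(1), of A] E(4) by (simp add: cyl_def B(2))
    moreover have "prob (E \<inter> D) = prob (cyl S A \<inter> D)"
      using E Vm \<open>D \<in> V\<close> cylm[OF E(2-4)] by (intro measure_eq_AE) auto
    moreover have "prob E = prob (cyl S A)"
      using E cylm[OF E(2-4)] by (intro measure_eq_AE) auto
    ultimately show "prob (E \<inter> D) = prob E * prob D" by simp
  qed
  moreover have "Int_stable G"
  proof (rule Int_stableI)
    fix C D assume CD: "C \<in> G" "D \<in> G"
    then obtain S A S' A' where 1: "C \<in> sets M" "finite S" "S \<subseteq> {0..a}" "\<forall>s. A s \<in> sets borel"
      "AE \<omega> in M. \<omega> \<in> C \<longleftrightarrow> \<omega> \<in> cyl S A"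
      and 2: "D \<in> sets M" "finite S'" "S' \<subseteq> {0..a}" "\<forall>s. A' s \<in> sets borel"
      "AE \<omega> in M. \<omega> \<in> D \<longleftrightarrow> \<omega> \<in> cyl S' A'" by (auto simp: G_def)
    define A'' where "A'' s = (if s \<in> S then A s else UNIV) \<inter> (if s \<in> S' then A' s else UNIV)" for s
    have "AE \<omega> in M. \<omega> \<in> C \<inter> D \<longleftrightarrow> \<omega> \<in> cyl (S \<union> S') A''"
      using 1(5) 2(5) by eventually_elim (auto simp: cyl_def A''_def)
    moreover have "\<forall>s. A'' s \<in> sets borel" using 1(4) 2(4) by (auto simp: A''_def)
    ultimately show "C \<inter> D \<in> G" unfolding G_def using 1(1-3) 2(1-3)
      by (intro CollectI conjI exI[of _ "S \<union> S'"] exI[of _ A'']) auto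
  qed
  moreover have "Int_stable V"
    unfolding V_def by (rule Int_stable_vimage)
  ultimately have I: "indep_set (sigma_sets (space M) G) (sigma_sets (space M) V)"
    by (rule indep_set_sigma_sets)
  have "sets (F a) \<subseteq> sigma_sets (space M) G"
    unfolding sets_F
  proof (rule sigma_sets_mono', safe)
    fix s A assume *: "0 \<le> s" "s \<le> a" "A \<in> sets (borel :: (real^'n) measure)"
    show "W s -` A \<inter> space M \<in> G"
      unfolding G_def using * W_measurable[of s]
      by (intro CollectI conjI exI[of _ "{s}"] exI[of _ "\<lambda>_. A"]) (auto simp: cyl_def measurable_sets)
  next
    fix N assume N: "N \<in> null_sets M"
    show "N \<in> G"
      unfolding G_def using N AE_not_in[OF N] assms
      by (intro CollectI conjI exI[of _ "{0}"] exI[of _ "\<lambda>_. {}"]) (auto simp: cyl_def)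
  qed
  moreover have "V \<subseteq> sigma_sets (space M) V" by (rule sigma_sets_superset_generator)
  moreover have "sets (F a) \<subseteq> events" by (rule sets_F_subset)
  ultimately show ?thesis
    using I Vm unfolding indep_sets2_eq V_def[symmetric] by blast
qed

lemma indep_var_past:
  assumes ab: "0 \<le> a" "a \<le> b" and X: "X \<in> borel_measurable (F a)"
    and g: "g \<in> borel_measurable borel"
  shows "indep_var borel X borel (\<lambda>\<omega>. g (W b \<omega> - W a \<omega>))"
proof -
  have [measurable]: "W a \<in> borel_measurable M" "W b \<in> borel_measurable M" using ab W_measurable by auto
  have sub: "sigma_sets (space M) {X -` A \<inter> space M |A. A \<in> sets borel} \<subseteq> sets (F a)"
    using measurable_sets[OF X] by (intro sets.sigma_sets_subset[of _ "F a", simplified]) auto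
  have "indep_set (sigma_sets (space M) {X -` A \<inter> space M |A. A \<in> sets borel})
    (sigma_sets (space M) {(\<lambda>\<omega>. g (W b \<omega> - W a \<omega>)) -` A \<inter> space M |A. A \<in> sets borel})"
  proof (rule indep_set_sigma_sets)
    show "indep_set {X -` A \<inter> space M |A. A \<in> sets borel}
      {(\<lambda>\<omega>. g (W b \<omega> - W a \<omega>)) -` A \<inter> space M |A. A \<in> sets borel}"
    proof (rule indep_setI)
      have gW: "(\<lambda>\<omega>. g (W b \<omega> - W a \<omega>)) -` B \<inter> space M
         \<in> {(\<lambda>\<omega>. W b \<omega> - W a \<omega>) -` B \<inter> space M | B. B \<in> sets borel}" if "B \<in> sets borel" for B
        using measurable_sets[OF g that] by (intro CollectI exI[of _ "g -` B"]) auto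
      have XF: "X -` A \<inter> space M \<in> sets (F a)" if "A \<in> sets borel" for A
        using measurable_sets[OF X that] by simp
      show "{X -` A \<inter> space M |A. A \<in> sets borel} \<subseteq> events"
        using XF sets_F_subset[of a] by auto
      show "{(\<lambda>\<omega>. g (W b \<omega> - W a \<omega>)) -` A \<inter> space M |A. A \<in> sets borel} \<subseteq> events"
        using subsetD[OF indep_setD_ev2[OF indep_past[OF ab]] gW] by auto
      fix C D assume "C \<in> {X -` A \<inter> space M |A. A \<in> sets borel}"
        "D \<in> {(\<lambda>\<omega>. g (W b \<omega> - W a \<omega>)) -` A \<inter> space M |A. A \<in> sets borel}"
      then obtain A B where "A \<in> sets borel" "C = X -` A \<inter> space M" "B \<in> sets borel"
        "D = (\<lambda>\<omega>. g (W b \<omega> - W a \<omega>)) -` B \<inter> space M" by auto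
      then show "prob (C \<inter> D) = prob C * prob D"
        using indep_setD[OF indep_past[OF ab] XF gW] by simp
    qed
  qed (rule Int_stable_vimage)+
  moreover have "X \<in> borel_measurable M" using X by (rule measurable_F_imp)
  ultimately show ?thesis unfolding indep_var_eq using g by auto
qed

lemma increment_measurable [measurable]:
  "0 \<le> s \<Longrightarrow> 0 \<le> t \<Longrightarrow> (\<lambda>\<omega>. W t \<omega> - W s \<omega>) \<in> borel_measurable M"
  using W_measurable by simp

text \<open>The components of an increment are independent centred Gaussian variables.\<close>

lemma emeasure_increment_components:
  assumes st: "0 \<le> s" "s < t" and A: "\<And>i. A i \<in> sets borel"
  shows "emeasure M {\<omega>\<in>space M. \<forall>i. (W t \<omega> - W s \<omega>) $ i \<in> A i} =
    (\<Prod>i\<in>UNIV. \<integral>\<^sup>+x. ennreal (normal_density 0 (sqrt (t - s)) x) * indicator (A i) x \<partial>lborel)"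
proof -
  let ?d = "normal_density 0 (sqrt (t - s))"
  let ?B = "{x :: real^'n. \<forall>i. x $ i \<in> A i}"
  have Bs: "?B \<in> sets borel"
  proof -
    have "?B = (\<Inter>i\<in>UNIV. (\<lambda>x. x $ i) -` A i \<inter> space borel)" by auto
    also have "\<dots> \<in> sets borel"
      using A by (intro sets.finite_INT measurable_sets[OF borel_measurable_nth]) auto
    finally show ?thesis .
  qed
  define g where "g b x = (ennreal (?d x) * indicator (A (SOME i. b = axis i (1::real))) x)" for b :: "real^'n" and x
  have some: "(SOME k. (axis i (1::real) :: real^'n) = axis k 1) = i" for i
    by (rule some_equality) (auto simp: axis_eq_axis)
  have "emeasure M {\<omega>\<in>space M. \<forall>i. (W t \<omega> - W s \<omega>) $ i \<in> A i}
      = emeasure M ((\<lambda>\<omega>. W t \<omega> - W s \<omega>) -` ?B \<inter> space M)"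
    by (intro arg_cong2[where f=emeasure]) auto
  also have "\<dots> = (\<integral>\<^sup>+x. ennreal (\<Prod>i\<in>UNIV. ?d (x $ i)) * indicator ?B x \<partial>lborel)"
    using Bs by (intro distributed_emeasure[OF W_gaussian_increments[OF st]]) simp
  also have "\<dots> = (\<integral>\<^sup>+x. (\<Prod>b\<in>Basis. g b (x \<bullet> b)) \<partial>lborel)"
  proof (rule nn_integral_cong)
    fix x :: "real^'n"
    have "indicator ?B x = (\<Prod>i\<in>UNIV. indicator (A i) (x $ i) :: ennreal)"
      by (cases "x \<in> ?B") (auto simp: indicator_def)
    then show "ennreal (\<Prod>i\<in>UNIV. ?d (x $ i)) * indicator ?B x = (\<Prod>b\<in>Basis. g b (x \<bullet> b))"
      by (simp add: prod_Basis_vec g_def some inner_axis prod.distrib prod_ennreal)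
  qed
  also have "\<dots> = (\<Prod>b\<in>Basis. \<integral>\<^sup>+x. g b x \<partial>lborel)"
  proof (rule nn_integral_lborel_prod)
    fix b :: "real^'n"
    have "A (SOME i. b = axis i 1) \<in> sets borel" by (rule A)
    then show "g b \<in> borel_measurable borel" unfolding g_def by measurable
  qed simp
  also have "\<dots> = (\<Prod>i\<in>UNIV. \<integral>\<^sup>+x. ennreal (?d x) * indicator (A i) x \<partial>lborel)"
    by (simp add: prod_Basis_vec g_def some)
  finally show ?thesis .
qed

lemma normal_density_total:
  "0 < \<sigma> \<Longrightarrow> (\<integral>\<^sup>+x. ennreal (normal_density 0 \<sigma> x) \<partial>lborel) = 1"
  using prob_space.emeasure_space_1[OF prob_space_normal_density[of \<sigma> 0]]
  by (simp add: emeasure_density)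

lemma emeasure_increment_pair:
  assumes st: "0 \<le> s" "s < t" and A: "A \<in> sets borel" "B \<in> sets borel" and "i \<noteq> j"
  shows "emeasure M {\<omega>\<in>space M. (W t \<omega> - W s \<omega>) $ i \<in> A \<and> (W t \<omega> - W s \<omega>) $ j \<in> B} =
    (\<integral>\<^sup>+x. ennreal (normal_density 0 (sqrt (t - s)) x) * indicator A x \<partial>lborel) *
    (\<integral>\<^sup>+x. ennreal (normal_density 0 (sqrt (t - s)) x) * indicator B x \<partial>lborel)"
proof -
  define C where "C k = (if k = i then A else if k = j then B else UNIV)" for k
  let ?I = "\<lambda>A. (\<integral>\<^sup>+x. ennreal (normal_density 0 (sqrt (t - s)) x) * indicator A x \<partial>lborel)"
  have "{\<omega>\<in>space M. (W t \<omega> - W s \<omega>) $ i \<in> A \<and> (W t \<omega> - W s \<omega>) $ j \<in> B}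
    = {\<omega>\<in>space M. \<forall>i. (W t \<omega> - W s \<omega>) $ i \<in> C i}"
    using \<open>i \<noteq> j\<close> by (auto simp: C_def)
  then have "emeasure M {\<omega>\<in>space M. (W t \<omega> - W s \<omega>) $ i \<in> A \<and> (W t \<omega> - W s \<omega>) $ j \<in> B}
    = (\<Prod>k\<in>UNIV. ?I (C k))"
    using emeasure_increment_components[OF st, of C] A by (simp add: C_def)
  also have "\<dots> = (\<Prod>k\<in>{i,j}. ?I (C k))"
    using st by (intro prod.mono_neutral_right) (auto simp: C_def normal_density_total)
  also have "\<dots> = ?I A * ?I B" using \<open>i \<noteq> j\<close> by (simp add: C_def)
  finally show ?thesis .
qed

lemma emeasure_increment_single:
  assumes st: "0 \<le> s" "s < t" and A: "A \<in> sets borel"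
  shows "emeasure M {\<omega>\<in>space M. (W t \<omega> - W s \<omega>) $ i \<in> A} =
    (\<integral>\<^sup>+x. ennreal (normal_density 0 (sqrt (t - s)) x) * indicator A x \<partial>lborel)"
proof -
  define C where "C k = (if k = i then A else UNIV)" for k
  let ?I = "\<lambda>A. (\<integral>\<^sup>+x. ennreal (normal_density 0 (sqrt (t - s)) x) * indicator A x \<partial>lborel)"
  have "{\<omega>\<in>space M. (W t \<omega> - W s \<omega>) $ i \<in> A} = {\<omega>\<in>space M. \<forall>i. (W t \<omega> - W s \<omega>) $ i \<in> C i}"
    by (auto simp: C_def)
  then have "emeasure M {\<omega>\<in>space M. (W t \<omega> - W s \<omega>) $ i \<in> A} = (\<Prod>k\<in>UNIV. ?I (C k))"
    using emeasure_increment_components[OF st, of C] A by (simp add: C_def)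
  also have "\<dots> = (\<Prod>k\<in>{i}. ?I (C k))"
    using st by (intro prod.mono_neutral_right) (auto simp: C_def normal_density_total)
  finally show ?thesis by (simp add: C_def)
qed

lemma distributed_increment_component:
  assumes st: "0 \<le> s" "s < t"
  shows "distributed M lborel (\<lambda>\<omega>. (W t \<omega> - W s \<omega>) $ i) (normal_density 0 (sqrt (t - s)))"
  unfolding distributed_def
proof (intro conjI)
  have [measurable]: "(\<lambda>\<omega>. W t \<omega> - W s \<omega>) \<in> borel_measurable M" using st by simp
  have X[measurable]: "(\<lambda>\<omega>. (W t \<omega> - W s \<omega>) $ i) \<in> borel_measurable M"
    by (rule measurable_compose[OF _ borel_measurable_nth]) simp
  then show "(\<lambda>\<omega>. (W t \<omega> - W s \<omega>) $ i) \<in> measurable M lborel" by simp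
  show "distr M lborel (\<lambda>\<omega>. (W t \<omega> - W s \<omega>) $ i) = density lborel (\<lambda>x. ennreal (normal_density 0 (sqrt (t - s)) x))"
  proof (rule measure_eqI)
    fix A assume "A \<in> sets (distr M lborel (\<lambda>\<omega>. (W t \<omega> - W s \<omega>) $ i))"
    then have A: "A \<in> sets borel" by simp
    have "emeasure (distr M lborel (\<lambda>\<omega>. (W t \<omega> - W s \<omega>) $ i)) A = emeasure M {\<omega>\<in>space M. (W t \<omega> - W s \<omega>) $ i \<in> A}"
      using A X by (subst emeasure_distr) (auto intro!: arg_cong2[where f=emeasure])
    then show "emeasure (distr M lborel (\<lambda>\<omega>. (W t \<omega> - W s \<omega>) $ i)) A =
      emeasure (density lborel (\<lambda>x. ennreal (normal_density 0 (sqrt (t - s)) x))) A"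
      using A emeasure_increment_single[OF st A] by (simp add: emeasure_density)
  qed simp
qed simp

lemma indep_var_increment_components:
  assumes st: "0 \<le> s" "s < t" and "i \<noteq> j"
  shows "indep_var borel (\<lambda>\<omega>. (W t \<omega> - W s \<omega>) $ i) borel (\<lambda>\<omega>. (W t \<omega> - W s \<omega>) $ j)"
proof -
  have [measurable]: "(\<lambda>\<omega>. W t \<omega> - W s \<omega>) \<in> borel_measurable M" using st by simp
  have X[measurable]: "(\<lambda>\<omega>. (W t \<omega> - W s \<omega>) $ i) \<in> borel_measurable M" for i
    by (rule measurable_compose[OF _ borel_measurable_nth]) simp
  let ?V = "\<lambda>i A. (\<lambda>\<omega>. (W t \<omega> - W s \<omega>) $ i) -` A \<inter> space M"
  have P: "prob (?V i A \<inter> ?V j B) = prob (?V i A) * prob (?V j B)" if AB: "A \<in> sets borel" "B \<in> sets borel" for A B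
  proof -
    have "?V i A \<inter> ?V j B = {\<omega>\<in>space M. (W t \<omega> - W s \<omega>) $ i \<in> A \<and> (W t \<omega> - W s \<omega>) $ j \<in> B}" by auto
    moreover have "?V i A = {\<omega>\<in>space M. (W t \<omega> - W s \<omega>) $ i \<in> A}" for i A by auto
    ultimately have "emeasure M (?V i A \<inter> ?V j B) = emeasure M (?V i A) * emeasure M (?V j B)"
      using emeasure_increment_pair[OF st AB \<open>i \<noteq> j\<close>] emeasure_increment_single[OF st] AB by simp
    then show ?thesis by (simp add: emeasure_eq_measure ennreal_mult[symmetric])
  qed
  have "indep_set (sigma_sets (space M) {?V i A |A. A \<in> sets borel}) (sigma_sets (space M) {?V j A |A. A \<in> sets borel})"
  proof (rule indep_set_sigma_sets)
    show "indep_set {?V i A |A. A \<in> sets borel} {?V j A |A. A \<in> sets borel}"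
      using measurable_sets[OF X] P by (intro indep_setI) auto
  qed (rule Int_stable_vimage)+
  then show ?thesis using X by (simp add: indep_var_eq)
qed

lemma increment_moment_integrable:
  assumes st: "0 \<le> s" "s \<le> t"
  shows "integrable M (\<lambda>\<omega>. ((W t \<omega> - W s \<omega>) $ i) ^ k)"
proof (cases "s = t")
  case False
  then have st: "0 \<le> s" "s < t" using st by auto
  have "integrable lborel (\<lambda>x. normal_density 0 (sqrt (t - s)) x * x ^ k)"
    using integrable_normal_moment[of "sqrt (t-s)" 0 k] st by simp
  then show ?thesis
    by (subst (asm) distributed_integrable[OF distributed_increment_component[OF st, of i]]) auto
qed simp

lemma increment_moment:
  assumes st: "0 \<le> s" "s < t"
  shows "expectation (\<lambda>\<omega>. ((W t \<omega> - W s \<omega>) $ i) ^ k)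
    = (LINT x|lborel. normal_density 0 (sqrt (t - s)) x * x ^ k)"
  by (subst distributed_integral[OF distributed_increment_component[OF st, of i]]) auto

lemma increment_mean:
  assumes st: "0 \<le> s" "s \<le> t"
  shows "expectation (\<lambda>\<omega>. (W t \<omega> - W s \<omega>) $ i) = 0"
proof (cases "s = t")
  case False
  then show ?thesis
    using increment_moment[of s t i 1] integral_normal_moment_odd[of "sqrt (t-s)" 0 0] st by simp
qed simp

lemma increment_variance:
  assumes st: "0 \<le> s" "s \<le> t"
  shows "expectation (\<lambda>\<omega>. ((W t \<omega> - W s \<omega>) $ i)\<^sup>2) = t - s"
proof (cases "s = t")
  case False
  then show ?thesis
    using increment_moment[of s t i 2] integral_normal_moment_even[of "sqrt (t-s)" 0 1] st by simp
qed simp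

lemma increment_fourth_moment:
  assumes st: "0 \<le> s" "s \<le> t"
  shows "expectation (\<lambda>\<omega>. ((W t \<omega> - W s \<omega>) $ i) ^ 4) = 3 * (t - s)\<^sup>2"
proof (cases "s = t")
  case False
  then show ?thesis
    using increment_moment[of s t i 4] integral_normal_moment_even[of "sqrt (t-s)" 0 2] st
    by (simp add: fact_numeral power_divide field_simps)
qed simp

lemma increment_prod_integrable:
  assumes st: "0 \<le> s" "s \<le> t"
  shows "integrable M (\<lambda>\<omega>. (W t \<omega> - W s \<omega>) $ i * (W t \<omega> - W s \<omega>) $ j)"
proof (rule Bochner_Integration.integrable_bound)
  have [measurable]: "(\<lambda>\<omega>. (W t \<omega> - W s \<omega>) $ i) \<in> borel_measurable M" for i
    using st by (intro measurable_compose[OF _ borel_measurable_nth]) simp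
  show "integrable M (\<lambda>\<omega>. ((W t \<omega> - W s \<omega>) $ i)\<^sup>2 + ((W t \<omega> - W s \<omega>) $ j)\<^sup>2)"
    using increment_moment_integrable[OF st] by simp
  show "(\<lambda>\<omega>. (W t \<omega> - W s \<omega>) $ i * (W t \<omega> - W s \<omega>) $ j) \<in> borel_measurable M" by measurable
  have "\<bar>x * y\<bar> \<le> x\<^sup>2 + y\<^sup>2" for x y :: real
  proof -
    have "2 * (\<bar>x\<bar> * \<bar>y\<bar>) \<le> x\<^sup>2 + y\<^sup>2" using sum_squares_bound[of "\<bar>x\<bar>" "\<bar>y\<bar>"] by (simp add: mult.assoc)
    moreover have "0 \<le> \<bar>x\<bar> * \<bar>y\<bar>" by simp
    ultimately show ?thesis unfolding abs_mult by linarith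
  qed
  then show "AE \<omega> in M. norm ((W t \<omega> - W s \<omega>) $ i * (W t \<omega> - W s \<omega>) $ j)
    \<le> norm (((W t \<omega> - W s \<omega>) $ i)\<^sup>2 + ((W t \<omega> - W s \<omega>) $ j)\<^sup>2)"
    by (intro AE_I2) (simp add: real_norm_def)
qed

lemma increment_covariance:
  assumes st: "0 \<le> s" "s \<le> t"
  shows "expectation (\<lambda>\<omega>. (W t \<omega> - W s \<omega>) $ i * (W t \<omega> - W s \<omega>) $ j) = (if i = j then t - s else 0)"
proof (cases "s = t \<or> i = j")
  case True
  then show ?thesis using increment_variance[OF st, of i] by (auto simp: power2_eq_square)
next
  case False
  then have st': "0 \<le> s" "s < t" and ij: "i \<noteq> j" using st by auto
  have "integrable M (\<lambda>\<omega>. (W t \<omega> - W s \<omega>) $ i)" for i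
    using increment_moment_integrable[OF st, of i 1] by simp
  then show ?thesis
    using indep_var_lebesgue_integral[OF indep_var_increment_components[OF st' ij]] ij
      increment_mean[OF st] by simp
qed

end

section \<open>Square integrable functions\<close>

text \<open>Square integrability for functions with values in a Euclidean space, as a predicate on functions
  rather than on equivalence classes.\<close>

definition square_integrable :: "'a measure \<Rightarrow> ('a \<Rightarrow> 'b :: euclidean_space) \<Rightarrow> bool" where
  "square_integrable M f \<longleftrightarrow> f \<in> borel_measurable M \<and> integrable M (\<lambda>x. (norm (f x))\<^sup>2)"

lemma square_integrable_measurable: "square_integrable M f \<Longrightarrow> f \<in> borel_measurable M"
  by (simp add: square_integrable_def)

lemma norm_add_sq_le: "(norm (x + y))\<^sup>2 \<le> 2 * (norm x)\<^sup>2 + 2 * (norm (y :: 'b :: real_inner))\<^sup>2"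
proof -
  have "(norm (x + y))\<^sup>2 + (norm (x - y))\<^sup>2 = 2 * (norm x)\<^sup>2 + 2 * (norm y)\<^sup>2"
    unfolding power2_norm_eq_inner by (simp add: inner_add_left inner_add_right inner_diff_left inner_diff_right)
  then show ?thesis using zero_le_power2[of "norm (x - y)"] by linarith
qed

lemma norm_diff_sq_le: "(norm (x - y))\<^sup>2 \<le> 2 * (norm x)\<^sup>2 + 2 * (norm (y :: 'b :: real_inner))\<^sup>2"
  using norm_add_sq_le[of x "- y"] by simp

lemma square_integrable_bound:
  assumes "square_integrable M f" "g \<in> borel_measurable M" "\<And>x. x \<in> space M \<Longrightarrow> norm (g x) \<le> C * norm (f x)"
  shows "square_integrable M g"
  unfolding square_integrable_def
proof
  show "integrable M (\<lambda>x. (norm (g x))\<^sup>2)"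
  proof (rule Bochner_Integration.integrable_bound)
    show "integrable M (\<lambda>x. C\<^sup>2 * (norm (f x))\<^sup>2)"
      using assms by (simp add: square_integrable_def)
    show "AE x in M. norm ((norm (g x))\<^sup>2) \<le> norm (C\<^sup>2 * (norm (f x))\<^sup>2)"
    proof (rule AE_I2)
      fix x assume "x \<in> space M"
      from power_mono[OF assms(3)[OF this], of 2]
      show "norm ((norm (g x))\<^sup>2) \<le> norm (C\<^sup>2 * (norm (f x))\<^sup>2)" by (simp add: power_mult_distrib)
    qed
  qed (use assms in measurable)
qed fact

lemma square_integrable_add:
  assumes "square_integrable M f" "square_integrable M g"
  shows "square_integrable M (\<lambda>x. f x + g x)"
proof -
  have [measurable]: "f \<in> borel_measurable M" "g \<in> borel_measurable M"
    using assms by (auto simp: square_integrable_def)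
  have "integrable M (\<lambda>x. (norm (f x + g x))\<^sup>2)"
  proof (rule Bochner_Integration.integrable_bound)
    show "integrable M (\<lambda>x. 2 * (norm (f x))\<^sup>2 + 2 * (norm (g x))\<^sup>2)"
      using assms by (simp add: square_integrable_def)
    show "AE x in M. norm ((norm (f x + g x))\<^sup>2) \<le> norm (2 * (norm (f x))\<^sup>2 + 2 * (norm (g x))\<^sup>2)"
      using norm_add_sq_le by (intro AE_I2) simp
  qed measurable
  then show ?thesis by (simp add: square_integrable_def)
qed

lemma square_integrable_scaleR:
  assumes "square_integrable M f"
  shows "square_integrable M (\<lambda>x. c *\<^sub>R f x)"
  using assms unfolding square_integrable_def by (auto simp: power_mult_distrib)

lemma square_integrable_cmult:
  fixes f :: "'a \<Rightarrow> real"
  shows "square_integrable M f \<Longrightarrow> square_integrable M (\<lambda>x. c * f x)"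
  using square_integrable_scaleR[of M f c] by simp

lemma square_integrable_diff:
  assumes "square_integrable M f" "square_integrable M g"
  shows "square_integrable M (\<lambda>x. f x - g x)"
  using square_integrable_add[OF assms(1) square_integrable_scaleR[OF assms(2), of "-1"]] by simp

lemma square_integrable_zero [simp]: "square_integrable M (\<lambda>x. 0)"
  by (simp add: square_integrable_def)

lemma square_integrable_sum:
  assumes "\<And>i. i \<in> A \<Longrightarrow> square_integrable M (f i)"
  shows "square_integrable M (\<lambda>x. \<Sum>i\<in>A. f i x)"
  using assms
proof (induction A rule: infinite_finite_induct)
  case (insert x F)
  then show ?case using square_integrable_add[of M "f x" "\<lambda>y. \<Sum>i\<in>F. f i y"] by simp
qed simp_all

lemma square_integrable_bdd_mult:
  fixes \<psi> :: "'a \<Rightarrow> real"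
  assumes "square_integrable M f" "\<psi> \<in> borel_measurable M" "\<And>x. x \<in> space M \<Longrightarrow> \<bar>\<psi> x\<bar> \<le> B"
  shows "square_integrable M (\<lambda>x. \<psi> x *\<^sub>R f x)"
  using assms by (intro square_integrable_bound[OF assms(1), of _ B])
    (auto simp: square_integrable_def intro!: mult_right_mono)

lemma (in finite_measure) square_integrable_bounded:
  assumes "f \<in> borel_measurable M" "\<And>x. x \<in> space M \<Longrightarrow> norm (f x) \<le> B"
  shows "square_integrable M f"
  unfolding square_integrable_def
proof
  show "integrable M (\<lambda>x. (norm (f x))\<^sup>2)"
    using assms power_mono[OF assms(2), of _ 2]
    by (intro integrable_const_bound[of _ "B\<^sup>2"]) auto
qed fact

lemma integrable_bdd_mult:
  fixes \<psi> f :: "'a \<Rightarrow> real"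
  assumes "integrable M f" "\<psi> \<in> borel_measurable M" "\<And>x. x \<in> space M \<Longrightarrow> \<bar>\<psi> x\<bar> \<le> B"
  shows "integrable M (\<lambda>x. \<psi> x * f x)"
proof (rule Bochner_Integration.integrable_bound)
  show "integrable M (\<lambda>x. B * \<bar>f x\<bar>)" using assms by simp
  show "AE x in M. norm (\<psi> x * f x) \<le> norm (B * \<bar>f x\<bar>)"
  proof (rule AE_I2)
    fix x assume "x \<in> space M"
    then have "\<bar>\<psi> x\<bar> * \<bar>f x\<bar> \<le> B * \<bar>f x\<bar>" "0 \<le> B" using assms(3)[of x] by (auto intro: mult_right_mono)
    then show "norm (\<psi> x * f x) \<le> norm (B * \<bar>f x\<bar>)" by (simp add: abs_mult)
  qed
qed (use assms in measurable)

lemma square_integrable_inner: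
  assumes "square_integrable M f" "square_integrable M g"
  shows "integrable M (\<lambda>x. f x \<bullet> g x)"
proof (rule Bochner_Integration.integrable_bound)
  show "integrable M (\<lambda>x. (norm (f x))\<^sup>2 + (norm (g x))\<^sup>2)"
    using assms by (simp add: square_integrable_def)
  show "(\<lambda>x. f x \<bullet> g x) \<in> borel_measurable M"
    using assms by (auto simp: square_integrable_def)
  have "\<bar>x \<bullet> y\<bar> \<le> (norm x)\<^sup>2 + (norm y)\<^sup>2" for x y :: 'b
    using Cauchy_Schwarz_ineq2[of x y] sum_squares_bound[of "norm x" "norm y"]
      mult_nonneg_nonneg[OF norm_ge_zero[of x] norm_ge_zero[of y]] by linarith
  then show "AE x in M. norm (f x \<bullet> g x) \<le> norm ((norm (f x))\<^sup>2 + (norm (g x))\<^sup>2)"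
    by (intro AE_I2) simp
qed

lemma square_integrable_mult:
  fixes f g :: "'a \<Rightarrow> real"
  shows "square_integrable M f \<Longrightarrow> square_integrable M g \<Longrightarrow> integrable M (\<lambda>x. f x * g x)"
  using square_integrable_inner[of M f g] by simp

lemma (in finite_measure) square_integrable_integrable:
  fixes f :: "'a \<Rightarrow> real"
  shows "square_integrable M f \<Longrightarrow> integrable M f"
  using square_integrable_mult[of M f "\<lambda>_. 1"] square_integrable_bounded[of "\<lambda>_. 1 :: real" 1] by simp

lemma Cauchy_Schwarz_integral:
  assumes f: "square_integrable M f" and g: "square_integrable M g"
  shows "\<bar>\<integral>x. f x \<bullet> g x \<partial>M\<bar> \<le> sqrt (\<integral>x. (norm (f x))\<^sup>2 \<partial>M) * sqrt (\<integral>x. (norm (g x))\<^sup>2 \<partial>M)"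
proof -
  let ?a = "\<integral>x. (norm (f x))\<^sup>2 \<partial>M" and ?b = "\<integral>x. (norm (g x))\<^sup>2 \<partial>M" and ?c = "\<integral>x. f x \<bullet> g x \<partial>M"
  have fi: "integrable M (\<lambda>x. (norm (f x))\<^sup>2)" and gi: "integrable M (\<lambda>x. (norm (g x))\<^sup>2)"
    and fg: "integrable M (\<lambda>x. f x \<bullet> g x)"
    using f g square_integrable_inner[OF f g] by (auto simp: square_integrable_def)
  have q: "0 \<le> r\<^sup>2 * ?a + 2 * r * ?c + ?b" for r
  proof -
    have "0 \<le> (\<integral>x. (norm (r *\<^sub>R f x + g x))\<^sup>2 \<partial>M)" by simp
    also have "\<dots> = (\<integral>x. r\<^sup>2 * (norm (f x))\<^sup>2 + 2 * r * (f x \<bullet> g x) + (norm (g x))\<^sup>2 \<partial>M)"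
      unfolding power2_norm_eq_inner
      by (intro Bochner_Integration.integral_cong)
        (simp_all add: inner_add_left inner_add_right inner_commute algebra_simps power2_eq_square)
    also have "\<dots> = r\<^sup>2 * ?a + 2 * r * ?c + ?b"
      using fi gi fg by simp
    finally show ?thesis .
  qed
  have a0: "0 \<le> ?a" "0 \<le> ?b" by auto
  have "?c\<^sup>2 \<le> ?a * ?b"
  proof (cases "?a = 0")
    case True
    have "?c = 0"
    proof (rule ccontr)
      assume "?c \<noteq> 0"
      have "0 \<le> 2 * (- (?b + 1) / (2 * ?c)) * ?c + ?b" using q[of "- (?b + 1) / (2 * ?c)"] True by simp
      also have "\<dots> = - 1" using \<open>?c \<noteq> 0\<close> by (simp add: field_simps)
      finally show False by simp
    qed
    then show ?thesis using True by simp
  next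
    case False
    then have "0 < ?a" using a0 by linarith
    \<comment> \<open>The minimum of the quadratic polynomial, attained at \<open>- c / a\<close>.\<close>
    have "0 \<le> ?a * ((- ?c / ?a)\<^sup>2 * ?a + 2 * (- ?c / ?a) * ?c + ?b)"
      using q[of "- ?c / ?a"] a0 by (intro mult_nonneg_nonneg) auto
    also have "\<dots> = ?a * ?b - ?c\<^sup>2" using False by (simp add: field_simps power2_eq_square)
    finally show ?thesis by simp
  qed
  then show ?thesis using a0 by (metis real_sqrt_abs real_sqrt_le_mono real_sqrt_mult)
qed

text \<open>Convergence in \<open>L\<^sup>2\<close> of both factors implies convergence of the integrals of weighted inner
  products; this carries the isometry over from elementary integrands to their limits.\<close>

lemma tendsto_integral_inner_L2:
  fixes \<psi> :: "'a \<Rightarrow> real" and f g :: "'a \<Rightarrow> 'b :: euclidean_space"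
  assumes f: "\<And>j. square_integrable M (fs j)" "square_integrable M f" "(\<lambda>j. \<integral>x. (norm (fs j x - f x))\<^sup>2 \<partial>M) \<longlonglongrightarrow> 0"
    and g: "\<And>j. square_integrable M (gs j)" "square_integrable M g" "(\<lambda>j. \<integral>x. (norm (gs j x - g x))\<^sup>2 \<partial>M) \<longlonglongrightarrow> 0"
    and \<psi>: "\<psi> \<in> borel_measurable M" "\<And>x. x \<in> space M \<Longrightarrow> \<bar>\<psi> x\<bar> \<le> B"
  shows "(\<lambda>j. \<integral>x. \<psi> x * (fs j x \<bullet> gs j x) \<partial>M) \<longlonglongrightarrow> (\<integral>x. \<psi> x * (f x \<bullet> g x) \<partial>M)"
proof -
  let ?n = "\<lambda>h. sqrt (\<integral>x. (norm (h x :: 'b))\<^sup>2 \<partial>M)"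
  let ?df = "\<lambda>j x. fs j x - f x" and ?dg = "\<lambda>j x. gs j x - g x"
  have df: "square_integrable M (?df j)" and dg: "square_integrable M (?dg j)" for j
    using f g by (auto intro: square_integrable_diff)
  have mul: "square_integrable M h \<Longrightarrow> square_integrable M (\<lambda>x. \<psi> x *\<^sub>R h x)" for h :: "'a \<Rightarrow> 'b"
    by (rule square_integrable_bdd_mult[OF _ \<psi>])
  have E: "(\<integral>x. \<psi> x * (fs j x \<bullet> gs j x) \<partial>M) - (\<integral>x. \<psi> x * (f x \<bullet> g x) \<partial>M)
    = (\<integral>x. ?df j x \<bullet> (\<psi> x *\<^sub>R ?dg j x) \<partial>M) + (\<integral>x. ?df j x \<bullet> (\<psi> x *\<^sub>R g x) \<partial>M) + (\<integral>x. ?dg j x \<bullet> (\<psi> x *\<^sub>R f x) \<partial>M)" for j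
  proof -
    have i: "integrable M (\<lambda>x. \<psi> x * (fs j x \<bullet> gs j x))" "integrable M (\<lambda>x. \<psi> x * (f x \<bullet> g x))"
      using square_integrable_inner[OF f(1) mul[OF g(1)], of j j] square_integrable_inner[OF f(2) mul[OF g(2)]] by simp_all
    have "(\<integral>x. ?df j x \<bullet> (\<psi> x *\<^sub>R ?dg j x) \<partial>M) + (\<integral>x. ?df j x \<bullet> (\<psi> x *\<^sub>R g x) \<partial>M) + (\<integral>x. ?dg j x \<bullet> (\<psi> x *\<^sub>R f x) \<partial>M)
       = (\<integral>x. ?df j x \<bullet> (\<psi> x *\<^sub>R ?dg j x) + ?df j x \<bullet> (\<psi> x *\<^sub>R g x) + ?dg j x \<bullet> (\<psi> x *\<^sub>R f x) \<partial>M)"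
      using square_integrable_inner[OF df mul[OF dg], of j j] square_integrable_inner[OF df mul[OF g(2)], of j]
        square_integrable_inner[OF dg mul[OF f(2)], of j]
      by (subst Bochner_Integration.integral_add Bochner_Integration.integrable_add; (simp del: inner_scaleR_right)?)+
    also have "\<dots> = (\<integral>x. \<psi> x * (fs j x \<bullet> gs j x) - \<psi> x * (f x \<bullet> g x) \<partial>M)"
      by (intro Bochner_Integration.integral_cong) (simp_all add: inner_diff_left inner_diff_right algebra_simps inner_commute)
    also have "\<dots> = (\<integral>x. \<psi> x * (fs j x \<bullet> gs j x) \<partial>M) - (\<integral>x. \<psi> x * (f x \<bullet> g x) \<partial>M)"
      using i by (rule Bochner_Integration.integral_diff)
    finally show ?thesis by simp
  qed
  have B: "?n (\<lambda>x. \<psi> x *\<^sub>R h x) \<le> \<bar>B\<bar> * ?n h" if "square_integrable M h" for h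
  proof -
    have "(\<integral>x. (norm (\<psi> x *\<^sub>R h x))\<^sup>2 \<partial>M) \<le> (\<integral>x. B\<^sup>2 * (norm (h x))\<^sup>2 \<partial>M)"
    proof (rule integral_mono)
      show "(norm (\<psi> x *\<^sub>R h x))\<^sup>2 \<le> B\<^sup>2 * (norm (h x))\<^sup>2" if "x \<in> space M" for x
        using power_mono[OF \<psi>(2)[OF that], of 2] by (simp add: power_mult_distrib mult_right_mono)
    qed (use that mul[OF that] in \<open>auto simp: square_integrable_def\<close>)
    then have "?n (\<lambda>x. \<psi> x *\<^sub>R h x) \<le> sqrt (B\<^sup>2 * (\<integral>x. (norm (h x))\<^sup>2 \<partial>M))"
      by (intro real_sqrt_le_mono) simp
    then show ?thesis by (simp add: real_sqrt_mult)
  qed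
  have CS: "\<bar>\<integral>x. p x \<bullet> (\<psi> x *\<^sub>R q x) \<partial>M\<bar> \<le> ?n p * (\<bar>B\<bar> * ?n q)" if "square_integrable M p" "square_integrable M q" for p q
    using Cauchy_Schwarz_integral[OF that(1) mul[OF that(2)]] B[OF that(2)]
    by (rule order_trans[OF _ mult_left_mono]) simp
  have l0: "(\<lambda>j. ?n (?df j)) \<longlonglongrightarrow> 0" "(\<lambda>j. ?n (?dg j)) \<longlonglongrightarrow> 0"
    using tendsto_real_sqrt[OF f(3)] tendsto_real_sqrt[OF g(3)] by simp_all
  have "(\<lambda>j. (\<integral>x. \<psi> x * (fs j x \<bullet> gs j x) \<partial>M) - (\<integral>x. \<psi> x * (f x \<bullet> g x) \<partial>M)) \<longlonglongrightarrow> 0"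
  proof (rule Lim_null_comparison)
    show "\<forall>\<^sub>F j in sequentially. norm ((\<integral>x. \<psi> x * (fs j x \<bullet> gs j x) \<partial>M) - (\<integral>x. \<psi> x * (f x \<bullet> g x) \<partial>M))
       \<le> ?n (?df j) * (\<bar>B\<bar> * ?n (?dg j)) + ?n (?df j) * (\<bar>B\<bar> * ?n g) + ?n (?dg j) * (\<bar>B\<bar> * ?n f)"
      unfolding E real_norm_def
      by (intro always_eventually allI order_trans[OF abs_triangle_ineq] add_mono CS df dg f g)
    have "(\<lambda>j. ?n (?df j) * (\<bar>B\<bar> * ?n (?dg j)) + ?n (?df j) * (\<bar>B\<bar> * ?n g) + ?n (?dg j) * (\<bar>B\<bar> * ?n f)) \<longlonglongrightarrow>
       0 * (\<bar>B\<bar> * 0) + 0 * (\<bar>B\<bar> * ?n g) + 0 * (\<bar>B\<bar> * ?n f)"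
      by (intro tendsto_intros l0)
    then show "(\<lambda>j. ?n (?df j) * (\<bar>B\<bar> * ?n (?dg j)) + ?n (?df j) * (\<bar>B\<bar> * ?n g) + ?n (?dg j) * (\<bar>B\<bar> * ?n f)) \<longlonglongrightarrow> 0"
      by simp
  qed
  then show ?thesis using LIM_zero_iff by blast
qed

lemma square_integrable_nn:
  assumes "f \<in> borel_measurable M" "(\<integral>\<^sup>+x. ennreal ((norm (f x))\<^sup>2) \<partial>M) < \<infinity>"
  shows "square_integrable M f"
  using assms unfolding square_integrable_def by (auto intro!: integrableI_nonneg)

lemma nn_integral_sq_eq:
  "square_integrable M f \<Longrightarrow> (\<integral>\<^sup>+x. ennreal ((norm (f x))\<^sup>2) \<partial>M) = ennreal (\<integral>x. (norm (f x))\<^sup>2 \<partial>M)"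
  by (intro nn_integral_eq_integral) (auto simp: square_integrable_def)

lemma L2_tendsto_nn:
  assumes "\<And>j. square_integrable M (fs j)" "square_integrable M f"
    "(\<lambda>j. \<integral>\<^sup>+x. ennreal ((norm (fs j x - f x))\<^sup>2) \<partial>M) \<longlonglongrightarrow> 0"
  shows "(\<lambda>j. \<integral>x. (norm (fs j x - f x))\<^sup>2 \<partial>M) \<longlonglongrightarrow> 0"
proof -
  have "(\<lambda>j. ennreal (\<integral>x. (norm (fs j x - f x))\<^sup>2 \<partial>M)) \<longlonglongrightarrow> ennreal 0"
    using assms(3) by (simp add: nn_integral_sq_eq square_integrable_diff assms(1,2))
  then show ?thesis by (subst (asm) tendsto_ennreal_iff) auto
qed

lemma L2_limit_square_integrable:
  assumes "\<And>j. square_integrable M (fs j)" "f \<in> borel_measurable M"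
    "(\<lambda>j. \<integral>\<^sup>+x. ennreal ((norm (fs j x - f x))\<^sup>2) \<partial>M) \<longlonglongrightarrow> 0"
  shows "square_integrable M f"
proof -
  have "\<forall>\<^sub>F j in sequentially. (\<integral>\<^sup>+x. ennreal ((norm (fs j x - f x))\<^sup>2) \<partial>M) < \<infinity>"
    using order_tendstoD(2)[OF assms(3), of \<infinity>] by simp
  then obtain j where j: "(\<integral>\<^sup>+x. ennreal ((norm (fs j x - f x))\<^sup>2) \<partial>M) < \<infinity>"
    by (auto simp: eventually_sequentially)
  have [measurable]: "fs j \<in> borel_measurable M" using assms(1) by (rule square_integrable_measurable)
  have "square_integrable M (\<lambda>x. fs j x - f x)"
    using j assms(2) by (intro square_integrable_nn) auto
  from square_integrable_diff[OF assms(1)[of j] this] show ?thesis by simp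
qed

lemma L2_tendsto_trans:
  assumes s: "\<And>j. square_integrable M (fs j)" "\<And>j. square_integrable M (gs j)" "square_integrable M f"
    and l: "(\<lambda>j. \<integral>x. (norm (gs j x - f x))\<^sup>2 \<partial>M) \<longlonglongrightarrow> 0"
    "(\<lambda>j. \<integral>x. (norm (fs j x - gs j x))\<^sup>2 \<partial>M) \<longlonglongrightarrow> 0"
  shows "(\<lambda>j. \<integral>x. (norm (fs j x - f x))\<^sup>2 \<partial>M) \<longlonglongrightarrow> 0"
proof (rule Lim_null_comparison)
  show "\<forall>\<^sub>F j in sequentially. norm (\<integral>x. (norm (fs j x - f x))\<^sup>2 \<partial>M) \<le>
    2 * (\<integral>x. (norm (fs j x - gs j x))\<^sup>2 \<partial>M) + 2 * (\<integral>x. (norm (gs j x - f x))\<^sup>2 \<partial>M)"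
  proof (intro always_eventually allI)
    fix j
    have i: "integrable M (\<lambda>x. (norm (fs j x - gs j x))\<^sup>2)" "integrable M (\<lambda>x. (norm (gs j x - f x))\<^sup>2)"
      "integrable M (\<lambda>x. (norm (fs j x - f x))\<^sup>2)"
      using square_integrable_diff[OF s(1) s(2), of j j] square_integrable_diff[OF s(2) s(3), of j]
        square_integrable_diff[OF s(1) s(3), of j] by (auto simp: square_integrable_def)
    have "(\<integral>x. (norm (fs j x - f x))\<^sup>2 \<partial>M) \<le> (\<integral>x. 2 * (norm (fs j x - gs j x))\<^sup>2 + 2 * (norm (gs j x - f x))\<^sup>2 \<partial>M)"
    proof (rule integral_mono)
      show "(norm (fs j x - f x))\<^sup>2 \<le> 2 * (norm (fs j x - gs j x))\<^sup>2 + 2 * (norm (gs j x - f x))\<^sup>2" for x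
        using norm_add_sq_le[of "fs j x - gs j x" "gs j x - f x"] by simp
    qed (use i in auto)
    then show "norm (\<integral>x. (norm (fs j x - f x))\<^sup>2 \<partial>M) \<le>
      2 * (\<integral>x. (norm (fs j x - gs j x))\<^sup>2 \<partial>M) + 2 * (\<integral>x. (norm (gs j x - f x))\<^sup>2 \<partial>M)"
      using i by simp
  qed
  show "(\<lambda>j. 2 * (\<integral>x. (norm (fs j x - gs j x))\<^sup>2 \<partial>M) + 2 * (\<integral>x. (norm (gs j x - f x))\<^sup>2 \<partial>M)) \<longlonglongrightarrow> 0"
    using tendsto_add[OF tendsto_mult_left[OF l(2), of 2] tendsto_mult_left[OF l(1), of 2]] by simp
qed

section \<open>Conditional moments of products with Brownian increments\<close>

lemma inner_vec_sum: "(x :: real^'k) \<bullet> y = (\<Sum>i\<in>UNIV. x $ i * y $ i)"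
  by (simp add: inner_vec_def)

lemma norm_power4_le: "norm (x :: real^'k) ^ 4 \<le> real CARD('k) * (\<Sum>i\<in>UNIV. (x $ i) ^ 4)"
proof -
  have "norm x ^ 4 = ((norm x)\<^sup>2)\<^sup>2" by simp
  also have "(norm x)\<^sup>2 = (\<Sum>i\<in>UNIV. (x $ i)\<^sup>2)"
    unfolding power2_norm_eq_inner inner_vec_sum by (simp add: power2_eq_square)
  also have "\<dots>\<^sup>2 \<le> (\<Sum>i\<in>UNIV. ((x $ i)\<^sup>2)\<^sup>2) * real CARD('k)"
    by (rule sum_squared_le_sum_of_squares)
  finally show ?thesis by (simp add: mult.commute)
qed

context brownian_motion begin

lemma F_measurable_increment:
  assumes "0 \<le> a" "a \<le> b" "b \<le> t"
  shows "(\<lambda>\<omega>. W b \<omega> - W a \<omega>) \<in> borel_measurable (F t)"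
  using W_adapted[of b t] W_adapted[of a t] assms by simp

lemma F_measurable_inner_increment:
  assumes "0 \<le> a" "a \<le> b" "b \<le> t" "\<xi> \<in> borel_measurable (F a)"
  shows "(\<lambda>\<omega>. \<xi> \<omega> \<bullet> (W b \<omega> - W a \<omega>)) \<in> borel_measurable (F t)"
  using F_measurable_increment[OF assms(1-3)] measurable_F_mono[OF assms(4), of t] assms(1-3) by simp

lemma expectation_mult_increment_fun:
  assumes ab: "0 \<le> a" "a \<le> b" and Z: "Z \<in> borel_measurable (F a)" "integrable M Z"
    and g: "g \<in> borel_measurable borel" "integrable M (\<lambda>\<omega>. g (W b \<omega> - W a \<omega>))"
  shows "integrable M (\<lambda>\<omega>. Z \<omega> * (g (W b \<omega> - W a \<omega>) :: real))"
    and "expectation (\<lambda>\<omega>. Z \<omega> * g (W b \<omega> - W a \<omega>)) = expectation Z * expectation (\<lambda>\<omega>. g (W b \<omega> - W a \<omega>))"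
  using indep_var_integrable[OF indep_var_past[OF ab Z(1) g(1)] Z(2) g(2)]
    indep_var_lebesgue_integral[OF indep_var_past[OF ab Z(1) g(1)] Z(2) g(2)] by auto

lemma integrable_mult_component:
  fixes \<xi> :: "'a \<Rightarrow> real^'k"
  assumes Z: "Z \<in> borel_measurable (F a)" "integrable M Z" and \<xi>: "\<xi> \<in> borel_measurable (F a)"
    "\<And>\<omega>. \<omega> \<in> space M \<Longrightarrow> norm (\<xi> \<omega>) \<le> B"
  shows "(\<lambda>\<omega>. Z \<omega> * \<xi> \<omega> $ i) \<in> borel_measurable (F a)" "integrable M (\<lambda>\<omega>. Z \<omega> * \<xi> \<omega> $ i)"
proof -
  have m: "(\<lambda>\<omega>. \<xi> \<omega> $ i) \<in> borel_measurable (F a)"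
    by (rule measurable_compose[OF \<xi>(1) borel_measurable_nth])
  then show "(\<lambda>\<omega>. Z \<omega> * \<xi> \<omega> $ i) \<in> borel_measurable (F a)" using Z(1) by simp
  have "integrable M (\<lambda>\<omega>. \<xi> \<omega> $ i * Z \<omega>)"
  proof (rule integrable_bdd_mult[OF Z(2)])
    show "(\<lambda>\<omega>. \<xi> \<omega> $ i) \<in> borel_measurable M" using m by (rule measurable_F_imp)
    show "\<bar>\<xi> \<omega> $ i\<bar> \<le> B" if "\<omega> \<in> space M" for \<omega>
      using \<xi>(2)[OF that] component_le_norm_cart[of "\<xi> \<omega>" i] by linarith
  qed
  then show "integrable M (\<lambda>\<omega>. Z \<omega> * \<xi> \<omega> $ i)" by (simp add: mult.commute)
qed

text \<open>An increment over \<open>[a, b]\<close> is centred, and independent of \<open>F a\<close>.\<close>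

lemma expectation_mult_inner_increment:
  assumes ab: "0 \<le> a" "a \<le> b" and Z: "Z \<in> borel_measurable (F a)" "integrable M Z"
    and \<xi>: "\<xi> \<in> borel_measurable (F a)" "\<And>\<omega>. \<omega> \<in> space M \<Longrightarrow> norm (\<xi> \<omega>) \<le> B"
  shows "integrable M (\<lambda>\<omega>. Z \<omega> * (\<xi> \<omega> \<bullet> (W b \<omega> - W a \<omega>)))"
    and "expectation (\<lambda>\<omega>. Z \<omega> * (\<xi> \<omega> \<bullet> (W b \<omega> - W a \<omega>))) = 0"
proof -
  have eq: "(\<lambda>\<omega>. Z \<omega> * (\<xi> \<omega> \<bullet> (W b \<omega> - W a \<omega>)))
    = (\<lambda>\<omega>. \<Sum>i\<in>UNIV. (Z \<omega> * \<xi> \<omega> $ i) * ((W b \<omega> - W a \<omega>) $ i))"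
    unfolding inner_vec_sum by (simp add: sum_distrib_left mult.assoc)
  have I: "integrable M (\<lambda>\<omega>. (Z \<omega> * \<xi> \<omega> $ i) * ((W b \<omega> - W a \<omega>) $ i))"
    "expectation (\<lambda>\<omega>. (Z \<omega> * \<xi> \<omega> $ i) * ((W b \<omega> - W a \<omega>) $ i)) = 0" for i
    using expectation_mult_increment_fun[OF ab integrable_mult_component[OF Z \<xi>] borel_measurable_nth, of i i]
      increment_moment_integrable[OF ab, of i 1] increment_mean[OF ab, of i] by simp_all
  show "integrable M (\<lambda>\<omega>. Z \<omega> * (\<xi> \<omega> \<bullet> (W b \<omega> - W a \<omega>)))"
    unfolding eq using I(1) by (rule Bochner_Integration.integrable_sum)
  show "expectation (\<lambda>\<omega>. Z \<omega> * (\<xi> \<omega> \<bullet> (W b \<omega> - W a \<omega>))) = 0"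
    unfolding eq using I by (subst Bochner_Integration.integral_sum) auto
qed

lemma expectation_mult_inner_increment_prod:
  assumes ab: "0 \<le> a" "a \<le> b" and Z: "Z \<in> borel_measurable (F a)" "integrable M Z"
    and \<xi>: "\<xi> \<in> borel_measurable (F a)" "\<And>\<omega>. \<omega> \<in> space M \<Longrightarrow> norm (\<xi> \<omega>) \<le> B"
    and \<xi>': "\<xi>' \<in> borel_measurable (F a)" "\<And>\<omega>. \<omega> \<in> space M \<Longrightarrow> norm (\<xi>' \<omega>) \<le> B'"
  shows "integrable M (\<lambda>\<omega>. Z \<omega> * ((\<xi> \<omega> \<bullet> (W b \<omega> - W a \<omega>)) * (\<xi>' \<omega> \<bullet> (W b \<omega> - W a \<omega>))))"
    and "expectation (\<lambda>\<omega>. Z \<omega> * ((\<xi> \<omega> \<bullet> (W b \<omega> - W a \<omega>)) * (\<xi>' \<omega> \<bullet> (W b \<omega> - W a \<omega>))))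
      = expectation (\<lambda>\<omega>. Z \<omega> * (\<xi> \<omega> \<bullet> \<xi>' \<omega>)) * (b - a)"
proof -
  let ?D = "\<lambda>\<omega>. W b \<omega> - W a \<omega>"
  let ?Z = "\<lambda>i j \<omega>. Z \<omega> * \<xi> \<omega> $ i * \<xi>' \<omega> $ j"
  have eq: "(\<lambda>\<omega>. Z \<omega> * ((\<xi> \<omega> \<bullet> ?D \<omega>) * (\<xi>' \<omega> \<bullet> ?D \<omega>)))
    = (\<lambda>\<omega>. \<Sum>i\<in>UNIV. \<Sum>j\<in>UNIV. ?Z i j \<omega> * (?D \<omega> $ i * ?D \<omega> $ j))"
    unfolding inner_vec_sum sum_product unfolding sum_distrib_left by (intro ext sum.cong) simp_all
  have Zij: "?Z i j \<in> borel_measurable (F a)" "integrable M (?Z i j)" for i j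
    using integrable_mult_component[OF integrable_mult_component[OF Z \<xi>] \<xi>', of i j] by auto
  have I: "integrable M (\<lambda>\<omega>. ?Z i j \<omega> * (?D \<omega> $ i * ?D \<omega> $ j))"
    "expectation (\<lambda>\<omega>. ?Z i j \<omega> * (?D \<omega> $ i * ?D \<omega> $ j)) = expectation (?Z i j) * (if i = j then b - a else 0)" for i j
  proof -
    have m: "(\<lambda>x. x $ i * x $ j) \<in> borel_measurable (borel :: (real^'n) measure)"
      by (intro borel_measurable_times borel_measurable_nth)
    show "integrable M (\<lambda>\<omega>. ?Z i j \<omega> * (?D \<omega> $ i * ?D \<omega> $ j))"
      "expectation (\<lambda>\<omega>. ?Z i j \<omega> * (?D \<omega> $ i * ?D \<omega> $ j)) = expectation (?Z i j) * (if i = j then b - a else 0)"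
      using expectation_mult_increment_fun[OF ab Zij m increment_prod_integrable[OF ab], of i j]
        increment_covariance[OF ab, of i j] by simp_all
  qed
  show "integrable M (\<lambda>\<omega>. Z \<omega> * ((\<xi> \<omega> \<bullet> ?D \<omega>) * (\<xi>' \<omega> \<bullet> ?D \<omega>)))"
    unfolding eq by (intro Bochner_Integration.integrable_sum I)
  have "expectation (\<lambda>\<omega>. Z \<omega> * ((\<xi> \<omega> \<bullet> ?D \<omega>) * (\<xi>' \<omega> \<bullet> ?D \<omega>)))
    = (\<Sum>i\<in>UNIV. \<Sum>j\<in>UNIV. expectation (?Z i j) * (if i = j then b - a else 0))"
    unfolding eq using I by (simp add: Bochner_Integration.integral_sum)
  also have "\<dots> = (\<Sum>i\<in>UNIV. expectation (?Z i i) * (b - a))"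
    by (intro sum.cong refl) (simp add: if_distrib cong: if_cong)
  also have "\<dots> = expectation (\<lambda>\<omega>. \<Sum>i\<in>UNIV. ?Z i i \<omega>) * (b - a)"
    using Zij by (simp add: Bochner_Integration.integral_sum sum_distrib_right)
  also have "(\<lambda>\<omega>. \<Sum>i\<in>UNIV. ?Z i i \<omega>) = (\<lambda>\<omega>. Z \<omega> * (\<xi> \<omega> \<bullet> \<xi>' \<omega>))"
    unfolding inner_vec_sum by (simp add: sum_distrib_left mult.assoc)
  finally show "expectation (\<lambda>\<omega>. Z \<omega> * ((\<xi> \<omega> \<bullet> ?D \<omega>) * (\<xi>' \<omega> \<bullet> ?D \<omega>)))
    = expectation (\<lambda>\<omega>. Z \<omega> * (\<xi> \<omega> \<bullet> \<xi>' \<omega>)) * (b - a)" .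
qed

lemma inner_increment_fourth:
  assumes ab: "0 \<le> a" "a \<le> b"
    and \<xi>: "\<xi> \<in> borel_measurable (F a)" "\<And>\<omega>. \<omega> \<in> space M \<Longrightarrow> norm (\<xi> \<omega>) \<le> B" and B: "0 \<le> B"
  shows "integrable M (\<lambda>\<omega>. (\<xi> \<omega> \<bullet> (W b \<omega> - W a \<omega>)) ^ 4)"
    and "expectation (\<lambda>\<omega>. (\<xi> \<omega> \<bullet> (W b \<omega> - W a \<omega>)) ^ 4) \<le> 3 * (real CARD('n))\<^sup>2 * B ^ 4 * (b - a)\<^sup>2"
proof -
  let ?D = "\<lambda>\<omega>. W b \<omega> - W a \<omega>"
  let ?R = "\<lambda>\<omega>. B ^ 4 * (real CARD('n) * (\<Sum>i\<in>UNIV. (?D \<omega> $ i) ^ 4))"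
  have le: "(\<xi> \<omega> \<bullet> ?D \<omega>) ^ 4 \<le> ?R \<omega>" if "\<omega> \<in> space M" for \<omega>
  proof -
    have "\<bar>\<xi> \<omega> \<bullet> ?D \<omega>\<bar> \<le> B * norm (?D \<omega>)"
      using Cauchy_Schwarz_ineq2[of "\<xi> \<omega>" "?D \<omega>"] mult_right_mono[OF \<xi>(2)[OF that] norm_ge_zero[of "?D \<omega>"]] by linarith
    from power_mono[OF this, of 4] have "(\<xi> \<omega> \<bullet> ?D \<omega>) ^ 4 \<le> B ^ 4 * norm (?D \<omega>) ^ 4"
      by (simp add: power_mult_distrib power_even_abs)
    also have "\<dots> \<le> ?R \<omega>" using B by (intro mult_left_mono norm_power4_le) simp
    finally show ?thesis .
  qed
  have Ri: "integrable M ?R" using increment_moment_integrable[OF ab] by simp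
  have m: "(\<lambda>\<omega>. \<xi> \<omega> \<bullet> ?D \<omega>) \<in> borel_measurable M"
    using F_measurable_inner_increment[OF ab order_refl \<xi>(1)] by (rule measurable_F_imp)
  show I: "integrable M (\<lambda>\<omega>. (\<xi> \<omega> \<bullet> ?D \<omega>) ^ 4)"
  proof (rule Bochner_Integration.integrable_bound[OF Ri])
    show "AE \<omega> in M. norm ((\<xi> \<omega> \<bullet> ?D \<omega>) ^ 4) \<le> norm (?R \<omega>)"
    proof (rule AE_I2)
      fix \<omega> assume "\<omega> \<in> space M"
      have "norm ((\<xi> \<omega> \<bullet> ?D \<omega>) ^ 4) = (\<xi> \<omega> \<bullet> ?D \<omega>) ^ 4" by simp
      also have "\<dots> \<le> ?R \<omega>" by (rule le) fact
      also have "\<dots> \<le> norm (?R \<omega>)" unfolding real_norm_def by (rule abs_ge_self)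
      finally show "norm ((\<xi> \<omega> \<bullet> ?D \<omega>) ^ 4) \<le> norm (?R \<omega>)" .
    qed
  qed (use m in simp)
  have "expectation (\<lambda>\<omega>. (\<xi> \<omega> \<bullet> ?D \<omega>) ^ 4) \<le> expectation ?R"
    using I Ri le by (rule integral_mono)
  also have "\<dots> = B ^ 4 * (real CARD('n) * (real CARD('n) * (3 * (b - a)\<^sup>2)))"
    using increment_moment_integrable[OF ab]
    by (simp add: increment_fourth_moment[OF ab] del: vector_minus_component)
  finally show "expectation (\<lambda>\<omega>. (\<xi> \<omega> \<bullet> ?D \<omega>) ^ 4) \<le> 3 * (real CARD('n))\<^sup>2 * B ^ 4 * (b - a)\<^sup>2"
    by (simp only: power2_eq_square mult_ac)
qed

lemma square_integrable_inner_increment: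
  assumes ab: "0 \<le> a" "a \<le> b"
    and \<xi>: "\<xi> \<in> borel_measurable (F a)" "\<And>\<omega>. \<omega> \<in> space M \<Longrightarrow> norm (\<xi> \<omega>) \<le> B"
  shows "square_integrable M (\<lambda>\<omega>. \<xi> \<omega> \<bullet> (W b \<omega> - W a \<omega>))"
proof -
  have "integrable M (\<lambda>\<omega>. 1 * ((\<xi> \<omega> \<bullet> (W b \<omega> - W a \<omega>)) * (\<xi> \<omega> \<bullet> (W b \<omega> - W a \<omega>))))"
    by (rule expectation_mult_inner_increment_prod(1)[OF ab _ _ \<xi> \<xi>]) simp_all
  then have "integrable M (\<lambda>\<omega>. (norm (\<xi> \<omega> \<bullet> (W b \<omega> - W a \<omega>)))\<^sup>2)"
    by (simp add: power2_eq_square del: inner_diff_right)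
  then show ?thesis
    using measurable_F_imp[OF F_measurable_inner_increment[OF ab order_refl \<xi>(1)]]
    unfolding square_integrable_def by blast
qed

text \<open>The length of the intersection of the intervals \<open>[c, d]\<close> and \<open>[c', d']\<close>.\<close>

definition overlap :: "real \<Rightarrow> real \<Rightarrow> real \<Rightarrow> real \<Rightarrow> real" where
  "overlap c d c' d' = max 0 (min d d' - max c c')"

lemma expectation_increment_pair_same_start:
  assumes c: "0 \<le> c" "c \<le> d" "d \<le> d'"
    and \<psi>: "\<psi> \<in> borel_measurable (F c)" "\<And>\<omega>. \<omega> \<in> space M \<Longrightarrow> \<bar>\<psi> \<omega>\<bar> \<le> K"
    and \<xi>: "\<xi> \<in> borel_measurable (F c)" "\<And>\<omega>. \<omega> \<in> space M \<Longrightarrow> norm (\<xi> \<omega>) \<le> B"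
    and \<xi>': "\<xi>' \<in> borel_measurable (F c)" "\<And>\<omega>. \<omega> \<in> space M \<Longrightarrow> norm (\<xi>' \<omega>) \<le> B'"
  shows "expectation (\<lambda>\<omega>. \<psi> \<omega> * ((\<xi> \<omega> \<bullet> (W d \<omega> - W c \<omega>)) * (\<xi>' \<omega> \<bullet> (W d' \<omega> - W c \<omega>))))
    = expectation (\<lambda>\<omega>. \<psi> \<omega> * (\<xi> \<omega> \<bullet> \<xi>' \<omega>)) * (d - c)"
proof -
  let ?V = "\<lambda>\<omega>. \<xi> \<omega> \<bullet> (W d \<omega> - W c \<omega>)"
  have d: "0 \<le> d" using c by simp
  have \<psi>i: "integrable M \<psi>"
    using \<psi> by (intro integrable_const_bound[of _ K]) (auto intro: measurable_F_imp)
  note A = expectation_mult_inner_increment_prod[OF c(1,2) \<psi>(1) \<psi>i \<xi> \<xi>']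
  have Vi: "integrable M (\<lambda>\<omega>. \<psi> \<omega> * ?V \<omega>)"
    using expectation_mult_inner_increment(1)[OF c(1,2) \<psi>(1) \<psi>i \<xi>] .
  have Vm: "(\<lambda>\<omega>. \<psi> \<omega> * ?V \<omega>) \<in> borel_measurable (F d)"
    using measurable_F_mono[OF \<psi>(1) c(2)] F_measurable_inner_increment[OF c(1,2) order_refl \<xi>(1)] by simp
  note B = expectation_mult_inner_increment[OF d c(3) Vm Vi measurable_F_mono[OF \<xi>'(1) c(2)] \<xi>'(2)]
  have "(\<lambda>\<omega>. \<psi> \<omega> * (?V \<omega> * (\<xi>' \<omega> \<bullet> (W d' \<omega> - W c \<omega>)))) =
    (\<lambda>\<omega>. \<psi> \<omega> * (?V \<omega> * (\<xi>' \<omega> \<bullet> (W d \<omega> - W c \<omega>))) + \<psi> \<omega> * ?V \<omega> * (\<xi>' \<omega> \<bullet> (W d' \<omega> - W d \<omega>)))"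
    by (simp add: inner_diff_right algebra_simps)
  then show ?thesis using A B by simp
qed

lemma expectation_increment_pair_le:
  assumes c: "0 \<le> c" "c \<le> d" "c \<le> c'" "c' \<le> d'"
    and \<psi>: "\<psi> \<in> borel_measurable (F c)" "\<And>\<omega>. \<omega> \<in> space M \<Longrightarrow> \<bar>\<psi> \<omega>\<bar> \<le> K"
    and \<xi>: "\<xi> \<in> borel_measurable (F c)" "\<And>\<omega>. \<omega> \<in> space M \<Longrightarrow> norm (\<xi> \<omega>) \<le> B"
    and \<xi>': "\<xi>' \<in> borel_measurable (F c')" "\<And>\<omega>. \<omega> \<in> space M \<Longrightarrow> norm (\<xi>' \<omega>) \<le> B'"
  shows "expectation (\<lambda>\<omega>. \<psi> \<omega> * ((\<xi> \<omega> \<bullet> (W d \<omega> - W c \<omega>)) * (\<xi>' \<omega> \<bullet> (W d' \<omega> - W c' \<omega>))))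
    = expectation (\<lambda>\<omega>. \<psi> \<omega> * (\<xi> \<omega> \<bullet> \<xi>' \<omega>)) * overlap c d c' d'"
proof -
  have c': "0 \<le> c'" using c by simp
  have \<psi>i: "integrable M \<psi>"
    using \<psi> by (intro integrable_const_bound[of _ K]) (auto intro: measurable_F_imp)
  note \<psi>' = measurable_F_mono[OF \<psi>(1) c(3)] and \<xi>c' = measurable_F_mono[OF \<xi>(1) c(3)]
  have zero: "integrable M (\<lambda>\<omega>. \<psi> \<omega> * (\<xi> \<omega> \<bullet> (W e \<omega> - W c \<omega>)) * (\<xi>' \<omega> \<bullet> (W d' \<omega> - W c' \<omega>)))"
    "expectation (\<lambda>\<omega>. \<psi> \<omega> * (\<xi> \<omega> \<bullet> (W e \<omega> - W c \<omega>)) * (\<xi>' \<omega> \<bullet> (W d' \<omega> - W c' \<omega>))) = 0"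
    if e: "c \<le> e" "e \<le> c'" for e
  proof -
    have "(\<lambda>\<omega>. \<psi> \<omega> * (\<xi> \<omega> \<bullet> (W e \<omega> - W c \<omega>))) \<in> borel_measurable (F c')"
      using \<psi>' F_measurable_inner_increment[OF c(1) e \<xi>(1)] by simp
    from expectation_mult_inner_increment[OF c' c(4) this
      expectation_mult_inner_increment(1)[OF c(1) e(1) \<psi>(1) \<psi>i \<xi>] \<xi>']
    show "integrable M (\<lambda>\<omega>. \<psi> \<omega> * (\<xi> \<omega> \<bullet> (W e \<omega> - W c \<omega>)) * (\<xi>' \<omega> \<bullet> (W d' \<omega> - W c' \<omega>)))"
    "expectation (\<lambda>\<omega>. \<psi> \<omega> * (\<xi> \<omega> \<bullet> (W e \<omega> - W c \<omega>)) * (\<xi>' \<omega> \<bullet> (W d' \<omega> - W c' \<omega>))) = 0"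
      by blast+
  qed
  show ?thesis
  proof (cases "d \<le> c'")
    case True
    then have "overlap c d c' d' = 0" using c by (simp add: overlap_def)
    then show ?thesis using zero(2)[OF c(2) True] by (simp add: mult.assoc)
  next
    case False
    then have dc': "c' \<le> d" by simp
    let ?V = "\<lambda>\<omega>. \<xi> \<omega> \<bullet> (W d \<omega> - W c' \<omega>)" and ?V' = "\<lambda>\<omega>. \<xi>' \<omega> \<bullet> (W d' \<omega> - W c' \<omega>)"
    have VV: "expectation (\<lambda>\<omega>. \<psi> \<omega> * (?V \<omega> * ?V' \<omega>)) = expectation (\<lambda>\<omega>. \<psi> \<omega> * (\<xi> \<omega> \<bullet> \<xi>' \<omega>)) * overlap c d c' d'"
    proof (cases "d \<le> d'")
      case True
      then have "overlap c d c' d' = d - c'" using c dc' by (simp add: overlap_def)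
      with expectation_increment_pair_same_start[OF c' dc' True \<psi>' \<psi>(2) \<xi>c' \<xi>(2) \<xi>'] show ?thesis by simp
    next
      case False
      then have "overlap c d c' d' = d' - c'" using c dc' by (simp add: overlap_def)
      with expectation_increment_pair_same_start[OF c' c(4) _ \<psi>' \<psi>(2) \<xi>' \<xi>c' \<xi>(2), of d] False
      show ?thesis by (simp add: inner_commute mult.commute)
    qed
    have VVi: "integrable M (\<lambda>\<omega>. \<psi> \<omega> * (?V \<omega> * ?V' \<omega>))"
      by (intro integrable_bdd_mult[OF _ measurable_F_imp[OF \<psi>(1)] \<psi>(2)] square_integrable_mult
         square_integrable_inner_increment[OF c' dc' \<xi>c' \<xi>(2)] square_integrable_inner_increment[OF c' c(4) \<xi>'])
    have "(\<lambda>\<omega>. \<psi> \<omega> * ((\<xi> \<omega> \<bullet> (W d \<omega> - W c \<omega>)) * ?V' \<omega>)) =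
      (\<lambda>\<omega>. \<psi> \<omega> * (\<xi> \<omega> \<bullet> (W c' \<omega> - W c \<omega>)) * ?V' \<omega> + \<psi> \<omega> * (?V \<omega> * ?V' \<omega>))"
      by (simp add: inner_diff_right algebra_simps)
    then show ?thesis using VVi VV zero[OF c(3) order_refl] by simp
  qed
qed

text \<open>Only the common part of two intervals contributes to the mixed moment: the increment over a
  later part is centred given all that precedes it. Since the intervals may overlap in any
  way, the isometry holds for two different partitions without a common refinement.\<close>

lemma expectation_increment_pair:
  assumes s: "0 \<le> s" "s \<le> c" "c \<le> d" "s \<le> c'" "c' \<le> d'"
    and \<psi>: "\<psi> \<in> borel_measurable (F s)" "\<And>\<omega>. \<omega> \<in> space M \<Longrightarrow> \<bar>\<psi> \<omega>\<bar> \<le> K"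
    and \<xi>: "\<xi> \<in> borel_measurable (F c)" "\<And>\<omega>. \<omega> \<in> space M \<Longrightarrow> norm (\<xi> \<omega>) \<le> B"
    and \<xi>': "\<xi>' \<in> borel_measurable (F c')" "\<And>\<omega>. \<omega> \<in> space M \<Longrightarrow> norm (\<xi>' \<omega>) \<le> B'"
  shows "expectation (\<lambda>\<omega>. \<psi> \<omega> * ((\<xi> \<omega> \<bullet> (W d \<omega> - W c \<omega>)) * (\<xi>' \<omega> \<bullet> (W d' \<omega> - W c' \<omega>))))
    = expectation (\<lambda>\<omega>. \<psi> \<omega> * (\<xi> \<omega> \<bullet> \<xi>' \<omega>)) * overlap c d c' d'"
proof (cases "c \<le> c'")
  case True
  then show ?thesis
    using s by (intro expectation_increment_pair_le[OF _ _ _ _ measurable_F_mono[OF \<psi>(1)] \<psi>(2) \<xi> \<xi>']) auto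
next
  case False
  have "overlap c d c' d' = overlap c' d' c d" by (simp add: overlap_def min.commute max.commute)
  then show ?thesis
    using s False expectation_increment_pair_le[OF _ _ _ _ measurable_F_mono[OF \<psi>(1)] \<psi>(2) \<xi>' \<xi>, of d' d]
    by (simp add: inner_commute mult.commute)
qed

end

section \<open>Integrals of elementary integrands: isometry and fourth moments\<close>

lemma emeasure_restrict_Ioc_space:
  "emeasure (restrict_space lborel {s<..t::real}) (space (restrict_space lborel {s<..t})) \<noteq> \<infinity>"
  by (cases "s \<le> t") (simp_all add: space_restrict_space emeasure_restrict_space emeasure_lborel_Ioc)

lemma sigma_finite_restrict_lborel: "sigma_finite_measure (restrict_space lborel {s<..t::real})"
  using emeasure_restrict_Ioc_space[of s t] by (intro finite_measure.sigma_finite_measure finite_measureI) simp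

text \<open>The integral is the length of the overlap of the two intervals.\<close>

lemma integral_restrict_indicator_Ioc:
  assumes "s \<le> a" "b \<le> (t::real)" "c \<le> d"
  shows "integrable (restrict_space lborel {s<..t}) (\<lambda>r. indicator {a<..b} r * indicator {c<..d} r :: real)"
    and "(\<integral>r. indicator {a<..b} r * indicator {c<..d} r \<partial>restrict_space lborel {s<..t}) = max 0 (min b d - max a c)"
proof -
  have eq: "indicator {s<..t} r *\<^sub>R (indicator {a<..b} r * indicator {c<..d} r :: real) = indicator {max a c<..min b d} r" for r
    using assms by (auto simp: indicator_def)
  have "integrable lborel (indicator {max a c<..min b d} :: real \<Rightarrow> real)"
    by (cases "max a c \<le> min b d") (auto simp: integrable_indicator_iff emeasure_lborel_Ioc)
  then show "integrable (restrict_space lborel {s<..t}) (\<lambda>r. indicator {a<..b} r * indicator {c<..d} r :: real)"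
    by (subst integrable_restrict_space) (simp_all add: eq del: real_scaleR_def)
  have "(\<integral>r. (indicator {a<..b} r * indicator {c<..d} r :: real) \<partial>restrict_space lborel {s<..t})
     = (\<integral>r. (indicator {max a c<..min b d} r :: real) \<partial>lborel)"
    by (subst integral_restrict_space) (simp_all add: eq del: real_scaleR_def)
  also have "\<dots> = max 0 (min b d - max a c)"
  proof (cases "max a c \<le> min b d")
    case True
    then have "(\<integral>r. (indicator {max a c<..min b d} r :: real) \<partial>lborel) = min b d - max a c"
      by (simp del: max.bounded_iff min.bounded_iff)
    then show ?thesis using True by simp
  next
    case False
    then have e: "{max a c<..min b d} = {}" by auto
    have "min b d - max a c \<le> 0" using False by linarith
    then show ?thesis unfolding e by simp
  qed
  finally show "(\<integral>r. indicator {a<..b} r * indicator {c<..d} r \<partial>restrict_space lborel {s<..t}) = max 0 (min b d - max a c)" .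
qed

lemma (in pair_sigma_finite) integral_pair_mult:
  fixes f :: "'a \<Rightarrow> real" and g :: "'b \<Rightarrow> real"
  assumes f: "integrable M1 f" and g: "integrable M2 g"
  shows "integrable (M1 \<Otimes>\<^sub>M M2) (\<lambda>p. f (fst p) * g (snd p))"
    and "(\<integral>p. f (fst p) * g (snd p) \<partial>(M1 \<Otimes>\<^sub>M M2)) = (\<integral>x. f x \<partial>M1) * (\<integral>y. g y \<partial>M2)"
proof -
  show i: "integrable (M1 \<Otimes>\<^sub>M M2) (\<lambda>p. f (fst p) * g (snd p))"
    using f g by (intro Fubini_integrable) (auto simp: abs_mult)
  show "(\<integral>p. f (fst p) * g (snd p) \<partial>(M1 \<Otimes>\<^sub>M M2)) = (\<integral>x. f x \<partial>M1) * (\<integral>y. g y \<partial>M2)"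
    using integral_fst'[OF i] by simp
qed

context brownian_motion begin

text \<open>A bounded elementary integrand on \<open>(s, t]\<close>: it equals \<open>\<xi> k\<close>, known at time \<open>\<tau> k\<close>, on
  \<open>(\<tau> k, \<tau> (k + 1)]\<close>. It is vector valued; its integral is real and stands for one
  row of a matrix-valued integral.\<close>

definition elem_integrand :: "real \<Rightarrow> real \<Rightarrow> nat \<Rightarrow> (nat \<Rightarrow> real) \<Rightarrow> (nat \<Rightarrow> 'a \<Rightarrow> real^'n) \<Rightarrow> bool" where
  "elem_integrand s t n \<tau> \<xi> \<longleftrightarrow> 0 \<le> s \<and> \<tau> 0 = s \<and> \<tau> n = t \<and> (\<forall>k<n. \<tau> k \<le> \<tau> (Suc k)) \<and>
     (\<forall>k<n. \<xi> k \<in> borel_measurable (F (\<tau> k)) \<and> (\<exists>B. \<forall>\<omega>\<in>space M. norm (\<xi> k \<omega>) \<le> B))"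

text \<open>The integrand as a function of the sample point and the time, in this order.\<close>

definition elem_process :: "nat \<Rightarrow> (nat \<Rightarrow> real) \<Rightarrow> (nat \<Rightarrow> 'a \<Rightarrow> real^'n) \<Rightarrow> 'a \<times> real \<Rightarrow> real^'n" where
  "elem_process n \<tau> \<xi> p = (\<Sum>k<n. indicator {\<tau> k<..\<tau> (Suc k)} (snd p) *\<^sub>R \<xi> k (fst p))"

text \<open>The stochastic integral of the elementary integrand.\<close>

definition elem_integral :: "nat \<Rightarrow> (nat \<Rightarrow> real) \<Rightarrow> (nat \<Rightarrow> 'a \<Rightarrow> real^'n) \<Rightarrow> 'a \<Rightarrow> real" where
  "elem_integral n \<tau> \<xi> \<omega> = (\<Sum>k<n. \<xi> k \<omega> \<bullet> (W (\<tau> (Suc k)) \<omega> - W (\<tau> k) \<omega>))"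

text \<open>The product of \<open>M\<close> and Lebesgue measure on \<open>(s, t]\<close>.\<close>

abbreviation PT :: "real \<Rightarrow> real \<Rightarrow> ('a \<times> real) measure" where
  "PT s t \<equiv> M \<Otimes>\<^sub>M restrict_space lborel {s<..t}"

lemma pair_sigma_finite_PT: "pair_sigma_finite M (restrict_space lborel {s<..t::real})"
  by (intro pair_sigma_finite.intro sigma_finite_restrict_lborel sigma_finite_measure_axioms)

lemma finite_measure_PT: "finite_measure (PT s t)"
proof
  interpret L: sigma_finite_measure "restrict_space lborel {s<..t}" by (rule sigma_finite_restrict_lborel)
  have "emeasure (PT s t) (space M \<times> space (restrict_space lborel {s<..t}))
     = emeasure M (space M) * emeasure (restrict_space lborel {s<..t}) (space (restrict_space lborel {s<..t}))"
    by (rule L.emeasure_pair_measure_Times; rule sets.top)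
  also have "\<dots> < \<infinity>"
    using emeasure_restrict_Ioc_space[of s t] by (simp add: emeasure_space_1 less_top)
  finally show "emeasure (PT s t) (space (PT s t)) \<noteq> \<infinity>" by (simp add: space_pair_measure)
qed

lemma elem_times:
  assumes "elem_integrand s t n \<tau> \<xi>" "i \<le> j" "j \<le> n"
  shows "\<tau> i \<le> \<tau> j"
proof -
  have "j \<le> n \<Longrightarrow> \<tau> i \<le> \<tau> j" using \<open>i \<le> j\<close>
  proof (induction j rule: dec_induct)
    case (step j)
    then have "\<tau> i \<le> \<tau> j" "\<tau> j \<le> \<tau> (Suc j)" using assms(1) by (simp_all add: elem_integrand_def)
    then show ?case by (rule order_trans)
  qed simp
  then show ?thesis using assms(3) by simp
qed

lemma elem_times_range:
  assumes "elem_integrand s t n \<tau> \<xi>" "k \<le> n"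
  shows "0 \<le> s" "0 \<le> \<tau> k" "s \<le> \<tau> k" "\<tau> k \<le> t"
  using elem_times[OF assms(1), of 0 k] elem_times[OF assms(1), of k n] assms by (auto simp: elem_integrand_def)

lemma elem_bound:
  assumes "elem_integrand s t n \<tau> \<xi>"
  shows "\<exists>B. 0 \<le> B \<and> (\<forall>k \<omega>. k < n \<longrightarrow> \<omega> \<in> space M \<longrightarrow> norm (\<xi> k \<omega>) \<le> B)"
proof -
  have "\<forall>k\<in>{..<n}. \<exists>B. \<forall>\<omega>\<in>space M. norm (\<xi> k \<omega>) \<le> B" using assms by (auto simp: elem_integrand_def)
  then obtain B where B: "\<forall>k\<in>{..<n}. \<forall>\<omega>\<in>space M. norm (\<xi> k \<omega>) \<le> B k" by metis
  show ?thesis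
  proof (intro exI[of _ "\<Sum>k<n. \<bar>B k\<bar>"] conjI allI impI)
    fix k \<omega> assume k: "k < n" "\<omega> \<in> space M"
    then have "norm (\<xi> k \<omega>) \<le> \<bar>B k\<bar>" using B by force
    also have "\<dots> \<le> (\<Sum>k<n. \<bar>B k\<bar>)" using k by (intro member_le_sum) auto
    finally show "norm (\<xi> k \<omega>) \<le> (\<Sum>k<n. \<bar>B k\<bar>)" .
  qed (simp add: sum_nonneg)
qed

lemma elem_measurable:
  assumes "elem_integrand s t n \<tau> \<xi>" "k < n"
  shows "\<xi> k \<in> borel_measurable (F (\<tau> k))" "\<xi> k \<in> borel_measurable M"
  using assms measurable_F_imp[of "\<xi> k" "\<tau> k"] by (auto simp: elem_integrand_def)

lemma elem_process_measurable:
  assumes "elem_integrand s t n \<tau> \<xi>"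
  shows "elem_process n \<tau> \<xi> \<in> borel_measurable (PT u v)"
  unfolding elem_process_def
proof (rule borel_measurable_sum)
  fix k assume "k \<in> {..<n}"
  then have [measurable]: "\<xi> k \<in> borel_measurable M" using elem_measurable(2)[OF assms] by simp
  show "(\<lambda>p. indicator {\<tau> k<..\<tau> (Suc k)} (snd p) *\<^sub>R \<xi> k (fst p)) \<in> borel_measurable (PT u v)"
  proof (rule borel_measurable_scaleR)
    have "snd \<in> measurable (PT u v) (restrict_space lborel {u<..v})" by measurable
    moreover have "(indicator {\<tau> k<..\<tau> (Suc k)} :: real \<Rightarrow> real) \<in> borel_measurable (restrict_space lborel {u<..v})"
      by (rule measurable_restrict_space1) simp
    ultimately show "(\<lambda>p. indicator {\<tau> k<..\<tau> (Suc k)} (snd p) :: real) \<in> borel_measurable (PT u v)"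
      by (rule measurable_compose[where f = snd])
  qed measurable
qed

lemma elem_process_square_integrable:
  assumes e: "elem_integrand s t n \<tau> \<xi>"
  shows "square_integrable (PT u v) (elem_process n \<tau> \<xi>)"
proof -
  interpret P: finite_measure "PT u v" by (rule finite_measure_PT)
  obtain B where B: "0 \<le> B" "\<And>k \<omega>. k < n \<Longrightarrow> \<omega> \<in> space M \<Longrightarrow> norm (\<xi> k \<omega>) \<le> B"
    using elem_bound[OF e] by blast
  show ?thesis
  proof (rule P.square_integrable_bounded[where B = "real n * B"])
    fix p assume p: "p \<in> space (PT u v)"
    have "norm (elem_process n \<tau> \<xi> p) \<le> (\<Sum>k<n. B)"
      unfolding elem_process_def
    proof (rule sum_norm_le)
      fix k assume "k \<in> {..<n}"
      then show "norm (indicator {\<tau> k<..\<tau> (Suc k)} (snd p) *\<^sub>R \<xi> k (fst p)) \<le> B"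
        using B p by (auto simp: space_pair_measure indicator_def)
    qed
    then show "norm (elem_process n \<tau> \<xi> p) \<le> real n * B" by simp
  qed (rule elem_process_measurable[OF e])
qed

lemma elem_integral_square_integrable:
  assumes e: "elem_integrand s t n \<tau> \<xi>"
  shows "square_integrable M (elem_integral n \<tau> \<xi>)"
  unfolding elem_integral_def
proof (rule square_integrable_sum)
  fix k assume "k \<in> {..<n}"
  then have k: "k < n" by simp
  obtain B where B: "\<And>k \<omega>. k < n \<Longrightarrow> \<omega> \<in> space M \<Longrightarrow> norm (\<xi> k \<omega>) \<le> B"
    using elem_bound[OF e] by blast
  show "square_integrable M (\<lambda>\<omega>. \<xi> k \<omega> \<bullet> (W (\<tau> (Suc k)) \<omega> - W (\<tau> k) \<omega>))"
  proof (rule square_integrable_inner_increment[OF _ _ elem_measurable(1)[OF e k] B[OF k]])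
    show "0 \<le> \<tau> k" "\<tau> k \<le> \<tau> (Suc k)"
      using k elem_times_range(2)[OF e, of k] elem_times[OF e, of k "Suc k"] by auto
  qed
qed

lemma elem_integral_mean_zero:
  assumes e: "elem_integrand s t n \<tau> \<xi>" and \<phi>: "\<phi> \<in> borel_measurable (F s)" "integrable M \<phi>"
  shows "expectation (\<lambda>\<omega>. \<phi> \<omega> * elem_integral n \<tau> \<xi> \<omega>) = 0"
proof -
  obtain B where B: "\<And>k \<omega>. k < n \<Longrightarrow> \<omega> \<in> space M \<Longrightarrow> norm (\<xi> k \<omega>) \<le> B"
    using elem_bound[OF e] by blast
  have I: "integrable M (\<lambda>\<omega>. \<phi> \<omega> * (\<xi> k \<omega> \<bullet> (W (\<tau> (Suc k)) \<omega> - W (\<tau> k) \<omega>)))"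
    "expectation (\<lambda>\<omega>. \<phi> \<omega> * (\<xi> k \<omega> \<bullet> (W (\<tau> (Suc k)) \<omega> - W (\<tau> k) \<omega>))) = 0" if k: "k < n" for k
  proof -
    have *: "0 \<le> \<tau> k" "s \<le> \<tau> k" "\<tau> k \<le> \<tau> (Suc k)"
      using elem_times_range[OF e, of k] elem_times[OF e, of k "Suc k"] k by auto
    note E = expectation_mult_inner_increment[OF *(1,3) measurable_F_mono[OF \<phi>(1) *(2)] \<phi>(2) elem_measurable(1)[OF e k] B[OF k]]
    show "integrable M (\<lambda>\<omega>. \<phi> \<omega> * (\<xi> k \<omega> \<bullet> (W (\<tau> (Suc k)) \<omega> - W (\<tau> k) \<omega>)))"
      "expectation (\<lambda>\<omega>. \<phi> \<omega> * (\<xi> k \<omega> \<bullet> (W (\<tau> (Suc k)) \<omega> - W (\<tau> k) \<omega>))) = 0"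
      using E by blast+
  qed
  show ?thesis
    unfolding elem_integral_def sum_distrib_left using I by (subst Bochner_Integration.integral_sum) auto
qed

text \<open>The It\^o isometry, polarised and conditional on \<open>F s\<close> in the form of a weight \<open>\<psi>\<close>.\<close>

lemma elem_isometry:
  assumes e: "elem_integrand s t n \<tau> \<xi>" and e': "elem_integrand s t n' \<tau>' \<xi>'"
    and \<psi>: "\<psi> \<in> borel_measurable (F s)" "\<And>\<omega>. \<omega> \<in> space M \<Longrightarrow> \<bar>\<psi> \<omega>\<bar> \<le> K"
  shows "expectation (\<lambda>\<omega>. \<psi> \<omega> * (elem_integral n \<tau> \<xi> \<omega> * elem_integral n' \<tau>' \<xi>' \<omega>))
     = (\<integral>p. \<psi> (fst p) * (elem_process n \<tau> \<xi> p \<bullet> elem_process n' \<tau>' \<xi>' p) \<partial>PT s t)"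
proof -
  interpret P: pair_sigma_finite M "restrict_space lborel {s<..t}" by (rule pair_sigma_finite_PT)
  obtain B where B: "0 \<le> B" "\<And>k \<omega>. k < n \<Longrightarrow> \<omega> \<in> space M \<Longrightarrow> norm (\<xi> k \<omega>) \<le> B"
    using elem_bound[OF e] by blast
  obtain B' where B': "0 \<le> B'" "\<And>k \<omega>. k < n' \<Longrightarrow> \<omega> \<in> space M \<Longrightarrow> norm (\<xi>' k \<omega>) \<le> B'"
    using elem_bound[OF e'] by blast
  let ?d = "\<lambda>k \<omega>. \<xi> k \<omega> \<bullet> (W (\<tau> (Suc k)) \<omega> - W (\<tau> k) \<omega>)"
  let ?d' = "\<lambda>k \<omega>. \<xi>' k \<omega> \<bullet> (W (\<tau>' (Suc k)) \<omega> - W (\<tau>' k) \<omega>)"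
  let ?f = "\<lambda>k l \<omega>. \<psi> \<omega> * (\<xi> k \<omega> \<bullet> \<xi>' l \<omega>)"
  let ?g = "\<lambda>k l r. indicator {\<tau> k<..\<tau> (Suc k)} r * indicator {\<tau>' l<..\<tau>' (Suc l)} r :: real"
  have \<psi>M: "\<psi> \<in> borel_measurable M" using \<psi>(1) by (rule measurable_F_imp)
  have sq: "square_integrable M (?d k)" if k: "k < n" for k
  proof (rule square_integrable_inner_increment[OF _ _ elem_measurable(1)[OF e k] B(2)[OF k]])
    show "0 \<le> \<tau> k" "\<tau> k \<le> \<tau> (Suc k)"
      using k elem_times_range(2)[OF e, of k] elem_times[OF e, of k "Suc k"] by auto
  qed
  have sq': "square_integrable M (?d' k)" if k: "k < n'" for k
  proof (rule square_integrable_inner_increment[OF _ _ elem_measurable(1)[OF e' k] B'(2)[OF k]])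
    show "0 \<le> \<tau>' k" "\<tau>' k \<le> \<tau>' (Suc k)"
      using k elem_times_range(2)[OF e', of k] elem_times[OF e', of k "Suc k"] by auto
  qed
  have ii: "integrable M (\<lambda>\<omega>. \<psi> \<omega> * (?d k \<omega> * ?d' l \<omega>))" if "k < n" "l < n'" for k l
    by (rule integrable_bdd_mult[OF square_integrable_mult[OF sq[OF that(1)] sq'[OF that(2)]] \<psi>M \<psi>(2)])
  have fi: "integrable M (?f k l)" if "k < n" "l < n'" for k l
  proof (rule integrable_bdd_mult[OF _ \<psi>M \<psi>(2)])
    show "integrable M (\<lambda>\<omega>. \<xi> k \<omega> \<bullet> \<xi>' l \<omega>)"
      using that B B' elem_measurable(2)[OF e, of k] elem_measurable(2)[OF e', of l]
      by (intro square_integrable_inner square_integrable_bounded[of _ B] square_integrable_bounded[of _ B']) auto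
  qed
  have pair: "expectation (\<lambda>\<omega>. \<psi> \<omega> * (?d k \<omega> * ?d' l \<omega>)) = (\<integral>p. ?f k l (fst p) * ?g k l (snd p) \<partial>PT s t)"
    and pairi: "integrable (PT s t) (\<lambda>p. ?f k l (fst p) * ?g k l (snd p))"
    if k: "k < n" "l < n'" for k l
  proof -
    have "expectation (\<lambda>\<omega>. \<psi> \<omega> * (?d k \<omega> * ?d' l \<omega>)) = expectation (?f k l) * overlap (\<tau> k) (\<tau> (Suc k)) (\<tau>' l) (\<tau>' (Suc l))"
      using k \<psi> B B' elem_times_range[OF e, of k] elem_times[OF e, of k "Suc k"]
        elem_times_range[OF e', of l] elem_times[OF e', of l "Suc l"]
      by (intro expectation_increment_pair[OF _ _ _ _ _ \<psi> elem_measurable(1)[OF e] _ elem_measurable(1)[OF e'], where B = B and B' = B']) auto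
    moreover have "s \<le> \<tau> k" "\<tau> (Suc k) \<le> t" "\<tau>' l \<le> \<tau>' (Suc l)"
      using k elem_times_range[OF e, of k] elem_times_range[OF e, of "Suc k"] elem_times[OF e', of l "Suc l"] by auto
    note g = integral_restrict_indicator_Ioc[OF this]
    ultimately show "expectation (\<lambda>\<omega>. \<psi> \<omega> * (?d k \<omega> * ?d' l \<omega>)) = (\<integral>p. ?f k l (fst p) * ?g k l (snd p) \<partial>PT s t)"
      using P.integral_pair_mult(2)[OF fi[OF k] g(1)] g(2) by (simp add: overlap_def)
    show "integrable (PT s t) (\<lambda>p. ?f k l (fst p) * ?g k l (snd p))"
      by (rule P.integral_pair_mult(1)[OF fi[OF k] g(1)])
  qed
  have "expectation (\<lambda>\<omega>. \<psi> \<omega> * (elem_integral n \<tau> \<xi> \<omega> * elem_integral n' \<tau>' \<xi>' \<omega>))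
    = expectation (\<lambda>\<omega>. \<Sum>k<n. \<Sum>l<n'. \<psi> \<omega> * (?d k \<omega> * ?d' l \<omega>))"
    unfolding elem_integral_def sum_product unfolding sum_distrib_left ..
  also have "\<dots> = (\<Sum>k<n. \<Sum>l<n'. expectation (\<lambda>\<omega>. \<psi> \<omega> * (?d k \<omega> * ?d' l \<omega>)))"
    by (subst Bochner_Integration.integral_sum)
      (auto intro!: Bochner_Integration.integrable_sum Bochner_Integration.integral_sum sum.cong ii simp del: inner_diff_right)
  also have "\<dots> = (\<Sum>k<n. \<Sum>l<n'. (\<integral>p. ?f k l (fst p) * ?g k l (snd p) \<partial>PT s t))"
    using pair by (intro sum.cong) auto
  also have "\<dots> = (\<integral>p. (\<Sum>k<n. \<Sum>l<n'. ?f k l (fst p) * ?g k l (snd p)) \<partial>PT s t)"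
    by (subst Bochner_Integration.integral_sum)
      (auto intro!: Bochner_Integration.integrable_sum Bochner_Integration.integral_sum[symmetric] sum.cong pairi)
  also have "(\<lambda>p. \<Sum>k<n. \<Sum>l<n'. ?f k l (fst p) * ?g k l (snd p))
    = (\<lambda>p. \<psi> (fst p) * (elem_process n \<tau> \<xi> p \<bullet> elem_process n' \<tau>' \<xi>' p))"
    unfolding elem_process_def inner_sum_left inner_sum_right
    by (intro ext, subst sum.swap) (simp only: sum_distrib_left inner_scaleR_left inner_scaleR_right mult_ac)
  finally show ?thesis .
qed

lemma elem_isometry_diff:
  assumes e: "elem_integrand s t n \<tau> \<xi>" and e': "elem_integrand s t n' \<tau>' \<xi>'"
  shows "expectation (\<lambda>\<omega>. (elem_integral n \<tau> \<xi> \<omega> - elem_integral n' \<tau>' \<xi>' \<omega>)\<^sup>2)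
     = (\<integral>p. (norm (elem_process n \<tau> \<xi> p - elem_process n' \<tau>' \<xi>' p))\<^sup>2 \<partial>PT s t)"
proof -
  let ?S = "elem_integral n \<tau> \<xi>" and ?S' = "elem_integral n' \<tau>' \<xi>'"
  let ?X = "elem_process n \<tau> \<xi>" and ?X' = "elem_process n' \<tau>' \<xi>'"
  note S = elem_integral_square_integrable[OF e] elem_integral_square_integrable[OF e']
  note X = elem_process_square_integrable[OF e, of s t] elem_process_square_integrable[OF e', of s t]
  have "expectation (\<lambda>\<omega>. (?S \<omega> - ?S' \<omega>)\<^sup>2) = expectation (\<lambda>\<omega>. ?S \<omega> * ?S \<omega> - 2 * (?S \<omega> * ?S' \<omega>) + ?S' \<omega> * ?S' \<omega>)"
    by (simp add: power2_eq_square algebra_simps)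
  also have "\<dots> = expectation (\<lambda>\<omega>. ?S \<omega> * ?S \<omega>) - 2 * expectation (\<lambda>\<omega>. ?S \<omega> * ?S' \<omega>) + expectation (\<lambda>\<omega>. ?S' \<omega> * ?S' \<omega>)"
    using square_integrable_mult[OF S(1) S(1)] square_integrable_mult[OF S(1) S(2)] square_integrable_mult[OF S(2) S(2)] by simp
  also have "\<dots> = (\<integral>p. ?X p \<bullet> ?X p \<partial>PT s t) - 2 * (\<integral>p. ?X p \<bullet> ?X' p \<partial>PT s t) + (\<integral>p. ?X' p \<bullet> ?X' p \<partial>PT s t)"
    using elem_isometry[OF e e, of "\<lambda>_. 1" 1] elem_isometry[OF e e', of "\<lambda>_. 1" 1] elem_isometry[OF e' e', of "\<lambda>_. 1" 1] by simp
  also have "\<dots> = (\<integral>p. ?X p \<bullet> ?X p - 2 * (?X p \<bullet> ?X' p) + ?X' p \<bullet> ?X' p \<partial>PT s t)"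
    using square_integrable_inner[OF X(1) X(1)] square_integrable_inner[OF X(1) X(2)] square_integrable_inner[OF X(2) X(2)] by simp
  also have "\<dots> = (\<integral>p. (norm (?X p - ?X' p))\<^sup>2 \<partial>PT s t)"
    by (simp only: power2_norm_eq_inner inner_diff_left inner_diff_right inner_commute[of "?X' _" "?X _"])
      (simp add: algebra_simps)
  finally show ?thesis .
qed

text \<open>Induction over the partial sums: with \<open>a\<close> the sum so far and \<open>x\<close> the next term,
  \<open>(a + x)\<^sup>4\<close> is at most \<open>a\<^sup>4 + 4 a\<^sup>3 x + 8 a\<^sup>2 x\<^sup>2 + 3 x\<^sup>4\<close>, where \<open>a\<^sup>3 x\<close> is centred and the
  second moment of \<open>a\<close> is controlled by the induction as well.\<close>

lemma elem_integral_fourth_moment: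
  assumes e: "elem_integrand s t n \<tau> \<xi>" and B: "0 \<le> B" "\<And>k \<omega>. k < n \<Longrightarrow> \<omega> \<in> space M \<Longrightarrow> norm (\<xi> k \<omega>) \<le> B"
  shows "integrable M (\<lambda>\<omega>. elem_integral n \<tau> \<xi> \<omega> ^ 4)"
    and "expectation (\<lambda>\<omega>. elem_integral n \<tau> \<xi> \<omega> ^ 4) \<le> 9 * (real CARD('n))\<^sup>2 * B ^ 4 * (t - s)\<^sup>2"
proof -
  let ?K = "9 * (real CARD('n))\<^sup>2"
  let ?x = "\<lambda>k \<omega>. \<xi> k \<omega> \<bullet> (W (\<tau> (Suc k)) \<omega> - W (\<tau> k) \<omega>)"
  let ?S = "\<lambda>j \<omega>. \<Sum>k<j. ?x k \<omega>"
  have card1: "1 \<le> (real CARD('n))\<^sup>2" by simp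
  have "j \<le> n \<Longrightarrow> ?S j \<in> borel_measurable (F (\<tau> j)) \<and>
    integrable M (\<lambda>\<omega>. (?S j \<omega>)\<^sup>2) \<and> expectation (\<lambda>\<omega>. (?S j \<omega>)\<^sup>2) \<le> B\<^sup>2 * (\<tau> j - s) \<and>
    integrable M (\<lambda>\<omega>. ?S j \<omega> ^ 4) \<and> expectation (\<lambda>\<omega>. ?S j \<omega> ^ 4) \<le> ?K * B ^ 4 * (\<tau> j - s)\<^sup>2" for j
  proof (induction j)
    case 0
    then show ?case using e by (simp add: elem_integrand_def)
  next
    case (Suc j)
    then have j: "j < n" by simp
    define a where "a = ?S j"
    define x where "x = ?x j"
    define \<delta> where "\<delta> = \<tau> (Suc j) - \<tau> j"
    define u where "u = \<tau> j - s"
    have \<delta>0: "0 \<le> \<delta>" and u0: "0 \<le> u" and \<tau>j: "0 \<le> \<tau> j" "\<tau> j \<le> \<tau> (Suc j)"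
      using elem_times[OF e, of j "Suc j"] elem_times_range[OF e, of j] j by (auto simp: \<delta>_def u_def)
    note \<xi>m = elem_measurable(1)[OF e j]
    note \<xi>B = B(2)[OF j]
    have IH: "a \<in> borel_measurable (F (\<tau> j))" "integrable M (\<lambda>\<omega>. (a \<omega>)\<^sup>2)"
      "expectation (\<lambda>\<omega>. (a \<omega>)\<^sup>2) \<le> B\<^sup>2 * u" "integrable M (\<lambda>\<omega>. a \<omega> ^ 4)"
      "expectation (\<lambda>\<omega>. a \<omega> ^ 4) \<le> ?K * B ^ 4 * u\<^sup>2"
      using Suc j by (auto simp: a_def u_def)
    have aM[measurable]: "a \<in> borel_measurable M" using IH(1) by (rule measurable_F_imp)
    have xm: "x \<in> borel_measurable (F (\<tau> (Suc j)))"
      unfolding x_def by (rule F_measurable_inner_increment[OF \<tau>j order_refl \<xi>m])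
    then have xM[measurable]: "x \<in> borel_measurable M" by (rule measurable_F_imp)
    have asq: "square_integrable M a" using IH(2) by (simp add: square_integrable_def)
    have a1: "integrable M a" using square_integrable_integrable[OF asq] .
    have a3: "integrable M (\<lambda>\<omega>. a \<omega> ^ 3)"
    proof (rule Bochner_Integration.integrable_bound)
      show "integrable M (\<lambda>\<omega>. (a \<omega>)\<^sup>2 + a \<omega> ^ 4)" using IH by simp
      have "\<bar>y ^ 3\<bar> \<le> y\<^sup>2 + y ^ 4" for y :: real
      proof -
        have "\<bar>y ^ 3\<bar> = y\<^sup>2 * \<bar>y\<bar>" by (simp add: power3_eq_cube power2_eq_square abs_mult)
        also have "\<dots> \<le> y\<^sup>2 * (1 + y\<^sup>2)"
        proof (rule mult_left_mono)
          show "\<bar>y\<bar> \<le> 1 + y\<^sup>2" using sum_squares_bound[of "\<bar>y\<bar>" 1] by simp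
        qed simp
        finally show ?thesis by (simp add: algebra_simps flip: power_add)
      qed
      then show "AE \<omega> in M. norm (a \<omega> ^ 3) \<le> norm ((a \<omega>)\<^sup>2 + a \<omega> ^ 4)"
        by (intro AE_I2) (simp add: abs_of_nonneg)
    qed measurable
    have Ex1: "integrable M (\<lambda>\<omega>. a \<omega> * x \<omega>)" "expectation (\<lambda>\<omega>. a \<omega> * x \<omega>) = 0"
      unfolding x_def using expectation_mult_inner_increment[OF \<tau>j IH(1) a1 \<xi>m \<xi>B] by auto
    have Ex3: "integrable M (\<lambda>\<omega>. a \<omega> ^ 3 * x \<omega>)" "expectation (\<lambda>\<omega>. a \<omega> ^ 3 * x \<omega>) = 0"
      unfolding x_def using expectation_mult_inner_increment[OF \<tau>j _ a3 \<xi>m \<xi>B] IH(1) by auto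
    have sqle: "expectation (\<lambda>\<omega>. Z \<omega> * (\<xi> j \<omega> \<bullet> \<xi> j \<omega>)) \<le> expectation Z * B\<^sup>2"
      if Z: "integrable M Z" "\<And>\<omega>. 0 \<le> Z \<omega>" for Z
    proof -
      have *: "\<xi> j \<omega> \<bullet> \<xi> j \<omega> \<le> B\<^sup>2" if "\<omega> \<in> space M" for \<omega>
        using power_mono[OF \<xi>B[OF that], of 2] by (simp add: power2_norm_eq_inner)
      have [measurable]: "\<xi> j \<in> borel_measurable M" using \<xi>m by (rule measurable_F_imp)
      have i: "integrable M (\<lambda>\<omega>. (\<xi> j \<omega> \<bullet> \<xi> j \<omega>) * Z \<omega>)"
        by (rule integrable_bdd_mult[OF Z(1), of _ "B\<^sup>2"]) (use * in auto)
      have "expectation (\<lambda>\<omega>. Z \<omega> * (\<xi> j \<omega> \<bullet> \<xi> j \<omega>)) \<le> expectation (\<lambda>\<omega>. Z \<omega> * B\<^sup>2)"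
        using i Z * by (intro integral_mono) (auto simp: mult.commute intro: mult_left_mono)
      then show ?thesis by simp
    qed
    have Zx2: "integrable M (\<lambda>\<omega>. Z \<omega> * (x \<omega>)\<^sup>2)" "expectation (\<lambda>\<omega>. Z \<omega> * (x \<omega>)\<^sup>2) \<le> expectation Z * B\<^sup>2 * \<delta>"
      if Z: "Z \<in> borel_measurable (F (\<tau> j))" "integrable M Z" "\<And>\<omega>. 0 \<le> Z \<omega>" for Z
    proof -
      note * = expectation_mult_inner_increment_prod[OF \<tau>j Z(1,2) \<xi>m \<xi>B \<xi>m \<xi>B]
      show "integrable M (\<lambda>\<omega>. Z \<omega> * (x \<omega>)\<^sup>2)" using *(1) unfolding x_def power2_eq_square by blast
      have "expectation (\<lambda>\<omega>. Z \<omega> * (x \<omega>)\<^sup>2) = expectation (\<lambda>\<omega>. Z \<omega> * (\<xi> j \<omega> \<bullet> \<xi> j \<omega>)) * \<delta>"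
        using *(2) unfolding x_def power2_eq_square \<delta>_def by blast
      also have "\<dots> \<le> expectation Z * B\<^sup>2 * \<delta>"
        by (intro mult_right_mono sqle Z \<delta>0)
      finally show "expectation (\<lambda>\<omega>. Z \<omega> * (x \<omega>)\<^sup>2) \<le> expectation Z * B\<^sup>2 * \<delta>" .
    qed
    have x2: "integrable M (\<lambda>\<omega>. (x \<omega>)\<^sup>2)" "expectation (\<lambda>\<omega>. (x \<omega>)\<^sup>2) \<le> B\<^sup>2 * \<delta>"
    proof -
      have "integrable M (\<lambda>\<omega>. 1 * (x \<omega>)\<^sup>2)" "expectation (\<lambda>\<omega>. 1 * (x \<omega>)\<^sup>2) \<le> expectation (\<lambda>_. 1) * B\<^sup>2 * \<delta>"
        by (rule Zx2; simp)+
      then show "integrable M (\<lambda>\<omega>. (x \<omega>)\<^sup>2)" "expectation (\<lambda>\<omega>. (x \<omega>)\<^sup>2) \<le> B\<^sup>2 * \<delta>"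
        by (simp_all add: prob_space)
    qed
    have a2x2: "integrable M (\<lambda>\<omega>. (a \<omega>)\<^sup>2 * (x \<omega>)\<^sup>2)" "expectation (\<lambda>\<omega>. (a \<omega>)\<^sup>2 * (x \<omega>)\<^sup>2) \<le> B ^ 4 * u * \<delta>"
    proof -
      have m: "(\<lambda>\<omega>. (a \<omega>)\<^sup>2) \<in> borel_measurable (F (\<tau> j))" using IH(1) by simp
      show "integrable M (\<lambda>\<omega>. (a \<omega>)\<^sup>2 * (x \<omega>)\<^sup>2)" by (rule Zx2(1)[OF m IH(2)]) simp
      have "expectation (\<lambda>\<omega>. (a \<omega>)\<^sup>2 * (x \<omega>)\<^sup>2) \<le> expectation (\<lambda>\<omega>. (a \<omega>)\<^sup>2) * B\<^sup>2 * \<delta>"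
        by (rule Zx2(2)[OF m IH(2)]) simp
      also have "\<dots> \<le> (B\<^sup>2 * u) * B\<^sup>2 * \<delta>"
        using IH(3) \<delta>0 by (intro mult_right_mono) auto
      finally show "expectation (\<lambda>\<omega>. (a \<omega>)\<^sup>2 * (x \<omega>)\<^sup>2) \<le> B ^ 4 * u * \<delta>"
        by (simp add: power4_eq_xxxx power2_eq_square mult_ac)
    qed
    have x4: "integrable M (\<lambda>\<omega>. x \<omega> ^ 4)" "expectation (\<lambda>\<omega>. x \<omega> ^ 4) \<le> 3 * (real CARD('n))\<^sup>2 * B ^ 4 * \<delta>\<^sup>2"
      unfolding x_def \<delta>_def using inner_increment_fourth[OF \<tau>j \<xi>m \<xi>B B(1)] by auto
    \<comment> \<open>The term \<open>4 p q\<^sup>3\<close> is absorbed by the even powers.\<close>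
    have pw: "(p + q) ^ 4 \<le> p ^ 4 + 4 * (p ^ 3 * q) + 8 * (p\<^sup>2 * q\<^sup>2) + 3 * q ^ 4" for p q :: real
    proof -
      have "(p + q) ^ 4 = p ^ 4 + 4 * (p ^ 3 * q) + 6 * (p\<^sup>2 * q\<^sup>2) + 4 * (p * q) * q\<^sup>2 + q ^ 4"
        by (simp add: power4_eq_xxxx power3_eq_cube power2_eq_square algebra_simps)
      moreover have "2 * (p * q) * q\<^sup>2 \<le> (p * q)\<^sup>2 + (q\<^sup>2)\<^sup>2" by (rule sum_squares_bound)
      ultimately show ?thesis by (simp add: power_mult_distrib)
    qed
    have S: "?S (Suc j) \<omega> = a \<omega> + x \<omega>" for \<omega> by (simp add: a_def x_def)
    let ?R = "\<lambda>\<omega>. a \<omega> ^ 4 + 4 * (a \<omega> ^ 3 * x \<omega>) + 8 * ((a \<omega>)\<^sup>2 * (x \<omega>)\<^sup>2) + 3 * x \<omega> ^ 4"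
    have Ri: "integrable M ?R" using IH(4) Ex3(1) a2x2(1) x4(1) by simp
    have m: "(\<lambda>\<omega>. a \<omega> + x \<omega>) \<in> borel_measurable (F (\<tau> (Suc j)))"
      using measurable_F_mono[OF IH(1) \<tau>j(2)] xm by simp
    have i4: "integrable M (\<lambda>\<omega>. (a \<omega> + x \<omega>) ^ 4)"
    proof (rule Bochner_Integration.integrable_bound[OF Ri])
      show "AE \<omega> in M. norm ((a \<omega> + x \<omega>) ^ 4) \<le> norm (?R \<omega>)"
      proof (rule AE_I2)
        fix \<omega>
        have "norm ((a \<omega> + x \<omega>) ^ 4) = (a \<omega> + x \<omega>) ^ 4" by simp
        also have "\<dots> \<le> ?R \<omega>" by (rule pw)
        also have "\<dots> \<le> norm (?R \<omega>)" unfolding real_norm_def by (rule abs_ge_self)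
        finally show "norm ((a \<omega> + x \<omega>) ^ 4) \<le> norm (?R \<omega>)" .
      qed
    qed measurable
    have "expectation (\<lambda>\<omega>. (a \<omega> + x \<omega>) ^ 4) \<le> expectation ?R"
      using i4 Ri pw by (intro integral_mono) auto
    also have "\<dots> = expectation (\<lambda>\<omega>. a \<omega> ^ 4) + 8 * expectation (\<lambda>\<omega>. (a \<omega>)\<^sup>2 * (x \<omega>)\<^sup>2) + 3 * expectation (\<lambda>\<omega>. x \<omega> ^ 4)"
      using IH(4) Ex3 a2x2(1) x4(1) by simp
    also have "\<dots> \<le> ?K * B ^ 4 * u\<^sup>2 + 8 * (B ^ 4 * u * \<delta>) + 3 * (3 * (real CARD('n))\<^sup>2 * B ^ 4 * \<delta>\<^sup>2)"
      using IH(5) a2x2(2) x4(2) by (intro add_mono mult_left_mono) auto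
    also have "\<dots> \<le> ?K * B ^ 4 * u\<^sup>2 + 2 * ?K * (B ^ 4 * u * \<delta>) + ?K * B ^ 4 * \<delta>\<^sup>2"
    proof -
      have "8 * (B ^ 4 * u * \<delta>) \<le> (2 * ?K) * (B ^ 4 * u * \<delta>)"
      proof (rule mult_right_mono)
        show "8 \<le> 2 * ?K" using card1 by linarith
      qed (use B(1) u0 \<delta>0 in simp)
      then show ?thesis by simp
    qed
    also have "\<dots> = ?K * B ^ 4 * (u + \<delta>)\<^sup>2" by (simp add: power2_sum algebra_simps)
    finally have E4: "expectation (\<lambda>\<omega>. (a \<omega> + x \<omega>) ^ 4) \<le> ?K * B ^ 4 * (u + \<delta>)\<^sup>2" .
    have e2: "(\<lambda>\<omega>. (a \<omega> + x \<omega>)\<^sup>2) = (\<lambda>\<omega>. (a \<omega>)\<^sup>2 + 2 * (a \<omega> * x \<omega>) + (x \<omega>)\<^sup>2)"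
      by (simp add: power2_sum algebra_simps)
    have i2: "integrable M (\<lambda>\<omega>. (a \<omega> + x \<omega>)\<^sup>2)" unfolding e2 using IH(2) Ex1(1) x2(1) by simp
    have "expectation (\<lambda>\<omega>. (a \<omega> + x \<omega>)\<^sup>2) = expectation (\<lambda>\<omega>. (a \<omega>)\<^sup>2) + expectation (\<lambda>\<omega>. (x \<omega>)\<^sup>2)"
      unfolding e2 using IH(2) Ex1 x2(1) by simp
    also have "\<dots> \<le> B\<^sup>2 * (u + \<delta>)" using IH(3) x2(2) by (simp add: algebra_simps)
    finally have E2: "expectation (\<lambda>\<omega>. (a \<omega> + x \<omega>)\<^sup>2) \<le> B\<^sup>2 * (u + \<delta>)" .
    have ud: "u + \<delta> = \<tau> (Suc j) - s" by (simp add: u_def \<delta>_def)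
    show ?case unfolding S ud[symmetric] by (intro conjI m i2 E2 i4 E4)
  qed
  note this[of n, OF order_refl]
  moreover have "\<tau> n = t" "?S n = elem_integral n \<tau> \<xi>"
    using e by (simp_all add: elem_integral_def elem_integrand_def fun_eq_iff)
  ultimately show "integrable M (\<lambda>\<omega>. elem_integral n \<tau> \<xi> \<omega> ^ 4)"
    "expectation (\<lambda>\<omega>. elem_integral n \<tau> \<xi> \<omega> ^ 4) \<le> ?K * B ^ 4 * (t - s)\<^sup>2"
    by (simp_all only: elem_integral_def)
qed

end

section \<open>Increments of the It\^o integral\<close>

lemma L2_tendsto_same_limit:
  assumes s: "\<And>j. square_integrable M (fs j)" "\<And>j. square_integrable M (gs j)" "square_integrable M f"
    and l: "(\<lambda>j. \<integral>x. (norm (fs j x - f x))\<^sup>2 \<partial>M) \<longlonglongrightarrow> 0"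
    "(\<lambda>j. \<integral>x. (norm (gs j x - f x))\<^sup>2 \<partial>M) \<longlonglongrightarrow> 0"
  shows "(\<lambda>j. \<integral>x. (norm (fs j x - gs j x))\<^sup>2 \<partial>M) \<longlonglongrightarrow> 0"
proof -
  have "(\<lambda>j. \<integral>x. (norm ((fs j x - gs j x) - 0))\<^sup>2 \<partial>M) \<longlonglongrightarrow> 0"
  proof (rule L2_tendsto_trans)
    show "square_integrable M (\<lambda>x. fs j x - gs j x)" "square_integrable M (\<lambda>x. f x - gs j x)" for j
      using s by (auto intro: square_integrable_diff)
    show "(\<lambda>j. \<integral>x. (norm (f x - gs j x - 0))\<^sup>2 \<partial>M) \<longlonglongrightarrow> 0" using l(2) by (simp add: norm_minus_commute)
    show "(\<lambda>j. \<integral>x. (norm (fs j x - gs j x - (f x - gs j x)))\<^sup>2 \<partial>M) \<longlonglongrightarrow> 0" using l(1) by simp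
  qed simp
  then show ?thesis by simp
qed

lemma measurable_norm_sq_ennreal:
  fixes f :: "'a \<Rightarrow> 'b :: euclidean_space"
  shows "f \<in> borel_measurable M \<Longrightarrow> (\<lambda>x. ennreal ((norm (f x))\<^sup>2)) \<in> borel_measurable M"
  by simp

context brownian_motion begin

lemma nn_integral_PT:
  assumes [measurable]: "f \<in> borel_measurable (PT s t)"
  shows "(\<integral>\<^sup>+p. f p \<partial>PT s t) = (\<integral>\<^sup>+\<omega>. (\<integral>\<^sup>+r\<in>{s<..t}. f (\<omega>, r) \<partial>lborel) \<partial>M)"
proof -
  interpret L: sigma_finite_measure "restrict_space lborel {s<..t}" by (rule sigma_finite_restrict_lborel)
  have "(\<integral>\<^sup>+p. f p \<partial>PT s t) = (\<integral>\<^sup>+\<omega>. (\<integral>\<^sup>+r. f (\<omega>, r) \<partial>restrict_space lborel {s<..t}) \<partial>M)"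
    by (rule L.nn_integral_fst[symmetric]) measurable
  then show ?thesis by (simp add: nn_integral_restrict_space)
qed

lemma measurable_PT_mono:
  assumes "f \<in> measurable (PT u v) N" "u \<le> s" "t \<le> v"
  shows "f \<in> measurable (PT s t) N"
proof -
  have "(\<lambda>p. (fst p, snd p)) \<in> measurable (PT s t) (PT u v)"
  proof (rule measurable_Pair)
    have "(\<lambda>r. r) \<in> measurable (restrict_space lborel {s<..t}) (restrict_space lborel {u<..v})"
      using assms(2,3) by (intro measurable_restrict_space2 measurable_restrict_space1) (auto simp: space_restrict_space)
    then show "snd \<in> measurable (PT s t) (restrict_space lborel {u<..v})"
      using measurable_compose[OF measurable_snd] by fast
  qed measurable
  from measurable_compose[OF this assms(1)] show ?thesis by simp
qed

lemma nn_integral_PT_mono: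
  assumes "f \<in> borel_measurable (PT u v)" "u \<le> s" "t \<le> v"
  shows "(\<integral>\<^sup>+p. f p \<partial>PT s t) \<le> (\<integral>\<^sup>+p. f p \<partial>PT u v)"
  unfolding nn_integral_PT[OF assms(1)] nn_integral_PT[OF measurable_PT_mono[OF assms]]
  using assms(2,3) by (intro nn_integral_mono mult_left_mono) (auto simp: indicator_def)

lemma square_integrable_PT_mono:
  assumes f: "square_integrable (PT u v) f" and st: "u \<le> s" "t \<le> v"
  shows "square_integrable (PT s t) f" and "(\<integral>p. (norm (f p))\<^sup>2 \<partial>PT s t) \<le> (\<integral>p. (norm (f p))\<^sup>2 \<partial>PT u v)"
proof -
  have m: "f \<in> borel_measurable (PT u v)" using f by (rule square_integrable_measurable)
  have le: "(\<integral>\<^sup>+p. ennreal ((norm (f p))\<^sup>2) \<partial>PT s t) \<le> (\<integral>\<^sup>+p. ennreal ((norm (f p))\<^sup>2) \<partial>PT u v)"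
    using m st by (intro nn_integral_PT_mono measurable_norm_sq_ennreal)
  also have "\<dots> < \<infinity>" unfolding nn_integral_sq_eq[OF f] by simp
  finally show sq: "square_integrable (PT s t) f"
    by (rule square_integrable_nn[OF measurable_PT_mono[OF m st]])
  from le show "(\<integral>p. (norm (f p))\<^sup>2 \<partial>PT s t) \<le> (\<integral>p. (norm (f p))\<^sup>2 \<partial>PT u v)"
    unfolding nn_integral_sq_eq[OF f] nn_integral_sq_eq[OF sq] by (subst (asm) ennreal_le_iff) auto
qed

text \<open>\<open>N\<close> is a version of the integral of \<open>h\<close> with respect to \<open>W\<close> over \<open>(s, t]\<close>: the \<open>L\<^sup>2\<close>-limit of the
  integrals of elementary integrands that converge to \<open>h\<close> in \<open>L\<^sup>2\<close>.\<close>

definition ito_increment :: "real \<Rightarrow> real \<Rightarrow> (real \<Rightarrow> 'a \<Rightarrow> real^'n) \<Rightarrow> ('a \<Rightarrow> real) \<Rightarrow> bool" where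
  "ito_increment s t h N \<longleftrightarrow> 0 \<le> s \<and> s \<le> t \<and> square_integrable M N \<and>
     square_integrable (PT s t) (\<lambda>p. h (snd p) (fst p)) \<and>
     (\<exists>n \<tau> \<xi>. (\<forall>j :: nat. elem_integrand s t (n j) (\<tau> j) (\<xi> j)) \<and>
       (\<lambda>j. \<integral>p. (norm (elem_process (n j) (\<tau> j) (\<xi> j) p - h (snd p) (fst p)))\<^sup>2 \<partial>PT s t) \<longlonglongrightarrow> 0 \<and>
       (\<lambda>j. \<integral>\<omega>. (norm (elem_integral (n j) (\<tau> j) (\<xi> j) \<omega> - N \<omega>))\<^sup>2 \<partial>M) \<longlonglongrightarrow> 0)"

text \<open>Each row of a matrix-valued integrand gives one component of the integral.\<close>

lemma has_ito_integral_imp_ito_increment: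
  assumes "has_ito_integral M F W T (H :: real \<Rightarrow> 'a \<Rightarrow> real^'n^'d) I" and T: "0 \<le> T"
  shows "ito_increment 0 T (\<lambda>s \<omega>. H s \<omega> $ i) (\<lambda>\<omega>. I \<omega> $ i)"
proof -
  obtain n \<tau> \<xi> where Hm: "(\<lambda>(s, \<omega>). H s \<omega>) \<in> borel_measurable (restrict_space borel {0..T} \<Otimes>\<^sub>M M)"
    and Hfin: "(\<integral>\<^sup>+\<omega>. (\<integral>\<^sup>+s\<in>{0..T}. ennreal ((norm (H s \<omega>))\<^sup>2) \<partial>lborel) \<partial>M) < \<infinity>"
    and Im: "I \<in> borel_measurable M"
    and si: "\<And>j :: nat. simple_integrand F T (n j) (\<tau> j) (\<xi> j)"
    and L: "(\<lambda>j. \<integral>\<^sup>+\<omega>. (\<integral>\<^sup>+s\<in>{0..T}.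
            ennreal ((norm (simple_process (n j) (\<tau> j) (\<xi> j) s \<omega> - H s \<omega>))\<^sup>2) \<partial>lborel) \<partial>M) \<longlonglongrightarrow> 0"
    and LI: "(\<lambda>j. \<integral>\<^sup>+\<omega>. ennreal ((norm (simple_ito_integral W (n j) (\<tau> j) (\<xi> j) \<omega> - I \<omega>))\<^sup>2) \<partial>M) \<longlonglongrightarrow> 0"
    using assms(1) unfolding has_ito_integral_def by blast
  let ?\<xi> = "\<lambda>j k \<omega>. \<xi> j k \<omega> $ i"
  let ?h = "\<lambda>p. H (snd p) (fst p) $ i"
  have nth: "(\<lambda>x. x $ i) \<in> borel_measurable (borel :: (real^'n^'d) measure)"
    by (intro borel_measurable_continuous_onI continuous_intros)
  have e: "elem_integrand 0 T (n j) (\<tau> j) (?\<xi> j)" for j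
    unfolding elem_integrand_def
  proof (intro conjI allI impI)
    fix k assume "k < n j"
    then have k: "\<xi> j k \<in> borel_measurable (F (\<tau> j k))" "\<exists>B. \<forall>\<omega>\<in>space M. norm (\<xi> j k \<omega>) \<le> B"
      "\<tau> j k \<le> \<tau> j (Suc k)"
      using si[of j] by (auto simp: simple_integrand_def)
    show "(\<lambda>\<omega>. \<xi> j k \<omega> $ i) \<in> borel_measurable (F (\<tau> j k))"
      by (rule measurable_compose[OF k(1) nth])
    show "\<exists>B. \<forall>\<omega>\<in>space M. norm (\<xi> j k \<omega> $ i) \<le> B"
      using k(2) Finite_Cartesian_Product.norm_nth_le[of _ i] order_trans by meson
    show "\<tau> j k \<le> \<tau> j (Suc k)" by fact
  qed (use si[of j] in \<open>auto simp: simple_integrand_def\<close>)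
  have pr: "elem_process (n j) (\<tau> j) (?\<xi> j) (\<omega>, s) = simple_process (n j) (\<tau> j) (\<xi> j) s \<omega> $ i" for j \<omega> s
    by (simp add: elem_process_def simple_process_def sum_component)
  have ig: "elem_integral (n j) (\<tau> j) (?\<xi> j) \<omega> = simple_ito_integral W (n j) (\<tau> j) (\<xi> j) \<omega> $ i" for j \<omega>
    by (simp add: elem_integral_def simple_ito_integral_def sum_component matrix_vector_mult_def inner_vec_sum)
  have hm: "?h \<in> borel_measurable (PT 0 T)"
  proof -
    have "(\<lambda>p. (snd p, fst p)) \<in> measurable (PT 0 T) (restrict_space borel {0..T} \<Otimes>\<^sub>M M)"
    proof (rule measurable_Pair)
      have "(\<lambda>r. r) \<in> measurable (restrict_space lborel {0<..T}) (restrict_space borel {0..T})"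
        by (intro measurable_restrict_space2 measurable_restrict_space1) (auto simp: space_restrict_space)
      then show "snd \<in> measurable (PT 0 T) (restrict_space borel {0..T})"
        using measurable_compose[OF measurable_snd] by fast
    qed measurable
    from measurable_compose[OF this measurable_compose[OF Hm nth]] show ?thesis by simp
  qed
  have mono: "(\<integral>\<^sup>+p. ennreal ((norm (g p :: real^'n))\<^sup>2) \<partial>PT 0 T) \<le> (\<integral>\<^sup>+\<omega>. (\<integral>\<^sup>+s\<in>{0..T}. ennreal ((norm (G s \<omega>))\<^sup>2) \<partial>lborel) \<partial>M)"
    if g: "g \<in> borel_measurable (PT 0 T)" and "\<And>\<omega> s. norm (g (\<omega>, s)) \<le> norm (G s \<omega>)" for g and G :: "real \<Rightarrow> 'a \<Rightarrow> real^'n^'d"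
  proof -
    have "(\<integral>\<^sup>+p. ennreal ((norm (g p))\<^sup>2) \<partial>PT 0 T) = (\<integral>\<^sup>+\<omega>. (\<integral>\<^sup>+r\<in>{0<..T}. ennreal ((norm (g (\<omega>, r)))\<^sup>2) \<partial>lborel) \<partial>M)"
      using g by (intro nn_integral_PT measurable_norm_sq_ennreal)
    also have "\<dots> \<le> (\<integral>\<^sup>+\<omega>. (\<integral>\<^sup>+s\<in>{0..T}. ennreal ((norm (G s \<omega>))\<^sup>2) \<partial>lborel) \<partial>M)"
      using that(2) by (intro nn_integral_mono mult_mono ennreal_leI power_mono) (auto simp: indicator_def)
    finally show ?thesis .
  qed
  have hsq: "square_integrable (PT 0 T) ?h"
  proof (rule square_integrable_nn[OF hm])
    have "(\<integral>\<^sup>+p. ennreal ((norm (?h p))\<^sup>2) \<partial>PT 0 T) \<le> (\<integral>\<^sup>+\<omega>. (\<integral>\<^sup>+s\<in>{0..T}. ennreal ((norm (H s \<omega>))\<^sup>2) \<partial>lborel) \<partial>M)"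
      by (rule mono[OF hm]) (simp add: Finite_Cartesian_Product.norm_nth_le)
    then show "(\<integral>\<^sup>+p. ennreal ((norm (?h p))\<^sup>2) \<partial>PT 0 T) < \<infinity>" using Hfin by (rule le_less_trans)
  qed
  have lp: "(\<lambda>j. \<integral>p. (norm (elem_process (n j) (\<tau> j) (?\<xi> j) p - ?h p))\<^sup>2 \<partial>PT 0 T) \<longlonglongrightarrow> 0"
  proof (rule L2_tendsto_nn[OF elem_process_square_integrable[OF e] hsq])
    show "(\<lambda>j. \<integral>\<^sup>+p. ennreal ((norm (elem_process (n j) (\<tau> j) (?\<xi> j) p - ?h p))\<^sup>2) \<partial>PT 0 T) \<longlonglongrightarrow> 0"
    proof (rule tendsto_sandwich[OF _ _ tendsto_const L])
      show "\<forall>\<^sub>F j in sequentially. (\<integral>\<^sup>+p. ennreal ((norm (elem_process (n j) (\<tau> j) (?\<xi> j) p - ?h p))\<^sup>2) \<partial>PT 0 T) \<le>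
        (\<integral>\<^sup>+\<omega>. (\<integral>\<^sup>+s\<in>{0..T}. ennreal ((norm (simple_process (n j) (\<tau> j) (\<xi> j) s \<omega> - H s \<omega>))\<^sup>2) \<partial>lborel) \<partial>M)"
      proof (intro always_eventually allI mono borel_measurable_diff elem_process_measurable[OF e] hm)
        show "norm (elem_process (n j) (\<tau> j) (?\<xi> j) (\<omega>, s) - ?h (\<omega>, s)) \<le> norm (simple_process (n j) (\<tau> j) (\<xi> j) s \<omega> - H s \<omega>)" for j \<omega> s
          unfolding pr using Finite_Cartesian_Product.norm_nth_le[of "simple_process (n j) (\<tau> j) (\<xi> j) s \<omega> - H s \<omega>" i] by simp
      qed
    qed simp
  qed
  have Iim: "(\<lambda>\<omega>. I \<omega> $ i) \<in> borel_measurable M" using measurable_compose[OF Im borel_measurable_nth] .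
  have li: "(\<lambda>j. \<integral>\<^sup>+\<omega>. ennreal ((norm (elem_integral (n j) (\<tau> j) (?\<xi> j) \<omega> - I \<omega> $ i))\<^sup>2) \<partial>M) \<longlonglongrightarrow> 0"
  proof (rule tendsto_sandwich[OF _ _ tendsto_const LI])
    show "\<forall>\<^sub>F j in sequentially. (\<integral>\<^sup>+\<omega>. ennreal ((norm (elem_integral (n j) (\<tau> j) (?\<xi> j) \<omega> - I \<omega> $ i))\<^sup>2) \<partial>M) \<le>
      (\<integral>\<^sup>+\<omega>. ennreal ((norm (simple_ito_integral W (n j) (\<tau> j) (\<xi> j) \<omega> - I \<omega>))\<^sup>2) \<partial>M)"
    proof (intro always_eventually allI nn_integral_mono ennreal_leI power_mono)
      show "norm (elem_integral (n j) (\<tau> j) (?\<xi> j) \<omega> - I \<omega> $ i) \<le> norm (simple_ito_integral W (n j) (\<tau> j) (\<xi> j) \<omega> - I \<omega>)" for j \<omega>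
        unfolding ig using component_le_norm_cart[of "simple_ito_integral W (n j) (\<tau> j) (\<xi> j) \<omega> - I \<omega>" i] by simp
    qed simp
  qed simp
  have Isq: "square_integrable M (\<lambda>\<omega>. I \<omega> $ i)"
    by (rule L2_limit_square_integrable[OF elem_integral_square_integrable[OF e] Iim li])
  show ?thesis
    unfolding ito_increment_def
    by (intro conjI exI[of _ n] exI[of _ \<tau>] exI[of _ "\<lambda>j k \<omega>. \<xi> j k \<omega> $ i"] allI order_refl
      T Isq hsq e lp L2_tendsto_nn[OF elem_integral_square_integrable[OF e] Isq li])
qed

text \<open>An elementary integrand on \<open>(0, t]\<close> is cut at time \<open>s\<close>. For the lower part, the values on the
  collapsed intervals are set to zero, as they need not be measurable at time \<open>s\<close>.\<close>

lemma elem_integrand_lower: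
  assumes e: "elem_integrand 0 t n \<tau> \<xi>" and s: "0 \<le> s" "s \<le> t"
  shows "elem_integrand 0 s n (\<lambda>k. min (\<tau> k) s) (\<lambda>k. if \<tau> k < s then \<xi> k else (\<lambda>_. 0))"
  using e s unfolding elem_integrand_def
  by (auto simp: min_def not_le not_less intro: exI[of _ 0])

lemma elem_integrand_upper:
  assumes e: "elem_integrand 0 t n \<tau> \<xi>" and s: "0 \<le> s" "s \<le> t"
  shows "elem_integrand s t n (\<lambda>k. max (\<tau> k) s) \<xi>"
  unfolding elem_integrand_def
proof (intro conjI allI impI)
  fix k assume k: "k < n"
  show "\<xi> k \<in> borel_measurable (F (max (\<tau> k) s))"
    by (rule measurable_F_mono[OF elem_measurable(1)[OF e k]]) simp
qed (use e s in \<open>auto simp: elem_integrand_def max_def\<close>)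

lemma elem_process_lower:
  assumes "r \<le> s"
  shows "elem_process n (\<lambda>k. min (\<tau> k) s) (\<lambda>k. if \<tau> k < s then \<xi> k else (\<lambda>_. 0)) (\<omega>, r) = elem_process n \<tau> \<xi> (\<omega>, r)"
  unfolding elem_process_def using assms by (intro sum.cong) (auto simp: indicator_def)

lemma elem_process_upper:
  assumes "s < r"
  shows "elem_process n (\<lambda>k. max (\<tau> k) s) \<xi> (\<omega>, r) = elem_process n \<tau> \<xi> (\<omega>, r)"
  unfolding elem_process_def using assms by (intro sum.cong) (auto simp: indicator_def)

lemma elem_integral_split:
  assumes "elem_integrand 0 t n \<tau> \<xi>"
  shows "elem_integral n \<tau> \<xi> \<omega> =
    elem_integral n (\<lambda>k. min (\<tau> k) s) (\<lambda>k. if \<tau> k < s then \<xi> k else (\<lambda>_. 0)) \<omega> +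
    elem_integral n (\<lambda>k. max (\<tau> k) s) \<xi> \<omega>"
  unfolding elem_integral_def sum.distrib[symmetric]
proof (rule sum.cong)
  fix k assume "k \<in> {..<n}"
  then have "\<tau> k \<le> \<tau> (Suc k)" using assms by (simp add: elem_integrand_def)
  then show "\<xi> k \<omega> \<bullet> (W (\<tau> (Suc k)) \<omega> - W (\<tau> k) \<omega>) =
    (if \<tau> k < s then \<xi> k else (\<lambda>_. 0)) \<omega> \<bullet> (W (min (\<tau> (Suc k)) s) \<omega> - W (min (\<tau> k) s) \<omega>) +
    \<xi> k \<omega> \<bullet> (W (max (\<tau> (Suc k)) s) \<omega> - W (max (\<tau> k) s) \<omega>)"
  proof (cases "\<tau> k < s")
    case True
    then show ?thesis using \<open>\<tau> k \<le> \<tau> (Suc k)\<close> by (auto simp: min_def max_def inner_diff_right)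
  next
    case False
    then have "s \<le> \<tau> k" "s \<le> \<tau> (Suc k)" using \<open>\<tau> k \<le> \<tau> (Suc k)\<close> by auto
    then show ?thesis by (simp add: max_absorb1)
  qed
qed simp

lemma space_PT: "p \<in> space (PT s t) \<longleftrightarrow> fst p \<in> space M \<and> s < snd p \<and> snd p \<le> t"
  by (cases p) (auto simp: space_pair_measure space_restrict_space)

text \<open>Both increments are the limits of elementary integrals; the isometry shows that the two
  approximations of the integral over the initial interval have the same limit.\<close>

lemma ito_increment_diff:
  assumes t: "ito_increment 0 t h N" and s: "ito_increment 0 s h N'" and st: "s \<le> t"
  shows "ito_increment s t h (\<lambda>\<omega>. N \<omega> - N' \<omega>)"
proof -
  let ?h = "\<lambda>p. h (snd p) (fst p)"
  obtain n \<tau> \<xi> where A: "\<And>j :: nat. elem_integrand 0 t (n j) (\<tau> j) (\<xi> j)"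
    "(\<lambda>j. \<integral>p. (norm (elem_process (n j) (\<tau> j) (\<xi> j) p - ?h p))\<^sup>2 \<partial>PT 0 t) \<longlonglongrightarrow> 0"
    "(\<lambda>j. \<integral>\<omega>. (norm (elem_integral (n j) (\<tau> j) (\<xi> j) \<omega> - N \<omega>))\<^sup>2 \<partial>M) \<longlonglongrightarrow> 0"
    "square_integrable M N" "square_integrable (PT 0 t) ?h"
    using t unfolding ito_increment_def by blast
  obtain n' \<tau>' \<xi>' where B: "\<And>j :: nat. elem_integrand 0 s (n' j) (\<tau>' j) (\<xi>' j)"
    "(\<lambda>j. \<integral>p. (norm (elem_process (n' j) (\<tau>' j) (\<xi>' j) p - ?h p))\<^sup>2 \<partial>PT 0 s) \<longlonglongrightarrow> 0"
    "(\<lambda>j. \<integral>\<omega>. (norm (elem_integral (n' j) (\<tau>' j) (\<xi>' j) \<omega> - N' \<omega>))\<^sup>2 \<partial>M) \<longlonglongrightarrow> 0"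
    "square_integrable M N'" "square_integrable (PT 0 s) ?h" and s0: "0 \<le> s"
    using s unfolding ito_increment_def by blast
  define \<tau>l where "\<tau>l j k = min (\<tau> j k) s" for j k
  define \<xi>l where "\<xi>l j k = (if \<tau> j k < s then \<xi> j k else (\<lambda>_. 0))" for j k
  define \<tau>u where "\<tau>u j k = max (\<tau> j k) s" for j k
  have l: "elem_integrand 0 s (n j) (\<tau>l j) (\<xi>l j)" for j
    using elem_integrand_lower[OF A(1) s0 st] unfolding \<tau>l_def \<xi>l_def .
  have u: "elem_integrand s t (n j) (\<tau>u j) (\<xi> j)" for j
    using elem_integrand_upper[OF A(1) s0 st] unfolding \<tau>u_def .
  have split: "elem_integral (n j) (\<tau> j) (\<xi> j) \<omega> = elem_integral (n j) (\<tau>l j) (\<xi>l j) \<omega> + elem_integral (n j) (\<tau>u j) (\<xi> j) \<omega>" for j \<omega>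
    using elem_integral_split[OF A(1)] unfolding \<tau>l_def \<xi>l_def \<tau>u_def .
  have dsq: "square_integrable (PT 0 t) (\<lambda>p. elem_process (n j) (\<tau> j) (\<xi> j) p - ?h p)" for j
    by (intro square_integrable_diff elem_process_square_integrable[OF A(1)] A(5))
  have restr: "(\<lambda>j. \<integral>p. (norm (elem_process (n j) (\<tau> j) (\<xi> j) p - ?h p))\<^sup>2 \<partial>PT a b) \<longlonglongrightarrow> 0" if "0 \<le> a" "b \<le> t" for a b
    by (rule tendsto_sandwich[OF _ _ tendsto_const A(2)])
      (auto intro!: always_eventually square_integrable_PT_mono(2)[OF dsq that] simp: integral_nonneg_AE)
  have lconv: "(\<lambda>j. \<integral>p. (norm (elem_process (n j) (\<tau>l j) (\<xi>l j) p - ?h p))\<^sup>2 \<partial>PT 0 s) \<longlonglongrightarrow> 0"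
  proof -
    have "(\<integral>p. (norm (elem_process (n j) (\<tau>l j) (\<xi>l j) p - ?h p))\<^sup>2 \<partial>PT 0 s) = (\<integral>p. (norm (elem_process (n j) (\<tau> j) (\<xi> j) p - ?h p))\<^sup>2 \<partial>PT 0 s)" for j
    proof (rule Bochner_Integration.integral_cong)
      fix p assume "p \<in> space (PT 0 s)"
      then show "(norm (elem_process (n j) (\<tau>l j) (\<xi>l j) p - ?h p))\<^sup>2 = (norm (elem_process (n j) (\<tau> j) (\<xi> j) p - ?h p))\<^sup>2"
        using elem_process_lower[of "snd p" s "n j" "\<tau> j" "\<xi> j" "fst p"] unfolding \<tau>l_def \<xi>l_def space_PT by simp
    qed simp
    then show ?thesis using restr[of 0 s] st by simp
  qed
  have uconv: "(\<lambda>j. \<integral>p. (norm (elem_process (n j) (\<tau>u j) (\<xi> j) p - ?h p))\<^sup>2 \<partial>PT s t) \<longlonglongrightarrow> 0"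
  proof -
    have "(\<integral>p. (norm (elem_process (n j) (\<tau>u j) (\<xi> j) p - ?h p))\<^sup>2 \<partial>PT s t) = (\<integral>p. (norm (elem_process (n j) (\<tau> j) (\<xi> j) p - ?h p))\<^sup>2 \<partial>PT s t)" for j
    proof (rule Bochner_Integration.integral_cong)
      fix p assume "p \<in> space (PT s t)"
      then show "(norm (elem_process (n j) (\<tau>u j) (\<xi> j) p - ?h p))\<^sup>2 = (norm (elem_process (n j) (\<tau> j) (\<xi> j) p - ?h p))\<^sup>2"
        using elem_process_upper[of s "snd p" "n j" "\<tau> j" "\<xi> j" "fst p"] unfolding \<tau>u_def space_PT by simp
    qed simp
    then show ?thesis using restr[of s t] s0 by simp
  qed
  \<comment> \<open>Two approximations of the same integrand on \<open>(0, s]\<close>, hence of the same integral.\<close>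
  have "(\<lambda>j. \<integral>p. (norm (elem_process (n j) (\<tau>l j) (\<xi>l j) p - elem_process (n' j) (\<tau>' j) (\<xi>' j) p))\<^sup>2 \<partial>PT 0 s) \<longlonglongrightarrow> 0"
    by (rule L2_tendsto_same_limit[OF elem_process_square_integrable[OF l] elem_process_square_integrable[OF B(1)] B(5) lconv B(2)])
  then have "(\<lambda>j. \<integral>\<omega>. (norm (elem_integral (n j) (\<tau>l j) (\<xi>l j) \<omega> - elem_integral (n' j) (\<tau>' j) (\<xi>' j) \<omega>))\<^sup>2 \<partial>M) \<longlonglongrightarrow> 0"
    by (simp add: elem_isometry_diff[OF l B(1)])
  then have lN': "(\<lambda>j. \<integral>\<omega>. (norm (elem_integral (n j) (\<tau>l j) (\<xi>l j) \<omega> - N' \<omega>))\<^sup>2 \<partial>M) \<longlonglongrightarrow> 0"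
    by (rule L2_tendsto_trans[OF elem_integral_square_integrable[OF l] elem_integral_square_integrable[OF B(1)] B(4) B(3)])
  have uN: "(\<lambda>j. \<integral>\<omega>. (norm (elem_integral (n j) (\<tau>u j) (\<xi> j) \<omega> - (N \<omega> - N' \<omega>)))\<^sup>2 \<partial>M) \<longlonglongrightarrow> 0"
  proof (rule L2_tendsto_trans)
    show "square_integrable M (elem_integral (n j) (\<tau>u j) (\<xi> j))" for j
      by (rule elem_integral_square_integrable[OF u])
    show "square_integrable M (\<lambda>\<omega>. N \<omega> - elem_integral (n j) (\<tau>l j) (\<xi>l j) \<omega>)" for j
      by (intro square_integrable_diff A(4) elem_integral_square_integrable[OF l])
    show "square_integrable M (\<lambda>\<omega>. N \<omega> - N' \<omega>)" by (intro square_integrable_diff A(4) B(4))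
    show "(\<lambda>j. \<integral>\<omega>. (norm (N \<omega> - elem_integral (n j) (\<tau>l j) (\<xi>l j) \<omega> - (N \<omega> - N' \<omega>)))\<^sup>2 \<partial>M) \<longlonglongrightarrow> 0"
      using lN' by (simp add: power2_commute[of "N' _"])
    show "(\<lambda>j. \<integral>\<omega>. (norm (elem_integral (n j) (\<tau>u j) (\<xi> j) \<omega> - (N \<omega> - elem_integral (n j) (\<tau>l j) (\<xi>l j) \<omega>)))\<^sup>2 \<partial>M) \<longlonglongrightarrow> 0"
      using A(3) by (simp add: split algebra_simps)
  qed
  have hst: "square_integrable (PT s t) ?h" using square_integrable_PT_mono(1)[OF A(5)] s0 by simp
  show ?thesis
    unfolding ito_increment_def
    using s0 st hst square_integrable_diff[OF A(4) B(4)] u uconv uN by blast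
qed

lemma ito_increment_mean_zero:
  assumes "ito_increment s t h N" and \<phi>: "\<phi> \<in> borel_measurable (F s)" "square_integrable M \<phi>"
  shows "integrable M (\<lambda>\<omega>. \<phi> \<omega> * N \<omega>)" "expectation (\<lambda>\<omega>. \<phi> \<omega> * N \<omega>) = 0"
proof -
  obtain n \<tau> \<xi> where A: "\<And>j :: nat. elem_integrand s t (n j) (\<tau> j) (\<xi> j)"
    "(\<lambda>j. \<integral>\<omega>. (norm (elem_integral (n j) (\<tau> j) (\<xi> j) \<omega> - N \<omega>))\<^sup>2 \<partial>M) \<longlonglongrightarrow> 0" "square_integrable M N"
    using assms(1) unfolding ito_increment_def by blast
  show "integrable M (\<lambda>\<omega>. \<phi> \<omega> * N \<omega>)" by (rule square_integrable_mult[OF \<phi>(2) A(3)])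
  have "(\<lambda>j. expectation (\<lambda>\<omega>. 1 * (\<phi> \<omega> \<bullet> elem_integral (n j) (\<tau> j) (\<xi> j) \<omega>))) \<longlonglongrightarrow> expectation (\<lambda>\<omega>. 1 * (\<phi> \<omega> \<bullet> N \<omega>))"
    by (rule tendsto_integral_inner_L2[where B = 1])
      (use \<phi>(2) A elem_integral_square_integrable[OF A(1)] in simp_all)
  moreover have "expectation (\<lambda>\<omega>. 1 * (\<phi> \<omega> \<bullet> elem_integral (n j) (\<tau> j) (\<xi> j) \<omega>)) = 0" for j
    using elem_integral_mean_zero[OF A(1) \<phi>(1) square_integrable_integrable[OF \<phi>(2)]] by simp
  ultimately have "(\<lambda>j :: nat. 0 :: real) \<longlonglongrightarrow> expectation (\<lambda>\<omega>. 1 * (\<phi> \<omega> \<bullet> N \<omega>))" by simp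
  then show "expectation (\<lambda>\<omega>. \<phi> \<omega> * N \<omega>) = 0" by (simp add: LIMSEQ_const_iff)
qed

lemma ito_increment_isometry:
  assumes N: "ito_increment s t h N" and N': "ito_increment s t h' N'"
    and \<psi>: "\<psi> \<in> borel_measurable (F s)" "\<And>\<omega>. \<omega> \<in> space M \<Longrightarrow> \<bar>\<psi> \<omega>\<bar> \<le> K"
  shows "expectation (\<lambda>\<omega>. \<psi> \<omega> * (N \<omega> * N' \<omega>))
    = (\<integral>p. \<psi> (fst p) * (h (snd p) (fst p) \<bullet> h' (snd p) (fst p)) \<partial>PT s t)"
proof -
  obtain n \<tau> \<xi> where A: "\<And>j :: nat. elem_integrand s t (n j) (\<tau> j) (\<xi> j)"
    "(\<lambda>j. \<integral>p. (norm (elem_process (n j) (\<tau> j) (\<xi> j) p - h (snd p) (fst p)))\<^sup>2 \<partial>PT s t) \<longlonglongrightarrow> 0"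
    "(\<lambda>j. \<integral>\<omega>. (norm (elem_integral (n j) (\<tau> j) (\<xi> j) \<omega> - N \<omega>))\<^sup>2 \<partial>M) \<longlonglongrightarrow> 0"
    "square_integrable M N" "square_integrable (PT s t) (\<lambda>p. h (snd p) (fst p))"
    using N unfolding ito_increment_def by blast
  obtain n' \<tau>' \<xi>' where B: "\<And>j :: nat. elem_integrand s t (n' j) (\<tau>' j) (\<xi>' j)"
    "(\<lambda>j. \<integral>p. (norm (elem_process (n' j) (\<tau>' j) (\<xi>' j) p - h' (snd p) (fst p)))\<^sup>2 \<partial>PT s t) \<longlonglongrightarrow> 0"
    "(\<lambda>j. \<integral>\<omega>. (norm (elem_integral (n' j) (\<tau>' j) (\<xi>' j) \<omega> - N' \<omega>))\<^sup>2 \<partial>M) \<longlonglongrightarrow> 0"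
    "square_integrable M N'" "square_integrable (PT s t) (\<lambda>p. h' (snd p) (fst p))"
    using N' unfolding ito_increment_def by blast
  have \<psi>M: "\<psi> \<in> borel_measurable M" using \<psi>(1) by (rule measurable_F_imp)
  have "(\<lambda>j. expectation (\<lambda>\<omega>. \<psi> \<omega> * (elem_integral (n j) (\<tau> j) (\<xi> j) \<omega> \<bullet> elem_integral (n' j) (\<tau>' j) (\<xi>' j) \<omega>)))
     \<longlonglongrightarrow> expectation (\<lambda>\<omega>. \<psi> \<omega> * (N \<omega> \<bullet> N' \<omega>))"
    by (rule tendsto_integral_inner_L2[OF elem_integral_square_integrable[OF A(1)] A(4,3)
       elem_integral_square_integrable[OF B(1)] B(4,3) \<psi>M \<psi>(2)])
  moreover have "(\<lambda>j. \<integral>p. \<psi> (fst p) * (elem_process (n j) (\<tau> j) (\<xi> j) p \<bullet> elem_process (n' j) (\<tau>' j) (\<xi>' j) p) \<partial>PT s t)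
     \<longlonglongrightarrow> (\<integral>p. \<psi> (fst p) * (h (snd p) (fst p) \<bullet> h' (snd p) (fst p)) \<partial>PT s t)"
    by (rule tendsto_integral_inner_L2[OF elem_process_square_integrable[OF A(1)] A(5,2)
       elem_process_square_integrable[OF B(1)] B(5,2)])
      (use \<psi>(2) measurable_compose[OF measurable_fst \<psi>M] in \<open>auto simp: space_PT\<close>)
  ultimately show ?thesis
    using elem_isometry[OF A(1) B(1) \<psi>] by (simp add: LIMSEQ_unique)
qed

text \<open>At a given time at most one summand is present, whatever the values of the integrand are.\<close>

lemma elem_process_at:
  assumes e: "elem_integrand s t n \<tau> \<xi>"
  shows "elem_process n \<tau> \<xi> p = 0 \<and> (\<forall>k<n. snd p \<notin> {\<tau> k<..\<tau> (Suc k)}) \<or>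
    (\<exists>k<n. \<forall>\<zeta>. elem_process n \<tau> \<zeta> p = \<zeta> k (fst p))"
proof (cases "\<exists>k<n. snd p \<in> {\<tau> k<..\<tau> (Suc k)}")
  case True
  then obtain k where k: "k < n" "snd p \<in> {\<tau> k<..\<tau> (Suc k)}" by blast
  have other: "snd p \<notin> {\<tau> l<..\<tau> (Suc l)}" if l: "l < n" "l \<noteq> k" for l
  proof (cases "l < k")
    case True
    then show ?thesis using elem_times[OF e, of "Suc l" k] k by auto
  next
    case False
    then show ?thesis using elem_times[OF e, of "Suc k" l] k l by auto
  qed
  have "elem_process n \<tau> \<zeta> p = \<zeta> k (fst p)" for \<zeta>
  proof -
    have "elem_process n \<tau> \<zeta> p = (\<Sum>l\<in>{k}. indicator {\<tau> l<..\<tau> (Suc l)} (snd p) *\<^sub>R \<zeta> l (fst p))"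
      unfolding elem_process_def using k(1) other by (intro sum.mono_neutral_right) auto
    moreover have "sum f {k} = f k" for f :: "nat \<Rightarrow> real^'n" by simp
    ultimately show ?thesis using k(2) by (simp only: indicator_simps scaleR_one)
  qed
  then show ?thesis using k(1) by blast
next
  case False
  then have "elem_process n \<tau> \<xi> p = 0" unfolding elem_process_def by (intro sum.neutral) auto
  then show ?thesis using False by blast
qed

lemma elem_process_map:
  assumes e: "elem_integrand s t n \<tau> \<xi>" and g: "g 0 = 0"
  shows "elem_process n \<tau> (\<lambda>k \<omega>. g (\<xi> k \<omega>)) p = g (elem_process n \<tau> \<xi> p)"
  using elem_process_at[OF e, of p]
proof
  assume *: "elem_process n \<tau> \<xi> p = 0 \<and> (\<forall>k<n. snd p \<notin> {\<tau> k<..\<tau> (Suc k)})"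
  then have "elem_process n \<tau> (\<lambda>k \<omega>. g (\<xi> k \<omega>)) p = 0" unfolding elem_process_def by (intro sum.neutral) auto
  with * show ?thesis using g by simp
next
  assume "\<exists>k<n. \<forall>\<zeta>. elem_process n \<tau> \<zeta> p = \<zeta> k (fst p)"
  then show ?thesis by force
qed

text \<open>The approximating integrands may leave the ball that contains the integrand; projecting
  them onto it does not spoil the approximation, and bounds their fourth moments.\<close>

lemma ito_increment_fourth_moment:
  assumes N: "ito_increment s t h N" and B: "0 \<le> B"
    "\<And>r \<omega>. \<omega> \<in> space M \<Longrightarrow> s < r \<Longrightarrow> r \<le> t \<Longrightarrow> norm (h r \<omega>) \<le> B"
  shows "integrable M (\<lambda>\<omega>. N \<omega> ^ 4)"
    and "expectation (\<lambda>\<omega>. N \<omega> ^ 4) \<le> 9 * (real CARD('n))\<^sup>2 * B ^ 4 * (t - s)\<^sup>2"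
proof -
  let ?h = "\<lambda>p. h (snd p) (fst p)"
  let ?C = "9 * (real CARD('n))\<^sup>2 * B ^ 4 * (t - s)\<^sup>2"
  obtain n \<tau> \<xi> where A: "\<And>j :: nat. elem_integrand s t (n j) (\<tau> j) (\<xi> j)"
    "(\<lambda>j. \<integral>p. (norm (elem_process (n j) (\<tau> j) (\<xi> j) p - ?h p))\<^sup>2 \<partial>PT s t) \<longlonglongrightarrow> 0"
    "(\<lambda>j. \<integral>\<omega>. (norm (elem_integral (n j) (\<tau> j) (\<xi> j) \<omega> - N \<omega>))\<^sup>2 \<partial>M) \<longlonglongrightarrow> 0"
    "square_integrable M N" "square_integrable (PT s t) ?h"
    using N unfolding ito_increment_def by blast
  \<comment> \<open>The projection onto the ball fixes the values of \<open>h\<close> and does not increase distances.\<close>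
  let ?g = "closest_point (cball (0 :: real^'n) B)"
  have ne: "cball (0 :: real^'n) B \<noteq> {}" using B(1) by simp
  have g0: "?g 0 = 0" using B(1) by (intro closest_point_self) simp
  have gle: "norm (?g x) \<le> B" for x
    using closest_point_in_set[OF closed_cball ne, of x] by simp
  have gm: "?g \<in> borel_measurable borel"
    by (intro borel_measurable_continuous_onI continuous_on_closest_point convex_cball closed_cball ne)
  have glip: "norm (?g x - y) \<le> norm (x - y)" if "norm y \<le> B" for x y
    using closest_point_lipschitz[OF convex_cball closed_cball ne, of x y] closest_point_self[of y "cball 0 B"] that
    by (simp add: dist_norm)
  define \<eta> where "\<eta> j k \<omega> = ?g (\<xi> j k \<omega>)" for j k \<omega>
  have e: "elem_integrand s t (n j) (\<tau> j) (\<eta> j)" for j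
    using A(1)[of j] gle measurable_compose[OF elem_measurable(1)[OF A(1)] gm]
    unfolding elem_integrand_def \<eta>_def by blast
  have ep: "elem_process (n j) (\<tau> j) (\<eta> j) p = ?g (elem_process (n j) (\<tau> j) (\<xi> j) p)" for j p
    unfolding \<eta>_def by (rule elem_process_map[where g = ?g, OF A(1) g0])
  have "(\<lambda>j. \<integral>p. (norm (elem_process (n j) (\<tau> j) (\<eta> j) p - ?h p))\<^sup>2 \<partial>PT s t) \<longlonglongrightarrow> 0"
  proof (rule tendsto_sandwich[OF _ _ tendsto_const A(2)])
    show "\<forall>\<^sub>F j in sequentially. (\<integral>p. (norm (elem_process (n j) (\<tau> j) (\<eta> j) p - ?h p))\<^sup>2 \<partial>PT s t) \<le>
      (\<integral>p. (norm (elem_process (n j) (\<tau> j) (\<xi> j) p - ?h p))\<^sup>2 \<partial>PT s t)"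
    proof (intro always_eventually allI integral_mono)
      fix j p assume p: "p \<in> space (PT s t)"
      show "(norm (elem_process (n j) (\<tau> j) (\<eta> j) p - ?h p))\<^sup>2 \<le> (norm (elem_process (n j) (\<tau> j) (\<xi> j) p - ?h p))\<^sup>2"
        unfolding ep using p by (intro power_mono glip B(2)) (auto simp: space_PT)
    next
      fix j
      show "integrable (PT s t) (\<lambda>p. (norm (elem_process (n j) (\<tau> j) (\<eta> j) p - ?h p))\<^sup>2)"
        "integrable (PT s t) (\<lambda>p. (norm (elem_process (n j) (\<tau> j) (\<xi> j) p - ?h p))\<^sup>2)"
        using square_integrable_diff[OF elem_process_square_integrable[OF e] A(5)]
          square_integrable_diff[OF elem_process_square_integrable[OF A(1)] A(5)] by (auto simp: square_integrable_def)
    qed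
  qed simp
  then have "(\<lambda>j. \<integral>p. (norm (elem_process (n j) (\<tau> j) (\<eta> j) p - elem_process (n j) (\<tau> j) (\<xi> j) p))\<^sup>2 \<partial>PT s t) \<longlonglongrightarrow> 0"
    by (rule L2_tendsto_same_limit[OF elem_process_square_integrable[OF e] elem_process_square_integrable[OF A(1)] A(5) _ A(2)])
  then have "(\<lambda>j. \<integral>\<omega>. (norm (elem_integral (n j) (\<tau> j) (\<eta> j) \<omega> - elem_integral (n j) (\<tau> j) (\<xi> j) \<omega>))\<^sup>2 \<partial>M) \<longlonglongrightarrow> 0"
    by (simp add: elem_isometry_diff[OF e A(1)])
  then have L: "(\<lambda>j. \<integral>\<omega>. (norm (elem_integral (n j) (\<tau> j) (\<eta> j) \<omega> - N \<omega>))\<^sup>2 \<partial>M) \<longlonglongrightarrow> 0"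
    by (rule L2_tendsto_trans[OF elem_integral_square_integrable[OF e] elem_integral_square_integrable[OF A(1)] A(4,3)])
  define S where "S j = elem_integral (n j) (\<tau> j) (\<eta> j)" for j
  have S4: "integrable M (\<lambda>\<omega>. S j \<omega> ^ 4)" "expectation (\<lambda>\<omega>. S j \<omega> ^ 4) \<le> ?C" for j
    unfolding S_def using elem_integral_fourth_moment[OF e B(1), of j] gle by (auto simp: \<eta>_def)
  have Ssq: "square_integrable M (\<lambda>\<omega>. S j \<omega> - N \<omega>)" for j
    unfolding S_def by (intro square_integrable_diff elem_integral_square_integrable[OF e] A(4))
  \<comment> \<open>Fatou's lemma along an almost surely convergent subsequence.\<close>
  have "\<exists>r. strict_mono r \<and> (AE \<omega> in M. (\<lambda>j. (S (r j) \<omega> - N \<omega>)\<^sup>2) \<longlonglongrightarrow> 0)"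
  proof (rule tendsto_L1_AE_subseq)
    show "integrable M (\<lambda>\<omega>. (S j \<omega> - N \<omega>)\<^sup>2)" for j
      using Ssq[of j] by (simp add: square_integrable_def)
    show "(\<lambda>j. expectation (\<lambda>\<omega>. norm ((S j \<omega> - N \<omega>)\<^sup>2))) \<longlonglongrightarrow> 0" using L by (simp add: S_def)
  qed
  then obtain r where r: "AE \<omega> in M. (\<lambda>j. (S (r j) \<omega> - N \<omega>)\<^sup>2) \<longlonglongrightarrow> 0" by blast
  have [measurable]: "S j \<in> borel_measurable M" for j
    unfolding S_def by (rule square_integrable_measurable[OF elem_integral_square_integrable[OF e]])
  have [measurable]: "N \<in> borel_measurable M" by (rule square_integrable_measurable[OF A(4)])
  have "(\<integral>\<^sup>+\<omega>. ennreal (N \<omega> ^ 4) \<partial>M) = (\<integral>\<^sup>+\<omega>. liminf (\<lambda>j. ennreal (S (r j) \<omega> ^ 4)) \<partial>M)"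
  proof (rule nn_integral_cong_AE)
    show "AE \<omega> in M. ennreal (N \<omega> ^ 4) = liminf (\<lambda>j. ennreal (S (r j) \<omega> ^ 4))"
      using r
    proof eventually_elim
      case (elim \<omega>)
      have "(\<lambda>j. \<bar>S (r j) \<omega> - N \<omega>\<bar>) \<longlonglongrightarrow> 0" using tendsto_real_sqrt[OF elim] by simp
      then have "(\<lambda>j. S (r j) \<omega>) \<longlonglongrightarrow> N \<omega>"
        by (rule LIM_zero_cancel[OF tendsto_rabs_zero_cancel])
      then have "(\<lambda>j. ennreal (S (r j) \<omega> ^ 4)) \<longlonglongrightarrow> ennreal (N \<omega> ^ 4)"
        by (intro tendsto_ennrealI tendsto_power)
      then show ?case by (intro lim_imp_Liminf[symmetric]) simp_all
    qed
  qed
  also have "\<dots> \<le> liminf (\<lambda>j. \<integral>\<^sup>+\<omega>. ennreal (S (r j) \<omega> ^ 4) \<partial>M)"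
    by (rule nn_integral_liminf) measurable
  also have "\<dots> \<le> liminf (\<lambda>j :: nat. ennreal ?C)"
  proof (intro Liminf_mono always_eventually allI)
    fix j
    have "(\<integral>\<^sup>+\<omega>. ennreal (S (r j) \<omega> ^ 4) \<partial>M) = ennreal (expectation (\<lambda>\<omega>. S (r j) \<omega> ^ 4))"
      by (rule nn_integral_eq_integral) (auto intro: S4)
    then show "(\<integral>\<^sup>+\<omega>. ennreal (S (r j) \<omega> ^ 4) \<partial>M) \<le> ennreal ?C"
      using S4(2) by (simp add: ennreal_leI)
  qed
  finally have le: "(\<integral>\<^sup>+\<omega>. ennreal (N \<omega> ^ 4) \<partial>M) \<le> ennreal ?C" by (simp add: Liminf_const)
  show i: "integrable M (\<lambda>\<omega>. N \<omega> ^ 4)"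
    using le by (intro integrableI_nonneg) (auto intro: le_less_trans)
  show "expectation (\<lambda>\<omega>. N \<omega> ^ 4) \<le> ?C"
  proof -
    have "ennreal (expectation (\<lambda>\<omega>. N \<omega> ^ 4)) \<le> ennreal ?C"
      using le nn_integral_eq_integral[OF i] by simp
    moreover have "0 \<le> ?C" using B(1) by (intro mult_nonneg_nonneg) simp_all
    ultimately show ?thesis by (rule ennreal_le_iff[THEN iffD1, rotated])
  qed
qed

end

section \<open>A monotonicity criterion, and calculus for the Lyapunov function\<close>

text \<open>A function whose increments over short intervals are at most \<open>\<eta>\<close> times the length of the interval,
  for every \<open>\<eta> > 0\<close>, does not increase. No continuity is needed.\<close>

lemma le_of_small_increments:
  fixes f :: "real \<Rightarrow> real"
  assumes ab: "a \<le> b"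
    and step: "\<And>\<eta>. \<eta> > 0 \<Longrightarrow> \<exists>\<delta>>0. \<forall>s t. a \<le> s \<longrightarrow> s < t \<longrightarrow> t \<le> b \<longrightarrow> t - s < \<delta> \<longrightarrow> f t \<le> f s + \<eta> * (t - s)"
  shows "f b \<le> f a"
proof (cases "a = b")
  case False
  then have ab': "a < b" using ab by simp
  have main: "f b \<le> f a + \<eta> * (b - a)" if \<eta>: "\<eta> > 0" for \<eta>
  proof -
    obtain \<delta> where \<delta>: "\<delta> > 0" "\<And>s t. a \<le> s \<Longrightarrow> s < t \<Longrightarrow> t \<le> b \<Longrightarrow> t - s < \<delta> \<Longrightarrow> f t \<le> f s + \<eta> * (t - s)"
      using step[OF \<eta>] by blast
    obtain n where n: "(b - a) / \<delta> < real n" using reals_Archimedean2 by blast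
    have n0: "0 < real n" using n \<delta>(1) ab' by (smt (verit) divide_pos_pos)
    define h where "h = (b - a) / real n"
    have h: "0 < h" "h < \<delta>" "real n * h = b - a"
      using n n0 \<delta>(1) ab' by (auto simp: h_def field_simps)
    have "j \<le> n \<Longrightarrow> f (a + real j * h) \<le> f a + \<eta> * (real j * h)" for j
    proof (induction j)
      case (Suc j)
      have "real (Suc j) * h \<le> real n * h" using Suc.prems h(1) by (intro mult_right_mono) auto
      then have "a + real (Suc j) * h \<le> b" using h(3) by simp
      then have "f (a + real (Suc j) * h) \<le> f (a + real j * h) + \<eta> * (a + real (Suc j) * h - (a + real j * h))"
        using h(1,2) by (intro \<delta>(2)) (auto simp: algebra_simps)
      then show ?case using Suc by (simp add: algebra_simps)
    qed simp
    from this[of n] show ?thesis using h(3) by simp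
  qed
  show ?thesis
  proof (rule field_le_epsilon)
    fix e :: real assume "e > 0"
    then show "f b \<le> f a + e" using main[of "e / (b - a)"] ab' by simp
  qed
qed simp

lemma le_of_three_halves_increments:
  fixes f :: "real \<Rightarrow> real"
  assumes ab: "a \<le> b" and step: "\<And>s t. a \<le> s \<Longrightarrow> s < t \<Longrightarrow> t \<le> b \<Longrightarrow> f t \<le> f s + C * (t - s) * sqrt (t - s)"
  shows "f b \<le> f a"
proof (rule le_of_small_increments[OF ab])
  fix \<eta> :: real assume \<eta>: "\<eta> > 0"
  let ?\<delta> = "(\<eta> / (\<bar>C\<bar> + 1))\<^sup>2"
  show "\<exists>\<delta>>0. \<forall>s t. a \<le> s \<longrightarrow> s < t \<longrightarrow> t \<le> b \<longrightarrow> t - s < \<delta> \<longrightarrow> f t \<le> f s + \<eta> * (t - s)"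
  proof (intro exI[of _ ?\<delta>] conjI allI impI)
    show "?\<delta> > 0" using \<eta> by (auto simp: add_nonneg_eq_0_iff)
    fix s t assume st: "a \<le> s" "s < t" "t \<le> b" "t - s < ?\<delta>"
    have "sqrt (t - s) \<le> sqrt ?\<delta>" using st(4) by (intro real_sqrt_le_mono) simp
    also have "\<dots> = \<eta> / (\<bar>C\<bar> + 1)" using \<eta> by simp
    finally have "(\<bar>C\<bar> + 1) * sqrt (t - s) \<le> \<eta>" by (simp add: field_simps)
    moreover have "C * sqrt (t - s) \<le> (\<bar>C\<bar> + 1) * sqrt (t - s)" using st(2) by (intro mult_right_mono) auto
    ultimately have "C * sqrt (t - s) \<le> \<eta>" by linarith
    then have "C * sqrt (t - s) * (t - s) \<le> \<eta> * (t - s)" using st(2) by (intro mult_right_mono) auto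
    then show "f t \<le> f s + \<eta> * (t - s)" using step[OF st(1-3)] by (simp add: mult_ac)
  qed
qed

text \<open>The decisive inequality, in the variables \<open>p = r - x\<close> and \<open>q = r + x\<close>. The left-hand side is what
  the generator of \<open>\<zeta>\<close>, together with the growth \<open>dr/dt = \<sigma>2 / r\<close> of the radius, makes of
  \<open>p\<^sup>3 / Q\<^sup>2\<close>; note that \<open>1 - z\<^sup>2 = p q / r\<^sup>2\<close> for \<open>z = x / r\<close>. It can only be positive
  for small \<open>p\<close>, and is then of order \<open>r\<^bsup>-3\<^esup>\<close>, which the derivative of \<open>K / r\<close> compensates.\<close>

lemma lyapunov_pq:
  fixes p q r k \<sigma>2 :: real
  assumes k: "0 < k" "0 < \<sigma>2" and pq: "0 \<le> p" "0 \<le> q" "p + q = 2 * r"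
    and r: "1 \<le> r" "18 * \<sigma>2 / k \<le> r"
  defines "Q \<equiv> q + 3 * \<sigma>2 / k" and "P \<equiv> 9 * \<sigma>2 / k"
  shows "(3 * p\<^sup>2 / Q\<^sup>2 - 2 * p ^ 3 / Q ^ 3) * (\<sigma>2 / r) + k * (p * q / r\<^sup>2) * (- 3 * p\<^sup>2 / Q\<^sup>2 - 2 * p ^ 3 / Q ^ 3)
    + 1 / 2 * (\<sigma>2 * (p * q / r\<^sup>2)) * (6 * p / Q\<^sup>2 + 12 * p\<^sup>2 / Q ^ 3 + 6 * p ^ 3 / Q ^ 4)
    \<le> P\<^sup>2 * \<sigma>2 * (9 + 6 * P) / r ^ 3" (is "?L \<le> _")
proof -
  have C: "0 < 3 * \<sigma>2 / k" using k by simp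
  then have Q: "0 < Q" "q \<le> Q" "3 * \<sigma>2 / k \<le> Q" using pq by (auto simp: Q_def)
  have r0: "0 < r" using r by simp
  have P: "0 < P" using k by (simp add: P_def)
  \<comment> \<open>The left-hand side is \<open>p\<^sup>2 / (r\<^sup>2 Q\<^sup>2)\<close> times \<open>E\<close>.\<close>
  define E where "E = \<sigma>2 * (3 * r - 2 * r * p / Q + 3 * q + 6 * p * q / Q + 3 * p\<^sup>2 * q / Q\<^sup>2) - k * q * (3 * p + 2 * p\<^sup>2 / Q)"
  have L: "?L = p\<^sup>2 * E / (r\<^sup>2 * Q\<^sup>2)"
  proof -
    have 1: "(3 * p\<^sup>2 / Q\<^sup>2 - 2 * p ^ 3 / Q ^ 3) * (\<sigma>2 / r) = p\<^sup>2 * (\<sigma>2 * (3 * r - 2 * r * p / Q)) / (r\<^sup>2 * Q\<^sup>2)"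
      using Q(1) r0 by (simp add: field_simps eval_nat_numeral)
    have 2: "k * (p * q / r\<^sup>2) * (- 3 * p\<^sup>2 / Q\<^sup>2 - 2 * p ^ 3 / Q ^ 3) = p\<^sup>2 * (- (k * q * (3 * p + 2 * p\<^sup>2 / Q))) / (r\<^sup>2 * Q\<^sup>2)"
      using Q(1) r0 by (simp add: field_simps eval_nat_numeral)
    have 3: "1 / 2 * (\<sigma>2 * (p * q / r\<^sup>2)) * (6 * p / Q\<^sup>2 + 12 * p\<^sup>2 / Q ^ 3 + 6 * p ^ 3 / Q ^ 4)
      = p\<^sup>2 * (\<sigma>2 * (3 * q + 6 * p * q / Q + 3 * p\<^sup>2 * q / Q\<^sup>2)) / (r\<^sup>2 * Q\<^sup>2)"
      using Q(1) r0 by (simp add: field_simps eval_nat_numeral)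
    show ?thesis unfolding 1 2 3 E_def by (simp add: add_divide_distrib[symmetric] algebra_simps)
  qed
  have rhs: "0 \<le> P\<^sup>2 * \<sigma>2 * (9 + 6 * P) / r ^ 3" using P k r0 by simp
  have E1: "E \<le> \<sigma>2 * (3 * r - 2 * r * p / Q + 3 * q + 6 * p) - k * q * (3 * p + p\<^sup>2 / Q)"
  proof -
    have "6 * p * (q / Q) \<le> 6 * p * 1" using Q pq by (intro mult_left_mono) auto
    then have a: "\<sigma>2 * (6 * p * q / Q) \<le> \<sigma>2 * (6 * p)" using k by (intro mult_left_mono) auto
    \<comment> \<open>By the choice of \<open>C\<close>, half of the second drift term beats the highest-order noise term.\<close>
    have "3 * \<sigma>2 \<le> k * Q" using Q(3) k by (simp add: field_simps)
    then have "3 * \<sigma>2 * (p\<^sup>2 * q / Q\<^sup>2) \<le> k * Q * (p\<^sup>2 * q / Q\<^sup>2)" using pq by (intro mult_right_mono) auto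
    also have "\<dots> = k * q * (p\<^sup>2 / Q)" using Q(1) by (simp add: power2_eq_square)
    finally show ?thesis using a unfolding E_def by (simp add: algebra_simps)
  qed
  show ?thesis
  proof (cases "r \<le> q")
    case True
    \<comment> \<open>In the half space of the pole, where \<open>Q \<ge> r\<close>: the drift term \<open>3 k r p\<close> dominates once \<open>p \<ge> P\<close>.\<close>
    have q2: "q \<le> 2 * r" using pq by simp
    have "0 \<le> 2 * r * p / Q" "0 \<le> k * q * (p\<^sup>2 / Q)" using Q pq r0 k by auto
    moreover have "k * r * (3 * p) \<le> k * q * (3 * p)" using True k pq by (intro mult_right_mono mult_left_mono) auto
    ultimately have E2: "E \<le> \<sigma>2 * (9 * r + 6 * p) - 3 * (k * r * p)"
    proof -
      have "\<sigma>2 * (3 * r - 2 * r * p / Q + 3 * q + 6 * p) \<le> \<sigma>2 * (9 * r + 6 * p)"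
        using \<open>0 \<le> 2 * r * p / Q\<close> q2 k by (intro mult_left_mono) auto
      then show ?thesis using E1 \<open>0 \<le> k * q * (p\<^sup>2 / Q)\<close> \<open>k * r * (3 * p) \<le> k * q * (3 * p)\<close> by (simp add: algebra_simps)
    qed
    show ?thesis
    proof (cases "P \<le> p")
      case True
      have "9 * \<sigma>2 \<le> k * p" using True k by (simp add: P_def field_simps)
      then have "9 * \<sigma>2 * r \<le> k * p * r" using r0 by (intro mult_right_mono) auto
      moreover have "6 * \<sigma>2 \<le> k * r" using r(2) k by (simp add: field_simps)
      then have "6 * \<sigma>2 * p \<le> k * r * p" using pq by (intro mult_right_mono) auto
      moreover have "0 \<le> k * r * p" using k r0 pq by simp
      ultimately have "E \<le> 0" using E2 by (simp add: algebra_simps)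
      then have "?L \<le> 0" unfolding L by (intro divide_nonpos_nonneg mult_nonneg_nonpos) auto
      then show ?thesis using rhs by linarith
    next
      case False
      have "0 \<le> k * r * p" using k r0 pq by simp
      then have "E \<le> \<sigma>2 * (9 * r + 6 * p)" using E2 by simp
      also have "\<dots> \<le> \<sigma>2 * (9 * r + 6 * P)" using False k by (intro mult_left_mono) auto
      also have "\<dots> \<le> \<sigma>2 * (9 * r + 6 * P * r)" using r P k by (intro mult_left_mono) auto
      finally have E3: "E \<le> \<sigma>2 * (9 + 6 * P) * r" by (simp add: algebra_simps)
      have "p\<^sup>2 * E \<le> P\<^sup>2 * (\<sigma>2 * (9 + 6 * P) * r)"
      proof (cases "E \<le> 0")
        case True
        then have "p\<^sup>2 * E \<le> 0" by (intro mult_nonneg_nonpos) auto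
        also have "\<dots> \<le> P\<^sup>2 * (\<sigma>2 * (9 + 6 * P) * r)" using P k r0 by simp
        finally show ?thesis .
      next
        case False
        then show ?thesis using E3 \<open>\<not> P \<le> p\<close> pq by (intro mult_mono power_mono) auto
      qed
      then have "?L \<le> P\<^sup>2 * (\<sigma>2 * (9 + 6 * P) * r) / (r\<^sup>2 * Q\<^sup>2)"
        unfolding L by (intro divide_right_mono) auto
      also have "\<dots> \<le> P\<^sup>2 * (\<sigma>2 * (9 + 6 * P) * r) / (r\<^sup>2 * r\<^sup>2)"
        using P k r0 Q \<open>r \<le> q\<close> by (intro divide_left_mono mult_left_mono power_mono mult_pos_pos) auto
      also have "\<dots> = P\<^sup>2 * \<sigma>2 * (9 + 6 * P) / r ^ 3" using r0 by (simp add: field_simps power2_eq_square power3_eq_cube)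
      finally show ?thesis .
    qed
  next
    case False
    \<comment> \<open>In the opposite half space: the growth of the radius and the drift win together, the former where \<open>q\<close> is small.\<close>
    then have qp: "q \<le> r" "r \<le> p" "q \<le> p" using pq by auto
    have E2: "E \<le> \<sigma>2 * (12 * p - 2 * r * p / Q) - k * q * (p\<^sup>2 / Q)"
    proof -
      have "\<sigma>2 * (3 * r - 2 * r * p / Q + 3 * q + 6 * p) \<le> \<sigma>2 * (12 * p - 2 * r * p / Q)"
        using qp k by (intro mult_left_mono) auto
      moreover have "0 \<le> k * q * (3 * p)" using k pq by simp
      ultimately show ?thesis using E1 by (simp add: algebra_simps)
    qed
    have "k * q * (r * p / Q) \<le> k * q * (p\<^sup>2 / Q)"
      using qp pq k Q by (intro mult_left_mono divide_right_mono) (auto simp: power2_eq_square intro: mult_right_mono)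
    then have "\<sigma>2 * (12 * p - 2 * r * p / Q) - k * q * (p\<^sup>2 / Q) \<le> \<sigma>2 * (12 * p - 2 * r * p / Q) - k * q * (r * p / Q)"
      by (rule diff_left_mono)
    also have "\<dots> = p * (12 * \<sigma>2 - r * (2 * \<sigma>2 + k * q) / Q)"
      using Q(1) by (simp add: field_simps)
    finally have "E \<le> p * (12 * \<sigma>2 - r * (2 * \<sigma>2 + k * q) / Q)" using E2 by (rule order_trans[rotated])
    moreover have "12 * \<sigma>2 \<le> r * (2 * \<sigma>2 + k * q) / Q"
    proof -
      have "2 * k / 3 * Q \<le> 2 * \<sigma>2 + k * q" using k pq by (simp add: Q_def field_simps)
      then have "r * (2 * k / 3 * Q) \<le> r * (2 * \<sigma>2 + k * q)" using r0 by (intro mult_left_mono) auto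
      moreover
      have "12 * \<sigma>2 \<le> r * (2 * k / 3)" using r(2) k by (simp add: field_simps)
      then have "12 * \<sigma>2 * Q \<le> r * (2 * k / 3) * Q" using Q by (intro mult_right_mono) auto
      then have "12 * \<sigma>2 * Q \<le> r * (2 * k / 3 * Q)" by (simp only: mult.assoc)
      ultimately have "12 * \<sigma>2 * Q \<le> r * (2 * \<sigma>2 + k * q)" by (rule order_trans[rotated])
      then show ?thesis using Q(1) by (simp add: field_simps)
    qed
    ultimately have "E \<le> 0" using pq by (smt (verit) mult_nonneg_nonpos)
    then have "?L \<le> 0" unfolding L by (intro divide_nonpos_nonneg mult_nonneg_nonpos) auto
    then show ?thesis using rhs by linarith
  qed
qed

text \<open>The main part of the Lyapunov function, at radius \<open>r\<close> and position \<open>x\<close>. It vanishes at the pole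
  \<open>x = r\<close> and is at least of order \<open>r\<close> away from it; the constant \<open>C > 0\<close> removes the singularity at \<open>x = -r\<close>.\<close>

definition lyap :: "real \<Rightarrow> real \<Rightarrow> real \<Rightarrow> real" where
  "lyap C r x = (r - x) ^ 3 / (r + x + C)\<^sup>2"

text \<open>The partial derivatives of \<open>lyap\<close>.\<close>

definition lyap_r :: "real \<Rightarrow> real \<Rightarrow> real \<Rightarrow> real" where
  "lyap_r C r x = 3 * (r - x)\<^sup>2 / (r + x + C)\<^sup>2 - 2 * (r - x) ^ 3 / (r + x + C) ^ 3"
definition lyap_x :: "real \<Rightarrow> real \<Rightarrow> real \<Rightarrow> real" where
  "lyap_x C r x = - 3 * (r - x)\<^sup>2 / (r + x + C)\<^sup>2 - 2 * (r - x) ^ 3 / (r + x + C) ^ 3"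
definition lyap_xx :: "real \<Rightarrow> real \<Rightarrow> real \<Rightarrow> real" where
  "lyap_xx C r x = 6 * (r - x) / (r + x + C)\<^sup>2 + 12 * (r - x)\<^sup>2 / (r + x + C) ^ 3 + 6 * (r - x) ^ 3 / (r + x + C) ^ 4"
definition lyap_xxx :: "real \<Rightarrow> real \<Rightarrow> real \<Rightarrow> real" where
  "lyap_xxx C r x = - (6 / (r + x + C)\<^sup>2 + 36 * (r - x) / (r + x + C) ^ 3 + 54 * (r - x)\<^sup>2 / (r + x + C) ^ 4
     + 24 * (r - x) ^ 3 / (r + x + C) ^ 5)"

lemma lyap_derivs:
  assumes "r + x + C \<noteq> 0"
  shows "((\<lambda>r. lyap C r x) has_real_derivative lyap_r C r x) (at r)"
    and "((\<lambda>x. lyap C r x) has_real_derivative lyap_x C r x) (at x)"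
    and "((\<lambda>x. lyap_x C r x) has_real_derivative lyap_xx C r x) (at x)"
    and "((\<lambda>x. lyap_xx C r x) has_real_derivative lyap_xxx C r x) (at x)"
proof -
  define q where "q = r + x + C"
  define p where "p = r - x"
  have q: "q \<noteq> 0" using assms by (simp add: q_def)
  show "((\<lambda>r. lyap C r x) has_real_derivative lyap_r C r x) (at r)"
    unfolding lyap_def lyap_r_def
    apply (rule derivative_eq_intros refl power_not_zero assms)+
    unfolding q_def[symmetric] p_def[symmetric] using q
    by (simp add: field_simps eval_nat_numeral)
  show "((\<lambda>x. lyap C r x) has_real_derivative lyap_x C r x) (at x)"
    unfolding lyap_def lyap_x_def
    apply (rule derivative_eq_intros refl power_not_zero assms)+
    unfolding q_def[symmetric] p_def[symmetric] using q
    by (simp add: field_simps eval_nat_numeral)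
  show "((\<lambda>x. lyap_x C r x) has_real_derivative lyap_xx C r x) (at x)"
    unfolding lyap_x_def lyap_xx_def
    apply (rule derivative_eq_intros refl power_not_zero assms)+
    unfolding q_def[symmetric] p_def[symmetric] using q
    by (simp add: field_simps eval_nat_numeral)
  show "((\<lambda>x. lyap_xx C r x) has_real_derivative lyap_xxx C r x) (at x)"
    unfolding lyap_xx_def lyap_xxx_def
    apply (rule derivative_eq_intros refl power_not_zero assms)+
    unfolding q_def[symmetric] p_def[symmetric] using q
    by (simp add: field_simps eval_nat_numeral)
qed

text \<open>Taylor's formula with a third-order remainder, the constant being generous.\<close>

lemma second_order_taylor_le:
  fixes f f' f'' f''' :: "real \<Rightarrow> real"
  assumes d: "\<And>x. a \<le> x \<Longrightarrow> x \<le> b \<Longrightarrow> (f has_real_derivative f' x) (at x)"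
    "\<And>x. a \<le> x \<Longrightarrow> x \<le> b \<Longrightarrow> (f' has_real_derivative f'' x) (at x)"
    "\<And>x. a \<le> x \<Longrightarrow> x \<le> b \<Longrightarrow> (f'' has_real_derivative f''' x) (at x)"
    and L: "\<And>x. a \<le> x \<Longrightarrow> x \<le> b \<Longrightarrow> \<bar>f''' x\<bar> \<le> L"
    and xy: "a \<le> x" "x \<le> b" "a \<le> y" "y \<le> b"
  shows "f y \<le> f x + f' x * (y - x) + 1 / 2 * f'' x * (y - x)\<^sup>2 + L * \<bar>y - x\<bar> ^ 3"
proof (cases "x = y")
  case False
  define D where "D n = (if n = 0 then f else if n = 1 then f' else if n = 2 then f'' else f''')" for n :: nat
  have "\<exists>t. (if y < x then y < t \<and> t < x else x < t \<and> t < y) \<and>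
      f y = (\<Sum>m<3. (D m x / fact m) * (y - x) ^ m) + (D 3 t / fact 3) * (y - x) ^ 3"
  proof (rule Taylor[where a = a and b = b])
    show "\<forall>m t. m < 3 \<and> a \<le> t \<and> t \<le> b \<longrightarrow> DERIV (D m) t :> D (Suc m) t"
      using d by (auto simp: D_def numeral_eq_Suc less_Suc_eq)
  qed (use xy False in \<open>auto simp: D_def\<close>)
  then obtain t where t': "if y < x then y < t \<and> t < x else x < t \<and> t < y"
    and e: "f y = (\<Sum>m<3. (D m x / fact m) * (y - x) ^ m) + (D 3 t / fact 3) * (y - x) ^ 3"
    by blast
  have t: "a \<le> t" "t \<le> b" using t' xy by (auto split: if_splits)
  have "f y = f x + f' x * (y - x) + 1 / 2 * f'' x * (y - x)\<^sup>2 + f''' t / 6 * (y - x) ^ 3"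
    using e by (simp add: D_def eval_nat_numeral)
  moreover have "f''' t / 6 * (y - x) ^ 3 \<le> L * \<bar>y - x\<bar> ^ 3"
  proof -
    have "f''' t / 6 * (y - x) ^ 3 \<le> \<bar>f''' t / 6 * (y - x) ^ 3\<bar>" by (rule abs_ge_self)
    also have "\<dots> = \<bar>f''' t\<bar> / 6 * \<bar>y - x\<bar> ^ 3" by (simp add: abs_mult power_abs)
    also have "\<dots> \<le> L * \<bar>y - x\<bar> ^ 3" using L[OF t] by (intro mult_right_mono) auto
    finally show ?thesis .
  qed
  ultimately show ?thesis by linarith
qed simp

lemma lyap_third_bound:
  assumes "0 < C" "\<bar>x\<bar> \<le> r" "r \<le> \<rho>"
  shows "\<bar>lyap_xxx C r x\<bar> \<le> 6 / C\<^sup>2 + 36 * (2 * \<rho>) / C ^ 3 + 54 * (2 * \<rho>)\<^sup>2 / C ^ 4 + 24 * (2 * \<rho>) ^ 3 / C ^ 5"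
proof -
  define p where "p = r - x"
  define q where "q = r + x + C"
  have p: "0 \<le> p" "p \<le> 2 * \<rho>" and q: "0 < q" "C \<le> q" using assms by (auto simp: p_def q_def)
  have "6 / q\<^sup>2 + 36 * p / q ^ 3 + 54 * p\<^sup>2 / q ^ 4 + 24 * p ^ 3 / q ^ 5
    \<le> 6 / C\<^sup>2 + 36 * (2 * \<rho>) / C ^ 3 + 54 * (2 * \<rho>)\<^sup>2 / C ^ 4 + 24 * (2 * \<rho>) ^ 3 / C ^ 5"
    using p q assms(1) by (intro add_mono frac_le power_mono mult_left_mono) auto
  moreover have "0 \<le> 6 / q\<^sup>2 + 36 * p / q ^ 3 + 54 * p\<^sup>2 / q ^ 4 + 24 * p ^ 3 / q ^ 5"
    using p q by simp
  ultimately show ?thesis unfolding lyap_xxx_def p_def q_def by linarith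
qed

lemma closure_Rats_atLeast: "closure (\<rat> \<inter> {a..}) = {a :: real..}"
proof (rule antisym)
  show "closure (\<rat> \<inter> {a..}) \<subseteq> {a..}" by (rule closure_minimal) auto
  show "{a..} \<subseteq> closure (\<rat> \<inter> {a..})"
  proof
    fix x assume x: "x \<in> {a..}"
    show "x \<in> closure (\<rat> \<inter> {a..})"
      unfolding closure_approachable
    proof (intro allI impI)
      fix e :: real assume "e > 0"
      then obtain q where "q \<in> \<rat>" "x < q" "q < x + e" using Rats_dense_in_real[of x "x + e"] by auto
      then show "\<exists>y\<in>\<rat> \<inter> {a..}. dist y x < e" using x by (intro bexI[of _ q]) (auto simp: dist_real_def)
    qed
  qed
qed

section \<open>The coefficients of the equation\<close>

lemma norm_cross3_le: "norm (cross3 x y) \<le> norm x * norm y"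
proof (rule power2_le_imp_le)
  show "(norm (cross3 x y))\<^sup>2 \<le> (norm x * norm y)\<^sup>2"
    using norm_cross_dot[of x y] zero_le_power2[of "x \<bullet> y"] by linarith
qed simp

lemma cross_matrix_component: "cross_matrix m $ i \<bullet> v = cross3 m v $ i"
proof -
  have "cross_matrix m $ i \<bullet> v = (cross_matrix m *v v) $ i"
    by (simp only: matrix_vector_mult_def inner_vec_sum vec_lambda_beta)
  then show ?thesis by simp
qed

lemma cross_matrix_square_component:
  "(cross_matrix m ** cross_matrix m) $ i \<bullet> v = cross3 m (cross3 m v) $ i"
proof -
  have "(cross_matrix m ** cross_matrix m) $ i \<bullet> v = ((cross_matrix m ** cross_matrix m) *v v) $ i"
    by (simp only: matrix_vector_mult_def inner_vec_sum vec_lambda_beta)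
  then show ?thesis by (simp add: matrix_vector_mul_assoc[symmetric])
qed

text \<open>This bounds a row \<open>r\<close> of a matrix through the value of the matrix at \<open>r\<close>.\<close>

lemma norm_le_of_inner_self_le:
  fixes r :: "'b :: real_inner"
  assumes "r \<bullet> r \<le> norm r" shows "norm r \<le> 1"
proof (cases "r = 0")
  case False
  have "norm r * norm r \<le> norm r * 1" using assms by (simp add: dot_square_norm power2_eq_square)
  then show ?thesis using False by (simp add: mult_le_cancel_left)
qed simp

lemma norm_cross_matrix_row_le:
  assumes "norm m \<le> 1"
  shows "norm (cross_matrix m $ i) \<le> 1" "norm ((cross_matrix m ** cross_matrix m) $ i) \<le> 1"
proof -
  have c: "norm (cross3 m v) \<le> norm v" for v
    using norm_cross3_le[of m v] mult_right_mono[OF assms norm_ge_zero[of v]] by simp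
  let ?r = "cross_matrix m $ i" and ?q = "(cross_matrix m ** cross_matrix m) $ i"
  have "?r \<bullet> ?r \<le> norm ?r"
    unfolding cross_matrix_component using component_le_norm_cart[of "cross3 m ?r" i] c[of ?r] by linarith
  then show "norm ?r \<le> 1" by (rule norm_le_of_inner_self_le)
  have "?q \<bullet> ?q \<le> norm ?q"
    unfolding cross_matrix_square_component
    using component_le_norm_cart[of "cross3 m (cross3 m ?q)" i] c[of ?q] c[of "cross3 m ?q"] by linarith
  then show "norm ?q \<le> 1" by (rule norm_le_of_inner_self_le)
qed

text \<open>With \<open>L\<close> the cross product matrix, the noise in \<open>dY\<close> is \<open>- \<epsilon> (L(m) + \<alpha> L(m)\<^sup>2) dW\<close>, so that its component
  along \<open>v\<close> is \<open>- \<epsilon>\<close> times the inner product of \<open>dW\<close> with the vector below, the transposed matrix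
  applied to \<open>v\<close>. Its squared norm, times \<open>\<epsilon>\<^sup>2\<close>, is the rate of quadratic variation in the direction \<open>v\<close>.\<close>

definition spin_noise :: "real \<Rightarrow> real^3 \<Rightarrow> real^3 \<Rightarrow> real^3" where
  "spin_noise \<alpha> m v = \<alpha> *\<^sub>R cross3 m (cross3 m v) - cross3 m v"

lemma spin_noise_rows:
  "(\<Sum>i\<in>UNIV. v $ i *\<^sub>R cross_matrix m $ i + (\<alpha> * v $ i) *\<^sub>R (cross_matrix m ** cross_matrix m) $ i) = spin_noise \<alpha> m v"
  (is "?l = _")
proof (rule vector_eq_rdot[THEN iffD1], rule allI)
  fix w
  have "?l \<bullet> w = (\<Sum>i\<in>UNIV. v $ i * cross3 m w $ i) + \<alpha> * (\<Sum>i\<in>UNIV. v $ i * cross3 m (cross3 m w) $ i)"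
    by (simp add: inner_sum_left inner_add_left cross_matrix_component cross_matrix_square_component
        sum.distrib sum_distrib_left mult.assoc)
  also have "\<dots> = v \<bullet> cross3 m w + \<alpha> * (v \<bullet> cross3 m (cross3 m w))" by (simp add: inner_vec_sum)
  also have "\<dots> = spin_noise \<alpha> m v \<bullet> w"
    by (simp add: spin_noise_def cross3_simps)
  finally show "?l \<bullet> w = spin_noise \<alpha> m v \<bullet> w" .
qed

lemma norm_spin_noise:
  assumes "norm m = 1"
  shows "(norm (spin_noise \<alpha> m v))\<^sup>2 = (1 + \<alpha>\<^sup>2) * ((norm v)\<^sup>2 - (m \<bullet> v)\<^sup>2)"
proof -
  have o: "cross3 m (cross3 m v) \<bullet> cross3 m v = 0" by (rule dot_cross_self)
  have c: "(norm (cross3 m v))\<^sup>2 = (norm v)\<^sup>2 - (m \<bullet> v)\<^sup>2" using norm_cross[of m v] assms by simp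
  have cc: "(norm (cross3 m (cross3 m v)))\<^sup>2 = (norm (cross3 m v))\<^sup>2"
    using norm_cross[of m "cross3 m v"] assms by (simp add: dot_cross_self)
  have "(norm (spin_noise \<alpha> m v))\<^sup>2 = \<alpha>\<^sup>2 * (norm (cross3 m (cross3 m v)))\<^sup>2 + (norm (cross3 m v))\<^sup>2"
    using o unfolding spin_noise_def power2_norm_eq_inner
    by (simp add: inner_diff_left inner_diff_right inner_commute power2_eq_square)
  then show ?thesis unfolding cc c by (simp add: algebra_simps)
qed

text \<open>The noise is orthogonal to \<open>m\<close>: only the part of \<open>v\<close> that is orthogonal to \<open>m\<close> matters.\<close>

lemma norm_spin_noise_le:
  assumes "norm m \<le> 1" "0 \<le> \<alpha>"
  shows "norm (spin_noise \<alpha> m v) \<le> (1 + \<alpha>) * norm (cross3 m v)"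
proof -
  have "norm (cross3 m (cross3 m v)) \<le> norm (cross3 m v)"
    using norm_cross3_le[of m "cross3 m v"] mult_right_mono[OF assms(1) norm_ge_zero[of "cross3 m v"]] by simp
  then have "\<alpha> * norm (cross3 m (cross3 m v)) \<le> \<alpha> * norm (cross3 m v)" using assms by (intro mult_left_mono) auto
  then show ?thesis
    using norm_triangle_ineq4[of "\<alpha> *\<^sub>R cross3 m (cross3 m v)" "cross3 m v"] assms(2)
    by (simp add: spin_noise_def algebra_simps)
qed

text \<open>The trace of the quadratic variation rate does not depend on the direction \<open>m\<close>.\<close>

lemma sum_norm_spin_noise_axis:
  assumes "norm m = 1"
  shows "(\<Sum>i\<in>UNIV. (norm (spin_noise \<alpha> m (axis i 1)))\<^sup>2) = 2 * (1 + \<alpha>\<^sup>2)"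
proof -
  have "(\<Sum>i\<in>UNIV. (m $ i)\<^sup>2) = 1"
    using assms by (simp add: norm_eq_1 inner_vec_sum power2_eq_square)
  then show ?thesis
    unfolding norm_spin_noise[OF assms] sum_distrib_left[symmetric] sum_subtractf by (simp add: inner_axis)
qed

text \<open>The drift of \<open>Y\<close> when the direction is \<open>m\<close>.\<close>

definition spin_drift :: "real^3 \<Rightarrow> real \<Rightarrow> real^3 \<Rightarrow> real^3" where
  "spin_drift b \<alpha> m = - cross3 m b - \<alpha> *\<^sub>R cross3 m (cross3 m b)"

lemma norm_spin_drift_le:
  assumes "norm m \<le> 1" "0 \<le> \<alpha>"
  shows "norm (spin_drift b \<alpha> m) \<le> (1 + \<alpha>) * norm b"
proof -
  have c: "norm (cross3 m v) \<le> norm v" for v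
    using norm_cross3_le[of m v] mult_right_mono[OF assms(1) norm_ge_zero[of v]] by simp
  have "norm (cross3 m (cross3 m b)) \<le> norm b" using c[of "cross3 m b"] c[of b] by linarith
  then have "\<alpha> * norm (cross3 m (cross3 m b)) \<le> \<alpha> * norm b" using assms by (intro mult_left_mono) auto
  then show ?thesis
    using norm_triangle_ineq4[of "- cross3 m b" "\<alpha> *\<^sub>R cross3 m (cross3 m b)"] c[of b] assms(2)
    by (simp add: spin_drift_def algebra_simps)
qed

lemma abs_spin_drift_inner_le:
  assumes "norm m \<le> 1" "0 \<le> \<alpha>"
  shows "\<bar>spin_drift b \<alpha> m \<bullet> v\<bar> \<le> (1 + \<alpha>) * norm b * norm (cross3 m v)"
proof -
  have c: "norm (cross3 m v) \<le> norm v" for v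
    using norm_cross3_le[of m v] mult_right_mono[OF assms(1) norm_ge_zero[of v]] by simp
  have skew: "cross3 m w \<bullet> v = - (w \<bullet> cross3 m v)" for w by (simp add: cross3_simps)
  have "spin_drift b \<alpha> m \<bullet> v = (b + \<alpha> *\<^sub>R cross3 m b) \<bullet> cross3 m v"
    unfolding spin_drift_def by (simp add: inner_diff_left inner_add_left skew)
  then have "\<bar>spin_drift b \<alpha> m \<bullet> v\<bar> \<le> norm (b + \<alpha> *\<^sub>R cross3 m b) * norm (cross3 m v)"
    using Cauchy_Schwarz_ineq2 by simp
  also have "\<dots> \<le> ((1 + \<alpha>) * norm b) * norm (cross3 m v)"
  proof (rule mult_right_mono)
    have "\<alpha> * norm (cross3 m b) \<le> \<alpha> * norm b" using c assms by (intro mult_left_mono) auto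
    then show "norm (b + \<alpha> *\<^sub>R cross3 m b) \<le> (1 + \<alpha>) * norm b"
      using norm_triangle_ineq[of b "\<alpha> *\<^sub>R cross3 m b"] assms(2) by (simp add: algebra_simps)
  qed simp
  finally show ?thesis .
qed

lemma spin_drift_inner_axis:
  assumes "norm m = 1" "b = norm b *\<^sub>R e" "norm e = 1"
  shows "spin_drift b \<alpha> m \<bullet> e = \<alpha> * norm b * (1 - (m \<bullet> e)\<^sup>2)"
proof -
  have "cross3 m e \<bullet> e = 0" by (rule dot_cross_self)
  moreover have "cross3 m (cross3 m e) \<bullet> e = (m \<bullet> e)\<^sup>2 - 1"
    using assms unfolding Lagrange by (simp add: inner_diff_left norm_eq_1 power2_eq_square)
  ultimately have "spin_drift e \<alpha> m \<bullet> e = \<alpha> * (1 - (m \<bullet> e)\<^sup>2)"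
    by (simp add: spin_drift_def inner_diff_left) (simp add: algebra_simps)
  moreover have "spin_drift b \<alpha> m = norm b *\<^sub>R spin_drift e \<alpha> m"
    by (subst assms(2)) (simp add: spin_drift_def cross_mult_right scaleR_diff_right)
  ultimately show ?thesis by (simp add: mult_ac)
qed

lemma continuous_on_spin_drift:
  fixes f :: "'b :: t2_space \<Rightarrow> real^3"
  shows "continuous_on S f \<Longrightarrow> continuous_on S (\<lambda>r. spin_drift b \<alpha> (f r))"
  unfolding spin_drift_def by (intro continuous_intros continuous_on_cross)

context brownian_motion begin

lemma AE_PT_fst:
  assumes "AE \<omega> in M. Q \<omega>"
  shows "AE p in PT s t. Q (fst p)"
proof -
  obtain N where N: "N \<in> null_sets M" "{\<omega>\<in>space M. \<not> Q \<omega>} \<subseteq> N" using assms by (auto elim!: AE_E simp: null_sets_def)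
  interpret L: sigma_finite_measure "restrict_space lborel {s<..t}" by (rule sigma_finite_restrict_lborel)
  let ?L = "restrict_space lborel {s<..t}"
  have "emeasure (PT s t) (N \<times> space ?L) = emeasure M N * emeasure ?L (space ?L)"
    using N by (intro L.emeasure_pair_measure_Times sets.top) auto
  moreover have "N \<times> space ?L \<in> sets (PT s t)" using N by (intro pair_measureI sets.top) auto
  ultimately have "N \<times> space ?L \<in> null_sets (PT s t)" using N by (auto simp: null_sets_def)
  moreover have "{p \<in> space (PT s t). \<not> Q (fst p)} \<subseteq> N \<times> space ?L"
    using N(2) by (auto simp: space_pair_measure)
  ultimately show ?thesis by (rule AE_I')
qed

lemma nn_integral_PT_le:
  assumes g: "g \<in> borel_measurable (PT s t)" and st: "s \<le> t" and c: "0 \<le> c"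
    and le: "\<And>r. s < r \<Longrightarrow> r \<le> t \<Longrightarrow> (\<integral>\<^sup>+\<omega>. g (\<omega>, r) \<partial>M) \<le> ennreal c"
  shows "(\<integral>\<^sup>+p. g p \<partial>PT s t) \<le> ennreal (c * (t - s))"
proof -
  interpret P: pair_sigma_finite M "restrict_space lborel {s<..t}" by (rule pair_sigma_finite_PT)
  have "(\<integral>\<^sup>+p. g p \<partial>PT s t) = (\<integral>\<^sup>+r. (\<integral>\<^sup>+\<omega>. g (\<omega>, r) \<partial>M) \<partial>restrict_space lborel {s<..t})"
    using P.nn_integral_snd[OF g] by simp
  also have "\<dots> \<le> (\<integral>\<^sup>+r. ennreal c \<partial>restrict_space lborel {s<..t})"
    using le by (intro nn_integral_mono) (auto simp: space_restrict_space)
  also have "\<dots> = ennreal (c * (t - s))"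
    using st c by (simp add: emeasure_restrict_space space_restrict_space ennreal_mult)
  finally show ?thesis .
qed

text \<open>The isometry for linear combinations of integrals with coefficients that are known at time \<open>s\<close>.\<close>

lemma ito_increment_combination:
  assumes A: "finite A" and N: "\<And>a. a \<in> A \<Longrightarrow> ito_increment s t (h a) (N a)"
    and V: "\<And>a. a \<in> A \<Longrightarrow> V a \<in> borel_measurable (F s)" "\<And>a \<omega>. a \<in> A \<Longrightarrow> \<omega> \<in> space M \<Longrightarrow> \<bar>V a \<omega>\<bar> \<le> B"
    and \<psi>: "\<psi> \<in> borel_measurable (F s)" "\<And>\<omega>. \<omega> \<in> space M \<Longrightarrow> \<bar>\<psi> \<omega>\<bar> \<le> K"
  shows "expectation (\<lambda>\<omega>. \<psi> \<omega> * (\<Sum>a\<in>A. V a \<omega> * N a \<omega>)\<^sup>2)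
    = (\<integral>p. \<psi> (fst p) * (norm (\<Sum>a\<in>A. V a (fst p) *\<^sub>R h a (snd p) (fst p)))\<^sup>2 \<partial>PT s t)"
proof -
  let ?\<psi> = "\<lambda>a c \<omega>. \<psi> \<omega> * V a \<omega> * V c \<omega>"
  let ?h = "\<lambda>a p. h a (snd p) (fst p)"
  have \<psi>ac: "?\<psi> a c \<in> borel_measurable (F s)" "\<And>\<omega>. \<omega> \<in> space M \<Longrightarrow> \<bar>?\<psi> a c \<omega>\<bar> \<le> K * B * B" if "a \<in> A" "c \<in> A" for a c
  proof -
    show "?\<psi> a c \<in> borel_measurable (F s)" using V(1) that \<psi>(1) by simp
    fix \<omega> assume \<omega>: "\<omega> \<in> space M"
    have "0 \<le> K" "0 \<le> B" using \<psi>(2)[OF \<omega>] V(2)[OF that(1) \<omega>] by linarith+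
    then show "\<bar>?\<psi> a c \<omega>\<bar> \<le> K * B * B"
      unfolding abs_mult using \<psi>(2)[OF \<omega>] V(2)[OF that(1) \<omega>] V(2)[OF that(2) \<omega>] by (intro mult_mono) auto
  qed
  have Nsq: "square_integrable M (N a)" and hsq: "square_integrable (PT s t) (?h a)" if "a \<in> A" for a
    using N[OF that] by (auto simp: ito_increment_def)
  have i: "integrable M (\<lambda>\<omega>. ?\<psi> a c \<omega> * (N a \<omega> * N c \<omega>))" if "a \<in> A" "c \<in> A" for a c
    by (rule integrable_bdd_mult[OF square_integrable_mult[OF Nsq[OF that(1)] Nsq[OF that(2)]] measurable_F_imp[OF \<psi>ac(1)[OF that]] \<psi>ac(2)[OF that]])
  have j: "integrable (PT s t) (\<lambda>p. ?\<psi> a c (fst p) * (?h a p \<bullet> ?h c p))" if "a \<in> A" "c \<in> A" for a c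
    by (rule integrable_bdd_mult[OF square_integrable_inner[OF hsq[OF that(1)] hsq[OF that(2)]]
        measurable_compose[OF measurable_fst measurable_F_imp[OF \<psi>ac(1)[OF that]]] \<psi>ac(2)[OF that]])
      (simp add: space_PT)
  have "expectation (\<lambda>\<omega>. \<psi> \<omega> * (\<Sum>a\<in>A. V a \<omega> * N a \<omega>)\<^sup>2)
     = expectation (\<lambda>\<omega>. \<Sum>a\<in>A. \<Sum>c\<in>A. ?\<psi> a c \<omega> * (N a \<omega> * N c \<omega>))"
    unfolding power2_eq_square sum_product unfolding sum_distrib_left by (simp only: mult_ac)
  also have "\<dots> = (\<Sum>a\<in>A. \<Sum>c\<in>A. expectation (\<lambda>\<omega>. ?\<psi> a c \<omega> * (N a \<omega> * N c \<omega>)))"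
    by (subst Bochner_Integration.integral_sum)
      (auto intro!: Bochner_Integration.integrable_sum Bochner_Integration.integral_sum sum.cong i)
  also have "\<dots> = (\<Sum>a\<in>A. \<Sum>c\<in>A. (\<integral>p. ?\<psi> a c (fst p) * (?h a p \<bullet> ?h c p) \<partial>PT s t))"
    by (intro sum.cong refl ito_increment_isometry[OF N N \<psi>ac(1) \<psi>ac(2)])
  also have "\<dots> = (\<integral>p. (\<Sum>a\<in>A. \<Sum>c\<in>A. ?\<psi> a c (fst p) * (?h a p \<bullet> ?h c p)) \<partial>PT s t)"
    by (subst Bochner_Integration.integral_sum)
      (auto intro!: Bochner_Integration.integrable_sum Bochner_Integration.integral_sum[symmetric] sum.cong j)
  also have "(\<lambda>p. \<Sum>a\<in>A. \<Sum>c\<in>A. ?\<psi> a c (fst p) * (?h a p \<bullet> ?h c p))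
    = (\<lambda>p. \<psi> (fst p) * (norm (\<Sum>a\<in>A. V a (fst p) *\<^sub>R ?h a p))\<^sup>2)"
    unfolding power2_norm_eq_inner inner_sum_left inner_sum_right sum_distrib_left inner_scaleR_left inner_scaleR_right
    by (intro ext, subst sum.swap) (simp only: mult_ac inner_commute)
  finally show ?thesis .
qed

end

section \<open>The increments of the solution\<close>

lemma set_integral_split_Icc:
  fixes f :: "real \<Rightarrow> 'b :: euclidean_space"
  assumes "set_integrable lborel {0..t} f" "0 \<le> s" "s \<le> t"
  shows "(LINT r:{0..t}|lborel. f r) = (LINT r:{0..s}|lborel. f r) + (LINT r:{s<..t}|lborel. f r)"
proof -
  have "{0..t} = {0..s} \<union> {s<..t}" using assms by auto
  moreover have "(LINT r:{0..s} \<union> {s<..t}|lborel. f r) = (LINT r:{0..s}|lborel. f r) + (LINT r:{s<..t}|lborel. f r)"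
    using assms by (intro set_integral_Un set_integrable_subset[OF assms(1)]) auto
  ultimately show ?thesis by simp
qed

lemma power4_add_le: "(p + q) ^ 4 \<le> 8 * p ^ 4 + 8 * (q :: real) ^ 4"
proof -
  have s: "(x + y)\<^sup>2 \<le> 2 * x\<^sup>2 + 2 * y\<^sup>2" for x y :: real
    using sum_squares_bound[of x y] by (simp add: power2_sum)
  have "(p + q) ^ 4 = ((p + q)\<^sup>2)\<^sup>2" by simp
  also have "\<dots> \<le> (2 * p\<^sup>2 + 2 * q\<^sup>2)\<^sup>2" using s by (intro power_mono) auto
  also have "\<dots> \<le> 2 * (2 * p\<^sup>2)\<^sup>2 + 2 * (2 * q\<^sup>2)\<^sup>2" by (rule s)
  also have "\<dots> = 8 * p ^ 4 + 8 * q ^ 4" by (simp add: power_mult_distrib)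
  finally show ?thesis .
qed

text \<open>The direction \<open>\<mu>\<close> can be read off from its cross product matrix. In this way the joint
  measurability of \<open>\<mu>\<close> is inherited from that of the integrand.\<close>

lemma vec3_eq_cross_components:
  "(m :: real^3) = (cross3 m (axis 2 1) $ 3) *\<^sub>R axis 1 1 + (cross3 m (axis 3 1) $ 1) *\<^sub>R axis 2 1 + (cross3 m (axis 1 1) $ 2) *\<^sub>R axis 3 1"
  by (simp add: vec_eq_iff forall_3 cross_components axis_def)

text \<open>The setting of the theorem; the field \<open>b\<close> may still vanish.\<close>

locale spin_diffusion = brownian_motion M W
  for M :: "'a measure" and W :: "real \<Rightarrow> 'a \<Rightarrow> real^3" +
  fixes b y :: "real^3" and \<alpha> \<epsilon> :: real and Y \<mu> :: "real \<Rightarrow> 'a \<Rightarrow> real^3"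
  assumes \<alpha>_pos: "0 < \<alpha>" and \<epsilon>_pos: "0 < \<epsilon>" and norm_y: "norm y = 1"
    and solution: "strong_solution M W b \<alpha> \<epsilon> y Y \<mu>"
begin

lemma Y_measurable_F: "0 \<le> t \<Longrightarrow> Y t \<in> borel_measurable (F t)"
  using solution by (simp add: strong_solution_def adapted_def)

lemma Y_measurable: "0 \<le> t \<Longrightarrow> Y t \<in> borel_measurable M"
  using Y_measurable_F by (rule measurable_F_imp)

lemma \<mu>_eq: "\<omega> \<in> space M \<Longrightarrow> 0 \<le> t \<Longrightarrow> \<mu> t \<omega> = Y t \<omega> /\<^sub>R norm (Y t \<omega>)"
  using solution by (simp add: strong_solution_def)

lemma \<mu>_measurable_F: "0 \<le> t \<Longrightarrow> \<mu> t \<in> borel_measurable (F t)"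
proof -
  assume t: "0 \<le> t"
  have "(\<lambda>\<omega>. Y t \<omega> /\<^sub>R norm (Y t \<omega>)) \<in> borel_measurable (F t)" using Y_measurable_F[OF t] by simp
  then show ?thesis using \<mu>_eq t by (subst measurable_cong) auto
qed

lemma \<mu>_measurable: "0 \<le> t \<Longrightarrow> \<mu> t \<in> borel_measurable M"
  using \<mu>_measurable_F by (rule measurable_F_imp)

lemma norm_\<mu>_le: "\<omega> \<in> space M \<Longrightarrow> 0 \<le> t \<Longrightarrow> norm (\<mu> t \<omega>) \<le> 1"
  by (cases "Y t \<omega> = 0") (simp_all add: \<mu>_eq)

text \<open>The paths that never vanish and start at \<open>y\<close>.\<close>

definition good :: "'a \<Rightarrow> bool" where
  "good \<omega> \<longleftrightarrow> \<omega> \<in> space M \<and> (\<forall>t\<ge>0. Y t \<omega> \<noteq> 0) \<and> Y 0 \<omega> = y"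

lemma AE_good: "AE \<omega> in M. good \<omega>"
proof -
  have "AE \<omega> in M. \<forall>t\<ge>0. Y t \<omega> \<noteq> 0" "AE \<omega> in M. Y 0 \<omega> = y"
    using solution by (auto simp: strong_solution_def)
  then show ?thesis using AE_space by eventually_elim (auto simp: good_def)
qed

lemma continuous_on_Y: "\<omega> \<in> space M \<Longrightarrow> continuous_on {0..} (\<lambda>t. Y t \<omega>)"
  using solution by (simp add: strong_solution_def)

lemma good_\<mu>: 
  assumes "good \<omega>"
  shows "continuous_on {0..} (\<lambda>t. \<mu> t \<omega>)" "0 \<le> t \<Longrightarrow> norm (\<mu> t \<omega>) = 1"
    "0 \<le> t \<Longrightarrow> Y t \<omega> = norm (Y t \<omega>) *\<^sub>R \<mu> t \<omega>"
proof -
  have \<omega>: "\<omega> \<in> space M" and nz: "\<And>t. 0 \<le> t \<Longrightarrow> Y t \<omega> \<noteq> 0" using assms by (auto simp: good_def)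
  have "continuous_on {0..} (\<lambda>t. Y t \<omega> /\<^sub>R norm (Y t \<omega>))"
    using nz by (intro continuous_intros continuous_on_Y[OF \<omega>]) auto
  then show "continuous_on {0..} (\<lambda>t. \<mu> t \<omega>)"
    by (rule continuous_on_eq) (simp add: \<mu>_eq[OF \<omega>])
  show "0 \<le> t \<Longrightarrow> norm (\<mu> t \<omega>) = 1" "0 \<le> t \<Longrightarrow> Y t \<omega> = norm (Y t \<omega>) *\<^sub>R \<mu> t \<omega>"
    using nz[of t] by (auto simp: \<mu>_eq[OF \<omega>])
qed

lemma ito_integrals_exist:
  assumes "0 \<le> t"
  shows "\<exists>I J. (\<forall>i. ito_increment 0 t (\<lambda>s \<omega>. cross_matrix (\<mu> s \<omega>) $ i) (\<lambda>\<omega>. I \<omega> $ i)) \<and>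
    (\<forall>i. ito_increment 0 t (\<lambda>s \<omega>. (cross_matrix (\<mu> s \<omega>) ** cross_matrix (\<mu> s \<omega>)) $ i) (\<lambda>\<omega>. J \<omega> $ i)) \<and>
    (AE \<omega> in M. Y t \<omega> = y
           - ((LINT s:{0..t}|lborel. cross3 (\<mu> s \<omega>) b) + \<epsilon> *\<^sub>R I \<omega>)
           - \<alpha> *\<^sub>R ((LINT s:{0..t}|lborel. cross3 (\<mu> s \<omega>) (cross3 (\<mu> s \<omega>) b)) + \<epsilon> *\<^sub>R J \<omega>))"
proof -
  note solution[unfolded strong_solution_def, THEN conjunct2, THEN conjunct2, THEN conjunct2, THEN conjunct2, THEN conjunct2, rule_format, OF assms]
  then obtain I J where *: "has_ito_integral M F W t (\<lambda>s \<omega>. cross_matrix (\<mu> s \<omega>)) I"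
    "has_ito_integral M F W t (\<lambda>s \<omega>. cross_matrix (\<mu> s \<omega>) ** cross_matrix (\<mu> s \<omega>)) J"
    "AE \<omega> in M. Y t \<omega> = y
           - ((LINT s:{0..t}|lborel. cross3 (\<mu> s \<omega>) b) + \<epsilon> *\<^sub>R I \<omega>)
           - \<alpha> *\<^sub>R ((LINT s:{0..t}|lborel. cross3 (\<mu> s \<omega>) (cross3 (\<mu> s \<omega>) b)) + \<epsilon> *\<^sub>R J \<omega>)"
    by (elim exE conjE) (rule that)
  show ?thesis
    by (intro exI[of _ I] exI[of _ J] conjI allI *(3)
      has_ito_integral_imp_ito_increment[OF *(1) assms] has_ito_integral_imp_ito_increment[OF *(2) assms])
qed

lemma \<mu>_measurable_PT:
  assumes "0 \<le> s" "s \<le> t"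
  shows "(\<lambda>p. \<mu> (snd p) (fst p)) \<in> borel_measurable (PT s t)"
proof -
  have t: "0 \<le> t" using assms by simp
  obtain I where I: "\<And>i. ito_increment 0 t (\<lambda>s \<omega>. cross_matrix (\<mu> s \<omega>) $ i) (\<lambda>\<omega>. I \<omega> $ i)"
    using ito_integrals_exist[OF t] by blast
  let ?m = "\<lambda>p. \<mu> (snd p) (fst p)"
  have "(\<lambda>p. cross_matrix (?m p) $ i) \<in> borel_measurable (PT 0 t)" for i
    using I[of i] by (auto simp: ito_increment_def intro: square_integrable_measurable)
  then have "(\<lambda>p. cross_matrix (?m p) $ i \<bullet> v) \<in> borel_measurable (PT 0 t)" for i v
    by (intro borel_measurable_inner) auto
  then have "(\<lambda>p. cross3 (?m p) v $ i) \<in> borel_measurable (PT 0 t)" for i v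
    by (simp add: cross_matrix_component)
  then have "?m \<in> borel_measurable (PT 0 t)"
    by (subst vec3_eq_cross_components)
      (intro borel_measurable_add borel_measurable_scaleR borel_measurable_const)
  then show ?thesis by (rule measurable_PT_mono) (use assms in auto)
qed

text \<open>The properties of the stochastic integral over \<open>(s, t]\<close> that the argument needs: with
  \<open>P\<close> in the role of \<open>\<integral> (L(\<mu>) + \<alpha> L(\<mu>)\<^sup>2) dW\<close>, orthogonality to the past, the isometry
  conditional on \<open>F s\<close> for the component along an \<open>F s\<close>-measurable vector \<open>V\<close>, and the fourth
  moments. The constant is \<open>648 = 8 * 81\<close>, where \<open>81 = 9 * 3\<^sup>2\<close> bounds, per squared time,
  the fourth moment of a component of either integral and \<open>8\<close> comes from \<open>(p + q)\<^sup>4 \<le> 8 p\<^sup>4 + 8 q\<^sup>4\<close>.\<close>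

definition noise :: "real \<Rightarrow> real \<Rightarrow> ('a \<Rightarrow> real^3) \<Rightarrow> bool" where
  "noise s t P \<longleftrightarrow>
    (\<forall>i. square_integrable M (\<lambda>\<omega>. P \<omega> $ i)) \<and>
    (\<forall>\<phi> i. \<phi> \<in> borel_measurable (F s) \<longrightarrow> square_integrable M \<phi> \<longrightarrow> expectation (\<lambda>\<omega>. \<phi> \<omega> * P \<omega> $ i) = 0) \<and>
    (\<forall>\<psi> V K B. \<psi> \<in> borel_measurable (F s) \<longrightarrow> (\<forall>\<omega>\<in>space M. \<bar>\<psi> \<omega>\<bar> \<le> K) \<longrightarrow>
      V \<in> borel_measurable (F s) \<longrightarrow> (\<forall>\<omega>\<in>space M. norm (V \<omega>) \<le> B) \<longrightarrow>
      expectation (\<lambda>\<omega>. \<psi> \<omega> * (V \<omega> \<bullet> P \<omega>)\<^sup>2)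
      = (\<integral>p. \<psi> (fst p) * (norm (spin_noise \<alpha> (\<mu> (snd p) (fst p)) (V (fst p))))\<^sup>2 \<partial>PT s t)) \<and>
    (\<forall>i. integrable M (\<lambda>\<omega>. (P \<omega> $ i) ^ 4) \<and> expectation (\<lambda>\<omega>. (P \<omega> $ i) ^ 4) \<le> 648 * (1 + \<alpha> ^ 4) * (t - s)\<^sup>2)"

lemma noise_exists:
  assumes st: "0 \<le> s" "s \<le> t"
  shows "\<exists>P. noise s t P \<and>
    (AE \<omega> in M. Y t \<omega> - Y s \<omega> = (LINT r:{s<..t}|lborel. spin_drift b \<alpha> (\<mu> r \<omega>)) - \<epsilon> *\<^sub>R P \<omega>)"
proof -
  have t: "0 \<le> t" using st by simp
  let ?L = "\<lambda>r \<omega>. cross_matrix (\<mu> r \<omega>)"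
  obtain I J where I: "\<And>i. ito_increment 0 t (\<lambda>r \<omega>. ?L r \<omega> $ i) (\<lambda>\<omega>. I \<omega> $ i)"
    and J: "\<And>i. ito_increment 0 t (\<lambda>r \<omega>. (?L r \<omega> ** ?L r \<omega>) $ i) (\<lambda>\<omega>. J \<omega> $ i)"
    and eq: "AE \<omega> in M. Y t \<omega> = y
           - ((LINT s:{0..t}|lborel. cross3 (\<mu> s \<omega>) b) + \<epsilon> *\<^sub>R I \<omega>)
           - \<alpha> *\<^sub>R ((LINT s:{0..t}|lborel. cross3 (\<mu> s \<omega>) (cross3 (\<mu> s \<omega>) b)) + \<epsilon> *\<^sub>R J \<omega>)"
    using ito_integrals_exist[OF t] by blast
  obtain I' J' where I': "\<And>i. ito_increment 0 s (\<lambda>r \<omega>. ?L r \<omega> $ i) (\<lambda>\<omega>. I' \<omega> $ i)"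
    and J': "\<And>i. ito_increment 0 s (\<lambda>r \<omega>. (?L r \<omega> ** ?L r \<omega>) $ i) (\<lambda>\<omega>. J' \<omega> $ i)"
    and eq': "AE \<omega> in M. Y s \<omega> = y
           - ((LINT s:{0..s}|lborel. cross3 (\<mu> s \<omega>) b) + \<epsilon> *\<^sub>R I' \<omega>)
           - \<alpha> *\<^sub>R ((LINT s:{0..s}|lborel. cross3 (\<mu> s \<omega>) (cross3 (\<mu> s \<omega>) b)) + \<epsilon> *\<^sub>R J' \<omega>)"
    using ito_integrals_exist[OF st(1)] by blast
  define N where "N \<omega> = I \<omega> - I' \<omega>" for \<omega>
  define K where "K \<omega> = J \<omega> - J' \<omega>" for \<omega>
  define P where "P \<omega> = N \<omega> + \<alpha> *\<^sub>R K \<omega>" for \<omega>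
  have N: "ito_increment s t (\<lambda>r \<omega>. ?L r \<omega> $ i) (\<lambda>\<omega>. N \<omega> $ i)" for i
    using ito_increment_diff[OF I I' st(2)] by (simp add: N_def)
  have K: "ito_increment s t (\<lambda>r \<omega>. (?L r \<omega> ** ?L r \<omega>) $ i) (\<lambda>\<omega>. K \<omega> $ i)" for i
    using ito_increment_diff[OF J J' st(2)] by (simp add: K_def)
  have Pi: "P \<omega> $ i = N \<omega> $ i + \<alpha> * K \<omega> $ i" for \<omega> i by (simp add: P_def)
  have Nsq: "square_integrable M (\<lambda>\<omega>. N \<omega> $ i)" and Ksq: "square_integrable M (\<lambda>\<omega>. K \<omega> $ i)" for i
    using N[of i] K[of i] by (auto simp: ito_increment_def)
  have row: "norm (?L r \<omega> $ i) \<le> 1" "norm ((?L r \<omega> ** ?L r \<omega>) $ i) \<le> 1" if "\<omega> \<in> space M" "s < r" for r \<omega> i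
    using norm_cross_matrix_row_le[OF norm_\<mu>_le[OF that(1)], of r i] that(2) st(1) by auto
  have "noise s t P"
    unfolding noise_def
  proof (intro conjI allI impI)
    show "square_integrable M (\<lambda>\<omega>. P \<omega> $ i)" for i
      unfolding Pi by (intro square_integrable_add square_integrable_cmult Nsq Ksq)
    fix \<phi> :: "'a \<Rightarrow> real" and i
    assume \<phi>: "\<phi> \<in> borel_measurable (F s)" "square_integrable M \<phi>"
    show "expectation (\<lambda>\<omega>. \<phi> \<omega> * P \<omega> $ i) = 0"
      using ito_increment_mean_zero[OF N \<phi>, of i] ito_increment_mean_zero[OF K \<phi>, of i]
      by (simp add: Pi distrib_left mult.left_commute[of _ \<alpha>])
  next
    fix \<psi> :: "'a \<Rightarrow> real" and V :: "'a \<Rightarrow> real^3" and k B :: real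
    assume \<psi>: "\<psi> \<in> borel_measurable (F s)" "\<forall>\<omega>\<in>space M. \<bar>\<psi> \<omega>\<bar> \<le> k"
      and V: "V \<in> borel_measurable (F s)" "\<forall>\<omega>\<in>space M. norm (V \<omega>) \<le> B"
    \<comment> \<open>The six scalar integrals: the index \<open>(i, c)\<close> is component \<open>i\<close> of the first or the second integral.\<close>
    define h where "h a r \<omega> = (if snd a then (?L r \<omega> ** ?L r \<omega>) $ fst a else ?L r \<omega> $ fst a)" for a :: "3 \<times> bool" and r \<omega>
    define n where "n a \<omega> = (if snd a then K \<omega> $ fst a else N \<omega> $ fst a)" for a :: "3 \<times> bool" and \<omega>
    define v where "v a \<omega> = (if snd a then \<alpha> * V \<omega> $ fst a else V \<omega> $ fst a)" for a :: "3 \<times> bool" and \<omega>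
    have sum_split: "(\<Sum>a\<in>UNIV. f a) = (\<Sum>i\<in>UNIV. f (i, False) + f (i, True))" for f :: "3 \<times> bool \<Rightarrow> 'z :: comm_monoid_add"
    proof -
      have "(\<Sum>i\<in>UNIV. \<Sum>b\<in>UNIV. f (i, b)) = (\<Sum>a\<in>UNIV \<times> UNIV. f a)"
        by (simp only: sum.cartesian_product case_prod_eta)
      then show ?thesis by (simp only: UNIV_Times_UNIV) (simp add: UNIV_bool)
    qed
    have "expectation (\<lambda>\<omega>. \<psi> \<omega> * (\<Sum>a\<in>UNIV. v a \<omega> * n a \<omega>)\<^sup>2)
      = (\<integral>p. \<psi> (fst p) * (norm (\<Sum>a\<in>UNIV. v a (fst p) *\<^sub>R h a (snd p) (fst p)))\<^sup>2 \<partial>PT s t)"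
    proof (rule ito_increment_combination[where B = "(1 + \<bar>\<alpha>\<bar>) * B" and K = k])
      show "ito_increment s t (h a) (n a)" for a
        unfolding h_def n_def using N K by (cases "snd a") auto
      have "(\<lambda>\<omega>. V \<omega> $ i) \<in> borel_measurable (F s)" for i
        by (rule measurable_compose[OF V(1) borel_measurable_nth])
      then show "v a \<in> borel_measurable (F s)" for a
        unfolding v_def by (cases "snd a") auto
      fix a :: "3 \<times> bool" and \<omega> assume "\<omega> \<in> space M"
      then have *: "\<bar>V \<omega> $ fst a\<bar> \<le> B" using V(2) component_le_norm_cart[of "V \<omega>" "fst a"] by force
      then have "0 \<le> B" "\<bar>\<alpha>\<bar> * \<bar>V \<omega> $ fst a\<bar> \<le> \<bar>\<alpha>\<bar> * B" by (auto intro: mult_left_mono)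
      moreover have "0 \<le> \<bar>\<alpha>\<bar> * B" using \<open>0 \<le> B\<close> by simp
      ultimately have "\<bar>\<alpha>\<bar> * \<bar>V \<omega> $ fst a\<bar> \<le> B + \<bar>\<alpha>\<bar> * B" "\<bar>V \<omega> $ fst a\<bar> \<le> B + \<bar>\<alpha>\<bar> * B"
        using * by linarith+
      then show "\<bar>v a \<omega>\<bar> \<le> (1 + \<bar>\<alpha>\<bar>) * B"
        by (cases "snd a") (simp_all add: v_def abs_mult distrib_right)
    qed (use \<psi> in auto)
    moreover have "(\<Sum>a\<in>UNIV. v a \<omega> * n a \<omega>) = V \<omega> \<bullet> P \<omega>" for \<omega>
      unfolding sum_split inner_vec_sum by (intro sum.cong) (simp_all add: v_def n_def Pi algebra_simps)
    moreover have "(\<Sum>a\<in>UNIV. v a \<omega> *\<^sub>R h a r \<omega>) = spin_noise \<alpha> (\<mu> r \<omega>) (V \<omega>)" for r \<omega>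
      unfolding sum_split by (simp add: v_def h_def spin_noise_rows)
    ultimately show "expectation (\<lambda>\<omega>. \<psi> \<omega> * (V \<omega> \<bullet> P \<omega>)\<^sup>2)
      = (\<integral>p. \<psi> (fst p) * (norm (spin_noise \<alpha> (\<mu> (snd p) (fst p)) (V (fst p))))\<^sup>2 \<partial>PT s t)" by simp
  next
    fix i
    have N4: "integrable M (\<lambda>\<omega>. (N \<omega> $ i) ^ 4)" "expectation (\<lambda>\<omega>. (N \<omega> $ i) ^ 4) \<le> 81 * (t - s)\<^sup>2"
      using ito_increment_fourth_moment[OF N[of i], of 1] row by auto
    have K4: "integrable M (\<lambda>\<omega>. (K \<omega> $ i) ^ 4)" "expectation (\<lambda>\<omega>. (K \<omega> $ i) ^ 4) \<le> 81 * (t - s)\<^sup>2"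
      using ito_increment_fourth_moment[OF K[of i], of 1] row by auto
    let ?R = "\<lambda>\<omega>. 8 * (N \<omega> $ i) ^ 4 + 8 * (\<alpha> ^ 4 * (K \<omega> $ i) ^ 4)"
    have le: "(P \<omega> $ i) ^ 4 \<le> ?R \<omega>" for \<omega>
      using power4_add_le[of "N \<omega> $ i" "\<alpha> * K \<omega> $ i"] by (simp add: Pi power_mult_distrib)
    have Pm: "(\<lambda>\<omega>. P \<omega> $ i) \<in> borel_measurable M"
      using square_integrable_measurable[OF Nsq] square_integrable_measurable[OF Ksq] unfolding Pi by simp
    have Ri: "integrable M ?R" using N4 K4 by simp
    show i: "integrable M (\<lambda>\<omega>. (P \<omega> $ i) ^ 4)"
    proof (rule Bochner_Integration.integrable_bound[OF Ri])
      show "AE \<omega> in M. norm ((P \<omega> $ i) ^ 4) \<le> norm (?R \<omega>)"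
      proof (rule AE_I2)
        fix \<omega>
        have "norm ((P \<omega> $ i) ^ 4) = (P \<omega> $ i) ^ 4" by simp
        also have "\<dots> \<le> ?R \<omega>" by (rule le)
        also have "\<dots> \<le> norm (?R \<omega>)" unfolding real_norm_def by (rule abs_ge_self)
        finally show "norm ((P \<omega> $ i) ^ 4) \<le> norm (?R \<omega>)" .
      qed
    qed (use Pm in simp)
    have "expectation (\<lambda>\<omega>. (P \<omega> $ i) ^ 4) \<le> expectation ?R"
      using i Ri le by (intro integral_mono) auto
    also have "\<dots> = 8 * expectation (\<lambda>\<omega>. (N \<omega> $ i) ^ 4) + 8 * (\<alpha> ^ 4 * expectation (\<lambda>\<omega>. (K \<omega> $ i) ^ 4))"
      using N4 K4 by simp
    also have "\<dots> \<le> 8 * (81 * (t - s)\<^sup>2) + 8 * (\<alpha> ^ 4 * (81 * (t - s)\<^sup>2))"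
      using N4 K4 by (intro add_mono mult_left_mono) auto
    finally show "expectation (\<lambda>\<omega>. (P \<omega> $ i) ^ 4) \<le> 648 * (1 + \<alpha> ^ 4) * (t - s)\<^sup>2" by (simp add: algebra_simps)
  qed
  moreover have "AE \<omega> in M. Y t \<omega> - Y s \<omega> = (LINT r:{s<..t}|lborel. spin_drift b \<alpha> (\<mu> r \<omega>)) - \<epsilon> *\<^sub>R P \<omega>"
    using AE_good eq eq'
  proof eventually_elim
    case (elim \<omega>)
    have \<mu>c: "continuous_on {0..t} (\<lambda>r. \<mu> r \<omega>)"
      by (rule continuous_on_subset[OF good_\<mu>(1)[OF elim(1)]]) auto
    let ?f = "\<lambda>r. cross3 (\<mu> r \<omega>) b" and ?g = "\<lambda>r. cross3 (\<mu> r \<omega>) (cross3 (\<mu> r \<omega>) b)"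
    have fi: "set_integrable lborel {0..t} ?f" and gi: "set_integrable lborel {0..t} ?g"
      by (intro borel_integrable_atLeastAtMost' continuous_on_cross \<mu>c continuous_on_const)+
    have fi': "set_integrable lborel {s<..t} ?f" and gi': "set_integrable lborel {s<..t} ?g"
      using st by (auto intro: set_integrable_subset[OF fi] set_integrable_subset[OF gi])
    have "(LINT r:{s<..t}|lborel. spin_drift b \<alpha> (\<mu> r \<omega>)) = - (LINT r:{s<..t}|lborel. ?f r) - \<alpha> *\<^sub>R (LINT r:{s<..t}|lborel. ?g r)"
    proof -
      have ag: "set_integrable lborel {s<..t} (\<lambda>r. \<alpha> *\<^sub>R ?g r)" using gi' by (rule set_integrable_scaleR_right)
      have "spin_drift b \<alpha> (\<mu> r \<omega>) = - (?f r + \<alpha> *\<^sub>R ?g r)" for r by (simp add: spin_drift_def)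
      then have "(LINT r:{s<..t}|lborel. spin_drift b \<alpha> (\<mu> r \<omega>)) = - (LINT r:{s<..t}|lborel. ?f r + \<alpha> *\<^sub>R ?g r)"
        using set_integral_uminus[OF set_integral_add(1)[OF fi' ag]] by simp
      then show ?thesis using set_integral_add(2)[OF fi' ag] by simp
    qed
    moreover have "Yt - Ys = D - \<epsilon> *\<^sub>R ((i - i') + \<alpha> *\<^sub>R (j - j'))"
      if "D = - fd - \<alpha> *\<^sub>R gd" "ft = fs + fd" "gt = gs + gd" "Yt = y - (ft + \<epsilon> *\<^sub>R i) - \<alpha> *\<^sub>R (gt + \<epsilon> *\<^sub>R j)"
        "Ys = y - (fs + \<epsilon> *\<^sub>R i') - \<alpha> *\<^sub>R (gs + \<epsilon> *\<^sub>R j')"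
      for Yt Ys D fd gd fs gs ft gt i i' j j' :: "real^3"
      unfolding that by (simp add: algebra_simps)
    ultimately show ?case
      using set_integral_split_Icc[OF fi st] set_integral_split_Icc[OF gi st] elim(2,3)
      unfolding P_def N_def K_def by blast
  qed
  ultimately show ?thesis by blast
qed

end

section \<open>Moments of the increments of the solution\<close>

lemma norm_set_integral_Ioc_le:
  fixes f :: "real \<Rightarrow> 'b :: euclidean_space"
  assumes f: "set_integrable lborel {s<..t} f" and st: "s \<le> t" and le: "\<And>r. s < r \<Longrightarrow> r \<le> t \<Longrightarrow> norm (f r) \<le> c"
  shows "norm (LINT r:{s<..t}|lborel. f r) \<le> c * (t - s)"
proof -
  have "norm (LINT r:{s<..t}|lborel. f r) \<le> (LINT r:{s<..t}|lborel. norm (f r))"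
    by (rule set_integral_norm_bound[OF f])
  also have "\<dots> \<le> (LINT r:{s<..t}|lborel. c)"
    using le st by (intro set_integral_mono set_integrable_norm f) (auto simp: set_integrable_def)
  also have "\<dots> = c * (t - s)" using st by (simp add: set_lebesgue_integral_def)
  finally show ?thesis .
qed

context prob_space begin

text \<open>The lower moments of a variable of the size of \<open>sqrt \<delta>\<close>.\<close>

lemma moment_from_fourth:
  fixes X :: "'a \<Rightarrow> real"
  assumes X: "X \<in> borel_measurable M" "\<And>\<omega>. 0 \<le> X \<omega>" and X4: "integrable M (\<lambda>\<omega>. X \<omega> ^ 4)" "expectation (\<lambda>\<omega>. X \<omega> ^ 4) \<le> C * \<delta>\<^sup>2"
    and \<delta>: "0 < \<delta>" and k: "k \<le> 4"
  shows "integrable M (\<lambda>\<omega>. X \<omega> ^ k)" "expectation (\<lambda>\<omega>. X \<omega> ^ k) \<le> (1 + C) * sqrt \<delta> ^ k"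
proof -
  let ?R = "\<lambda>\<omega>. sqrt \<delta> ^ k * (1 + X \<omega> ^ 4 / \<delta>\<^sup>2)"
  have le: "X \<omega> ^ k \<le> ?R \<omega>" for \<omega>
  proof -
    define u where "u = X \<omega> / sqrt \<delta>"
    have u0: "0 \<le> u" using X(2)[of \<omega>] \<delta> by (simp add: u_def)
    have "u ^ k \<le> 1 + u ^ 4"
    proof (cases "u \<le> 1")
      case True
      then have "u ^ k \<le> 1" using u0 by (simp add: power_le_one)
      then show ?thesis using zero_le_power[OF u0, of 4] by linarith
    next
      case False
      then have "u ^ k \<le> u ^ 4" using k by (intro power_increasing) auto
      then show ?thesis by simp
    qed
    moreover have "X \<omega> = sqrt \<delta> * u" using \<delta> by (simp add: u_def)
    moreover have "sqrt \<delta> ^ 4 = \<delta>\<^sup>2"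
    proof -
      have "sqrt \<delta> ^ 4 = ((sqrt \<delta>)\<^sup>2)\<^sup>2" by simp
      then show ?thesis using \<delta> by simp
    qed
    then have "u ^ 4 = X \<omega> ^ 4 / \<delta>\<^sup>2" by (simp add: u_def power_divide)
    moreover have "0 \<le> sqrt \<delta> ^ k" using \<delta> by simp
    ultimately show ?thesis by (metis mult_left_mono power_mult_distrib)
  qed
  have Ri: "integrable M ?R" using X4(1) by simp
  show i: "integrable M (\<lambda>\<omega>. X \<omega> ^ k)"
  proof (rule Bochner_Integration.integrable_bound[OF Ri])
    show "AE \<omega> in M. norm (X \<omega> ^ k) \<le> norm (?R \<omega>)"
    proof (rule AE_I2)
      fix \<omega>
      have "norm (X \<omega> ^ k) = X \<omega> ^ k" using X(2)[of \<omega>] by simp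
      also have "\<dots> \<le> ?R \<omega>" by (rule le)
      also have "\<dots> \<le> norm (?R \<omega>)" unfolding real_norm_def by (rule abs_ge_self)
      finally show "norm (X \<omega> ^ k) \<le> norm (?R \<omega>)" .
    qed
  qed (use X in simp)
  have "expectation (\<lambda>\<omega>. X \<omega> ^ k) \<le> expectation ?R" using i Ri le by (intro integral_mono) auto
  also have "\<dots> = sqrt \<delta> ^ k * (1 + expectation (\<lambda>\<omega>. X \<omega> ^ 4) / \<delta>\<^sup>2)" using X4(1) by (simp add: prob_space)
  also have "\<dots> \<le> sqrt \<delta> ^ k * (1 + C)"
    using X4(2) \<delta> by (intro mult_left_mono) (auto simp: field_simps)
  finally show "expectation (\<lambda>\<omega>. X \<omega> ^ k) \<le> (1 + C) * sqrt \<delta> ^ k" by (simp add: mult.commute)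
qed

end

context spin_diffusion begin

text \<open>A bound for the drift.\<close>

definition c0 :: real where "c0 = (1 + \<alpha>) * norm b"

lemma c0_nonneg: "0 \<le> c0" using \<alpha>_pos by (simp add: c0_def)

text \<open>\<open>P\<close> is the noise part of the increment of \<open>Y\<close> over \<open>(s, t]\<close>, up to the factor \<open>- \<epsilon>\<close>.\<close>

definition noise_of :: "real \<Rightarrow> real \<Rightarrow> ('a \<Rightarrow> real^3) \<Rightarrow> bool" where
  "noise_of s t P \<longleftrightarrow> noise s t P \<and>
    (AE \<omega> in M. Y t \<omega> - Y s \<omega> = (LINT r:{s<..t}|lborel. spin_drift b \<alpha> (\<mu> r \<omega>)) - \<epsilon> *\<^sub>R P \<omega>)"

text \<open>What remains of the increment of \<open>Y\<close> without its noise part; almost surely it is the integral of the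
  drift.\<close>

abbreviation drift_part :: "real \<Rightarrow> real \<Rightarrow> ('a \<Rightarrow> real^3) \<Rightarrow> 'a \<Rightarrow> real^3" where
  "drift_part s t P \<omega> \<equiv> Y t \<omega> - Y s \<omega> + \<epsilon> *\<^sub>R P \<omega>"

lemma good_drift_integrable:
  assumes "good \<omega>" "0 \<le> s"
  shows "set_integrable lborel {s<..t} (\<lambda>r. spin_drift b \<alpha> (\<mu> r \<omega>))"
proof -
  have "set_integrable lborel {s..t} (\<lambda>r. spin_drift b \<alpha> (\<mu> r \<omega>))"
    by (intro borel_integrable_atLeastAtMost' continuous_on_spin_drift
      continuous_on_subset[OF good_\<mu>(1)[OF assms(1)]]) (use assms(2) in auto)
  then show ?thesis by (rule set_integrable_subset) auto
qed

lemma norm_drift_part_le: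
  assumes "noise_of s t P" "0 \<le> s" "s \<le> t"
  shows "AE \<omega> in M. norm (drift_part s t P \<omega>) \<le> c0 * (t - s)"
proof -
  have "AE \<omega> in M. Y t \<omega> - Y s \<omega> = (LINT r:{s<..t}|lborel. spin_drift b \<alpha> (\<mu> r \<omega>)) - \<epsilon> *\<^sub>R P \<omega>"
    using assms by (simp add: noise_of_def)
  then show ?thesis
    using AE_good
  proof eventually_elim
    case (elim \<omega>)
    have "norm (LINT r:{s<..t}|lborel. spin_drift b \<alpha> (\<mu> r \<omega>)) \<le> c0 * (t - s)"
      using norm_spin_drift_le[OF norm_\<mu>_le] elim(2) assms(2,3) \<alpha>_pos
      by (intro norm_set_integral_Ioc_le good_drift_integrable) (auto simp: c0_def good_def)
    then show ?case using elim(1) by simp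
  qed
qed

text \<open>Replacing the drift along \<open>V\<close> by a rate \<open>c\<close> that does not depend on the time costs at most the
  integral of the pointwise error.\<close>

lemma drift_part_deviation:
  assumes P: "noise_of s t P" and st: "0 \<le> s" "s \<le> t" 
  shows "(\<integral>\<^sup>+\<omega>. ennreal \<bar>drift_part s t P \<omega> \<bullet> V \<omega> - c \<omega> * (t - s)\<bar> \<partial>M)
    \<le> (\<integral>\<^sup>+\<omega>. (\<integral>\<^sup>+r\<in>{s<..t}. ennreal \<bar>spin_drift b \<alpha> (\<mu> r \<omega>) \<bullet> V \<omega> - c \<omega>\<bar> \<partial>lborel) \<partial>M)"
proof (rule nn_integral_mono_AE)
  have "AE \<omega> in M. Y t \<omega> - Y s \<omega> = (LINT r:{s<..t}|lborel. spin_drift b \<alpha> (\<mu> r \<omega>)) - \<epsilon> *\<^sub>R P \<omega>"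
    using P by (simp add: noise_of_def)
  then show "AE \<omega> in M. ennreal \<bar>drift_part s t P \<omega> \<bullet> V \<omega> - c \<omega> * (t - s)\<bar>
    \<le> (\<integral>\<^sup>+r\<in>{s<..t}. ennreal \<bar>spin_drift b \<alpha> (\<mu> r \<omega>) \<bullet> V \<omega> - c \<omega>\<bar> \<partial>lborel)"
    using AE_good
  proof eventually_elim
    case (elim \<omega>)
    let ?f = "\<lambda>r. spin_drift b \<alpha> (\<mu> r \<omega>)"
    let ?g = "\<lambda>r. indicator {s<..t} r *\<^sub>R (?f r \<bullet> V \<omega>) - indicator {s<..t} r * c \<omega>"
    have fi: "integrable lborel (\<lambda>r. indicator {s<..t} r *\<^sub>R ?f r)"
      using good_drift_integrable[OF elim(2) st(1)] by (simp add: set_integrable_def)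
    have f1: "integrable lborel (\<lambda>r. indicator {s<..t} r *\<^sub>R (?f r \<bullet> V \<omega>))"
      using integrable_inner_left[OF fi] by simp
    have f2: "integrable lborel (\<lambda>r. indicator {s<..t} r * c \<omega>)" using st by simp
    have e: "drift_part s t P \<omega> = (LINT r:{s<..t}|lborel. ?f r)" using elim(1) by simp
    have "drift_part s t P \<omega> \<bullet> V \<omega> = (\<integral>r. indicator {s<..t} r *\<^sub>R (?f r \<bullet> V \<omega>) \<partial>lborel)"
      unfolding e set_lebesgue_integral_def using integral_inner_left[OF fi, of "V \<omega>"] by simp
    moreover have "c \<omega> * (t - s) = (\<integral>r. indicator {s<..t} r * c \<omega> \<partial>lborel)" using st by simp
    ultimately have "drift_part s t P \<omega> \<bullet> V \<omega> - c \<omega> * (t - s) = (\<integral>r. ?g r \<partial>lborel)"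
      using f1 f2 by simp
    also have "ennreal \<bar>\<dots>\<bar> \<le> (\<integral>\<^sup>+r. ennreal \<bar>?g r\<bar> \<partial>lborel)"
      using integral_norm_bound_ennreal[of lborel ?g] f1 f2 by simp
    also have "\<dots> = (\<integral>\<^sup>+r\<in>{s<..t}. ennreal \<bar>?f r \<bullet> V \<omega> - c \<omega>\<bar> \<partial>lborel)"
      by (intro nn_integral_cong) (auto simp: indicator_def)
    finally show ?case .
  qed
qed

lemma spin_drift_measurable: "spin_drift b \<alpha> \<in> borel_measurable borel"
  by (intro borel_measurable_continuous_onI continuous_on_spin_drift continuous_on_id)

lemma cross_measurable:
  fixes f g :: "'z \<Rightarrow> real^3"
  assumes "f \<in> borel_measurable N" "g \<in> borel_measurable N"
  shows "(\<lambda>x. cross3 (f x) (g x)) \<in> borel_measurable N"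
proof -
  have "(\<lambda>p :: (real^3) \<times> (real^3). cross3 (fst p) (snd p)) \<in> borel_measurable borel"
    by (intro borel_measurable_continuous_onI continuous_on_cross continuous_intros)
  from measurable_compose[OF borel_measurable_Pair[OF assms] this] show ?thesis by simp
qed

lemma norm_P_fourth:
  assumes P: "noise s t P"
  shows "P \<in> borel_measurable M" "integrable M (\<lambda>\<omega>. norm (P \<omega>) ^ 4)"
    "expectation (\<lambda>\<omega>. norm (P \<omega>) ^ 4) \<le> 5832 * (1 + \<alpha> ^ 4) * (t - s)\<^sup>2"
proof -
  have Pi: "(\<lambda>\<omega>. P \<omega> $ i) \<in> borel_measurable M" "integrable M (\<lambda>\<omega>. (P \<omega> $ i) ^ 4)"
    "expectation (\<lambda>\<omega>. (P \<omega> $ i) ^ 4) \<le> 648 * (1 + \<alpha> ^ 4) * (t - s)\<^sup>2" for i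
    using P by (auto simp: noise_def square_integrable_def)
  show m: "P \<in> borel_measurable M"
  proof -
    have "(\<lambda>\<omega>. \<Sum>i\<in>UNIV. P \<omega> $ i *\<^sub>R (axis i 1 :: real^3)) \<in> borel_measurable M"
      using Pi(1) by (intro borel_measurable_sum borel_measurable_scaleR) auto
    moreover have "(\<Sum>i\<in>UNIV. x $ i *\<^sub>R (axis i 1 :: real^3)) = x" for x :: "real^3"
      by (simp add: vec_eq_iff sum_component axis_def if_distrib cong: if_cong)
    ultimately show ?thesis by simp
  qed
  let ?R = "\<lambda>\<omega>. 3 * (\<Sum>i\<in>UNIV. (P \<omega> $ i) ^ 4)"
  have le: "norm (P \<omega>) ^ 4 \<le> ?R \<omega>" for \<omega> using norm_power4_le[of "P \<omega>"] by simp
  have Ri: "integrable M ?R" using Pi(2) by simp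
  show i: "integrable M (\<lambda>\<omega>. norm (P \<omega>) ^ 4)"
    by (rule Bochner_Integration.integrable_bound[OF Ri])
      (use m in \<open>auto intro!: AE_I2 order_trans[OF le] simp: sum_nonneg\<close>)
  have "expectation (\<lambda>\<omega>. norm (P \<omega>) ^ 4) \<le> expectation ?R" using i Ri le by (intro integral_mono) auto
  also have "\<dots> = 3 * (\<Sum>i\<in>UNIV. expectation (\<lambda>\<omega>. (P \<omega> $ i) ^ 4))" using Pi(2) by simp
  also have "\<dots> \<le> 3 * (\<Sum>i\<in>(UNIV :: 3 set). 648 * (1 + \<alpha> ^ 4) * (t - s)\<^sup>2)"
    using Pi(3) by (intro mult_left_mono sum_mono) auto
  finally show "expectation (\<lambda>\<omega>. norm (P \<omega>) ^ 4) \<le> 5832 * (1 + \<alpha> ^ 4) * (t - s)\<^sup>2"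
    by (simp add: algebra_simps)
qed

text \<open>A bound for the fourth moment of the noise part, per squared time.\<close>

definition c4 :: real where "c4 = 5832 * (1 + \<alpha> ^ 4)"

lemma increment_norm_fourth:
  assumes st: "0 \<le> s" "s \<le> t" "t \<le> T"
  shows "integrable M (\<lambda>\<omega>. norm (Y t \<omega> - Y s \<omega>) ^ 4)"
    "expectation (\<lambda>\<omega>. norm (Y t \<omega> - Y s \<omega>) ^ 4) \<le> (8 * c0 ^ 4 * T\<^sup>2 + 8 * \<epsilon> ^ 4 * c4) * (t - s)\<^sup>2"
proof -
  obtain P where P: "noise_of s t P" using noise_exists[OF st(1,2)] by (auto simp: noise_of_def)
  then have Pn: "noise s t P" by (simp add: noise_of_def)
  note P4 = norm_P_fourth[OF Pn]
  let ?R = "\<lambda>\<omega>. 8 * (c0 * (t - s)) ^ 4 + 8 * (\<epsilon> ^ 4 * norm (P \<omega>) ^ 4)"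
  have le: "AE \<omega> in M. norm (Y t \<omega> - Y s \<omega>) ^ 4 \<le> ?R \<omega>"
    using norm_drift_part_le[OF P st(1,2)]
  proof eventually_elim
    case (elim \<omega>)
    have "norm (Y t \<omega> - Y s \<omega>) \<le> c0 * (t - s) + \<epsilon> * norm (P \<omega>)"
      using norm_triangle_ineq4[of "drift_part s t P \<omega>" "\<epsilon> *\<^sub>R P \<omega>"] elim \<epsilon>_pos by simp
    from power_mono[OF this norm_ge_zero, of 4] power4_add_le[of "c0 * (t - s)" "\<epsilon> * norm (P \<omega>)"]
    show ?case by (simp add: power_mult_distrib)
  qed
  have Ri: "integrable M ?R" using P4(2) by simp
  have [measurable]: "Y t \<in> borel_measurable M" "Y s \<in> borel_measurable M" using Y_measurable st by auto
  show i: "integrable M (\<lambda>\<omega>. norm (Y t \<omega> - Y s \<omega>) ^ 4)"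
  proof (rule Bochner_Integration.integrable_bound[OF Ri])
    show "AE \<omega> in M. norm (norm (Y t \<omega> - Y s \<omega>) ^ 4) \<le> norm (?R \<omega>)"
      using le by eventually_elim simp
  qed measurable
  have "expectation (\<lambda>\<omega>. norm (Y t \<omega> - Y s \<omega>) ^ 4) \<le> expectation ?R"
    by (rule integral_mono_AE[OF i Ri le])
  also have "\<dots> = 8 * (c0 * (t - s)) ^ 4 + 8 * (\<epsilon> ^ 4 * expectation (\<lambda>\<omega>. norm (P \<omega>) ^ 4))"
    using P4(2) by (simp add: prob_space)
  also have "\<dots> \<le> 8 * (c0 ^ 4 * T\<^sup>2 * (t - s)\<^sup>2) + 8 * (\<epsilon> ^ 4 * (c4 * (t - s)\<^sup>2))"
  proof (intro add_mono mult_left_mono)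
    have "(t - s)\<^sup>2 \<le> T\<^sup>2" using st by (intro power_mono) auto
    then have "(t - s)\<^sup>2 * (t - s)\<^sup>2 \<le> T\<^sup>2 * (t - s)\<^sup>2" by (intro mult_right_mono) auto
    then have "c0 ^ 4 * ((t - s)\<^sup>2 * (t - s)\<^sup>2) \<le> c0 ^ 4 * (T\<^sup>2 * (t - s)\<^sup>2)" by (intro mult_left_mono) auto
    then show "(c0 * (t - s)) ^ 4 \<le> c0 ^ 4 * T\<^sup>2 * (t - s)\<^sup>2" by (simp add: power_mult_distrib power4_eq_xxxx power2_eq_square mult_ac)
  qed (use P4(3) in \<open>simp_all add: c4_def\<close>)
  finally show "expectation (\<lambda>\<omega>. norm (Y t \<omega> - Y s \<omega>) ^ 4) \<le> (8 * c0 ^ 4 * T\<^sup>2 + 8 * \<epsilon> ^ 4 * c4) * (t - s)\<^sup>2"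
    by (simp add: algebra_simps)
qed

text \<open>A bound, on \<open>[0, T]\<close>, for the moments up to the fourth of the increments of \<open>Y\<close>.\<close>

definition cY :: "real \<Rightarrow> real" where "cY T = 1 + (8 * c0 ^ 4 * T\<^sup>2 + 8 * \<epsilon> ^ 4 * c4)"

lemma c4_nonneg: "0 \<le> c4" and cY_ge_1: "1 \<le> cY T"
proof -
  show "0 \<le> c4" by (simp add: c4_def)
  then show "1 \<le> cY T" by (simp add: cY_def)
qed

lemma increment_norm_moment:
  assumes st: "0 \<le> s" "s < t" "t \<le> T" and k: "k \<le> 4"
  shows "integrable M (\<lambda>\<omega>. norm (Y t \<omega> - Y s \<omega>) ^ k)"
    "expectation (\<lambda>\<omega>. norm (Y t \<omega> - Y s \<omega>) ^ k) \<le> cY T * sqrt (t - s) ^ k"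
proof -
  have [measurable]: "Y t \<in> borel_measurable M" "Y s \<in> borel_measurable M" using Y_measurable st by auto
  have st': "s \<le> t" using st by simp
  note m = moment_from_fourth[OF _ _ increment_norm_fourth[OF st(1) st' st(3)] _ k]
  show "integrable M (\<lambda>\<omega>. norm (Y t \<omega> - Y s \<omega>) ^ k)" by (rule m) (use st in auto)
  show "expectation (\<lambda>\<omega>. norm (Y t \<omega> - Y s \<omega>) ^ k) \<le> cY T * sqrt (t - s) ^ k"
    unfolding cY_def by (rule m) (use st in auto)
qed

lemma nn_increment_norm_moment:
  assumes st: "0 \<le> s" "s < t" "t \<le> T" and k: "k \<le> 4"
  shows "(\<integral>\<^sup>+\<omega>. ennreal (norm (Y t \<omega> - Y s \<omega>) ^ k) \<partial>M) \<le> ennreal (cY T * sqrt (t - s) ^ k)"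
  using nn_integral_eq_integral[OF increment_norm_moment(1)[OF assms]] increment_norm_moment(2)[OF assms]
  by (simp add: ennreal_leI)

lemma nn_P_moment:
  assumes P: "noise s t P" and st: "s < t" and k: "k \<le> 4"
  shows "(\<integral>\<^sup>+\<omega>. ennreal (norm (P \<omega>) ^ k) \<partial>M) \<le> ennreal ((1 + c4) * sqrt (t - s) ^ k)"
proof -
  note P4 = norm_P_fourth[OF P, folded c4_def]
  note m = moment_from_fourth[OF _ _ P4(2,3) _ k]
  have m': "integrable M (\<lambda>\<omega>. norm (P \<omega>) ^ k)" "expectation (\<lambda>\<omega>. norm (P \<omega>) ^ k) \<le> (1 + c4) * sqrt (t - s) ^ k"
    using P4(1) st by (auto intro!: m)
  then show ?thesis using nn_integral_eq_integral[OF m'(1)] by (simp add: ennreal_leI)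
qed

text \<open>\<open>\<mu>\<^sub>r\<close> is parallel to \<open>Y\<^sub>r\<close>, so \<open>\<mu>\<^sub>r \<times> Y\<^sub>s\<close> is of the order of \<open>Y\<^sub>r - Y\<^sub>s\<close>.\<close>

lemma norm_cross_\<mu>_Y_le:
  assumes "\<omega> \<in> space M" "0 \<le> r"
  shows "norm (cross3 (\<mu> r \<omega>) (Y s \<omega>)) \<le> norm (Y r \<omega> - Y s \<omega>)"
proof -
  have "cross3 (\<mu> r \<omega>) (Y r \<omega>) = 0" by (simp add: \<mu>_eq[OF assms] cross_mult_left)
  then have "cross3 (\<mu> r \<omega>) (Y s \<omega>) = cross3 (\<mu> r \<omega>) (Y s \<omega> - Y r \<omega>)"
    by (simp add: Cross3.right_diff_distrib)
  then have "norm (cross3 (\<mu> r \<omega>) (Y s \<omega>)) \<le> norm (\<mu> r \<omega>) * norm (Y s \<omega> - Y r \<omega>)" using norm_cross3_le by simp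
  also have "\<dots> \<le> 1 * norm (Y s \<omega> - Y r \<omega>)" using norm_\<mu>_le[OF assms] by (intro mult_right_mono) auto
  finally show ?thesis by (simp add: norm_minus_commute)
qed

lemma nn_cross_\<mu>_Y:
  assumes st: "0 \<le> s" "s < t" "t \<le> T" and k: "k \<le> 4"
  shows "(\<integral>\<^sup>+p. ennreal (norm (cross3 (\<mu> (snd p) (fst p)) (Y s (fst p))) ^ k) \<partial>PT s t)
    \<le> ennreal (cY T * sqrt (t - s) ^ k * (t - s))"
proof (rule nn_integral_PT_le)
  have "(\<lambda>p. cross3 (\<mu> (snd p) (fst p)) (Y s (fst p))) \<in> borel_measurable (PT s t)"
    using st by (intro cross_measurable \<mu>_measurable_PT measurable_compose[OF measurable_fst Y_measurable]) auto
  then show "(\<lambda>p. ennreal (norm (cross3 (\<mu> (snd p) (fst p)) (Y s (fst p))) ^ k)) \<in> borel_measurable (PT s t)"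
    by (rule measurable_compose[where g = "\<lambda>x. ennreal (norm x ^ k)"]) simp
  show "0 \<le> cY T * sqrt (t - s) ^ k" using cY_ge_1[of T] st by simp
  fix r assume r: "s < r" "r \<le> t"
  have "(\<integral>\<^sup>+\<omega>. ennreal (norm (cross3 (\<mu> r \<omega>) (Y s \<omega>)) ^ k) \<partial>M) \<le> (\<integral>\<^sup>+\<omega>. ennreal (norm (Y r \<omega> - Y s \<omega>) ^ k) \<partial>M)"
    using r st by (intro nn_integral_mono ennreal_leI power_mono norm_cross_\<mu>_Y_le) auto
  also have "\<dots> \<le> ennreal (cY T * sqrt (r - s) ^ k)"
    using r st k by (intro nn_increment_norm_moment) auto
  also have "\<dots> \<le> ennreal (cY T * sqrt (t - s) ^ k)"
    using r cY_ge_1[of T] by (intro ennreal_leI mult_left_mono power_mono) auto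
  finally show "(\<integral>\<^sup>+\<omega>. ennreal (norm (cross3 (\<mu> (snd (\<omega>, r)) (fst (\<omega>, r))) (Y s (fst (\<omega>, r)))) ^ k) \<partial>M)
     \<le> ennreal (cY T * sqrt (t - s) ^ k)" by simp
qed (use st in simp)

end

section \<open>Second moments of the increments of the squared norm\<close>

lemma ennreal_integral_le_nn_integral:
  fixes f :: "'a \<Rightarrow> real"
  assumes "\<And>x. 0 \<le> f x"
  shows "ennreal (integral\<^sup>L M f) \<le> (\<integral>\<^sup>+x. ennreal (f x) \<partial>M)"
proof (cases "integrable M f")
  case True
  then show ?thesis using nn_integral_eq_integral[OF True] assms by simp
qed (simp add: not_integrable_integral_eq)

context prob_space begin

lemma abs_expectation_mult_le:
  fixes \<phi> f :: "'a \<Rightarrow> real"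
  assumes f: "integrable M f" "(\<integral>\<^sup>+\<omega>. ennreal \<bar>f \<omega>\<bar> \<partial>M) \<le> ennreal e" and e: "0 \<le> e"
    and \<phi>: "\<phi> \<in> borel_measurable M" "\<And>\<omega>. \<omega> \<in> space M \<Longrightarrow> \<bar>\<phi> \<omega>\<bar> \<le> K" and K: "0 \<le> K"
  shows "\<bar>expectation (\<lambda>\<omega>. \<phi> \<omega> * f \<omega>)\<bar> \<le> K * e"
proof -
  have i: "integrable M (\<lambda>\<omega>. \<phi> \<omega> * f \<omega>)" by (rule integrable_bdd_mult[OF f(1) \<phi>])
  have "ennreal (expectation (\<lambda>\<omega>. \<bar>f \<omega>\<bar>)) \<le> ennreal e"
    using f(2) nn_integral_eq_integral[of M "\<lambda>\<omega>. \<bar>f \<omega>\<bar>"] f(1) by simp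
  then have le: "expectation (\<lambda>\<omega>. \<bar>f \<omega>\<bar>) \<le> e" using e by (simp add: ennreal_le_iff)
  have "\<bar>expectation (\<lambda>\<omega>. \<phi> \<omega> * f \<omega>)\<bar> \<le> expectation (\<lambda>\<omega>. \<bar>\<phi> \<omega> * f \<omega>\<bar>)" by (rule integral_abs_bound)
  also have "\<dots> \<le> expectation (\<lambda>\<omega>. K * \<bar>f \<omega>\<bar>)"
  proof (rule integral_mono)
    show "\<bar>\<phi> \<omega> * f \<omega>\<bar> \<le> K * \<bar>f \<omega>\<bar>" if "\<omega> \<in> space M" for \<omega>
      using \<phi>(2)[OF that] by (simp add: abs_mult mult_right_mono)
  qed (use integrable_abs[OF i] f(1) in simp_all)
  also have "\<dots> \<le> K * e" using le K by (simp add: mult_left_mono)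
  finally show ?thesis .
qed

end

context spin_diffusion begin

lemma noise_mean_zero:
  assumes "noise s t P" "\<phi> \<in> borel_measurable (F s)" "square_integrable M \<phi>"
  shows "expectation (\<lambda>\<omega>. \<phi> \<omega> * P \<omega> $ i) = 0"
  using assms(1)[unfolded noise_def, THEN conjunct2, THEN conjunct1, rule_format, OF assms(2,3)] .

lemma noise_isometry:
  assumes "noise s t P" "\<psi> \<in> borel_measurable (F s)" "\<And>\<omega>. \<omega> \<in> space M \<Longrightarrow> \<bar>\<psi> \<omega>\<bar> \<le> K"
    "V \<in> borel_measurable (F s)" "\<And>\<omega>. \<omega> \<in> space M \<Longrightarrow> norm (V \<omega>) \<le> B"
  shows "expectation (\<lambda>\<omega>. \<psi> \<omega> * (V \<omega> \<bullet> P \<omega>)\<^sup>2)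
    = (\<integral>p. \<psi> (fst p) * (norm (spin_noise \<alpha> (\<mu> (snd p) (fst p)) (V (fst p))))\<^sup>2 \<partial>PT s t)"
  by (rule assms(1)[unfolded noise_def, THEN conjunct2, THEN conjunct2, THEN conjunct1, rule_format, OF assms(2) _ assms(4)])
    (rule assms(3) assms(5), assumption)+

text \<open>The growth rate of \<open>|Y|\<^sup>2\<close>: \<open>\<epsilon>\<^sup>2\<close> times the trace of the rate of quadratic variation.\<close>

definition rate :: real where "rate = 2 * \<epsilon>\<^sup>2 * (1 + \<alpha>\<^sup>2)"

lemma rate_pos: "0 < rate"
  using \<epsilon>_pos unfolding rate_def by (intro mult_pos_pos) (auto simp: add_pos_nonneg)

lemma nn_Y_norm_sq:
  assumes "0 \<le> s" "s \<le> T"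
  shows "(\<integral>\<^sup>+\<omega>. ennreal ((norm (Y s \<omega>))\<^sup>2) \<partial>M) \<le> ennreal (2 * cY T * T + 2)"
proof -
  have T: "0 \<le> T" using assms by simp
  have m: "Y s \<in> borel_measurable M" "Y 0 \<in> borel_measurable M" using Y_measurable assms by auto
  have inc: "(\<integral>\<^sup>+\<omega>. ennreal ((norm (Y s \<omega> - Y 0 \<omega>))\<^sup>2) \<partial>M) \<le> ennreal (cY T * T)"
  proof (cases "s = 0")
    case False
    then have "(\<integral>\<^sup>+\<omega>. ennreal ((norm (Y s \<omega> - Y 0 \<omega>))\<^sup>2) \<partial>M) \<le> ennreal (cY T * (sqrt (s - 0))\<^sup>2)"
      using assms by (intro nn_increment_norm_moment) auto
    also have "\<dots> \<le> ennreal (cY T * T)"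
      using assms cY_ge_1[of T] by (intro ennreal_leI) (simp add: mult_left_mono)
    finally show ?thesis .
  qed simp
  have "(\<integral>\<^sup>+\<omega>. ennreal ((norm (Y s \<omega>))\<^sup>2) \<partial>M) \<le> (\<integral>\<^sup>+\<omega>. 2 * ennreal ((norm (Y s \<omega> - Y 0 \<omega>))\<^sup>2) + 2 \<partial>M)"
  proof (rule nn_integral_mono_AE)
    show "AE \<omega> in M. ennreal ((norm (Y s \<omega>))\<^sup>2) \<le> 2 * ennreal ((norm (Y s \<omega> - Y 0 \<omega>))\<^sup>2) + 2"
      using AE_good
    proof eventually_elim
      case (elim \<omega>)
      then have "norm (Y 0 \<omega>) = 1" using norm_y by (simp add: good_def)
      then have "(norm (Y s \<omega>))\<^sup>2 \<le> 2 * (norm (Y s \<omega> - Y 0 \<omega>))\<^sup>2 + 2"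
        using norm_add_sq_le[of "Y s \<omega> - Y 0 \<omega>" "Y 0 \<omega>"] by simp
      then have "ennreal ((norm (Y s \<omega>))\<^sup>2) \<le> ennreal (2 * (norm (Y s \<omega> - Y 0 \<omega>))\<^sup>2 + 2)" by (rule ennreal_leI)
      then show ?case by (simp add: ennreal_mult)
    qed
  qed
  also have "\<dots> = 2 * (\<integral>\<^sup>+\<omega>. ennreal ((norm (Y s \<omega> - Y 0 \<omega>))\<^sup>2) \<partial>M) + 2"
    using m by (simp add: nn_integral_add nn_integral_cmult emeasure_space_1)
  also have "\<dots> \<le> 2 * ennreal (cY T * T) + 2" using inc by (intro add_mono mult_left_mono) auto
  also have "\<dots> = ennreal (2 * cY T * T + 2)"
  proof -
    have "0 \<le> cY T * T" using cY_ge_1[of T] T by simp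
    then have "ennreal (2 * (cY T * T) + 2) = ennreal 2 * ennreal (cY T * T) + ennreal 2"
      by (simp only: ennreal_mult[symmetric] ennreal_plus[symmetric] zero_le_numeral mult_nonneg_nonneg)
    then show ?thesis by (simp add: mult.assoc)
  qed
  finally show ?thesis .
qed

lemma Y_square_integrable: "0 \<le> s \<Longrightarrow> square_integrable M (Y s)"
  using nn_Y_norm_sq[of s s] Y_measurable[of s] by (intro square_integrable_nn) (auto intro: le_less_trans)

text \<open>The noise over \<open>(s, t]\<close> is nearly orthogonal to \<open>Y s\<close>: the mean square is \<open>O((t - s)\<^sup>2)\<close> instead of
  the usual \<open>O(t - s)\<close>, because the noise is orthogonal to \<open>Y r\<close> at each time \<open>r\<close>, and \<open>Y r\<close> is close
  to \<open>Y s\<close>. This is why \<open>|Y|\<^sup>2\<close> has no quadratic variation.\<close>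

lemma nn_Y_inner_P:
  assumes P: "noise s t P" and st: "0 \<le> s" "s < t" "t \<le> T"
  shows "(\<integral>\<^sup>+\<omega>. ennreal ((Y s \<omega> \<bullet> P \<omega>)\<^sup>2) \<partial>M) \<le> ennreal ((1 + \<alpha>)\<^sup>2 * cY T * (t - s)\<^sup>2)"
proof -
  \<comment> \<open>The isometry requires bounded weights: truncate \<open>Y s\<close> and apply the lemma of Fatou.\<close>
  define V where "V n \<omega> = (if norm (Y s \<omega>) \<le> real n then Y s \<omega> else 0)" for n :: nat and \<omega>
  let ?C = "ennreal ((1 + \<alpha>)\<^sup>2 * cY T * (t - s)\<^sup>2)"
  have YF[measurable]: "Y s \<in> borel_measurable (F s)" by (rule Y_measurable_F[OF st(1)])
  have VF: "V n \<in> borel_measurable (F s)" for n unfolding V_def by measurable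
  have Vb: "norm (V n \<omega>) \<le> real n" for n \<omega> by (simp add: V_def)
  have Pm: "P \<in> borel_measurable M" by (rule norm_P_fourth(1)[OF P])
  have Vm: "V n \<in> borel_measurable M" for n using VF by (rule measurable_F_imp)
  have m: "(\<lambda>\<omega>. V n \<omega> \<bullet> P \<omega>) \<in> borel_measurable M" for n using Vm Pm by (rule borel_measurable_inner)
  have bound: "(\<integral>\<^sup>+\<omega>. ennreal ((V n \<omega> \<bullet> P \<omega>)\<^sup>2) \<partial>M) \<le> ?C" for n
  proof -
    have iso: "expectation (\<lambda>\<omega>. 1 * (V n \<omega> \<bullet> P \<omega>)\<^sup>2) =
       (\<integral>p. 1 * (norm (spin_noise \<alpha> (\<mu> (snd p) (fst p)) (V n (fst p))))\<^sup>2 \<partial>PT s t)"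
      by (rule noise_isometry[OF P _ _ VF Vb, where K = 1]) simp_all
    have P2: "integrable M (\<lambda>\<omega>. (norm (P \<omega>))\<^sup>2)"
      using moment_from_fourth(1)[OF _ _ norm_P_fourth(2,3)[OF P], of 2] Pm st by simp
    have i: "integrable M (\<lambda>\<omega>. (V n \<omega> \<bullet> P \<omega>)\<^sup>2)"
    proof (rule Bochner_Integration.integrable_bound)
      show "integrable M (\<lambda>\<omega>. (real n)\<^sup>2 * (norm (P \<omega>))\<^sup>2)" using P2 by simp
      show "AE \<omega> in M. norm ((V n \<omega> \<bullet> P \<omega>)\<^sup>2) \<le> norm ((real n)\<^sup>2 * (norm (P \<omega>))\<^sup>2)"
      proof (rule AE_I2)
        fix \<omega>
        have "\<bar>V n \<omega> \<bullet> P \<omega>\<bar> \<le> real n * norm (P \<omega>)"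
          using Cauchy_Schwarz_ineq2[of "V n \<omega>" "P \<omega>"] mult_right_mono[OF Vb[of n \<omega>] norm_ge_zero[of "P \<omega>"]] by linarith
        from power_mono[OF this, of 2] show "norm ((V n \<omega> \<bullet> P \<omega>)\<^sup>2) \<le> norm ((real n)\<^sup>2 * (norm (P \<omega>))\<^sup>2)"
          by (simp add: power_mult_distrib)
      qed
    qed (use m in simp)
    have "(\<integral>\<^sup>+\<omega>. ennreal ((V n \<omega> \<bullet> P \<omega>)\<^sup>2) \<partial>M) = ennreal (\<integral>p. (norm (spin_noise \<alpha> (\<mu> (snd p) (fst p)) (V n (fst p))))\<^sup>2 \<partial>PT s t)"
      using nn_integral_eq_integral[OF i] iso by simp
    also have "\<dots> \<le> (\<integral>\<^sup>+p. ennreal ((norm (spin_noise \<alpha> (\<mu> (snd p) (fst p)) (V n (fst p))))\<^sup>2) \<partial>PT s t)"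
      by (rule ennreal_integral_le_nn_integral) simp
    also have "\<dots> \<le> (\<integral>\<^sup>+p. ennreal ((1 + \<alpha>)\<^sup>2) * ennreal (norm (cross3 (\<mu> (snd p) (fst p)) (Y s (fst p))) ^ 2) \<partial>PT s t)"
    proof (rule nn_integral_mono)
      fix p assume p: "p \<in> space (PT s t)"
      let ?m = "\<mu> (snd p) (fst p)"
      have m1: "norm ?m \<le> 1" using p st by (intro norm_\<mu>_le) (auto simp: space_PT)
      have "norm (spin_noise \<alpha> ?m (V n (fst p))) \<le> (1 + \<alpha>) * norm (cross3 ?m (V n (fst p)))"
        using \<alpha>_pos m1 by (intro norm_spin_noise_le) auto
      also have "\<dots> \<le> (1 + \<alpha>) * norm (cross3 ?m (Y s (fst p)))"
        using \<alpha>_pos by (intro mult_left_mono) (auto simp: V_def)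
      finally have "(norm (spin_noise \<alpha> ?m (V n (fst p))))\<^sup>2 \<le> ((1 + \<alpha>) * norm (cross3 ?m (Y s (fst p))))\<^sup>2"
        by (rule power_mono) simp
      then show "ennreal ((norm (spin_noise \<alpha> ?m (V n (fst p))))\<^sup>2) \<le> ennreal ((1 + \<alpha>)\<^sup>2) * ennreal (norm (cross3 ?m (Y s (fst p))) ^ 2)"
        by (simp add: power_mult_distrib ennreal_mult[symmetric] ennreal_leI)
    qed
    also have "\<dots> = ennreal ((1 + \<alpha>)\<^sup>2) * (\<integral>\<^sup>+p. ennreal (norm (cross3 (\<mu> (snd p) (fst p)) (Y s (fst p))) ^ 2) \<partial>PT s t)"
    proof (rule nn_integral_cmult)
      have "(\<lambda>p. cross3 (\<mu> (snd p) (fst p)) (Y s (fst p))) \<in> borel_measurable (PT s t)"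
        using st by (intro cross_measurable \<mu>_measurable_PT measurable_compose[OF measurable_fst Y_measurable]) auto
      then show "(\<lambda>p. ennreal (norm (cross3 (\<mu> (snd p) (fst p)) (Y s (fst p))) ^ 2)) \<in> borel_measurable (PT s t)"
        by (rule measurable_norm_sq_ennreal)
    qed
    also have "\<dots> \<le> ennreal ((1 + \<alpha>)\<^sup>2) * ennreal (cY T * sqrt (t - s) ^ 2 * (t - s))"
      by (intro mult_left_mono nn_cross_\<mu>_Y st) auto
    also have "\<dots> = ?C"
    proof -
      have "0 \<le> cY T * (t - s)\<^sup>2" using cY_ge_1[of T] by simp
      moreover have "cY T * sqrt (t - s) ^ 2 * (t - s) = cY T * (t - s)\<^sup>2" using st by (simp add: power2_eq_square)
      ultimately show ?thesis
        by (simp only: mult.assoc) (rule ennreal_mult[symmetric], simp_all)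
    qed
    finally show ?thesis .
  qed
  have "(\<integral>\<^sup>+\<omega>. ennreal ((Y s \<omega> \<bullet> P \<omega>)\<^sup>2) \<partial>M) = (\<integral>\<^sup>+\<omega>. liminf (\<lambda>n. ennreal ((V n \<omega> \<bullet> P \<omega>)\<^sup>2)) \<partial>M)"
  proof (rule nn_integral_cong)
    fix \<omega>
    obtain n0 where n0: "norm (Y s \<omega>) \<le> real n0" using real_arch_simple by blast
    have "\<forall>\<^sub>F n in sequentially. ennreal ((V n \<omega> \<bullet> P \<omega>)\<^sup>2) = ennreal ((Y s \<omega> \<bullet> P \<omega>)\<^sup>2)"
      unfolding eventually_sequentially
    proof (intro exI[of _ n0] allI impI)
      fix n assume "n0 \<le> n"
      then have "norm (Y s \<omega>) \<le> real n" using n0 by linarith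
      then show "ennreal ((V n \<omega> \<bullet> P \<omega>)\<^sup>2) = ennreal ((Y s \<omega> \<bullet> P \<omega>)\<^sup>2)" by (simp add: V_def)
    qed
    then have "(\<lambda>n. ennreal ((V n \<omega> \<bullet> P \<omega>)\<^sup>2)) \<longlonglongrightarrow> ennreal ((Y s \<omega> \<bullet> P \<omega>)\<^sup>2)" by (rule tendsto_eventually)
    then show "ennreal ((Y s \<omega> \<bullet> P \<omega>)\<^sup>2) = liminf (\<lambda>n. ennreal ((V n \<omega> \<bullet> P \<omega>)\<^sup>2))"
      by (intro lim_imp_Liminf[symmetric]) simp_all
  qed
  also have "\<dots> \<le> liminf (\<lambda>n. \<integral>\<^sup>+\<omega>. ennreal ((V n \<omega> \<bullet> P \<omega>)\<^sup>2) \<partial>M)"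
    using m by (intro nn_integral_liminf) simp
  also have "\<dots> \<le> liminf (\<lambda>n :: nat. ?C)"
    by (intro Liminf_mono always_eventually allI bound)
  finally show ?thesis by (simp add: Liminf_const)
qed

text \<open>The increment of the compensated process \<open>|Y|\<^sup>2 - rate * t\<close>.\<close>

definition sq_incr :: "real \<Rightarrow> real \<Rightarrow> 'a \<Rightarrow> real" where
  "sq_incr s t \<omega> = (norm (Y t \<omega>))\<^sup>2 - (norm (Y s \<omega>))\<^sup>2 - rate * (t - s)"

text \<open>A bound for the second moment of \<open>sq_incr\<close> on \<open>[0, T]\<close>, per squared time.\<close>

definition cD :: "real \<Rightarrow> real" where
  "cD T = 24 * c0\<^sup>2 * (2 * cY T * T + 2) + 24 * \<epsilon>\<^sup>2 * ((1 + \<alpha>)\<^sup>2 * cY T) + 3 * cY T + 3 * rate\<^sup>2"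

lemma nn_sq_incr_sq:
  assumes st: "0 \<le> s" "s < t" "t \<le> T"
  shows "(\<integral>\<^sup>+\<omega>. ennreal ((sq_incr s t \<omega>)\<^sup>2) \<partial>M) \<le> ennreal (cD T * (t - s)\<^sup>2)"
proof -
  have st': "s \<le> t" "0 \<le> T" using st by auto
  obtain P where P: "noise_of s t P" using noise_exists[OF st(1) st'(1)] by (auto simp: noise_of_def)
  then have Pn: "noise s t P" by (simp add: noise_of_def)
  let ?d = "t - s"
  let ?a = "24 * c0\<^sup>2 * ?d\<^sup>2"
  have [measurable]: "Y t \<in> borel_measurable M" "Y s \<in> borel_measurable M" using Y_measurable st by auto
  have [measurable]: "P \<in> borel_measurable M" by (rule norm_P_fourth(1)[OF Pn])
  have pw: "AE \<omega> in M. (sq_incr s t \<omega>)\<^sup>2 \<le> ?a * (norm (Y s \<omega>))\<^sup>2 + 24 * \<epsilon>\<^sup>2 * (Y s \<omega> \<bullet> P \<omega>)\<^sup>2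
     + 3 * norm (Y t \<omega> - Y s \<omega>) ^ 4 + 3 * rate\<^sup>2 * ?d\<^sup>2"
    using norm_drift_part_le[OF P st(1) st'(1)]
  proof eventually_elim
    case (elim \<omega>)
    define A where "A = drift_part s t P \<omega>"
    define \<Delta> where "\<Delta> = Y t \<omega> - Y s \<omega>"
    have yd: "Y s \<omega> \<bullet> \<Delta> = Y s \<omega> \<bullet> A - \<epsilon> * (Y s \<omega> \<bullet> P \<omega>)" by (simp add: A_def \<Delta>_def inner_add_right)
    have D: "sq_incr s t \<omega> = 2 * (Y s \<omega> \<bullet> \<Delta>) + (norm \<Delta>)\<^sup>2 - rate * ?d"
      unfolding sq_incr_def \<Delta>_def power2_norm_eq_inner by (simp add: inner_diff_left inner_diff_right inner_commute)
    have yA: "(Y s \<omega> \<bullet> A)\<^sup>2 \<le> (norm (Y s \<omega>))\<^sup>2 * (c0\<^sup>2 * ?d\<^sup>2)"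
    proof -
      have "\<bar>Y s \<omega> \<bullet> A\<bar> \<le> norm (Y s \<omega>) * (c0 * ?d)"
        using Cauchy_Schwarz_ineq2[of "Y s \<omega>" A] mult_left_mono[OF elim norm_ge_zero[of "Y s \<omega>"]] unfolding A_def by linarith
      from power_mono[OF this, of 2] show ?thesis by (simp add: power_mult_distrib)
    qed
    have two: "(Y s \<omega> \<bullet> \<Delta>)\<^sup>2 \<le> 2 * (Y s \<omega> \<bullet> A)\<^sup>2 + 2 * (\<epsilon>\<^sup>2 * (Y s \<omega> \<bullet> P \<omega>)\<^sup>2)"
      using norm_diff_sq_le[of "Y s \<omega> \<bullet> A" "\<epsilon> * (Y s \<omega> \<bullet> P \<omega>)"] by (simp add: yd power_mult_distrib)
    have three: "(x + y - z)\<^sup>2 \<le> 3 * x\<^sup>2 + 3 * y\<^sup>2 + 3 * z\<^sup>2" for x y z :: real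
      using sum_squares_bound[of x y] sum_squares_bound[of x "-z"] sum_squares_bound[of y "-z"]
      by (simp add: power2_eq_square algebra_simps)
    have "(sq_incr s t \<omega>)\<^sup>2 \<le> 3 * (2 * (Y s \<omega> \<bullet> \<Delta>))\<^sup>2 + 3 * ((norm \<Delta>)\<^sup>2)\<^sup>2 + 3 * (rate * ?d)\<^sup>2"
      unfolding D by (rule three)
    also have "\<dots> = 12 * (Y s \<omega> \<bullet> \<Delta>)\<^sup>2 + 3 * norm \<Delta> ^ 4 + 3 * rate\<^sup>2 * ?d\<^sup>2"
      by (simp add: power_mult_distrib)
    also have "\<dots> \<le> 12 * (2 * ((norm (Y s \<omega>))\<^sup>2 * (c0\<^sup>2 * ?d\<^sup>2)) + 2 * (\<epsilon>\<^sup>2 * (Y s \<omega> \<bullet> P \<omega>)\<^sup>2)) + 3 * norm \<Delta> ^ 4 + 3 * rate\<^sup>2 * ?d\<^sup>2"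
    proof -
      have "12 * x + p + q \<le> 12 * (2 * w + 2 * v) + p + q" if "x \<le> 2 * u + 2 * v" "u \<le> w" for x u v w p q :: real
      proof -
        have "x \<le> 2 * w + 2 * v" using that by simp
        then show ?thesis by simp
      qed
      from this[OF two yA] show ?thesis .
    qed
    finally show ?case by (simp add: \<Delta>_def algebra_simps)
  qed
  have "(\<integral>\<^sup>+\<omega>. ennreal ((sq_incr s t \<omega>)\<^sup>2) \<partial>M) \<le>
    (\<integral>\<^sup>+\<omega>. ennreal ?a * ennreal ((norm (Y s \<omega>))\<^sup>2) + ennreal (24 * \<epsilon>\<^sup>2) * ennreal ((Y s \<omega> \<bullet> P \<omega>)\<^sup>2)
     + ennreal 3 * ennreal (norm (Y t \<omega> - Y s \<omega>) ^ 4) + ennreal (3 * rate\<^sup>2 * ?d\<^sup>2) \<partial>M)"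
  proof (rule nn_integral_mono_AE)
    show "AE \<omega> in M. ennreal ((sq_incr s t \<omega>)\<^sup>2) \<le> ennreal ?a * ennreal ((norm (Y s \<omega>))\<^sup>2) + ennreal (24 * \<epsilon>\<^sup>2) * ennreal ((Y s \<omega> \<bullet> P \<omega>)\<^sup>2)
     + ennreal 3 * ennreal (norm (Y t \<omega> - Y s \<omega>) ^ 4) + ennreal (3 * rate\<^sup>2 * ?d\<^sup>2)"
      using pw
    proof eventually_elim
      case (elim \<omega>)
      from ennreal_leI[OF elim] show ?case
        by (simp only: ennreal_mult[symmetric] ennreal_plus[symmetric] zero_le_power2 zero_le_power norm_ge_zero
            mult_nonneg_nonneg add_nonneg_nonneg zero_le_numeral)
    qed
  qed
  also have "\<dots> = ennreal ?a * (\<integral>\<^sup>+\<omega>. ennreal ((norm (Y s \<omega>))\<^sup>2) \<partial>M) + ennreal (24 * \<epsilon>\<^sup>2) * (\<integral>\<^sup>+\<omega>. ennreal ((Y s \<omega> \<bullet> P \<omega>)\<^sup>2) \<partial>M)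
     + ennreal 3 * (\<integral>\<^sup>+\<omega>. ennreal (norm (Y t \<omega> - Y s \<omega>) ^ 4) \<partial>M) + ennreal (3 * rate\<^sup>2 * ?d\<^sup>2)"
    by (subst nn_integral_add nn_integral_cmult; (simp; fail)?)+ (simp add: emeasure_space_1)
  also have "\<dots> \<le> ennreal ?a * ennreal (2 * cY T * T + 2) + ennreal (24 * \<epsilon>\<^sup>2) * ennreal ((1 + \<alpha>)\<^sup>2 * cY T * ?d\<^sup>2)
     + ennreal 3 * ennreal (cY T * sqrt ?d ^ 4) + ennreal (3 * rate\<^sup>2 * ?d\<^sup>2)"
    using st by (intro add_mono mult_left_mono nn_Y_norm_sq nn_Y_inner_P[OF Pn] nn_increment_norm_moment) auto
  also have "\<dots> = ennreal (cD T * ?d\<^sup>2)"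
  proof -
    have "sqrt ?d ^ 4 = ((sqrt ?d)\<^sup>2)\<^sup>2" by simp
    then have s4: "sqrt ?d ^ 4 = ?d\<^sup>2" using st by simp
    have "0 \<le> cY T" using cY_ge_1[of T] by simp
    then have "ennreal ?a * ennreal (2 * cY T * T + 2) + ennreal (24 * \<epsilon>\<^sup>2) * ennreal ((1 + \<alpha>)\<^sup>2 * cY T * ?d\<^sup>2)
     + ennreal 3 * ennreal (cY T * ?d\<^sup>2) + ennreal (3 * rate\<^sup>2 * ?d\<^sup>2)
     = ennreal (?a * (2 * cY T * T + 2) + 24 * \<epsilon>\<^sup>2 * ((1 + \<alpha>)\<^sup>2 * cY T * ?d\<^sup>2) + 3 * (cY T * ?d\<^sup>2) + 3 * rate\<^sup>2 * ?d\<^sup>2)"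
      using st'(2) by (subst ennreal_mult[symmetric] ennreal_plus[symmetric]; (simp; fail)?)+
    then show ?thesis unfolding s4 by (simp add: cD_def algebra_simps)
  qed
  finally show ?thesis .
qed

end

section \<open>The norm of the solution is deterministic\<close>

lemma cos_taylor_ge: "cos x - sin x * h - h\<^sup>2 / 2 \<le> cos (x + h)" for x h :: real
proof (cases "h = 0")
  case False
  define D where "D m = (if m = 0 then cos else if m = 1 then (\<lambda>x. - sin x) else (\<lambda>x. - cos x) :: real \<Rightarrow> real)" for m :: nat
  have "\<exists>t. (if x + h < x then x + h < t \<and> t < x else x < t \<and> t < x + h) \<and>
      cos (x + h) = (\<Sum>m<2. (D m x / fact m) * ((x + h) - x) ^ m) + (D 2 t / fact 2) * ((x + h) - x) ^ 2"
  proof (rule Taylor[where a = "min x (x + h)" and b = "max x (x + h)"])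
    show "\<forall>m t. m < 2 \<and> min x (x + h) \<le> t \<and> t \<le> max x (x + h) \<longrightarrow> DERIV (D m) t :> D (Suc m) t"
      by (auto simp: D_def numeral_eq_Suc less_Suc_eq intro!: derivative_eq_intros)
  qed (use False in \<open>auto simp: D_def min_def max_def\<close>)
  then obtain t where "cos (x + h) = (\<Sum>m<2. (D m x / fact m) * h ^ m) + (D 2 t / fact 2) * h ^ 2" by auto
  then have "cos (x + h) = cos x - sin x * h - cos t * h\<^sup>2 / 2" by (simp add: D_def numeral_eq_Suc)
  moreover have "cos t * h\<^sup>2 \<le> 1 * h\<^sup>2" by (intro mult_right_mono) auto
  ultimately show ?thesis by simp
qed simp

context spin_diffusion begin

lemma drift_part_deviation_PT:
  assumes P: "noise_of s t P" and st: "0 \<le> s" "s \<le> t" and V: "V \<in> borel_measurable M" and c: "c \<in> borel_measurable M"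
  shows "(\<integral>\<^sup>+\<omega>. ennreal \<bar>drift_part s t P \<omega> \<bullet> V \<omega> - c \<omega> * (t - s)\<bar> \<partial>M)
    \<le> (\<integral>\<^sup>+p. ennreal \<bar>spin_drift b \<alpha> (\<mu> (snd p) (fst p)) \<bullet> V (fst p) - c (fst p)\<bar> \<partial>PT s t)"
proof -
  have m: "(\<lambda>p. spin_drift b \<alpha> (\<mu> (snd p) (fst p)) \<bullet> V (fst p) - c (fst p)) \<in> borel_measurable (PT s t)"
    using st by (intro borel_measurable_diff borel_measurable_inner measurable_compose[OF \<mu>_measurable_PT spin_drift_measurable]
      measurable_compose[OF measurable_fst V] measurable_compose[OF measurable_fst c])
  have m': "(\<lambda>p. ennreal \<bar>spin_drift b \<alpha> (\<mu> (snd p) (fst p)) \<bullet> V (fst p) - c (fst p)\<bar>) \<in> borel_measurable (PT s t)"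
    by (rule measurable_compose[OF m, where g = "\<lambda>x. ennreal \<bar>x\<bar>"]) simp
  show ?thesis
    using drift_part_deviation[OF P st, of V c] unfolding nn_integral_PT[OF m'] by simp
qed

text \<open>The drift is orthogonal to \<open>Y\<close> as well, so that its effect on \<open>|Y|\<^sup>2\<close> is of smaller order.\<close>

lemma nn_Y_inner_drift_part:
  assumes P: "noise_of s t P" and st: "0 \<le> s" "s < t" "t \<le> T"
  shows "(\<integral>\<^sup>+\<omega>. ennreal \<bar>drift_part s t P \<omega> \<bullet> Y s \<omega>\<bar> \<partial>M) \<le> ennreal (c0 * cY T * ((t - s) * sqrt (t - s)))"
proof -
  have st': "s \<le> t" using st by simp
  let ?x = "\<lambda>p. norm (cross3 (\<mu> (snd p) (fst p)) (Y s (fst p))) ^ 1"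
  have "(\<integral>\<^sup>+\<omega>. ennreal \<bar>drift_part s t P \<omega> \<bullet> Y s \<omega>\<bar> \<partial>M)
    \<le> (\<integral>\<^sup>+p. ennreal \<bar>spin_drift b \<alpha> (\<mu> (snd p) (fst p)) \<bullet> Y s (fst p)\<bar> \<partial>PT s t)"
    using drift_part_deviation_PT[OF P st(1) st' Y_measurable[OF st(1)], of "\<lambda>_. 0"] by simp
  also have "\<dots> \<le> (\<integral>\<^sup>+p. ennreal c0 * ennreal (?x p) \<partial>PT s t)"
  proof (rule nn_integral_mono)
    fix p assume "p \<in> space (PT s t)"
    then have "norm (\<mu> (snd p) (fst p)) \<le> 1" using st by (intro norm_\<mu>_le) (auto simp: space_PT)
    then have "\<bar>spin_drift b \<alpha> (\<mu> (snd p) (fst p)) \<bullet> Y s (fst p)\<bar> \<le> c0 * ?x p"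
      using abs_spin_drift_inner_le[of "\<mu> (snd p) (fst p)" \<alpha> b "Y s (fst p)"] \<alpha>_pos by (simp add: c0_def)
    then show "ennreal \<bar>spin_drift b \<alpha> (\<mu> (snd p) (fst p)) \<bullet> Y s (fst p)\<bar> \<le> ennreal c0 * ennreal (?x p)"
      using c0_nonneg by (simp add: ennreal_mult[symmetric] ennreal_leI)
  qed
  also have "\<dots> = ennreal c0 * (\<integral>\<^sup>+p. ennreal (?x p) \<partial>PT s t)"
  proof (rule nn_integral_cmult)
    have "(\<lambda>p. cross3 (\<mu> (snd p) (fst p)) (Y s (fst p))) \<in> borel_measurable (PT s t)"
      using st by (intro cross_measurable \<mu>_measurable_PT measurable_compose[OF measurable_fst Y_measurable]) auto
    then show "(\<lambda>p. ennreal (?x p)) \<in> borel_measurable (PT s t)"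
      by (rule measurable_compose[where g = "\<lambda>x. ennreal (norm x ^ 1)"]) simp
  qed
  also have "\<dots> \<le> ennreal c0 * ennreal (cY T * sqrt (t - s) ^ 1 * (t - s))"
    by (intro mult_left_mono nn_cross_\<mu>_Y st) auto
  also have "\<dots> = ennreal (c0 * (cY T * sqrt (t - s) ^ 1 * (t - s)))"
    using c0_nonneg cY_ge_1[of T] st by (intro ennreal_mult[symmetric]) auto
  finally show ?thesis by (simp add: mult_ac)
qed

lemma integrable_bounded_noise_PT:
  assumes st: "0 \<le> s" "s \<le> t" and \<psi>: "\<psi> \<in> borel_measurable M" "\<And>\<omega>. \<omega> \<in> space M \<Longrightarrow> \<bar>\<psi> \<omega>\<bar> \<le> K"
    and V: "V \<in> borel_measurable M" "\<And>\<omega>. \<omega> \<in> space M \<Longrightarrow> norm (V \<omega>) \<le> B"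
  shows "integrable (PT s t) (\<lambda>p. \<psi> (fst p) * (norm (spin_noise \<alpha> (\<mu> (snd p) (fst p)) (V (fst p))))\<^sup>2)"
proof -
  interpret P: finite_measure "PT s t" by (rule finite_measure_PT)
  have \<psi>': "(\<lambda>p. \<psi> (fst p)) \<in> borel_measurable (PT s t)" by (rule measurable_compose[OF measurable_fst \<psi>(1)])
  have V': "(\<lambda>p. V (fst p)) \<in> borel_measurable (PT s t)" by (rule measurable_compose[OF measurable_fst V(1)])
  have m: "(\<lambda>p. spin_noise \<alpha> (\<mu> (snd p) (fst p)) (V (fst p))) \<in> borel_measurable (PT s t)"
    unfolding spin_noise_def using st V'
    by (intro borel_measurable_diff borel_measurable_scaleR borel_measurable_const cross_measurable \<mu>_measurable_PT)
  have "square_integrable (PT s t) (\<lambda>p. spin_noise \<alpha> (\<mu> (snd p) (fst p)) (V (fst p)))"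
  proof (rule P.square_integrable_bounded[OF m, where B = "(1 + \<alpha>) * B"])
    fix p assume p: "p \<in> space (PT s t)"
    then have m1: "norm (\<mu> (snd p) (fst p)) \<le> 1" using st by (intro norm_\<mu>_le) (auto simp: space_PT)
    have "norm (cross3 (\<mu> (snd p) (fst p)) (V (fst p))) \<le> 1 * B"
      using norm_cross3_le[of "\<mu> (snd p) (fst p)" "V (fst p)"] p V(2)[of "fst p"] m1
        mult_mono[OF m1 V(2)[of "fst p"]] by (auto simp: space_PT)
    then have "(1 + \<alpha>) * norm (cross3 (\<mu> (snd p) (fst p)) (V (fst p))) \<le> (1 + \<alpha>) * B"
      using \<alpha>_pos by (intro mult_left_mono) auto
    then show "norm (spin_noise \<alpha> (\<mu> (snd p) (fst p)) (V (fst p))) \<le> (1 + \<alpha>) * B"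
      using norm_spin_noise_le[OF m1, of \<alpha> "V (fst p)"] \<alpha>_pos by linarith
  qed
  then show ?thesis
    by (intro integrable_bdd_mult[OF _ \<psi>', where B = K]) (auto simp: square_integrable_def space_PT \<psi>(2))
qed

text \<open>The isometry, summed over the three coordinate directions.\<close>

lemma expectation_mult_norm_P_sq:
  assumes P: "noise s t P" and st: "0 \<le> s" "s < t" and \<phi>: "\<phi> \<in> borel_measurable (F s)" "\<And>\<omega>. \<omega> \<in> space M \<Longrightarrow> \<bar>\<phi> \<omega>\<bar> \<le> K"
  shows "integrable M (\<lambda>\<omega>. \<phi> \<omega> * (norm (P \<omega>))\<^sup>2)"
    "expectation (\<lambda>\<omega>. \<phi> \<omega> * (norm (P \<omega>))\<^sup>2) = 2 * (1 + \<alpha>\<^sup>2) * (t - s) * expectation \<phi>"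
proof -
  have st': "s \<le> t" using st by simp
  have \<phi>M: "\<phi> \<in> borel_measurable M" using \<phi>(1) by (rule measurable_F_imp)
  have \<phi>i: "integrable M \<phi>" using \<phi>M \<phi>(2) by (intro integrable_const_bound[of _ K]) auto
  have sq: "(norm x)\<^sup>2 = (\<Sum>i\<in>UNIV. ((axis i 1 :: real^3) \<bullet> x)\<^sup>2)" for x :: "real^3"
    unfolding power2_norm_eq_inner inner_vec_sum[of x] by (simp add: inner_axis' power2_eq_square)
  have i: "integrable M (\<lambda>\<omega>. \<phi> \<omega> * ((axis i 1 :: real^3) \<bullet> P \<omega>)\<^sup>2)" for i
    using P by (intro integrable_bdd_mult[OF _ \<phi>M \<phi>(2)]) (auto simp: noise_def square_integrable_def inner_axis')
  have eq: "(\<lambda>\<omega>. \<phi> \<omega> * (norm (P \<omega>))\<^sup>2) = (\<lambda>\<omega>. \<Sum>i\<in>UNIV. \<phi> \<omega> * ((axis i 1 :: real^3) \<bullet> P \<omega>)\<^sup>2)"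
    by (simp only: sq sum_distrib_left)
  show "integrable M (\<lambda>\<omega>. \<phi> \<omega> * (norm (P \<omega>))\<^sup>2)" unfolding eq using i by (rule Bochner_Integration.integrable_sum)
  let ?g = "\<lambda>i p. \<phi> (fst p) * (norm (spin_noise \<alpha> (\<mu> (snd p) (fst p)) (axis i 1 :: real^3)))\<^sup>2"
  have gi: "integrable (PT s t) (?g i)" for i
    by (rule integrable_bounded_noise_PT[OF st(1) st' \<phi>M \<phi>(2), where V = "\<lambda>_. axis i 1" and B = 1]) auto
  interpret PS: pair_sigma_finite M "restrict_space lborel {s<..t}" by (rule pair_sigma_finite_PT)
  have "expectation (\<lambda>\<omega>. \<phi> \<omega> * (norm (P \<omega>))\<^sup>2) = (\<Sum>i\<in>UNIV. expectation (\<lambda>\<omega>. \<phi> \<omega> * ((axis i 1 :: real^3) \<bullet> P \<omega>)\<^sup>2))"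
    unfolding eq using i by (rule Bochner_Integration.integral_sum)
  also have "\<dots> = (\<Sum>i\<in>UNIV. \<integral>p. ?g i p \<partial>PT s t)"
  proof (rule sum.cong)
    fix i :: 3
    show "expectation (\<lambda>\<omega>. \<phi> \<omega> * ((axis i 1 :: real^3) \<bullet> P \<omega>)\<^sup>2) = (\<integral>p. ?g i p \<partial>PT s t)"
      by (rule noise_isometry[OF P \<phi>, where V = "\<lambda>_. axis i 1" and B = 1]) simp_all
  qed simp
  also have "\<dots> = (\<integral>p. (\<Sum>i\<in>UNIV. ?g i p) \<partial>PT s t)" using gi by (rule Bochner_Integration.integral_sum[symmetric])
  also have "\<dots> = (\<integral>p. \<phi> (fst p) * (2 * (1 + \<alpha>\<^sup>2)) \<partial>PT s t)"
  proof (rule integral_cong_AE)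
    show "AE p in PT s t. (\<Sum>i\<in>UNIV. ?g i p) = \<phi> (fst p) * (2 * (1 + \<alpha>\<^sup>2))"
      using AE_PT_fst[OF AE_good, of s t] AE_space
    proof eventually_elim
      case (elim p)
      then have "norm (\<mu> (snd p) (fst p)) = 1" using st by (intro good_\<mu>(2)) (auto simp: space_PT)
      from sum_norm_spin_noise_axis[OF this, of \<alpha>] show ?case by (simp add: sum_distrib_left[symmetric])
    qed
    show "(\<lambda>p. \<Sum>i\<in>UNIV. ?g i p) \<in> borel_measurable (PT s t)" using gi by auto
    show "(\<lambda>p. \<phi> (fst p) * (2 * (1 + \<alpha>\<^sup>2))) \<in> borel_measurable (PT s t)"
      by (intro borel_measurable_times measurable_compose[OF measurable_fst \<phi>M] borel_measurable_const)
  qed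
  also have "\<dots> = expectation \<phi> * (\<integral>r. 2 * (1 + \<alpha>\<^sup>2) \<partial>restrict_space lborel {s<..t})"
    using PS.integral_pair_mult(2)[OF \<phi>i, of "\<lambda>_. 2 * (1 + \<alpha>\<^sup>2)"] st
    by (simp add: integrable_restrict_space)
  also have "(\<integral>r. 2 * (1 + \<alpha>\<^sup>2) \<partial>restrict_space lborel {s<..t}) = 2 * (1 + \<alpha>\<^sup>2) * (t - s)"
    using st by (simp add: measure_restrict_space space_restrict_space)
  finally show "expectation (\<lambda>\<omega>. \<phi> \<omega> * (norm (P \<omega>))\<^sup>2) = 2 * (1 + \<alpha>\<^sup>2) * (t - s) * expectation \<phi>" by simp
qed

lemma expectation_mult_inner_P:
  assumes P: "noise s t P" and \<phi>: "\<phi> \<in> borel_measurable (F s)" "\<And>\<omega>. \<omega> \<in> space M \<Longrightarrow> \<bar>\<phi> \<omega>\<bar> \<le> K"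
    and V: "V \<in> borel_measurable (F s)" "square_integrable M V"
  shows "integrable M (\<lambda>\<omega>. \<phi> \<omega> * (V \<omega> \<bullet> P \<omega>))" "expectation (\<lambda>\<omega>. \<phi> \<omega> * (V \<omega> \<bullet> P \<omega>)) = 0"
proof -
  have eq: "(\<lambda>\<omega>. \<phi> \<omega> * (V \<omega> \<bullet> P \<omega>)) = (\<lambda>\<omega>. \<Sum>i\<in>UNIV. (\<phi> \<omega> * V \<omega> $ i) * P \<omega> $ i)"
    by (simp add: inner_vec_sum sum_distrib_left mult.assoc)
  have Vi: "(\<lambda>\<omega>. V \<omega> $ i) \<in> borel_measurable (F s)" for i by (rule measurable_compose[OF V(1) borel_measurable_nth])
  have sq: "square_integrable M (\<lambda>\<omega>. \<phi> \<omega> * V \<omega> $ i)" for i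
  proof -
    have "square_integrable M (\<lambda>\<omega>. V \<omega> $ i)"
      by (rule square_integrable_bound[OF V(2), where C = 1])
        (use measurable_F_imp[OF Vi] component_le_norm_cart in auto)
    from square_integrable_bdd_mult[OF this measurable_F_imp[OF \<phi>(1)] \<phi>(2)] show ?thesis by simp
  qed
  have m: "(\<lambda>\<omega>. \<phi> \<omega> * V \<omega> $ i) \<in> borel_measurable (F s)" for i using \<phi>(1) Vi by simp
  have i: "integrable M (\<lambda>\<omega>. (\<phi> \<omega> * V \<omega> $ i) * P \<omega> $ i)" for i
    using P by (intro square_integrable_mult sq) (simp add: noise_def)
  show "integrable M (\<lambda>\<omega>. \<phi> \<omega> * (V \<omega> \<bullet> P \<omega>))" unfolding eq using i by (rule Bochner_Integration.integrable_sum)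
  show "expectation (\<lambda>\<omega>. \<phi> \<omega> * (V \<omega> \<bullet> P \<omega>)) = 0"
    unfolding eq using i by (subst Bochner_Integration.integral_sum) (simp_all add: noise_mean_zero[OF P m sq])
qed

lemma sq_incr_integrable:
  assumes st: "0 \<le> s" "s < t"
  shows "square_integrable M (sq_incr s t)" "integrable M (sq_incr s t)"
proof -
  have "sq_incr s t \<in> borel_measurable M"
    unfolding sq_incr_def using Y_measurable[of s] Y_measurable[of t] st by simp
  then show "square_integrable M (sq_incr s t)"
    using nn_sq_incr_sq[OF st order_refl] by (intro square_integrable_nn) (auto intro: le_less_trans)
  then show "integrable M (sq_incr s t)" by (rule square_integrable_integrable)
qed

text \<open>A bound for the conditional mean of \<open>sq_incr\<close> on \<open>[0, T]\<close>, in units of \<open>(t - s)\<^bsup>3/2\<^esup>\<close>.\<close>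

definition cE :: "real \<Rightarrow> real" where
  "cE T = 2 * c0 * cY T + c0\<^sup>2 * sqrt T + 2 * \<epsilon> * c0 * (1 + c4)"

text \<open>The compensator \<open>rate * (t - s)\<close> cancels \<open>\<epsilon>\<^sup>2 |P|\<^sup>2\<close>, as the conditional mean of \<open>|P|\<^sup>2\<close> is exactly
  \<open>2 (1 + \<alpha>\<^sup>2) (t - s)\<close>.\<close>

lemma sq_incr_mean:
  assumes st: "0 \<le> s" "s < t" "t \<le> T" and \<phi>: "\<phi> \<in> borel_measurable (F s)" "\<And>\<omega>. \<omega> \<in> space M \<Longrightarrow> \<bar>\<phi> \<omega>\<bar> \<le> 1"
  shows "\<bar>expectation (\<lambda>\<omega>. \<phi> \<omega> * sq_incr s t \<omega>)\<bar> \<le> cE T * ((t - s) * sqrt (t - s))"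
proof -
  have st': "s \<le> t" "0 \<le> T" using st by auto
  obtain P where P: "noise_of s t P" using noise_exists[OF st(1) st'(1)] by (auto simp: noise_of_def)
  then have Pn: "noise s t P" by (simp add: noise_of_def)
  let ?d = "t - s"
  let ?A = "drift_part s t P"
  have \<phi>M: "\<phi> \<in> borel_measurable M" using \<phi>(1) by (rule measurable_F_imp)
  have \<phi>i: "integrable M \<phi>" using \<phi>M \<phi>(2) by (intro integrable_const_bound[of _ 1]) auto
  \<comment> \<open>The terms that involve the drift part; all of them are of order \<open>(t - s)\<^bsup>3/2\<^esup>\<close>.\<close>
  define R where "R \<omega> = 2 * (?A \<omega> \<bullet> Y s \<omega>) + (norm (?A \<omega>))\<^sup>2 - 2 * \<epsilon> * (?A \<omega> \<bullet> P \<omega>)" for \<omega>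
  have dec: "sq_incr s t \<omega> = R \<omega> - 2 * \<epsilon> * (Y s \<omega> \<bullet> P \<omega>) + (\<epsilon>\<^sup>2 * (norm (P \<omega>))\<^sup>2 - rate * ?d)" for \<omega>
    unfolding sq_incr_def R_def power2_norm_eq_inner
    by (simp add: inner_diff_left inner_diff_right inner_add_left inner_add_right inner_commute algebra_simps power2_eq_square)
  note P2 = expectation_mult_norm_P_sq[OF Pn st(1,2) \<phi>]
  note YP = expectation_mult_inner_P[OF Pn \<phi> Y_measurable_F[OF st(1)] Y_square_integrable[OF st(1)]]
  have \<phi>D: "integrable M (\<lambda>\<omega>. \<phi> \<omega> * sq_incr s t \<omega>)"
    by (rule integrable_bdd_mult[OF sq_incr_integrable(2)[OF st(1,2)] \<phi>M \<phi>(2)])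
  have one: "(\<lambda>_. 1 :: real) \<in> borel_measurable (F s)" by simp
  have Ri: "integrable M R"
  proof -
    have "integrable M (\<lambda>\<omega>. sq_incr s t \<omega> + 2 * \<epsilon> * (1 * (Y s \<omega> \<bullet> P \<omega>)) - (\<epsilon>\<^sup>2 * (1 * (norm (P \<omega>))\<^sup>2) - rate * ?d))"
      using sq_incr_integrable(2)[OF st(1,2)] expectation_mult_inner_P(1)[OF Pn one, of 1 "Y s"]
        expectation_mult_norm_P_sq(1)[OF Pn st(1,2) one, of 1] Y_measurable_F[OF st(1)] Y_square_integrable[OF st(1)]
      by simp
    then show ?thesis by (simp add: dec)
  qed
  have "expectation (\<lambda>\<omega>. \<phi> \<omega> * sq_incr s t \<omega>) = expectation (\<lambda>\<omega>. \<phi> \<omega> * R \<omega>)"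
  proof -
    have \<phi>R: "integrable M (\<lambda>\<omega>. \<phi> \<omega> * R \<omega>)" by (rule integrable_bdd_mult[OF Ri \<phi>M \<phi>(2)])
    have "(\<lambda>\<omega>. \<phi> \<omega> * sq_incr s t \<omega>) = (\<lambda>\<omega>. \<phi> \<omega> * R \<omega> - 2 * \<epsilon> * (\<phi> \<omega> * (Y s \<omega> \<bullet> P \<omega>))
       + (\<epsilon>\<^sup>2 * (\<phi> \<omega> * (norm (P \<omega>))\<^sup>2) - rate * ?d * \<phi> \<omega>))"
      by (simp add: dec algebra_simps)
    then show ?thesis using \<phi>R YP P2 \<phi>i by (simp add: rate_def)
  qed
  also have "\<bar>\<dots>\<bar> \<le> 1 * (cE T * (?d * sqrt ?d))"
  proof (rule abs_expectation_mult_le[OF Ri _ _ \<phi>M \<phi>(2)])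
    have [measurable]: "Y t \<in> borel_measurable M" "Y s \<in> borel_measurable M" using Y_measurable st by auto
    have [measurable]: "P \<in> borel_measurable M" by (rule norm_P_fourth(1)[OF Pn])
    have pos: "0 \<le> cY T" "0 \<le> c4" using cY_ge_1[of T] c4_nonneg by auto
    show "0 \<le> cE T * (?d * sqrt ?d)"
      unfolding cE_def using st st' c0_nonneg pos \<epsilon>_pos by (intro mult_nonneg_nonneg add_nonneg_nonneg) auto
    have "(\<integral>\<^sup>+\<omega>. ennreal \<bar>R \<omega>\<bar> \<partial>M) \<le> (\<integral>\<^sup>+\<omega>. ennreal 2 * ennreal \<bar>?A \<omega> \<bullet> Y s \<omega>\<bar> + ennreal ((c0 * ?d)\<^sup>2)
       + ennreal (2 * \<epsilon> * (c0 * ?d)) * ennreal (norm (P \<omega>) ^ 1) \<partial>M)"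
    proof (rule nn_integral_mono_AE)
      show "AE \<omega> in M. ennreal \<bar>R \<omega>\<bar> \<le> ennreal 2 * ennreal \<bar>?A \<omega> \<bullet> Y s \<omega>\<bar> + ennreal ((c0 * ?d)\<^sup>2)
       + ennreal (2 * \<epsilon> * (c0 * ?d)) * ennreal (norm (P \<omega>) ^ 1)"
        using norm_drift_part_le[OF P st(1) st'(1)]
      proof eventually_elim
        case (elim \<omega>)
        have cd: "0 \<le> c0 * ?d" using c0_nonneg st by simp
        have 1: "(norm (?A \<omega>))\<^sup>2 \<le> (c0 * ?d)\<^sup>2" using elim by (intro power_mono) auto
        have "\<bar>?A \<omega> \<bullet> P \<omega>\<bar> \<le> (c0 * ?d) * norm (P \<omega>)"
          using Cauchy_Schwarz_ineq2[of "?A \<omega>" "P \<omega>"] mult_right_mono[OF elim norm_ge_zero[of "P \<omega>"]] by linarith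
        then have 2: "2 * \<epsilon> * \<bar>?A \<omega> \<bullet> P \<omega>\<bar> \<le> 2 * \<epsilon> * ((c0 * ?d) * norm (P \<omega>))"
          using \<epsilon>_pos by (intro mult_left_mono) auto
        have "\<bar>R \<omega>\<bar> \<le> 2 * \<bar>?A \<omega> \<bullet> Y s \<omega>\<bar> + (norm (?A \<omega>))\<^sup>2 + 2 * \<epsilon> * \<bar>?A \<omega> \<bullet> P \<omega>\<bar>"
        proof -
          have "\<bar>x + y - z\<bar> \<le> \<bar>x\<bar> + \<bar>y\<bar> + \<bar>z\<bar>" for x y z :: real by linarith
          from this[of "2 * (?A \<omega> \<bullet> Y s \<omega>)" "(norm (?A \<omega>))\<^sup>2" "2 * \<epsilon> * (?A \<omega> \<bullet> P \<omega>)"] show ?thesis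
            using \<epsilon>_pos by (simp add: R_def abs_mult)
        qed
        also have "\<dots> \<le> 2 * \<bar>?A \<omega> \<bullet> Y s \<omega>\<bar> + (c0 * ?d)\<^sup>2 + 2 * \<epsilon> * (c0 * ?d) * norm (P \<omega>) ^ 1"
          using 1 2 by (simp add: mult.assoc)
        finally have "ennreal \<bar>R \<omega>\<bar> \<le> ennreal (2 * \<bar>?A \<omega> \<bullet> Y s \<omega>\<bar> + (c0 * ?d)\<^sup>2 + 2 * \<epsilon> * (c0 * ?d) * norm (P \<omega>) ^ 1)"
          by (rule ennreal_leI)
        also have "\<dots> = ennreal 2 * ennreal \<bar>?A \<omega> \<bullet> Y s \<omega>\<bar> + ennreal ((c0 * ?d)\<^sup>2)
           + ennreal (2 * \<epsilon> * (c0 * ?d)) * ennreal (norm (P \<omega>) ^ 1)"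
          using cd \<epsilon>_pos by (subst ennreal_mult[symmetric] ennreal_plus[symmetric]; (simp; fail)?)+ 
        finally show ?case .
      qed
    qed
    also have "\<dots> = ennreal 2 * (\<integral>\<^sup>+\<omega>. ennreal \<bar>?A \<omega> \<bullet> Y s \<omega>\<bar> \<partial>M) + ennreal ((c0 * ?d)\<^sup>2)
       + ennreal (2 * \<epsilon> * (c0 * ?d)) * (\<integral>\<^sup>+\<omega>. ennreal (norm (P \<omega>) ^ 1) \<partial>M)"
      by (subst nn_integral_add nn_integral_cmult; (simp; fail)?)+ (simp add: emeasure_space_1)
    also have "\<dots> \<le> ennreal 2 * ennreal (c0 * cY T * (?d * sqrt ?d)) + ennreal ((c0 * ?d)\<^sup>2)
       + ennreal (2 * \<epsilon> * (c0 * ?d)) * ennreal ((1 + c4) * sqrt ?d ^ 1)"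
      using st by (intro add_mono mult_left_mono nn_Y_inner_drift_part[OF P] nn_P_moment[OF Pn]) auto
    also have "\<dots> = ennreal (2 * (c0 * cY T * (?d * sqrt ?d)) + (c0 * ?d)\<^sup>2 + 2 * \<epsilon> * (c0 * ?d) * ((1 + c4) * sqrt ?d ^ 1))"
      using c0_nonneg pos \<epsilon>_pos st by (subst ennreal_mult[symmetric] ennreal_plus[symmetric]; (simp; fail)?)+
    also have "\<dots> \<le> ennreal (cE T * (?d * sqrt ?d))"
    proof (rule ennreal_leI)
      have "?d = sqrt ?d * sqrt ?d" using st by simp
      have "sqrt ?d \<le> sqrt T" using st by simp
      then have "?d * sqrt ?d * sqrt ?d \<le> ?d * sqrt ?d * sqrt T" using st by (intro mult_left_mono) auto
      then have "?d\<^sup>2 \<le> ?d * sqrt ?d * sqrt T" using st by (simp add: power2_eq_square)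
      then have "c0\<^sup>2 * ?d\<^sup>2 \<le> c0\<^sup>2 * (?d * sqrt ?d * sqrt T)" by (intro mult_left_mono) auto
      then have "2 * (c0 * cY T * (?d * sqrt ?d)) + (c0 * ?d)\<^sup>2 + 2 * \<epsilon> * (c0 * ?d) * ((1 + c4) * sqrt ?d ^ 1) \<le> cE T * (?d * sqrt ?d)"
      proof -
        have "2 * (c0 * c * (d * S)) + (c0 * d)\<^sup>2 + 2 * \<epsilon> * (c0 * d) * ((1 + c4) * S ^ 1)
          \<le> (2 * c0 * c + c0\<^sup>2 * q + 2 * \<epsilon> * c0 * (1 + c4)) * (d * S)"
          if "c0\<^sup>2 * d\<^sup>2 \<le> c0\<^sup>2 * (d * S * q)" for c d S q :: real
          using that by (simp add: power_mult_distrib algebra_simps)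
        from this[OF \<open>c0\<^sup>2 * ?d\<^sup>2 \<le> c0\<^sup>2 * (?d * sqrt ?d * sqrt T)\<close>] show ?thesis unfolding cE_def .
      qed
      then show "2 * (c0 * cY T * (?d * sqrt ?d)) + (c0 * ?d)\<^sup>2 + 2 * \<epsilon> * (c0 * ?d) * ((1 + c4) * sqrt ?d ^ 1) \<le> cE T * (?d * sqrt ?d)" .
    qed
    finally show "(\<integral>\<^sup>+\<omega>. ennreal \<bar>R \<omega>\<bar> \<partial>M) \<le> ennreal (cE T * (?d * sqrt ?d))" .
  qed simp_all
  finally show ?thesis by simp
qed

text \<open>The compensated process. It has neither drift nor quadratic variation, so that the expectation of
  \<open>1 - cos (l Z)\<close> does not grow. The cosine takes the place of the square because its derivative,
  the weight in \<open>sq_incr_mean\<close>, is bounded.\<close>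

definition Z :: "real \<Rightarrow> 'a \<Rightarrow> real" where "Z t \<omega> = (norm (Y t \<omega>))\<^sup>2 - 1 - rate * t"

lemma Z_diff: "Z t \<omega> = Z s \<omega> + sq_incr s t \<omega>"
  by (simp add: Z_def sq_incr_def algebra_simps)

lemma Z_measurable_F: "0 \<le> t \<Longrightarrow> Z t \<in> borel_measurable (F t)"
  unfolding Z_def using Y_measurable_F[of t] by simp

lemma integrable_one_minus_cos_Z:
  assumes "0 \<le> t" shows "integrable M (\<lambda>\<omega>. 1 - cos (l * Z t \<omega>))"
proof (rule integrable_const_bound[of _ 2])
  show "AE \<omega> in M. norm (1 - cos (l * Z t \<omega>)) \<le> 2"
  proof (rule AE_I2)
    fix \<omega>
    show "norm (1 - cos (l * Z t \<omega>)) \<le> 2"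
      using cos_ge_minus_one[of "l * Z t \<omega>"] cos_le_one[of "l * Z t \<omega>"] by (simp add: abs_le_iff)
  qed
  show "(\<lambda>\<omega>. 1 - cos (l * Z t \<omega>)) \<in> borel_measurable M"
    using measurable_F_imp[OF Z_measurable_F[OF assms]] by simp
qed

lemma cos_Z_step:
  assumes st: "0 \<le> s" "s < t" "t \<le> T"
  shows "expectation (\<lambda>\<omega>. 1 - cos (l * Z t \<omega>)) \<le> expectation (\<lambda>\<omega>. 1 - cos (l * Z s \<omega>))
    + (\<bar>l\<bar> * cE T + l\<^sup>2 * cD T * sqrt T) * (t - s) * sqrt (t - s)"
proof -
  have [measurable]: "Z t \<in> borel_measurable M" "Z s \<in> borel_measurable M"
    using Z_measurable_F[of t] Z_measurable_F[of s] st by (auto intro: measurable_F_imp)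
  note D = sq_incr_integrable[OF st(1,2)]
  have sF: "(\<lambda>\<omega>. sin (l * Z s \<omega>)) \<in> borel_measurable (F s)" using Z_measurable_F[OF st(1)] by simp
  have i1: "integrable M (\<lambda>\<omega>. 1 - cos (l * Z r \<omega>))" if "r \<in> {s, t}" for r
    using that st by (intro integrable_one_minus_cos_Z) auto
  have i2: "integrable M (\<lambda>\<omega>. sin (l * Z s \<omega>) * sq_incr s t \<omega>)"
    by (rule integrable_bdd_mult[OF D(2) measurable_F_imp[OF sF], of 1]) simp
  have i3: "integrable M (\<lambda>\<omega>. (sq_incr s t \<omega>)\<^sup>2)" using D(1) by (simp add: square_integrable_def)
  have "expectation (\<lambda>\<omega>. 1 - cos (l * Z t \<omega>)) \<le> expectation (\<lambda>\<omega>. (1 - cos (l * Z s \<omega>)) + l * (sin (l * Z s \<omega>) * sq_incr s t \<omega>)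
      + l\<^sup>2 / 2 * (sq_incr s t \<omega>)\<^sup>2)"
  proof (rule integral_mono)
    show "1 - cos (l * Z t \<omega>) \<le> (1 - cos (l * Z s \<omega>)) + l * (sin (l * Z s \<omega>) * sq_incr s t \<omega>) + l\<^sup>2 / 2 * (sq_incr s t \<omega>)\<^sup>2" for \<omega>
      using cos_taylor_ge[of "l * Z s \<omega>" "l * sq_incr s t \<omega>"] unfolding Z_diff[of t \<omega> s]
      by (simp add: distrib_left power_mult_distrib mult.assoc mult.left_commute[of l "sin (l * Z s \<omega>)"])
  qed (use i1 i2 i3 in simp_all)
  also have "\<dots> = expectation (\<lambda>\<omega>. 1 - cos (l * Z s \<omega>)) + l * expectation (\<lambda>\<omega>. sin (l * Z s \<omega>) * sq_incr s t \<omega>)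
      + l\<^sup>2 / 2 * expectation (\<lambda>\<omega>. (sq_incr s t \<omega>)\<^sup>2)"
    using i1[of s] i2 i3 by simp
  also have "\<dots> \<le> expectation (\<lambda>\<omega>. 1 - cos (l * Z s \<omega>)) + \<bar>l\<bar> * (cE T * ((t - s) * sqrt (t - s))) + l\<^sup>2 * (cD T * ((t - s) * sqrt (t - s) * sqrt T))"
  proof (intro add_mono order_refl)
    have "l * expectation (\<lambda>\<omega>. sin (l * Z s \<omega>) * sq_incr s t \<omega>) \<le> \<bar>l\<bar> * \<bar>expectation (\<lambda>\<omega>. sin (l * Z s \<omega>) * sq_incr s t \<omega>)\<bar>"
      by (simp only: abs_mult[symmetric] abs_ge_self)
    also have "\<dots> \<le> \<bar>l\<bar> * (cE T * ((t - s) * sqrt (t - s)))"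
      using sq_incr_mean[OF st sF] by (intro mult_left_mono) auto
    finally show "l * expectation (\<lambda>\<omega>. sin (l * Z s \<omega>) * sq_incr s t \<omega>) \<le> \<bar>l\<bar> * (cE T * ((t - s) * sqrt (t - s)))" .
    have cD0: "0 \<le> cD T" using cY_ge_1[of T] c0_nonneg st unfolding cD_def
      by (intro add_nonneg_nonneg mult_nonneg_nonneg) auto
    have "ennreal (expectation (\<lambda>\<omega>. (sq_incr s t \<omega>)\<^sup>2)) \<le> ennreal (cD T * (t - s)\<^sup>2)"
      using nn_sq_incr_sq[OF st] nn_integral_sq_eq[OF D(1)] by simp
    then have "expectation (\<lambda>\<omega>. (sq_incr s t \<omega>)\<^sup>2) \<le> cD T * (t - s)\<^sup>2"
      using cD0 by (subst (asm) ennreal_le_iff) auto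
    also have "(t - s)\<^sup>2 = (t - s) * sqrt (t - s) * sqrt (t - s)" using st by (simp add: power2_eq_square)
    also have "cD T * \<dots> \<le> cD T * ((t - s) * sqrt (t - s) * sqrt T)"
      using cD0 st by (intro mult_left_mono) auto
    finally have "l\<^sup>2 * expectation (\<lambda>\<omega>. (sq_incr s t \<omega>)\<^sup>2) \<le> l\<^sup>2 * (cD T * ((t - s) * sqrt (t - s) * sqrt T))"
      by (rule mult_left_mono) simp
    moreover have "0 \<le> l\<^sup>2 * expectation (\<lambda>\<omega>. (sq_incr s t \<omega>)\<^sup>2)" by simp
    ultimately show "l\<^sup>2 / 2 * expectation (\<lambda>\<omega>. (sq_incr s t \<omega>)\<^sup>2) \<le> l\<^sup>2 * (cD T * ((t - s) * sqrt (t - s) * sqrt T))" by linarith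
  qed
  finally show ?thesis by (simp add: algebra_simps)
qed

lemma cos_Z:
  assumes T: "0 \<le> T"
  shows "AE \<omega> in M. cos (l * Z T \<omega>) = 1"
proof -
  have "expectation (\<lambda>\<omega>. 1 - cos (l * Z T \<omega>)) \<le> expectation (\<lambda>\<omega>. 1 - cos (l * Z 0 \<omega>))"
    by (rule le_of_three_halves_increments[OF T]) (rule cos_Z_step)
  also have "\<dots> = expectation (\<lambda>\<omega>. 0)"
  proof (rule integral_cong_AE)
    show "AE \<omega> in M. 1 - cos (l * Z 0 \<omega>) = 0"
      using AE_good by eventually_elim (simp add: good_def Z_def norm_y)
    show "(\<lambda>\<omega>. 1 - cos (l * Z 0 \<omega>)) \<in> borel_measurable M"
      using measurable_F_imp[OF Z_measurable_F[of 0]] by simp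
  qed simp
  finally have "expectation (\<lambda>\<omega>. 1 - cos (l * Z T \<omega>)) \<le> 0" by simp
  moreover have "0 \<le> expectation (\<lambda>\<omega>. 1 - cos (l * Z T \<omega>))"
    by (rule Bochner_Integration.integral_nonneg) simp
  ultimately have "expectation (\<lambda>\<omega>. 1 - cos (l * Z T \<omega>)) = 0" by simp
  then have "AE \<omega> in M. 1 - cos (l * Z T \<omega>) = 0"
    using integral_nonneg_eq_0_iff_AE[OF integrable_one_minus_cos_Z[OF T]] by simp
  then show ?thesis by eventually_elim simp
qed

text \<open>The cosine of \<open>l Z\<close> is \<open>1\<close> for all \<open>l = 1 / (n + 1)\<close>, and some of these are so small that \<open>l Z\<close> lies
  in \<open>(-\<pi>, \<pi>)\<close>.\<close>

lemma norm_Y_at: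
  assumes T: "0 \<le> T"
  shows "AE \<omega> in M. (norm (Y T \<omega>))\<^sup>2 = 1 + rate * T"
proof -
  have "AE \<omega> in M. \<forall>n. cos (1 / real (Suc n) * Z T \<omega>) = 1"
    using cos_Z[OF T] by (subst AE_all_countable) blast
  then show ?thesis
  proof eventually_elim
    case (elim \<omega>)
    obtain n where n: "\<bar>Z T \<omega>\<bar> < real (Suc n)" 
    proof -
      obtain m where "\<bar>Z T \<omega>\<bar> < real m" using reals_Archimedean2 by blast
      then show thesis by (intro that[of m]) simp
    qed
    let ?z = "1 / real (Suc n) * Z T \<omega>"
    have z: "\<bar>?z\<bar> < 1" using n by (simp add: abs_mult field_simps)
    have "sin ?z = 0" using elim sin_cos_squared_add[of ?z] by simp
    moreover have "- pi < ?z" "?z < pi" using z pi_gt3 by linarith+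
    ultimately have "?z = 0" using sin_eq_0_pi by blast
    then have "Z T \<omega> = 0" by simp
    then show ?case by (simp add: Z_def)
  qed
qed

text \<open>The radius at time \<open>t\<close>.\<close>

definition R :: "real \<Rightarrow> real" where "R t = sqrt (1 + rate * t)"

lemma norm_Y: "AE \<omega> in M. \<forall>t\<ge>0. norm (Y t \<omega>) = R t"
proof -
  have "AE \<omega> in M. \<forall>q\<in>\<rat> \<inter> {0..}. (norm (Y q \<omega>))\<^sup>2 = 1 + rate * q"
    by (subst AE_ball_countable) (auto intro: norm_Y_at simp: countable_rat)
  then show ?thesis
    using AE_space
  proof eventually_elim
    case (elim \<omega>)
    have "(norm (Y t \<omega>))\<^sup>2 - (1 + rate * t) = 0" if t: "0 \<le> t" for t
    proof -
      have "continuous_on {0..} (\<lambda>t. (norm (Y t \<omega>))\<^sup>2 - (1 + rate * t))"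
        by (intro continuous_intros continuous_on_Y[OF elim(2)])
      moreover note closure_Rats_atLeast[of 0]
      ultimately show ?thesis
        using continuous_constant_on_closure[of "\<rat> \<inter> {0..}" "\<lambda>t. (norm (Y t \<omega>))\<^sup>2 - (1 + rate * t)" 0 t] elim(1) t by auto
    qed
    then show ?case by (auto simp: R_def intro!: real_sqrt_unique[symmetric])
  qed
qed

end

section \<open>The component of the solution along the field\<close>

lemma abs_power2_diff_le:
  fixes x y :: real
  assumes "\<bar>x\<bar> \<le> 1" "\<bar>y\<bar> \<le> 1"
  shows "\<bar>x\<^sup>2 - y\<^sup>2\<bar> \<le> 2 * \<bar>x - y\<bar>"
proof -
  have "\<bar>x\<^sup>2 - y\<^sup>2\<bar> = \<bar>x + y\<bar> * \<bar>x - y\<bar>" by (simp add: abs_mult[symmetric] power2_eq_square algebra_simps)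
  also have "\<dots> \<le> 2 * \<bar>x - y\<bar>" using assms by (intro mult_right_mono) auto
  finally show ?thesis .
qed

context spin_diffusion begin

lemma AE_norm_Y_at: "0 \<le> t \<Longrightarrow> AE \<omega> in M. norm (Y t \<omega>) = R t"
  using norm_Y by eventually_elim auto

lemma R_ge_1: "0 \<le> t \<Longrightarrow> 1 \<le> R t"
  using rate_pos by (simp add: R_def)

lemma R_mono: "s \<le> t \<Longrightarrow> R s \<le> R t"
  using rate_pos by (simp add: R_def)

lemma nn_\<mu>_diff:
  assumes st: "0 \<le> s" "s < t" "t \<le> T"
  shows "(\<integral>\<^sup>+p. ennreal (norm (\<mu> (snd p) (fst p) - \<mu> s (fst p))) \<partial>PT s t) \<le> ennreal (2 * cY T * ((t - s) * sqrt (t - s)))"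
proof -
  have m: "(\<lambda>p. \<mu> (snd p) (fst p) - \<mu> s (fst p)) \<in> borel_measurable (PT s t)"
    using st by (intro borel_measurable_diff \<mu>_measurable_PT measurable_compose[OF measurable_fst \<mu>_measurable]) auto
  have "(\<integral>\<^sup>+p. ennreal (norm (\<mu> (snd p) (fst p) - \<mu> s (fst p))) \<partial>PT s t) \<le> ennreal (2 * (cY T * sqrt (t - s) ^ 1) * (t - s))"
  proof (rule nn_integral_PT_le)
    show "(\<lambda>p. ennreal (norm (\<mu> (snd p) (fst p) - \<mu> s (fst p)))) \<in> borel_measurable (PT s t)"
      by (rule measurable_compose[OF m, where g = "\<lambda>x. ennreal (norm x)"]) simp
    show "0 \<le> 2 * (cY T * sqrt (t - s) ^ 1)" using cY_ge_1[of T] st by simp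
    fix r assume r: "s < r" "r \<le> t"
    then have r0: "0 \<le> r" using st by simp
    have m': "(\<lambda>\<omega>. ennreal (norm (Y r \<omega> - Y s \<omega>) ^ 1)) \<in> borel_measurable M"
      using Y_measurable[OF r0] Y_measurable[OF st(1)] by simp
    have "(\<integral>\<^sup>+\<omega>. ennreal (norm (\<mu> r \<omega> - \<mu> s \<omega>)) \<partial>M) \<le> (\<integral>\<^sup>+\<omega>. ennreal 2 * ennreal (norm (Y r \<omega> - Y s \<omega>) ^ 1) \<partial>M)"
    proof (rule nn_integral_mono_AE)
      show "AE \<omega> in M. ennreal (norm (\<mu> r \<omega> - \<mu> s \<omega>)) \<le> ennreal 2 * ennreal (norm (Y r \<omega> - Y s \<omega>) ^ 1)"
        using AE_good AE_norm_Y_at[OF st(1)]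
      proof eventually_elim
        case (elim \<omega>)
        have y1: "1 \<le> norm (Y s \<omega>)" using R_ge_1[OF st(1)] elim by simp
        have mr: "norm (\<mu> r \<omega>) = 1" using good_\<mu>(2)[OF elim(1) r0] .
        have "norm (Y s \<omega>) *\<^sub>R (\<mu> r \<omega> - \<mu> s \<omega>) = norm (Y s \<omega>) *\<^sub>R \<mu> r \<omega> - Y s \<omega>"
          using good_\<mu>(3)[OF elim(1) st(1)] by (simp add: scaleR_diff_right)
        also have "\<dots> = (norm (Y s \<omega>) - norm (Y r \<omega>)) *\<^sub>R \<mu> r \<omega> + (Y r \<omega> - Y s \<omega>)"
          using good_\<mu>(3)[OF elim(1) r0] by (simp add: scaleR_diff_left)
        finally have "norm (Y s \<omega>) * norm (\<mu> r \<omega> - \<mu> s \<omega>) = norm ((norm (Y s \<omega>) - norm (Y r \<omega>)) *\<^sub>R \<mu> r \<omega> + (Y r \<omega> - Y s \<omega>))"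
          by (metis abs_norm_cancel norm_scaleR)
        also have "\<dots> \<le> \<bar>norm (Y s \<omega>) - norm (Y r \<omega>)\<bar> + norm (Y r \<omega> - Y s \<omega>)"
          using norm_triangle_ineq[of "(norm (Y s \<omega>) - norm (Y r \<omega>)) *\<^sub>R \<mu> r \<omega>" "Y r \<omega> - Y s \<omega>"] mr by simp
        also have "\<dots> \<le> 2 * norm (Y r \<omega> - Y s \<omega>)"
          using norm_triangle_ineq3[of "Y r \<omega>" "Y s \<omega>"] by (simp add: abs_minus_commute)
        finally have "1 * norm (\<mu> r \<omega> - \<mu> s \<omega>) \<le> 2 * norm (Y r \<omega> - Y s \<omega>)"
          using mult_right_mono[OF y1 norm_ge_zero[of "\<mu> r \<omega> - \<mu> s \<omega>"]] by linarith
        then show ?case by (simp add: ennreal_mult[symmetric] ennreal_leI del: ennreal_numeral)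
      qed
    qed
    also have "\<dots> = ennreal 2 * (\<integral>\<^sup>+\<omega>. ennreal (norm (Y r \<omega> - Y s \<omega>) ^ 1) \<partial>M)"
      by (rule nn_integral_cmult[OF m'])
    also have "\<dots> \<le> ennreal 2 * ennreal (cY T * sqrt (r - s) ^ 1)"
      using r st by (intro mult_left_mono nn_increment_norm_moment) auto
    also have "\<dots> = ennreal (2 * (cY T * sqrt (r - s) ^ 1))"
      using cY_ge_1[of T] r by (intro ennreal_mult[symmetric]) auto
    also have "\<dots> \<le> ennreal (2 * (cY T * sqrt (t - s) ^ 1))"
      using cY_ge_1[of T] r by (intro ennreal_leI mult_left_mono power_mono) auto
    finally show "(\<integral>\<^sup>+\<omega>. ennreal (norm (\<mu> (snd (\<omega>, r)) (fst (\<omega>, r)) - \<mu> s (fst (\<omega>, r)))) \<partial>M)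
      \<le> ennreal (2 * (cY T * sqrt (t - s) ^ 1))" by simp
  qed (use st in simp)
  then show ?thesis by (simp add: mult_ac)
qed

text \<open>The direction of the field, and the constants in the drift and the quadratic variation of
  the component \<open>\<zeta>\<close> along it. The factor \<open>side\<close> is the squared distance of \<open>\<mu>\<close> from the axis through \<open>e\<close>;
  both drift and quadratic variation are proportional to it.\<close>

definition e :: "real^3" where "e = b /\<^sub>R norm b"
definition k :: real where "k = \<alpha> * norm b"
definition \<sigma>2 :: real where "\<sigma>2 = \<epsilon>\<^sup>2 * (1 + \<alpha>\<^sup>2)"
definition \<zeta> :: "real \<Rightarrow> 'a \<Rightarrow> real" where "\<zeta> t \<omega> = Y t \<omega> \<bullet> e"
definition side :: "real \<Rightarrow> 'a \<Rightarrow> real" where "side t \<omega> = 1 - (\<mu> t \<omega> \<bullet> e)\<^sup>2"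

lemma rate_eq: "rate = 2 * \<sigma>2"
  by (simp add: rate_def \<sigma>2_def)

lemma \<sigma>2_pos: "0 < \<sigma>2" using rate_pos by (simp add: rate_eq)

lemma side_measurable_F: "0 \<le> t \<Longrightarrow> side t \<in> borel_measurable (F t)"
  unfolding side_def using \<mu>_measurable_F[of t] by simp

lemma \<zeta>_measurable_F: "0 \<le> t \<Longrightarrow> \<zeta> t \<in> borel_measurable (F t)"
  unfolding \<zeta>_def using Y_measurable_F[of t] by simp

lemma \<zeta>_measurable: "0 \<le> t \<Longrightarrow> \<zeta> t \<in> borel_measurable M"
  using \<zeta>_measurable_F by (rule measurable_F_imp)

end

text \<open>From here on the field does not vanish.\<close>

locale spin_diffusion_field = spin_diffusion +
  assumes b: "b \<noteq> 0"
begin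

lemma norm_e: "norm e = 1" and b_eq: "b = norm b *\<^sub>R e" and k_pos: "0 < k"
  using b \<alpha>_pos by (auto simp: e_def k_def)

lemma abs_\<mu>_e_le: "\<omega> \<in> space M \<Longrightarrow> 0 \<le> t \<Longrightarrow> \<bar>\<mu> t \<omega> \<bullet> e\<bar> \<le> 1"
  using Cauchy_Schwarz_ineq2[of "\<mu> t \<omega>" e] norm_\<mu>_le[of \<omega> t] norm_e by simp

lemma side_range: "\<omega> \<in> space M \<Longrightarrow> 0 \<le> t \<Longrightarrow> 0 \<le> side t \<omega> \<and> side t \<omega> \<le> 1"
  using power_mono[OF abs_\<mu>_e_le[of \<omega> t], of 2] by (simp add: side_def)

lemma abs_side_diff_le:
  assumes "\<omega> \<in> space M" "0 \<le> s" "0 \<le> t"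
  shows "\<bar>side t \<omega> - side s \<omega>\<bar> \<le> 2 * norm (\<mu> t \<omega> - \<mu> s \<omega>)"
proof -
  have "\<bar>side t \<omega> - side s \<omega>\<bar> \<le> 2 * \<bar>\<mu> s \<omega> \<bullet> e - \<mu> t \<omega> \<bullet> e\<bar>"
    using abs_power2_diff_le[OF abs_\<mu>_e_le[OF assms(1,2)] abs_\<mu>_e_le[OF assms(1,3)]] by (simp add: side_def)
  also have "\<bar>\<mu> s \<omega> \<bullet> e - \<mu> t \<omega> \<bullet> e\<bar> \<le> norm (\<mu> t \<omega> - \<mu> s \<omega>)"
    using Cauchy_Schwarz_ineq2[of "\<mu> s \<omega> - \<mu> t \<omega>" e] norm_e by (simp add: inner_diff_left norm_minus_commute)
  finally show ?thesis by simp
qed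

lemma nn_side_diff:
  assumes st: "0 \<le> s" "s < t" "t \<le> T"
  shows "(\<integral>\<^sup>+p. ennreal \<bar>side (snd p) (fst p) - side s (fst p)\<bar> \<partial>PT s t) \<le> ennreal (4 * cY T * ((t - s) * sqrt (t - s)))"
proof -
  have m: "(\<lambda>p. \<mu> (snd p) (fst p) - \<mu> s (fst p)) \<in> borel_measurable (PT s t)"
    using st by (intro borel_measurable_diff \<mu>_measurable_PT measurable_compose[OF measurable_fst \<mu>_measurable]) auto
  have m': "(\<lambda>p. ennreal (norm (\<mu> (snd p) (fst p) - \<mu> s (fst p)))) \<in> borel_measurable (PT s t)"
    by (rule measurable_compose[OF m, where g = "\<lambda>x. ennreal (norm x)"]) simp
  have "(\<integral>\<^sup>+p. ennreal \<bar>side (snd p) (fst p) - side s (fst p)\<bar> \<partial>PT s t)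
    \<le> (\<integral>\<^sup>+p. ennreal 2 * ennreal (norm (\<mu> (snd p) (fst p) - \<mu> s (fst p))) \<partial>PT s t)"
  proof (rule nn_integral_mono)
    fix p assume "p \<in> space (PT s t)"
    then have "\<bar>side (snd p) (fst p) - side s (fst p)\<bar> \<le> 2 * norm (\<mu> (snd p) (fst p) - \<mu> s (fst p))"
      using st by (intro abs_side_diff_le) (auto simp: space_PT)
    then show "ennreal \<bar>side (snd p) (fst p) - side s (fst p)\<bar> \<le> ennreal 2 * ennreal (norm (\<mu> (snd p) (fst p) - \<mu> s (fst p)))"
      by (simp add: ennreal_mult[symmetric] ennreal_leI del: ennreal_numeral)
  qed
  also have "\<dots> = ennreal 2 * (\<integral>\<^sup>+p. ennreal (norm (\<mu> (snd p) (fst p) - \<mu> s (fst p))) \<partial>PT s t)"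
    by (rule nn_integral_cmult[OF m'])
  also have "\<dots> \<le> ennreal 2 * ennreal (2 * cY T * ((t - s) * sqrt (t - s)))"
    by (intro mult_left_mono nn_\<mu>_diff st) simp
  also have "\<dots> = ennreal (2 * (2 * cY T * ((t - s) * sqrt (t - s))))"
    using cY_ge_1[of T] st by (intro ennreal_mult[symmetric]) auto
  finally show ?thesis by (simp add: mult_ac)
qed

lemma \<zeta>_diff: "\<zeta> t \<omega> - \<zeta> s \<omega> = drift_part s t P \<omega> \<bullet> e - \<epsilon> * (P \<omega> \<bullet> e)"
  by (simp add: \<zeta>_def inner_diff_left inner_add_left)

lemma abs_\<zeta>_diff_le: "\<bar>\<zeta> t \<omega> - \<zeta> s \<omega>\<bar> \<le> norm (Y t \<omega> - Y s \<omega>)"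
  using Cauchy_Schwarz_ineq2[of "Y t \<omega> - Y s \<omega>" e] norm_e by (simp add: \<zeta>_def inner_diff_left)

lemma \<zeta>_diff_moment:
  assumes st: "0 \<le> s" "s < t" "t \<le> T" and n: "n \<le> 4"
  shows "integrable M (\<lambda>\<omega>. \<bar>\<zeta> t \<omega> - \<zeta> s \<omega>\<bar> ^ n)" "expectation (\<lambda>\<omega>. \<bar>\<zeta> t \<omega> - \<zeta> s \<omega>\<bar> ^ n) \<le> cY T * sqrt (t - s) ^ n"
proof -
  have [measurable]: "\<zeta> t \<in> borel_measurable M" "\<zeta> s \<in> borel_measurable M" using \<zeta>_measurable st by auto
  note Yn = increment_norm_moment[OF st n]
  have le: "\<bar>\<zeta> t \<omega> - \<zeta> s \<omega>\<bar> ^ n \<le> norm (Y t \<omega> - Y s \<omega>) ^ n" for \<omega>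
    by (intro power_mono abs_\<zeta>_diff_le) simp
  show i: "integrable M (\<lambda>\<omega>. \<bar>\<zeta> t \<omega> - \<zeta> s \<omega>\<bar> ^ n)"
    by (rule Bochner_Integration.integrable_bound[OF Yn(1)]) (use le in auto)
  have "expectation (\<lambda>\<omega>. \<bar>\<zeta> t \<omega> - \<zeta> s \<omega>\<bar> ^ n) \<le> expectation (\<lambda>\<omega>. norm (Y t \<omega> - Y s \<omega>) ^ n)"
    using i Yn(1) le by (intro integral_mono) auto
  then show "expectation (\<lambda>\<omega>. \<bar>\<zeta> t \<omega> - \<zeta> s \<omega>\<bar> ^ n) \<le> cY T * sqrt (t - s) ^ n" using Yn(2) by linarith
qed

text \<open>The drift of \<open>\<zeta>\<close> is \<open>k * side\<close>.\<close>

lemma \<zeta>_mean: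
  assumes st: "0 \<le> s" "s < t" "t \<le> T" and \<phi>: "\<phi> \<in> borel_measurable (F s)" "\<And>\<omega>. \<omega> \<in> space M \<Longrightarrow> \<bar>\<phi> \<omega>\<bar> \<le> K" and K: "0 \<le> K"
  shows "integrable M (\<lambda>\<omega>. \<phi> \<omega> * (\<zeta> t \<omega> - \<zeta> s \<omega> - k * side s \<omega> * (t - s)))"
    "\<bar>expectation (\<lambda>\<omega>. \<phi> \<omega> * (\<zeta> t \<omega> - \<zeta> s \<omega> - k * side s \<omega> * (t - s)))\<bar> \<le> K * (4 * k * cY T * ((t - s) * sqrt (t - s)))"
proof -
  have st': "s \<le> t" using st by simp
  obtain P where P: "noise_of s t P" using noise_exists[OF st(1) st'(1)] by (auto simp: noise_of_def)
  then have Pn: "noise s t P" by (simp add: noise_of_def)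
  have \<phi>M: "\<phi> \<in> borel_measurable M" using \<phi>(1) by (rule measurable_F_imp)
  have sM: "side s \<in> borel_measurable M" using side_measurable_F[OF st(1)] by (rule measurable_F_imp)
  have sb: "integrable M (side s)"
    using sM side_range[of _ s] st(1) by (intro integrable_const_bound[of _ 1]) auto
  \<comment> \<open>The error in the drift, with the factor \<open>side\<close> frozen at time \<open>s\<close>.\<close>
  define G where "G \<omega> = drift_part s t P \<omega> \<bullet> e - k * side s \<omega> * (t - s)" for \<omega>
  have dec: "\<zeta> t \<omega> - \<zeta> s \<omega> - k * side s \<omega> * (t - s) = G \<omega> - \<epsilon> * (e \<bullet> P \<omega>)" for \<omega>
    unfolding G_def \<zeta>_diff[of t \<omega> s P] by (simp add: inner_commute)
  have di: "integrable M (\<lambda>\<omega>. \<zeta> t \<omega> - \<zeta> s \<omega>)"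
    using \<zeta>_diff_moment(1)[OF st, of 1] \<zeta>_measurable[of t] \<zeta>_measurable[of s] st
    by (subst integrable_abs_iff[symmetric]) auto
  have Li: "integrable M (\<lambda>\<omega>. \<zeta> t \<omega> - \<zeta> s \<omega> - k * side s \<omega> * (t - s))" using di sb by simp
  then show \<phi>L: "integrable M (\<lambda>\<omega>. \<phi> \<omega> * (\<zeta> t \<omega> - \<zeta> s \<omega> - k * side s \<omega> * (t - s)))"
    by (rule integrable_bdd_mult[OF _ \<phi>M \<phi>(2)])
  have esq: "square_integrable M (\<lambda>_. e)" by (rule square_integrable_bounded[of _ 1]) (auto simp: norm_e)
  have Pi: "integrable M (\<lambda>\<omega>. e \<bullet> P \<omega>)"
    using expectation_mult_inner_P(1)[OF Pn, of "\<lambda>_. 1" 1 "\<lambda>_. e"] esq by simp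
  have Gi: "integrable M G"
  proof -
    have "integrable M (\<lambda>\<omega>. (\<zeta> t \<omega> - \<zeta> s \<omega> - k * side s \<omega> * (t - s)) + \<epsilon> * (e \<bullet> P \<omega>))" using Li Pi by simp
    then show ?thesis by (simp add: dec)
  qed
  have "expectation (\<lambda>\<omega>. \<phi> \<omega> * (\<zeta> t \<omega> - \<zeta> s \<omega> - k * side s \<omega> * (t - s))) = expectation (\<lambda>\<omega>. \<phi> \<omega> * G \<omega>)"
  proof -
    have "(\<lambda>\<omega>. \<phi> \<omega> * (\<zeta> t \<omega> - \<zeta> s \<omega> - k * side s \<omega> * (t - s))) = (\<lambda>\<omega>. \<phi> \<omega> * G \<omega> - \<epsilon> * (\<phi> \<omega> * (e \<bullet> P \<omega>)))"
      unfolding dec by (simp add: right_diff_distrib mult_ac)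
    moreover have "integrable M (\<lambda>\<omega>. \<phi> \<omega> * G \<omega>)" by (rule integrable_bdd_mult[OF Gi \<phi>M \<phi>(2)])
    moreover have "integrable M (\<lambda>\<omega>. \<phi> \<omega> * (e \<bullet> P \<omega>))" "expectation (\<lambda>\<omega>. \<phi> \<omega> * (e \<bullet> P \<omega>)) = 0"
      by (rule expectation_mult_inner_P[OF Pn \<phi>, of "\<lambda>_. e", OF _ _ esq]; simp)+
    ultimately show ?thesis by simp
  qed
  also have "\<bar>\<dots>\<bar> \<le> K * (4 * k * cY T * ((t - s) * sqrt (t - s)))"
  proof (rule abs_expectation_mult_le[OF Gi _ _ \<phi>M \<phi>(2) K])
    show "0 \<le> 4 * k * cY T * ((t - s) * sqrt (t - s))" using k_pos cY_ge_1[of T] st by simp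
    have c: "(\<lambda>\<omega>. k * side s \<omega>) \<in> borel_measurable M" using sM by simp
    have m: "(\<lambda>p. side (snd p) (fst p) - side s (fst p)) \<in> borel_measurable (PT s t)"
      unfolding side_def using st
      by (intro borel_measurable_diff borel_measurable_power borel_measurable_inner borel_measurable_const \<mu>_measurable_PT
         measurable_compose[OF measurable_fst \<mu>_measurable]) auto
    have m': "(\<lambda>p. ennreal \<bar>side (snd p) (fst p) - side s (fst p)\<bar>) \<in> borel_measurable (PT s t)"
      by (rule measurable_compose[OF m, where g = "\<lambda>x. ennreal \<bar>x\<bar>"]) simp
    have "(\<integral>\<^sup>+\<omega>. ennreal \<bar>G \<omega>\<bar> \<partial>M) \<le> (\<integral>\<^sup>+p. ennreal \<bar>spin_drift b \<alpha> (\<mu> (snd p) (fst p)) \<bullet> e - k * side s (fst p)\<bar> \<partial>PT s t)"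
      unfolding G_def using drift_part_deviation_PT[OF P st(1) st' _ c, of "\<lambda>_. e"] by simp
    also have "\<dots> = (\<integral>\<^sup>+p. ennreal k * ennreal \<bar>side (snd p) (fst p) - side s (fst p)\<bar> \<partial>PT s t)"
    proof (rule nn_integral_cong_AE)
      show "AE p in PT s t. ennreal \<bar>spin_drift b \<alpha> (\<mu> (snd p) (fst p)) \<bullet> e - k * side s (fst p)\<bar>
         = ennreal k * ennreal \<bar>side (snd p) (fst p) - side s (fst p)\<bar>"
        using AE_PT_fst[OF AE_good, of s t] AE_space
      proof eventually_elim
        case (elim p)
        then have "norm (\<mu> (snd p) (fst p)) = 1" using st by (intro good_\<mu>(2)) (auto simp: space_PT)
        from spin_drift_inner_axis[OF this b_eq norm_e, of \<alpha>]
        have "spin_drift b \<alpha> (\<mu> (snd p) (fst p)) \<bullet> e - k * side s (fst p) = k * (side (snd p) (fst p) - side s (fst p))"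
          by (simp add: k_def side_def algebra_simps)
        then show ?case using k_pos by (simp add: abs_mult ennreal_mult)
      qed
    qed
    also have "\<dots> = ennreal k * (\<integral>\<^sup>+p. ennreal \<bar>side (snd p) (fst p) - side s (fst p)\<bar> \<partial>PT s t)"
      by (rule nn_integral_cmult[OF m'])
    also have "\<dots> \<le> ennreal k * ennreal (4 * cY T * ((t - s) * sqrt (t - s)))"
      by (intro mult_left_mono nn_side_diff st) simp
    also have "\<dots> = ennreal (k * (4 * cY T * ((t - s) * sqrt (t - s))))"
      using cY_ge_1[of T] st k_pos by (intro ennreal_mult[symmetric]) auto
    finally show "(\<integral>\<^sup>+\<omega>. ennreal \<bar>G \<omega>\<bar> \<partial>M) \<le> ennreal (4 * k * cY T * ((t - s) * sqrt (t - s)))" by (simp add: mult_ac)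
  qed
  finally show "\<bar>expectation (\<lambda>\<omega>. \<phi> \<omega> * (\<zeta> t \<omega> - \<zeta> s \<omega> - k * side s \<omega> * (t - s)))\<bar> \<le> K * (4 * k * cY T * ((t - s) * sqrt (t - s)))" .
qed

text \<open>A bound for the error in the conditional variance of \<open>\<zeta>\<close> on \<open>[0, T]\<close>, in units of \<open>(t - s)\<^bsup>3/2\<^esup>\<close>.\<close>

definition cV :: "real \<Rightarrow> real" where
  "cV T = c0\<^sup>2 * sqrt T + 2 * \<epsilon> * c0 * (1 + c4) + 4 * \<sigma>2 * cY T"

text \<open>The rate of quadratic variation of \<open>\<zeta>\<close> is \<open>\<sigma>2 * side\<close>.\<close>

lemma \<zeta>_variance:
  assumes st: "0 \<le> s" "s < t" "t \<le> T" and \<phi>: "\<phi> \<in> borel_measurable (F s)" "\<And>\<omega>. \<omega> \<in> space M \<Longrightarrow> \<bar>\<phi> \<omega>\<bar> \<le> K" and K: "0 \<le> K"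
  shows "integrable M (\<lambda>\<omega>. \<phi> \<omega> * ((\<zeta> t \<omega> - \<zeta> s \<omega>)\<^sup>2 - \<sigma>2 * side s \<omega> * (t - s)))"
    "\<bar>expectation (\<lambda>\<omega>. \<phi> \<omega> * ((\<zeta> t \<omega> - \<zeta> s \<omega>)\<^sup>2 - \<sigma>2 * side s \<omega> * (t - s)))\<bar> \<le> K * (cV T * ((t - s) * sqrt (t - s)))"
proof -
  have st': "s \<le> t" using st by simp
  let ?d = "t - s"
  interpret PS: pair_sigma_finite M "restrict_space lborel {s<..t}" by (rule pair_sigma_finite_PT)
  interpret PF: finite_measure "PT s t" by (rule finite_measure_PT)
  obtain P where P: "noise_of s t P" using noise_exists[OF st(1) st'(1)] by (auto simp: noise_of_def)
  then have Pn: "noise s t P" by (simp add: noise_of_def)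
  let ?A = "drift_part s t P"
  have \<phi>M: "\<phi> \<in> borel_measurable M" using \<phi>(1) by (rule measurable_F_imp)
  have [measurable]: "P \<in> borel_measurable M" by (rule norm_P_fourth(1)[OF Pn])
  have [measurable]: "Y t \<in> borel_measurable M" "Y s \<in> borel_measurable M" using Y_measurable st by auto
  have sM: "side s \<in> borel_measurable M" using side_measurable_F[OF st(1)] by (rule measurable_F_imp)
  have sb: "integrable M (side s)"
    using sM side_range[of _ s] st(1) by (intro integrable_const_bound[of _ 1]) auto
  have d2: "integrable M (\<lambda>\<omega>. (\<zeta> t \<omega> - \<zeta> s \<omega>)\<^sup>2)" using \<zeta>_diff_moment(1)[OF st, of 2] by simp
  have Li: "integrable M (\<lambda>\<omega>. (\<zeta> t \<omega> - \<zeta> s \<omega>)\<^sup>2 - \<sigma>2 * side s \<omega> * ?d)" using d2 sb by simp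
  then show \<phi>L: "integrable M (\<lambda>\<omega>. \<phi> \<omega> * ((\<zeta> t \<omega> - \<zeta> s \<omega>)\<^sup>2 - \<sigma>2 * side s \<omega> * ?d))"
    by (rule integrable_bdd_mult[OF _ \<phi>M \<phi>(2)])
  have P2: "integrable M (\<lambda>\<omega>. (e \<bullet> P \<omega>)\<^sup>2)"
  proof (rule Bochner_Integration.integrable_bound)
    show "integrable M (\<lambda>\<omega>. norm (P \<omega>) ^ 2)"
      using expectation_mult_norm_P_sq(1)[OF Pn st(1,2), of "\<lambda>_. 1" 1] by simp
    show "AE \<omega> in M. norm ((e \<bullet> P \<omega>)\<^sup>2) \<le> norm (norm (P \<omega>) ^ 2)"
    proof (rule AE_I2)
      fix \<omega>
      have "\<bar>e \<bullet> P \<omega>\<bar> \<le> norm (P \<omega>)" using Cauchy_Schwarz_ineq2[of e "P \<omega>"] norm_e by simp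
      from power_mono[OF this, of 2] show "norm ((e \<bullet> P \<omega>)\<^sup>2) \<le> norm (norm (P \<omega>) ^ 2)" by simp
    qed
  qed measurable
  \<comment> \<open>The terms that involve the drift part.\<close>
  define Q where "Q \<omega> = (?A \<omega> \<bullet> e)\<^sup>2 - 2 * \<epsilon> * ((?A \<omega> \<bullet> e) * (e \<bullet> P \<omega>))" for \<omega>
  have dec: "(\<zeta> t \<omega> - \<zeta> s \<omega>)\<^sup>2 = Q \<omega> + \<epsilon>\<^sup>2 * (e \<bullet> P \<omega>)\<^sup>2" for \<omega>
    unfolding \<zeta>_diff[of t \<omega> s P] Q_def by (simp add: inner_commute power2_eq_square algebra_simps)
  have Qi: "integrable M Q"
  proof -
    have "integrable M (\<lambda>\<omega>. (\<zeta> t \<omega> - \<zeta> s \<omega>)\<^sup>2 - \<epsilon>\<^sup>2 * (e \<bullet> P \<omega>)\<^sup>2)" using d2 P2 by simp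
    then show ?thesis by (simp add: dec)
  qed
  have \<phi>Q: "integrable M (\<lambda>\<omega>. \<phi> \<omega> * Q \<omega>)" by (rule integrable_bdd_mult[OF Qi \<phi>M \<phi>(2)])
  have \<phi>P: "integrable M (\<lambda>\<omega>. \<phi> \<omega> * (e \<bullet> P \<omega>)\<^sup>2)" by (rule integrable_bdd_mult[OF P2 \<phi>M \<phi>(2)])
  have \<phi>s: "integrable M (\<lambda>\<omega>. \<phi> \<omega> * side s \<omega>)" by (rule integrable_bdd_mult[OF sb \<phi>M \<phi>(2)])
  let ?sr = "\<lambda>p. side (snd p) (fst p)"
  have \<phi>': "(\<lambda>p. \<phi> (fst p)) \<in> borel_measurable (PT s t)" by (rule measurable_compose[OF measurable_fst \<phi>M])
  have srm: "?sr \<in> borel_measurable (PT s t)" "(\<lambda>p. side s (fst p)) \<in> borel_measurable (PT s t)"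
    using measurable_compose[OF measurable_fst sM] st' st(1)
    by (auto simp: side_def[of "snd _"] intro!: borel_measurable_diff borel_measurable_power borel_measurable_inner \<mu>_measurable_PT)
  have \<phi>sr: "integrable (PT s t) (\<lambda>p. \<phi> (fst p) * ?sr p)" "integrable (PT s t) (\<lambda>p. \<phi> (fst p) * side s (fst p))"
  proof -
    have "integrable (PT s t) ?sr" "integrable (PT s t) (\<lambda>p. side s (fst p))"
      using srm side_range st(1) by (auto intro!: PF.integrable_const_bound[of _ 1] AE_I2 simp: space_PT)
    then show "integrable (PT s t) (\<lambda>p. \<phi> (fst p) * ?sr p)" "integrable (PT s t) (\<lambda>p. \<phi> (fst p) * side s (fst p))"
      using \<phi>(2) by (auto intro!: integrable_bdd_mult[OF _ \<phi>', where B = K] simp: space_PT)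
  qed
  have E1: "\<epsilon>\<^sup>2 * expectation (\<lambda>\<omega>. \<phi> \<omega> * (e \<bullet> P \<omega>)\<^sup>2) = \<sigma>2 * (\<integral>p. \<phi> (fst p) * ?sr p \<partial>PT s t)"
  proof -
    have "expectation (\<lambda>\<omega>. \<phi> \<omega> * (e \<bullet> P \<omega>)\<^sup>2) = (\<integral>p. \<phi> (fst p) * (norm (spin_noise \<alpha> (\<mu> (snd p) (fst p)) e))\<^sup>2 \<partial>PT s t)"
      by (rule noise_isometry[OF Pn \<phi>, where V = "\<lambda>_. e" and B = 1]) (simp_all add: norm_e)
    also have "\<dots> = (\<integral>p. (1 + \<alpha>\<^sup>2) * (\<phi> (fst p) * ?sr p) \<partial>PT s t)"
    proof (rule integral_cong_AE)
      show "AE p in PT s t. \<phi> (fst p) * (norm (spin_noise \<alpha> (\<mu> (snd p) (fst p)) e))\<^sup>2 = (1 + \<alpha>\<^sup>2) * (\<phi> (fst p) * ?sr p)"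
        using AE_PT_fst[OF AE_good, of s t] AE_space
      proof eventually_elim
        case (elim p)
        then have "norm (\<mu> (snd p) (fst p)) = 1" using st by (intro good_\<mu>(2)) (auto simp: space_PT)
        from norm_spin_noise[OF this, of \<alpha> e] show ?case by (simp add: norm_e side_def)
      qed
      show "(\<lambda>p. \<phi> (fst p) * (norm (spin_noise \<alpha> (\<mu> (snd p) (fst p)) e))\<^sup>2) \<in> borel_measurable (PT s t)"
        by (rule borel_measurable_integrable[OF integrable_bounded_noise_PT[OF st(1) st' \<phi>M \<phi>(2), where V = "\<lambda>_. e" and B = 1]]) (auto simp: norm_e)
    qed (use \<phi>' srm in simp)
    finally show ?thesis by (simp add: \<sigma>2_def)
  qed
  have E2: "?d * expectation (\<lambda>\<omega>. \<phi> \<omega> * side s \<omega>) = (\<integral>p. \<phi> (fst p) * side s (fst p) \<partial>PT s t)"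
  proof -
    have "integrable (restrict_space lborel {s<..t}) (\<lambda>_. 1 :: real)" "(\<integral>r. 1 \<partial>restrict_space lborel {s<..t}) = ?d"
      using st by (auto simp: integrable_restrict_space measure_restrict_space space_restrict_space)
    then show ?thesis using PS.integral_pair_mult(2)[OF \<phi>s, of "\<lambda>_. 1"] by simp
  qed
  have "expectation (\<lambda>\<omega>. \<phi> \<omega> * ((\<zeta> t \<omega> - \<zeta> s \<omega>)\<^sup>2 - \<sigma>2 * side s \<omega> * ?d))
     = expectation (\<lambda>\<omega>. \<phi> \<omega> * Q \<omega> + \<epsilon>\<^sup>2 * (\<phi> \<omega> * (e \<bullet> P \<omega>)\<^sup>2) - \<sigma>2 * ?d * (\<phi> \<omega> * side s \<omega>))"
    unfolding dec by (intro Bochner_Integration.integral_cong) (simp_all add: algebra_simps)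
  also have "\<dots> = expectation (\<lambda>\<omega>. \<phi> \<omega> * Q \<omega>) + \<epsilon>\<^sup>2 * expectation (\<lambda>\<omega>. \<phi> \<omega> * (e \<bullet> P \<omega>)\<^sup>2) - \<sigma>2 * (?d * expectation (\<lambda>\<omega>. \<phi> \<omega> * side s \<omega>))"
    using \<phi>Q \<phi>P \<phi>s by simp
  also have "\<dots> = expectation (\<lambda>\<omega>. \<phi> \<omega> * Q \<omega>) + \<sigma>2 * (\<integral>p. \<phi> (fst p) * (?sr p - side s (fst p)) \<partial>PT s t)"
    unfolding E1 E2 using \<phi>sr by (simp add: right_diff_distrib)
  finally have E: "expectation (\<lambda>\<omega>. \<phi> \<omega> * ((\<zeta> t \<omega> - \<zeta> s \<omega>)\<^sup>2 - \<sigma>2 * side s \<omega> * ?d))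
    = expectation (\<lambda>\<omega>. \<phi> \<omega> * Q \<omega>) + \<sigma>2 * (\<integral>p. \<phi> (fst p) * (?sr p - side s (fst p)) \<partial>PT s t)" .
  have pos: "0 \<le> cY T" "0 \<le> c4" using cY_ge_1[of T] c4_nonneg by auto
  have B1: "\<bar>expectation (\<lambda>\<omega>. \<phi> \<omega> * Q \<omega>)\<bar> \<le> K * ((c0\<^sup>2 * sqrt T + 2 * \<epsilon> * c0 * (1 + c4)) * (?d * sqrt ?d))"
  proof (rule abs_expectation_mult_le[OF Qi _ _ \<phi>M \<phi>(2) K])
    show "0 \<le> (c0\<^sup>2 * sqrt T + 2 * \<epsilon> * c0 * (1 + c4)) * (?d * sqrt ?d)"
      using st c0_nonneg pos \<epsilon>_pos by (intro mult_nonneg_nonneg add_nonneg_nonneg) auto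
    have "(\<integral>\<^sup>+\<omega>. ennreal \<bar>Q \<omega>\<bar> \<partial>M) \<le> (\<integral>\<^sup>+\<omega>. ennreal ((c0 * ?d)\<^sup>2) + ennreal (2 * \<epsilon> * (c0 * ?d)) * ennreal (norm (P \<omega>) ^ 1) \<partial>M)"
    proof (rule nn_integral_mono_AE)
      show "AE \<omega> in M. ennreal \<bar>Q \<omega>\<bar> \<le> ennreal ((c0 * ?d)\<^sup>2) + ennreal (2 * \<epsilon> * (c0 * ?d)) * ennreal (norm (P \<omega>) ^ 1)"
        using norm_drift_part_le[OF P st(1) st'(1)]
      proof eventually_elim
        case (elim \<omega>)
        have cd: "0 \<le> c0 * ?d" using c0_nonneg st by simp
        have A: "\<bar>?A \<omega> \<bullet> e\<bar> \<le> c0 * ?d" using Cauchy_Schwarz_ineq2[of "?A \<omega>" e] norm_e elim by simp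
        have 1: "(?A \<omega> \<bullet> e)\<^sup>2 \<le> (c0 * ?d)\<^sup>2" using power_mono[OF A, of 2] by simp
        have Pe: "\<bar>e \<bullet> P \<omega>\<bar> \<le> norm (P \<omega>)" using Cauchy_Schwarz_ineq2[of e "P \<omega>"] norm_e by simp
        have 2: "2 * \<epsilon> * (\<bar>?A \<omega> \<bullet> e\<bar> * \<bar>e \<bullet> P \<omega>\<bar>) \<le> 2 * \<epsilon> * ((c0 * ?d) * norm (P \<omega>))"
          using \<epsilon>_pos cd A Pe by (intro mult_left_mono mult_mono) auto
        have "\<bar>x - z\<bar> \<le> \<bar>x\<bar> + \<bar>z\<bar>" for x z :: real by linarith
        from this[of "(?A \<omega> \<bullet> e)\<^sup>2" "2 * \<epsilon> * ((?A \<omega> \<bullet> e) * (e \<bullet> P \<omega>))"]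
        have "\<bar>Q \<omega>\<bar> \<le> (?A \<omega> \<bullet> e)\<^sup>2 + 2 * \<epsilon> * (\<bar>?A \<omega> \<bullet> e\<bar> * \<bar>e \<bullet> P \<omega>\<bar>)"
          using \<epsilon>_pos by (simp add: Q_def abs_mult)
        also have "\<dots> \<le> (c0 * ?d)\<^sup>2 + 2 * \<epsilon> * (c0 * ?d) * norm (P \<omega>) ^ 1" using 1 2 by (simp add: mult.assoc)
        finally have "ennreal \<bar>Q \<omega>\<bar> \<le> ennreal ((c0 * ?d)\<^sup>2 + 2 * \<epsilon> * (c0 * ?d) * norm (P \<omega>) ^ 1)" by (rule ennreal_leI)
        also have "\<dots> = ennreal ((c0 * ?d)\<^sup>2) + ennreal (2 * \<epsilon> * (c0 * ?d)) * ennreal (norm (P \<omega>) ^ 1)"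
          using cd \<epsilon>_pos by (subst ennreal_mult[symmetric] ennreal_plus[symmetric]; (simp; fail)?)+
        finally show ?case .
      qed
    qed
    also have "\<dots> = ennreal ((c0 * ?d)\<^sup>2) + ennreal (2 * \<epsilon> * (c0 * ?d)) * (\<integral>\<^sup>+\<omega>. ennreal (norm (P \<omega>) ^ 1) \<partial>M)"
      by (subst nn_integral_add nn_integral_cmult; (simp; fail)?)+ (simp add: emeasure_space_1)
    also have "\<dots> \<le> ennreal ((c0 * ?d)\<^sup>2) + ennreal (2 * \<epsilon> * (c0 * ?d)) * ennreal ((1 + c4) * sqrt ?d ^ 1)"
      using st by (intro add_mono mult_left_mono nn_P_moment[OF Pn]) auto
    also have "\<dots> = ennreal ((c0 * ?d)\<^sup>2 + 2 * \<epsilon> * (c0 * ?d) * ((1 + c4) * sqrt ?d ^ 1))"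
      using c0_nonneg pos \<epsilon>_pos st by (subst ennreal_mult[symmetric] ennreal_plus[symmetric]; (simp; fail)?)+
    also have "\<dots> \<le> ennreal ((c0\<^sup>2 * sqrt T + 2 * \<epsilon> * c0 * (1 + c4)) * (?d * sqrt ?d))"
    proof (rule ennreal_leI)
      have "?d * sqrt ?d * sqrt ?d \<le> ?d * sqrt ?d * sqrt T" using st by (intro mult_left_mono) auto
      then have "?d\<^sup>2 \<le> ?d * sqrt ?d * sqrt T" using st by (simp add: power2_eq_square)
      then have "c0\<^sup>2 * ?d\<^sup>2 \<le> c0\<^sup>2 * (?d * sqrt ?d * sqrt T)" by (intro mult_left_mono) auto
      moreover have "(c0 * d)\<^sup>2 + 2 * \<epsilon> * (c0 * d) * ((1 + c4) * S ^ 1) \<le> (c0\<^sup>2 * q + 2 * \<epsilon> * c0 * (1 + c4)) * (d * S)"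
        if "c0\<^sup>2 * d\<^sup>2 \<le> c0\<^sup>2 * (d * S * q)" for d S q :: real
        using that by (simp add: power_mult_distrib algebra_simps)
      ultimately show "(c0 * ?d)\<^sup>2 + 2 * \<epsilon> * (c0 * ?d) * ((1 + c4) * sqrt ?d ^ 1)
        \<le> (c0\<^sup>2 * sqrt T + 2 * \<epsilon> * c0 * (1 + c4)) * (?d * sqrt ?d)" by blast
    qed
    finally show "(\<integral>\<^sup>+\<omega>. ennreal \<bar>Q \<omega>\<bar> \<partial>M) \<le> ennreal ((c0\<^sup>2 * sqrt T + 2 * \<epsilon> * c0 * (1 + c4)) * (?d * sqrt ?d))" .
  qed simp_all
  have B2: "\<bar>\<integral>p. \<phi> (fst p) * (?sr p - side s (fst p)) \<partial>PT s t\<bar> \<le> K * (4 * cY T * (?d * sqrt ?d))"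
  proof -
    have i: "integrable (PT s t) (\<lambda>p. \<bar>?sr p - side s (fst p)\<bar>)"
    proof (rule PF.integrable_const_bound[of _ 1])
      show "AE p in PT s t. norm \<bar>?sr p - side s (fst p)\<bar> \<le> 1"
      proof (rule AE_I2)
        fix p assume "p \<in> space (PT s t)"
        then have "0 \<le> ?sr p \<and> ?sr p \<le> 1" "0 \<le> side s (fst p) \<and> side s (fst p) \<le> 1"
          using side_range st(1) by (auto simp: space_PT)
        then show "norm \<bar>?sr p - side s (fst p)\<bar> \<le> 1" unfolding real_norm_def by linarith
      qed
    qed (use srm in simp)
    have "\<bar>\<integral>p. \<phi> (fst p) * (?sr p - side s (fst p)) \<partial>PT s t\<bar> \<le> (\<integral>p. \<bar>\<phi> (fst p) * (?sr p - side s (fst p))\<bar> \<partial>PT s t)"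
      by (rule integral_abs_bound)
    also have "\<dots> \<le> (\<integral>p. K * \<bar>?sr p - side s (fst p)\<bar> \<partial>PT s t)"
    proof (rule integral_mono)
      show "\<bar>\<phi> (fst p) * (?sr p - side s (fst p))\<bar> \<le> K * \<bar>?sr p - side s (fst p)\<bar>" if "p \<in> space (PT s t)" for p
        using \<phi>(2)[of "fst p"] that by (auto simp: space_PT abs_mult intro: mult_right_mono)
      show "integrable (PT s t) (\<lambda>p. \<bar>\<phi> (fst p) * (?sr p - side s (fst p))\<bar>)"
        using \<phi>sr by (intro integrable_abs) (simp add: right_diff_distrib)
    qed (use i in simp)
    also have "\<dots> = K * (\<integral>p. \<bar>?sr p - side s (fst p)\<bar> \<partial>PT s t)" by simp
    also have "\<dots> \<le> K * (4 * cY T * (?d * sqrt ?d))"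
    proof (rule mult_left_mono[OF _ K])
      have "ennreal (\<integral>p. \<bar>?sr p - side s (fst p)\<bar> \<partial>PT s t) \<le> ennreal (4 * cY T * (?d * sqrt ?d))"
        using nn_side_diff[OF st] nn_integral_eq_integral[OF i] by simp
      moreover have "0 \<le> 4 * cY T * (?d * sqrt ?d)" using pos st by simp
      ultimately show "(\<integral>p. \<bar>?sr p - side s (fst p)\<bar> \<partial>PT s t) \<le> 4 * cY T * (?d * sqrt ?d)"
        by (rule ennreal_le_iff[THEN iffD1, rotated])
    qed
    finally show ?thesis .
  qed
  have "\<bar>x + \<sigma>2 * z\<bar> \<le> \<bar>x\<bar> + \<sigma>2 * \<bar>z\<bar>" for x z :: real
    using abs_triangle_ineq[of x "\<sigma>2 * z"] \<sigma>2_pos by (simp add: abs_mult)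
  from order_trans[OF this add_mono[OF B1 mult_left_mono[OF B2]]] \<sigma>2_pos
  show "\<bar>expectation (\<lambda>\<omega>. \<phi> \<omega> * ((\<zeta> t \<omega> - \<zeta> s \<omega>)\<^sup>2 - \<sigma>2 * side s \<omega> * (t - s)))\<bar> \<le> K * (cV T * ((t - s) * sqrt (t - s)))"
    unfolding E by (simp add: cV_def algebra_simps)
qed

end

section \<open>The Lyapunov supermartingale and the limit\<close>

context spin_diffusion_field begin

text \<open>The constants of the Lyapunov function, as required by \<open>lyapunov_pq\<close>.\<close>

definition lyC :: real where "lyC = 3 * \<sigma>2 / k"
definition lyK :: real where "lyK = (9 * \<sigma>2 / k)\<^sup>2 * (9 + 6 * (9 * \<sigma>2 / k))"

text \<open>The Lyapunov function and its time derivative.\<close>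

definition V :: "real \<Rightarrow> real \<Rightarrow> real" where "V t x = lyap lyC (R t) x + lyK / R t"
definition Vt :: "real \<Rightarrow> real \<Rightarrow> real" where "Vt t x = lyap_r lyC (R t) x * (\<sigma>2 / R t) - lyK * (\<sigma>2 / R t ^ 3)"

text \<open>The time at which the radius reaches the size that \<open>lyapunov_pq\<close> demands.\<close>

definition T0 :: real where "T0 = (max 1 (18 * \<sigma>2 / k))\<^sup>2 / rate"

lemma lyC_pos: "0 < lyC" and lyK_pos: "0 < lyK"
proof -
  have P: "0 < 9 * \<sigma>2 / k" using \<sigma>2_pos k_pos by simp
  then show "0 < lyC" by (simp add: lyC_def)
  have "0 < 9 + 6 * (9 * \<sigma>2 / k)" using P by linarith
  then show "0 < lyK" unfolding lyK_def using P by (intro mult_pos_pos zero_less_power)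
qed

lemma T0_nonneg: "0 \<le> T0"
  using rate_pos by (simp add: T0_def)

lemma R_T0_le: assumes "T0 \<le> t" shows "18 * \<sigma>2 / k \<le> R t"
proof -
  let ?m = "max 1 (18 * \<sigma>2 / k)"
  have "?m\<^sup>2 = rate * T0" using rate_pos by (simp add: T0_def)
  also have "\<dots> \<le> rate * t" using assms rate_pos by simp
  finally have "?m\<^sup>2 \<le> 1 + rate * t" by simp
  then have "?m \<le> R t" unfolding R_def by (rule real_le_rsqrt)
  then show ?thesis by simp
qed

lemma R_deriv:
  assumes "0 \<le> t" shows "(R has_real_derivative \<sigma>2 / R t) (at t)"
proof -
  have "0 < 1 + rate * t" using assms rate_pos by (simp add: add_pos_nonneg)
  then show ?thesis unfolding R_def
    by (auto intro!: derivative_eq_intros simp: rate_eq field_simps)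
qed

lemma V_deriv_t:
  assumes t: "0 \<le> t" and x: "\<bar>x\<bar> \<le> R t"
  shows "((\<lambda>t. V t x) has_real_derivative Vt t x) (at t)"
proof -
  have R0: "R t \<noteq> 0" using R_ge_1[OF t] by simp
  have nz: "R t + x + lyC \<noteq> 0" using x lyC_pos by simp
  have "((\<lambda>t. lyap lyC (R t) x) has_real_derivative lyap_r lyC (R t) x * (\<sigma>2 / R t)) (at t)"
    by (rule DERIV_chain2[OF lyap_derivs(1)[OF nz] R_deriv[OF t]])
  moreover have "((\<lambda>t. lyK / R t) has_real_derivative - (lyK * (\<sigma>2 / R t ^ 3))) (at t)"
  proof -
    have quotient: "(0 * R t - lyK * (\<sigma>2 / R t)) / (R t * R t) = - (lyK * (\<sigma>2 / R t ^ 3))"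
      using R0 by (simp add: field_simps power3_eq_cube)
    show ?thesis
      unfolding quotient[symmetric] by (rule DERIV_divide[OF DERIV_const R_deriv[OF t] R0])
  qed
  ultimately show ?thesis unfolding V_def Vt_def diff_conv_add_uminus by (rule DERIV_add)
qed

lemma generator_V_nonpos:
  assumes t: "T0 \<le> t" and x: "\<bar>x\<bar> \<le> R t"
  shows "Vt t x + lyap_x lyC (R t) x * (k * (1 - (x / R t)\<^sup>2)) + 1 / 2 * lyap_xx lyC (R t) x * (\<sigma>2 * (1 - (x / R t)\<^sup>2)) \<le> 0"
proof -
  let ?r = "R t"
  have r1: "1 \<le> ?r" using R_ge_1 T0_nonneg t by simp
  have pq: "(?r - x) * (?r + x) / ?r\<^sup>2 = 1 - (x / ?r)\<^sup>2"
    using r1 by (simp add: field_simps power2_eq_square)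
  have "lyap_r lyC ?r x * (\<sigma>2 / ?r) + k * ((?r - x) * (?r + x) / ?r\<^sup>2) * lyap_x lyC ?r x
    + 1 / 2 * (\<sigma>2 * ((?r - x) * (?r + x) / ?r\<^sup>2)) * lyap_xx lyC ?r x
    \<le> (9 * \<sigma>2 / k)\<^sup>2 * \<sigma>2 * (9 + 6 * (9 * \<sigma>2 / k)) / ?r ^ 3"
    unfolding lyap_r_def lyap_x_def lyap_xx_def lyC_def
    by (rule lyapunov_pq[OF k_pos \<sigma>2_pos]) (use x r1 R_T0_le[OF t] in auto)
  also have "\<dots> = lyK * (\<sigma>2 / ?r ^ 3)" by (simp add: lyK_def)
  finally show ?thesis unfolding pq Vt_def by (simp add: mult_ac)
qed

lemma AE_\<zeta>:
  assumes t: "0 \<le> t"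
  shows "AE \<omega> in M. \<bar>\<zeta> t \<omega>\<bar> \<le> R t \<and> side t \<omega> = 1 - (\<zeta> t \<omega> / R t)\<^sup>2"
  using AE_norm_Y_at[OF t] AE_good
proof eventually_elim
  case (elim \<omega>)
  have R0: "R t \<noteq> 0" using R_ge_1[OF t] by simp
  have "Y t \<omega> = R t *\<^sub>R \<mu> t \<omega>" using good_\<mu>(3)[OF elim(2) t] elim(1) by simp
  then have "\<zeta> t \<omega> / R t = \<mu> t \<omega> \<bullet> e" using R0 by (simp add: \<zeta>_def)
  moreover have "\<bar>\<zeta> t \<omega>\<bar> \<le> R t"
    using Cauchy_Schwarz_ineq2[of "Y t \<omega>" e] elim(1) norm_e by (simp add: \<zeta>_def)
  ultimately show ?case by (simp add: side_def)
qed

lemma V_bounds: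
  assumes t: "0 \<le> t" and x: "\<bar>x\<bar> \<le> R t"
  shows "0 \<le> V t x" "V t x \<le> (2 * R t) ^ 3 / lyC\<^sup>2 + lyK / R t"
proof -
  have R1: "1 \<le> R t" using R_ge_1[OF t] .
  have p: "0 \<le> R t - x" "R t - x \<le> 2 * R t" "lyC \<le> R t + x + lyC" using x by auto
  show "0 \<le> V t x" using p R1 lyK_pos unfolding V_def lyap_def by simp
  have "(R t - x) ^ 3 / (R t + x + lyC)\<^sup>2 \<le> (2 * R t) ^ 3 / lyC\<^sup>2"
    using p R1 lyC_pos by (intro frac_le power_mono) auto
  then show "V t x \<le> (2 * R t) ^ 3 / lyC\<^sup>2 + lyK / R t" by (simp add: V_def lyap_def)
qed

lemma V_measurable: "0 \<le> t \<Longrightarrow> (\<lambda>\<omega>. V t (\<zeta> t \<omega>)) \<in> borel_measurable (F t)"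
  unfolding V_def lyap_def using \<zeta>_measurable_F[of t] by simp

lemma V_integrable:
  assumes t: "0 \<le> t" and A: "A \<in> sets M"
  shows "integrable M (\<lambda>\<omega>. indicator A \<omega> * V t (\<zeta> t \<omega>))"
proof (rule integrable_const_bound[of _ "(2 * R t) ^ 3 / lyC\<^sup>2 + lyK / R t"])
  show "AE \<omega> in M. norm (indicator A \<omega> * V t (\<zeta> t \<omega>)) \<le> (2 * R t) ^ 3 / lyC\<^sup>2 + lyK / R t"
    using AE_\<zeta>[OF t]
  proof eventually_elim
    case (elim \<omega>)
    then have "\<bar>V t (\<zeta> t \<omega>)\<bar> \<le> (2 * R t) ^ 3 / lyC\<^sup>2 + lyK / R t" using V_bounds[OF t, of "\<zeta> t \<omega>"] by simp
    then show ?case by (auto simp: indicator_def)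
  qed
  show "(\<lambda>\<omega>. indicator A \<omega> * V t (\<zeta> t \<omega>)) \<in> borel_measurable M"
    using A measurable_F_imp[OF V_measurable[OF t]] by simp
qed

text \<open>The supermartingale property, up to an error that is small compared to the length of the step. The
  position \<open>\<zeta>\<close> varies in \<open>[-R, R]\<close>, so that the derivatives of \<open>V\<close> only matter on the compact set \<open>S\<close>, on
  which they are uniformly continuous.\<close>

lemma V_step:
  assumes a: "T0 \<le> a" "a \<le> c" and A: "A \<in> sets (F a)" and \<eta>: "0 < \<eta>"
  shows "\<exists>\<delta>>0. \<forall>s t. a \<le> s \<longrightarrow> s < t \<longrightarrow> t \<le> c \<longrightarrow> t - s < \<delta> \<longrightarrow>
    expectation (\<lambda>\<omega>. indicator A \<omega> * V t (\<zeta> t \<omega>)) \<le> expectation (\<lambda>\<omega>. indicator A \<omega> * V s (\<zeta> s \<omega>)) + \<eta> * (t - s)"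
proof -
  have a0: "0 \<le> a" using a T0_nonneg by simp
  define S where "S = {p :: real \<times> real. fst p \<in> {a..c} \<and> \<bar>snd p\<bar> \<le> R (fst p)}"
  have Rc: "continuous_on UNIV R" unfolding R_def by (intro continuous_intros)
  have Rfst: "continuous_on X (\<lambda>p. R (fst p))" for X :: "(real \<times> real) set"
    by (intro continuous_on_compose2[OF Rc] continuous_intros) auto
  have "compact S"
  proof -
    have "closed {p :: real \<times> real. \<bar>snd p\<bar> \<le> R (fst p)}"
      by (intro closed_Collect_le continuous_intros Rfst)
    then have "compact (({a..c} \<times> {- R c..R c}) \<inter> {p :: real \<times> real. \<bar>snd p\<bar> \<le> R (fst p)})"
      by (intro compact_Int_closed compact_Times compact_Icc)
    moreover have "S = ({a..c} \<times> {- R c..R c}) \<inter> {p :: real \<times> real. \<bar>snd p\<bar> \<le> R (fst p)}"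
    proof (intro set_eqI iffI)
      fix p assume "p \<in> S"
      moreover from this have "R (fst p) \<le> R c" by (intro R_mono) (auto simp: S_def)
      ultimately show "p \<in> ({a..c} \<times> {- R c..R c}) \<inter> {p. \<bar>snd p\<bar> \<le> R (fst p)}" by (cases p) (auto simp: S_def)
    qed (auto simp: S_def)
    ultimately show ?thesis by simp
  qed
  have nz: "R (fst p) + snd p + lyC \<noteq> 0" "R (fst p) \<noteq> 0" if "p \<in> S" for p
  proof -
    have "1 \<le> R (fst p)" using that a0 by (intro R_ge_1) (auto simp: S_def)
    then show "R (fst p) \<noteq> 0" by simp
    show "R (fst p) + snd p + lyC \<noteq> 0" using that lyC_pos by (auto simp: S_def)
  qed
  define g1 where "g1 p = Vt (fst p) (snd p)" for p
  define g2 where "g2 p = lyap_x lyC (R (fst p)) (snd p)" for p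
  define g3 where "g3 p = lyap_xx lyC (R (fst p)) (snd p)" for p
  have c1: "continuous_on S g1" unfolding g1_def Vt_def lyap_r_def
    by (intro continuous_intros Rfst) (use nz in auto)
  have c2: "continuous_on S g2" unfolding g2_def lyap_x_def
    by (intro continuous_intros Rfst) (use nz in auto)
  have c3: "continuous_on S g3" unfolding g3_def lyap_xx_def
    by (intro continuous_intros Rfst) (use nz in auto)
  obtain B2 where B2: "0 < B2" "\<And>p. p \<in> S \<Longrightarrow> \<bar>g2 p\<bar> \<le> B2"
    using compact_imp_bounded[OF compact_continuous_image[OF c2 \<open>compact S\<close>]] unfolding bounded_pos by auto
  obtain B3 where B3: "0 < B3" "\<And>p. p \<in> S \<Longrightarrow> \<bar>g3 p\<bar> \<le> B3"
    using compact_imp_bounded[OF compact_continuous_image[OF c3 \<open>compact S\<close>]] unfolding bounded_pos by auto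
  define \<eta>' where "\<eta>' = \<eta> / (2 * (1 + k + \<sigma>2))"
  have \<eta>': "0 < \<eta>'" "\<eta>' * (1 + k + \<sigma>2) = \<eta> / 2" using \<eta> k_pos \<sigma>2_pos by (auto simp: \<eta>'_def field_simps)
  have uc: "\<exists>d>0. \<forall>x\<in>S. \<forall>x'\<in>S. dist x' x < d \<longrightarrow> dist (g x') (g x) < \<eta>'"
    if "continuous_on S g" for g :: "real \<times> real \<Rightarrow> real"
    using compact_uniformly_continuous[OF that \<open>compact S\<close>] \<eta>'(1) unfolding uniformly_continuous_on_def by blast
  obtain d1 where d1: "0 < d1" "\<And>x x'. x \<in> S \<Longrightarrow> x' \<in> S \<Longrightarrow> dist x' x < d1 \<Longrightarrow> dist (g1 x') (g1 x) < \<eta>'"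
    using uc[OF c1] by blast
  obtain d2 where d2: "0 < d2" "\<And>x x'. x \<in> S \<Longrightarrow> x' \<in> S \<Longrightarrow> dist x' x < d2 \<Longrightarrow> dist (g2 x') (g2 x) < \<eta>'"
    using uc[OF c2] by blast
  obtain d3 where d3: "0 < d3" "\<And>x x'. x \<in> S \<Longrightarrow> x' \<in> S \<Longrightarrow> dist x' x < d3 \<Longrightarrow> dist (g3 x') (g3 x) < \<eta>'"
    using uc[OF c3] by blast
  define L where "L = 6 / lyC\<^sup>2 + 36 * (2 * R c) / lyC ^ 3 + 54 * (2 * R c)\<^sup>2 / lyC ^ 4 + 24 * (2 * R c) ^ 3 / lyC ^ 5"
  have Rc1: "1 \<le> R c" using a a0 by (intro R_ge_1) simp
  have L0: "0 \<le> L" unfolding L_def using Rc1 lyC_pos by (intro add_nonneg_nonneg divide_nonneg_nonneg mult_nonneg_nonneg zero_le_power) auto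
  \<comment> \<open>The sum of all errors of order \<open>(t - s)\<^bsup>3/2\<^esup>\<close>.\<close>
  define D where "D = B2 * (4 * k * cY c) + 1 / 2 * (B3 * cV c) + L * cY c"
  define d4 where "d4 = (\<eta> / (2 * (\<bar>D\<bar> + 1)))\<^sup>2"
  have d4: "0 < d4" using \<eta> by (auto simp: d4_def add_nonneg_eq_0_iff)
  show ?thesis
  proof (intro exI[of _ "min (min d1 d2) (min d3 d4)"] conjI allI impI)
    show "0 < min (min d1 d2) (min d3 d4)" using d1 d2 d3 d4 by simp
    fix s t assume st: "a \<le> s" "s < t" "t \<le> c" and small: "t - s < min (min d1 d2) (min d3 d4)"
    have s0: "0 \<le> s" and t0: "0 \<le> t" using st a0 by auto
    let ?d = "t - s"
    define x where "x = \<zeta> s"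
    define \<delta> where "\<delta> \<omega> = \<zeta> t \<omega> - \<zeta> s \<omega>" for \<omega>
    \<comment> \<open>The derivatives at time \<open>t\<close>, cut off outside \<open>[-R s, R s]\<close>, where \<open>\<zeta> s\<close> lies almost surely; this makes them bounded everywhere.\<close>
    define h2 where "h2 x = (if \<bar>x\<bar> \<le> R s then lyap_x lyC (R t) x else 0)" for x
    define h3 where "h3 x = (if \<bar>x\<bar> \<le> R s then lyap_xx lyC (R t) x else 0)" for x
    define \<phi>2 where "\<phi>2 \<omega> = indicator A \<omega> * h2 (x \<omega>)" for \<omega>
    define \<phi>3 where "\<phi>3 \<omega> = indicator A \<omega> * h3 (x \<omega>)" for \<omega>
    have AF: "A \<in> sets (F s)" using A sets_F_mono[OF st(1)] by auto
    have AM: "A \<in> sets M" using AF sets_F_subset by auto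
    have xF: "x \<in> borel_measurable (F s)" unfolding x_def by (rule \<zeta>_measurable_F[OF s0])
    have hm: "h2 \<in> borel_measurable borel" "h3 \<in> borel_measurable borel"
      unfolding h2_def h3_def lyap_x_def lyap_xx_def by measurable
    have \<phi>2F: "\<phi>2 \<in> borel_measurable (F s)" and \<phi>3F: "\<phi>3 \<in> borel_measurable (F s)"
      unfolding \<phi>2_def \<phi>3_def using AF measurable_compose[OF xF hm(1)] measurable_compose[OF xF hm(2)] by auto
    have inS: "(r, x) \<in> S" if "\<bar>x\<bar> \<le> R s" "s \<le> r" "r \<le> t" for r x
      using that R_mono[OF that(2)] st by (auto simp: S_def)
    have hb: "\<bar>h2 x\<bar> \<le> B2" "\<bar>h3 x\<bar> \<le> B3" for x
      using B2 B3 inS[of x t] st by (auto simp: h2_def h3_def g2_def g3_def)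
    have \<phi>b: "\<bar>\<phi>2 \<omega>\<bar> \<le> B2" "\<bar>\<phi>3 \<omega>\<bar> \<le> B3" for \<omega>
      using hb[of "x \<omega>"] B2(1) B3(1) by (auto simp: \<phi>2_def \<phi>3_def indicator_def)
    have E2: "integrable M (\<lambda>\<omega>. \<phi>2 \<omega> * (\<delta> \<omega> - k * side s \<omega> * ?d))"
      "\<bar>expectation (\<lambda>\<omega>. \<phi>2 \<omega> * (\<delta> \<omega> - k * side s \<omega> * ?d))\<bar> \<le> B2 * (4 * k * cY c * (?d * sqrt ?d))"
      unfolding \<delta>_def using \<zeta>_mean[OF s0 st(2,3) \<phi>2F \<phi>b(1)] B2(1) by auto
    have E3: "integrable M (\<lambda>\<omega>. \<phi>3 \<omega> * ((\<delta> \<omega>)\<^sup>2 - \<sigma>2 * side s \<omega> * ?d))"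
      "\<bar>expectation (\<lambda>\<omega>. \<phi>3 \<omega> * ((\<delta> \<omega>)\<^sup>2 - \<sigma>2 * side s \<omega> * ?d))\<bar> \<le> B3 * (cV c * (?d * sqrt ?d))"
      unfolding \<delta>_def using \<zeta>_variance[OF s0 st(2,3) \<phi>3F \<phi>b(2)] B3(1) by auto
    have E4: "integrable M (\<lambda>\<omega>. \<bar>\<delta> \<omega>\<bar> ^ 3)" "expectation (\<lambda>\<omega>. \<bar>\<delta> \<omega>\<bar> ^ 3) \<le> cY c * sqrt ?d ^ 3"
      unfolding \<delta>_def using \<zeta>_diff_moment[OF s0 st(2,3), of 3] by auto
    have pw: "AE \<omega> in M. indicator A \<omega> * V t (\<zeta> t \<omega>) \<le> indicator A \<omega> * V s (\<zeta> s \<omega>) + ?d * (\<eta> / 2)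
       + \<phi>2 \<omega> * (\<delta> \<omega> - k * side s \<omega> * ?d) + 1 / 2 * (\<phi>3 \<omega> * ((\<delta> \<omega>)\<^sup>2 - \<sigma>2 * side s \<omega> * ?d)) + L * \<bar>\<delta> \<omega>\<bar> ^ 3"
      using AE_\<zeta>[OF s0] AE_\<zeta>[OF t0] AE_space
    proof eventually_elim
      case (elim \<omega>)
      let ?x = "\<zeta> s \<omega>" and ?y = "\<zeta> t \<omega>"
      have xs: "\<bar>?x\<bar> \<le> R s" and side: "side s \<omega> = 1 - (?x / R s)\<^sup>2" and yt: "\<bar>?y\<bar> \<le> R t" using elim by auto
      have sr: "0 \<le> side s \<omega>" "side s \<omega> \<le> 1" using side_range[OF elim(3) s0] by auto
      have xt: "\<bar>?x\<bar> \<le> R t" using xs R_mono[of s t] st by simp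
      show ?case
      proof (cases "\<omega> \<in> A")
        case False
        then show ?thesis using st \<eta> L0 by (simp add: \<phi>2_def \<phi>3_def)
      next
        case True
        have \<phi>: "\<phi>2 \<omega> = g2 (t, ?x)" "\<phi>3 \<omega> = g3 (t, ?x)"
          using True xs by (simp_all add: \<phi>2_def \<phi>3_def h2_def h3_def x_def g2_def g3_def)
        have T: "V t ?y \<le> V t ?x + g2 (t, ?x) * \<delta> \<omega> + 1 / 2 * g3 (t, ?x) * (\<delta> \<omega>)\<^sup>2 + L * \<bar>\<delta> \<omega>\<bar> ^ 3"
        proof -
          have nz': "R t + z + lyC \<noteq> 0" if "- R t \<le> z" for z using that lyC_pos by simp
          have "lyap lyC (R t) ?y \<le> lyap lyC (R t) ?x + lyap_x lyC (R t) ?x * (?y - ?x)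
              + 1 / 2 * lyap_xx lyC (R t) ?x * (?y - ?x)\<^sup>2 + L * \<bar>?y - ?x\<bar> ^ 3"
          proof (rule second_order_taylor_le[where a = "- R t" and b = "R t" and f''' = "lyap_xxx lyC (R t)"])
            show "\<bar>lyap_xxx lyC (R t) z\<bar> \<le> L" if "- R t \<le> z" "z \<le> R t" for z
              unfolding L_def using that R_mono[OF st(3)] lyC_pos by (intro lyap_third_bound) auto
          qed (use xt yt in \<open>auto intro!: lyap_derivs nz'\<close>)
          then show ?thesis by (simp add: V_def g2_def g3_def \<delta>_def)
        qed
        have "\<exists>\<theta>>s. \<theta> < t \<and> V t ?x - V s ?x = (t - s) * Vt \<theta> ?x"
        proof (rule MVT2[OF st(2)])
          fix r assume r: "s \<le> r" "r \<le> t"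
          show "((\<lambda>t. V t ?x) has_real_derivative Vt r ?x) (at r)"
            using r s0 xs R_mono[OF r(1)] by (intro V_deriv_t) auto
        qed
        then obtain \<theta> where \<theta>: "s < \<theta>" "\<theta> < t" "V t ?x - V s ?x = ?d * g1 (\<theta>, ?x)" by (auto simp: g1_def)
        have mem: "(\<theta>, ?x) \<in> S" "(s, ?x) \<in> S" "(t, ?x) \<in> S" using inS[OF xs] \<theta> st by auto
        have n1: "g1 (\<theta>, ?x) \<le> g1 (s, ?x) + \<eta>'"
          using d1(2)[OF mem(2,1)] \<theta> small by (simp add: dist_Pair_Pair dist_real_def)
        have n2: "g2 (t, ?x) \<le> g2 (s, ?x) + \<eta>'"
          using d2(2)[OF mem(2,3)] st small by (simp add: dist_Pair_Pair dist_real_def)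
        have n3: "g3 (t, ?x) \<le> g3 (s, ?x) + \<eta>'"
          using d3(2)[OF mem(2,3)] st small by (simp add: dist_Pair_Pair dist_real_def)
        have gen: "g1 (s, ?x) + g2 (s, ?x) * (k * side s \<omega>) + 1 / 2 * g3 (s, ?x) * (\<sigma>2 * side s \<omega>) \<le> 0"
          using generator_V_nonpos[of s ?x] a st xs by (simp add: g1_def g2_def g3_def side)
        have k1: "0 \<le> k * side s \<omega>" "k * side s \<omega> \<le> k" "0 \<le> \<sigma>2 * side s \<omega>" "\<sigma>2 * side s \<omega> \<le> \<sigma>2"
          using sr k_pos \<sigma>2_pos by (auto intro: mult_left_le)
        have "g1 (\<theta>, ?x) + g2 (t, ?x) * (k * side s \<omega>) + 1 / 2 * g3 (t, ?x) * (\<sigma>2 * side s \<omega>)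
          \<le> (g1 (s, ?x) + \<eta>') + (g2 (s, ?x) + \<eta>') * (k * side s \<omega>) + 1 / 2 * (g3 (s, ?x) + \<eta>') * (\<sigma>2 * side s \<omega>)"
          using n1 n2 n3 k1 by (intro add_mono mult_right_mono mult_left_mono) auto
        also have "\<dots> \<le> \<eta>' + \<eta>' * (k * side s \<omega>) + 1 / 2 * (\<eta>' * (\<sigma>2 * side s \<omega>))"
          using gen by (simp add: algebra_simps)
        also have "\<dots> \<le> \<eta>' + \<eta>' * k + \<eta>' * \<sigma>2"
        proof -
          have "\<eta>' * (k * side s \<omega>) \<le> \<eta>' * k" "\<eta>' * (\<sigma>2 * side s \<omega>) \<le> \<eta>' * \<sigma>2" "0 \<le> \<eta>' * (\<sigma>2 * side s \<omega>)"
            using k1 \<eta>'(1) by (auto intro: mult_left_mono)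
          then show ?thesis by linarith
        qed
        also have "\<dots> = \<eta> / 2" using \<eta>'(2) by (simp add: algebra_simps)
        finally have "?d * (g1 (\<theta>, ?x) + g2 (t, ?x) * (k * side s \<omega>) + 1 / 2 * g3 (t, ?x) * (\<sigma>2 * side s \<omega>)) \<le> ?d * (\<eta> / 2)"
          using st by (intro mult_left_mono) auto
        then have "V t ?y \<le> V s ?x + ?d * (\<eta> / 2) + g2 (t, ?x) * (\<delta> \<omega> - k * side s \<omega> * ?d)
          + 1 / 2 * (g3 (t, ?x) * ((\<delta> \<omega>)\<^sup>2 - \<sigma>2 * side s \<omega> * ?d)) + L * \<bar>\<delta> \<omega>\<bar> ^ 3"
        proof -
          assume h: "?d * (g1 (\<theta>, ?x) + g2 (t, ?x) * (k * side s \<omega>) + 1 / 2 * g3 (t, ?x) * (\<sigma>2 * side s \<omega>)) \<le> ?d * (\<eta> / 2)"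
          have "Vy \<le> Vs + E + b2 * (dl - ks * d) + 1 / 2 * (b3 * (dl2 - ss * d)) + l"
            if "Vy \<le> Vx + b2 * dl + 1 / 2 * b3 * dl2 + l" "Vx - Vs = d * b1" "d * (b1 + b2 * ks + 1 / 2 * b3 * ss) \<le> E"
            for Vy Vs Vx E b1 b2 b3 dl dl2 ks ss d l :: real
            using that by (simp add: algebra_simps)
          from this[OF T \<theta>(3) h] show ?thesis .
        qed
        then show ?thesis using True unfolding \<phi> by simp
      qed
    qed
    have Vi: "integrable M (\<lambda>\<omega>. indicator A \<omega> * V t (\<zeta> t \<omega>))" "integrable M (\<lambda>\<omega>. indicator A \<omega> * V s (\<zeta> s \<omega>))"
      using V_integrable[OF t0 AM] V_integrable[OF s0 AM] by auto
    have "expectation (\<lambda>\<omega>. indicator A \<omega> * V t (\<zeta> t \<omega>)) \<le> expectation (\<lambda>\<omega>. indicator A \<omega> * V s (\<zeta> s \<omega>) + ?d * (\<eta> / 2)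
       + \<phi>2 \<omega> * (\<delta> \<omega> - k * side s \<omega> * ?d) + 1 / 2 * (\<phi>3 \<omega> * ((\<delta> \<omega>)\<^sup>2 - \<sigma>2 * side s \<omega> * ?d)) + L * \<bar>\<delta> \<omega>\<bar> ^ 3)"
      by (rule integral_mono_AE[OF Vi(1) _ pw]) (use Vi(2) E2(1) E3(1) E4(1) in simp)
    also have "\<dots> = expectation (\<lambda>\<omega>. indicator A \<omega> * V s (\<zeta> s \<omega>)) + ?d * (\<eta> / 2)
       + expectation (\<lambda>\<omega>. \<phi>2 \<omega> * (\<delta> \<omega> - k * side s \<omega> * ?d))
       + 1 / 2 * expectation (\<lambda>\<omega>. \<phi>3 \<omega> * ((\<delta> \<omega>)\<^sup>2 - \<sigma>2 * side s \<omega> * ?d)) + L * expectation (\<lambda>\<omega>. \<bar>\<delta> \<omega>\<bar> ^ 3)"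
      using Vi(2) E2(1) E3(1) E4(1) by (simp add: prob_space)
    also have "\<dots> \<le> expectation (\<lambda>\<omega>. indicator A \<omega> * V s (\<zeta> s \<omega>)) + ?d * (\<eta> / 2)
       + B2 * (4 * k * cY c * (?d * sqrt ?d)) + 1 / 2 * (B3 * (cV c * (?d * sqrt ?d))) + L * (cY c * sqrt ?d ^ 3)"
      using E2(2) E3(2) E4(2) L0 by (intro add_mono mult_left_mono order_refl) auto
    also have "\<dots> = expectation (\<lambda>\<omega>. indicator A \<omega> * V s (\<zeta> s \<omega>)) + ?d * (\<eta> / 2) + D * sqrt ?d * ?d"
    proof -
      have "sqrt ?d ^ 3 = sqrt ?d * sqrt ?d * sqrt ?d" by (simp add: power3_eq_cube)
      also have "\<dots> = ?d * sqrt ?d" using st by simp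
      finally have s3: "sqrt ?d ^ 3 = ?d * sqrt ?d" .
      have "b * (q * (d * S)) + 1 / 2 * (b' * (c * (d * S))) + l * (y * (d * S)) = (b * q + 1 / 2 * (b' * c) + l * y) * S * d"
        for b q d S b' c l y :: real by (simp add: algebra_simps)
      then show ?thesis unfolding s3 D_def add.assoc by simp
    qed
    also have "\<dots> \<le> expectation (\<lambda>\<omega>. indicator A \<omega> * V s (\<zeta> s \<omega>)) + ?d * (\<eta> / 2) + \<eta> / 2 * ?d"
    proof (intro add_left_mono mult_right_mono)
      have "sqrt ?d \<le> sqrt d4" using small by simp
      also have "\<dots> = \<eta> / (2 * (\<bar>D\<bar> + 1))" using \<eta> by (simp add: d4_def)
      finally have "(\<bar>D\<bar> + 1) * sqrt ?d \<le> \<eta> / 2" by (simp add: field_simps)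
      moreover have "D * sqrt ?d \<le> (\<bar>D\<bar> + 1) * sqrt ?d" using st by (intro mult_right_mono) auto
      ultimately show "D * sqrt ?d \<le> \<eta> / 2" by linarith
    qed (use st in simp)
    finally show "expectation (\<lambda>\<omega>. indicator A \<omega> * V t (\<zeta> t \<omega>)) \<le> expectation (\<lambda>\<omega>. indicator A \<omega> * V s (\<zeta> s \<omega>)) + \<eta> * ?d"
      by (simp add: field_simps)
  qed
qed

lemma V_supermartingale:
  assumes "T0 \<le> s" "s \<le> t" "A \<in> sets (F s)"
  shows "expectation (\<lambda>\<omega>. indicator A \<omega> * V t (\<zeta> t \<omega>)) \<le> expectation (\<lambda>\<omega>. indicator A \<omega> * V s (\<zeta> s \<omega>))"
  by (rule le_of_small_increments[OF assms(2)]) (rule V_step[OF assms])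

lemma V_level_event:
  assumes "0 \<le> t" shows "{\<omega>\<in>space M. l \<le> V t (\<zeta> t \<omega>)} \<in> sets M"
  using measurable_sets[OF measurable_F_imp[OF V_measurable[OF assms]], of "{l..}"]
  by (simp add: vimage_def Int_def conj_commute)

text \<open>The maximal inequality for finitely many times. The induction removes the earliest time \<open>m\<close>: on the
  event \<open>B\<close> the level is reached at \<open>m\<close>, and off \<open>B\<close> the inequality for the remaining times, started
  at \<open>m\<close>, applies.\<close>

lemma V_maximal_finite:
  assumes D: "finite D" and l: "0 < l"
  shows "T0 \<le> s \<Longrightarrow> (\<forall>t\<in>D. s \<le> t) \<Longrightarrow> A \<in> sets (F s) \<Longrightarrow>
    l * prob {\<omega>\<in>A. \<exists>t\<in>D. l \<le> V t (\<zeta> t \<omega>)} \<le> expectation (\<lambda>\<omega>. indicator A \<omega> * V s (\<zeta> s \<omega>))"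
  using D
proof (induction D arbitrary: s A rule: finite_linorder_min_induct)
  case empty
  have "AE \<omega> in M. 0 \<le> indicator A \<omega> * V s (\<zeta> s \<omega>)"
    using AE_\<zeta>[of s] T0_nonneg empty
    by (auto elim!: eventually_mono simp: indicator_def intro: V_bounds)
  then have "0 \<le> expectation (\<lambda>\<omega>. indicator A \<omega> * V s (\<zeta> s \<omega>))" by (rule integral_nonneg_AE)
  then show ?case by simp
next
  case (insert m D)
  have m: "T0 \<le> m" "s \<le> m" "0 \<le> m" using insert.prems T0_nonneg by auto
  define B where "B = {\<omega>\<in>space M. l \<le> V m (\<zeta> m \<omega>)}"
  have BF: "B \<in> sets (F m)"
    using measurable_sets[OF V_measurable[OF m(3)], of "{l..}"] by (simp add: B_def vimage_def Int_def conj_commute)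
  have AF: "A \<in> sets (F m)" using insert.prems(3) sets_F_mono[OF m(2)] by auto
  have AM: "A \<in> sets M" and BM: "B \<in> sets M" using AF BF sets_F_subset by auto
  have AB: "A - B \<in> sets (F m)" using AF BF by (rule sets.Diff)
  let ?Q = "{\<omega>\<in>A - B. \<exists>t\<in>D. l \<le> V t (\<zeta> t \<omega>)}"
  have QM: "?Q \<in> sets M"
  proof -
    have "?Q = (A - B) \<inter> (\<Union>t\<in>D. {\<omega>\<in>space M. l \<le> V t (\<zeta> t \<omega>)})"
      using sets.sets_into_space[OF AM] by auto
    also have "\<dots> \<in> sets M"
    proof (intro sets.Int sets.Diff AM BM sets.finite_UN insert.hyps(1))
      fix t assume "t \<in> D"
      then have "0 \<le> t" using insert.hyps(2) m(3) by force
      then show "{\<omega>\<in>space M. l \<le> V t (\<zeta> t \<omega>)} \<in> sets M" by (rule V_level_event)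
    qed
    finally show ?thesis .
  qed
  have "{\<omega>\<in>A. \<exists>t\<in>insert m D. l \<le> V t (\<zeta> t \<omega>)} = (A \<inter> B) \<union> ?Q"
    using sets.sets_into_space[OF AM] by (auto simp: B_def)
  then have "prob {\<omega>\<in>A. \<exists>t\<in>insert m D. l \<le> V t (\<zeta> t \<omega>)} \<le> prob (A \<inter> B) + prob ?Q"
    using measure_Un_le[of "A \<inter> B" M ?Q] AM BM QM by simp
  then have "l * prob {\<omega>\<in>A. \<exists>t\<in>insert m D. l \<le> V t (\<zeta> t \<omega>)} \<le> l * prob (A \<inter> B) + l * prob ?Q"
    using l by (simp add: distrib_left[symmetric])
  also have "l * prob (A \<inter> B) \<le> expectation (\<lambda>\<omega>. indicator (A \<inter> B) \<omega> * V m (\<zeta> m \<omega>))"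
  proof -
    have "l * prob (A \<inter> B) = expectation (\<lambda>\<omega>. indicator (A \<inter> B) \<omega> * l)" using AM BM by simp
    also have "\<dots> \<le> expectation (\<lambda>\<omega>. indicator (A \<inter> B) \<omega> * V m (\<zeta> m \<omega>))"
    proof (rule integral_mono)
      show "integrable M (\<lambda>\<omega>. indicator (A \<inter> B) \<omega> * l)"
        using AM BM by (intro integrable_mult_left integrable_real_indicator) (auto simp: less_top[symmetric])
      show "integrable M (\<lambda>\<omega>. indicator (A \<inter> B) \<omega> * V m (\<zeta> m \<omega>))"
        using AM BM by (intro V_integrable m) auto
    qed (auto simp: indicator_def B_def)
    finally show ?thesis .
  qed
  also have "l * prob ?Q \<le> expectation (\<lambda>\<omega>. indicator (A - B) \<omega> * V m (\<zeta> m \<omega>))"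
    using insert.hyps(2) by (intro insert.IH m AB) (auto intro: less_imp_le)
  also have "expectation (\<lambda>\<omega>. indicator (A \<inter> B) \<omega> * V m (\<zeta> m \<omega>)) + expectation (\<lambda>\<omega>. indicator (A - B) \<omega> * V m (\<zeta> m \<omega>))
    = expectation (\<lambda>\<omega>. indicator A \<omega> * V m (\<zeta> m \<omega>))"
  proof -
    have split: "(\<lambda>\<omega>. indicator A \<omega> * V m (\<zeta> m \<omega>))
      = (\<lambda>\<omega>. indicator (A \<inter> B) \<omega> * V m (\<zeta> m \<omega>) + indicator (A - B) \<omega> * V m (\<zeta> m \<omega>))"
      by (auto simp: indicator_def fun_eq_iff)
    show ?thesis unfolding split
      by (rule Bochner_Integration.integral_add[symmetric]; rule V_integrable[OF m(3)])
        (use AM BM in auto)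
  qed
  also have "\<dots> \<le> expectation (\<lambda>\<omega>. indicator A \<omega> * V s (\<zeta> s \<omega>))"
    using insert.prems m by (intro V_supermartingale) auto
  finally show ?case by simp
qed

lemma V_maximal:
  assumes l: "0 < l"
  shows "l * prob {\<omega>\<in>space M. \<exists>t\<in>\<rat> \<inter> {T0..}. l \<le> V t (\<zeta> t \<omega>)} \<le> expectation (\<lambda>\<omega>. V T0 (\<zeta> T0 \<omega>))"
proof -
  let ?Q = "\<rat> \<inter> {T0..}"
  have Qne: "?Q \<noteq> {}" using closure_Rats_atLeast[of T0] by force
  have Qc: "countable ?Q" using countable_rat by auto
  define q where "q = from_nat_into ?Q"
  have Qr: "range q = ?Q" unfolding q_def by (rule range_from_nat_into[OF Qne Qc])
  then have q: "T0 \<le> q i" for i by (metis IntE atLeast_iff rangeI)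
  define E where "E n = {\<omega>\<in>space M. \<exists>t\<in>q ` {..<n}. l \<le> V t (\<zeta> t \<omega>)}" for n :: nat
  have EM: "E n \<in> sets M" for n
  proof -
    have "E n = (\<Union>i\<in>{..<n}. {\<omega>\<in>space M. l \<le> V (q i) (\<zeta> (q i) \<omega>)})" by (auto simp: E_def)
    also have "\<dots> \<in> sets M" using V_level_event q T0_nonneg order_trans by (intro sets.finite_UN) blast+
    finally show ?thesis .
  qed
  have "l * prob (E n) \<le> expectation (\<lambda>\<omega>. V T0 (\<zeta> T0 \<omega>))" for n
  proof -
    have "l * prob {\<omega>\<in>space M. \<exists>t\<in>q ` {..<n}. l \<le> V t (\<zeta> t \<omega>)} \<le> expectation (\<lambda>\<omega>. indicator (space M) \<omega> * V T0 (\<zeta> T0 \<omega>))"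
      using q sets.top[of "F T0"] by (intro V_maximal_finite[OF _ l]) auto
    also have "\<dots> = expectation (\<lambda>\<omega>. V T0 (\<zeta> T0 \<omega>))" by (intro Bochner_Integration.integral_cong) auto
    finally show ?thesis by (simp add: E_def)
  qed
  moreover have "(\<lambda>n. l * prob (E n)) \<longlonglongrightarrow> l * prob (\<Union>n. E n)"
    by (intro tendsto_mult_left finite_Lim_measure_incseq) (use EM in \<open>auto simp: incseq_def E_def\<close>)
  ultimately have "l * prob (\<Union>n. E n) \<le> expectation (\<lambda>\<omega>. V T0 (\<zeta> T0 \<omega>))"
    by (intro LIMSEQ_le_const2) auto
  moreover have "(\<Union>n. E n) = {\<omega>\<in>space M. \<exists>t\<in>?Q. l \<le> V t (\<zeta> t \<omega>)}"
    unfolding Qr[symmetric] by (auto simp: E_def)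
  ultimately show ?thesis by simp
qed

lemma AE_V_bounded: "AE \<omega> in M. \<exists>n :: nat. \<forall>t\<in>\<rat> \<inter> {T0..}. V t (\<zeta> t \<omega>) < real (Suc n)"
proof -
  let ?Q = "\<rat> \<inter> {T0..}"
  define E where "E n = {\<omega>\<in>space M. \<exists>t\<in>?Q. real (Suc n) \<le> V t (\<zeta> t \<omega>)}" for n :: nat
  define m where "m = expectation (\<lambda>\<omega>. V T0 (\<zeta> T0 \<omega>))"
  have EM: "E n \<in> sets M" for n
  proof -
    have "E n = (\<Union>t\<in>?Q. {\<omega>\<in>space M. real (Suc n) \<le> V t (\<zeta> t \<omega>)})" by (auto simp: E_def)
    also have "\<dots> \<in> sets M"
      using T0_nonneg countable_rat by (intro sets.countable_UN'') (auto intro!: V_level_event)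
    finally show ?thesis .
  qed
  have le: "prob (\<Inter>n. E n) \<le> m / real (Suc n)" for n
  proof -
    have "prob (\<Inter>n. E n) \<le> prob (E n)" using EM by (intro finite_measure_mono) auto
    also have "\<dots> \<le> m / real (Suc n)"
      using V_maximal[of "real (Suc n)"] by (simp add: E_def m_def field_simps)
    finally show ?thesis .
  qed
  have "(\<lambda>n. m / real (Suc n)) \<longlonglongrightarrow> 0" using LIMSEQ_Suc[OF lim_const_over_n[of m]] by simp
  then have "prob (\<Inter>n. E n) \<le> 0" using le by (intro LIMSEQ_le_const) auto
  then have "prob (\<Inter>n. E n) = 0" by (simp add: measure_le_0_iff)
  moreover have "(\<Inter>n. E n) \<in> sets M" using EM by auto
  ultimately have "(\<Inter>n. E n) \<in> null_sets M" by (simp add: emeasure_eq_measure null_setsI)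
  from AE_not_in[OF this] AE_space show ?thesis
  proof eventually_elim
    case (elim \<omega>)
    then obtain n where "\<omega> \<notin> E n" by auto
    then show ?case using elim(2) by (intro exI[of _ n]) (auto simp: E_def not_le)
  qed
qed

lemma R_at_top: "filterlim R at_top at_top"
proof -
  have "filterlim (\<lambda>t. rate * t) at_top at_top"
    by (rule filterlim_tendsto_pos_mult_at_top[OF tendsto_const rate_pos filterlim_ident])
  then have "filterlim (\<lambda>t. 1 + rate * t) at_top at_top"
    by (rule filterlim_tendsto_add_at_top[OF tendsto_const])
  then show ?thesis unfolding R_def by (rule filterlim_compose[OF sqrt_at_top])
qed

lemma \<mu>_inner_e_tendsto: "AE \<omega> in M. ((\<lambda>t. \<mu> t \<omega> \<bullet> e) \<longlongrightarrow> 1) at_top"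
  using AE_V_bounded norm_Y AE_good
proof eventually_elim
  case (elim \<omega>)
  then obtain n :: nat where n: "\<And>t. t \<in> \<rat> \<inter> {T0..} \<Longrightarrow> V t (\<zeta> t \<omega>) \<le> real (Suc n)" by (force intro: less_imp_le)
  have \<omega>: "\<omega> \<in> space M" using elim by (simp add: good_def)
  have z: "\<zeta> t \<omega> = R t * (\<mu> t \<omega> \<bullet> e)" if "0 \<le> t" for t
    using good_\<mu>(3)[OF elim(3) that] elim(2) that by (metis \<zeta>_def inner_scaleR_left)
  have zr: "\<bar>\<zeta> t \<omega>\<bar> \<le> R t" if "0 \<le> t" for t
    using Cauchy_Schwarz_ineq2[of "Y t \<omega>" e] elim(2) that norm_e by (simp add: \<zeta>_def)
  have "continuous_on {T0..} (\<lambda>t. V t (\<zeta> t \<omega>))"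
  proof -
    have "continuous_on {T0..} (\<lambda>t. Y t \<omega>)" using T0_nonneg by (intro continuous_on_subset[OF continuous_on_Y[OF \<omega>]]) auto
    moreover have "R t \<noteq> 0 \<and> R t + \<zeta> t \<omega> + lyC \<noteq> 0" if "T0 \<le> t" for t
      using R_ge_1[of t] zr[of t] T0_nonneg lyC_pos that by (auto simp: abs_le_iff)
    ultimately show ?thesis
      unfolding V_def lyap_def \<zeta>_def R_def by (intro continuous_intros) auto
  qed
  then have Vle: "V t (\<zeta> t \<omega>) \<le> real (Suc n)" if "T0 \<le> t" for t
    using continuous_le_on_closure[of "\<rat> \<inter> {T0..}" "\<lambda>t. V t (\<zeta> t \<omega>)" t "real (Suc n)"] n that
    by (simp add: closure_Rats_atLeast)
  have cube: "(1 - \<mu> t \<omega> \<bullet> e) ^ 3 \<le> real (Suc n) * (2 + lyC)\<^sup>2 / R t" if t: "T0 \<le> t" for t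
  proof -
    have t0: "0 \<le> t" using t T0_nonneg by simp
    have R1: "1 \<le> R t" using R_ge_1[OF t0] .
    have "\<zeta> t \<omega> \<le> R t" "- R t \<le> \<zeta> t \<omega>" using zr[OF t0] by (auto simp: abs_le_iff)
    moreover have "lyC \<le> lyC * R t" using mult_left_mono[OF R1, of lyC] lyC_pos by simp
    ultimately have q: "0 < R t + \<zeta> t \<omega> + lyC" "R t + \<zeta> t \<omega> + lyC \<le> (2 + lyC) * R t"
      using lyC_pos unfolding distrib_right by linarith+
    have "lyap lyC (R t) (\<zeta> t \<omega>) \<le> real (Suc n)"
      using Vle[OF t] lyK_pos R1 divide_nonneg_nonneg[of lyK "R t"] unfolding V_def by linarith
    then have "(R t - \<zeta> t \<omega>) ^ 3 \<le> real (Suc n) * (R t + \<zeta> t \<omega> + lyC)\<^sup>2"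
      using q(1) by (simp add: lyap_def field_simps)
    also have "\<dots> \<le> real (Suc n) * ((2 + lyC) * R t)\<^sup>2"
      using q by (intro mult_left_mono power_mono) auto
    finally have "R t ^ 3 * (1 - \<mu> t \<omega> \<bullet> e) ^ 3 \<le> real (Suc n) * ((2 + lyC) * R t)\<^sup>2"
      unfolding z[OF t0] by (simp add: power_mult_distrib[symmetric] right_diff_distrib)
    then have "(R t)\<^sup>2 * (R t * (1 - \<mu> t \<omega> \<bullet> e) ^ 3) \<le> (R t)\<^sup>2 * (real (Suc n) * (2 + lyC)\<^sup>2)"
      by (simp add: power_mult_distrib power2_eq_square power3_eq_cube mult_ac)
    then have "R t * (1 - \<mu> t \<omega> \<bullet> e) ^ 3 \<le> real (Suc n) * (2 + lyC)\<^sup>2"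
      using R1 by (subst (asm) mult_le_cancel_left_pos) auto
    then show ?thesis using R1 by (simp add: field_simps)
  qed
  have upper: "((\<lambda>t. real (Suc n) * (2 + lyC)\<^sup>2 / R t) \<longlongrightarrow> 0) at_top"
    by (rule real_tendsto_divide_at_top[OF tendsto_const R_at_top])
  have "((\<lambda>t. (1 - \<mu> t \<omega> \<bullet> e) ^ 3) \<longlongrightarrow> 0) at_top"
  proof (rule tendsto_sandwich[OF _ _ tendsto_const upper])
    show "\<forall>\<^sub>F t in at_top. 0 \<le> (1 - \<mu> t \<omega> \<bullet> e) ^ 3"
      using eventually_ge_at_top[of 0]
    proof eventually_elim
      case (elim t)
      then show ?case using abs_\<mu>_e_le[OF \<omega>, of t] by (intro zero_le_power) auto
    qed
    show "\<forall>\<^sub>F t in at_top. (1 - \<mu> t \<omega> \<bullet> e) ^ 3 \<le> real (Suc n) * (2 + lyC)\<^sup>2 / R t"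
      using eventually_ge_at_top[of T0] by eventually_elim (rule cube)
  qed
  then have "((\<lambda>t. root 3 ((1 - \<mu> t \<omega> \<bullet> e) ^ 3)) \<longlongrightarrow> root 3 0) at_top" by (rule tendsto_real_root)
  then have "((\<lambda>t. 1 - \<mu> t \<omega> \<bullet> e) \<longlongrightarrow> 0) at_top" by (simp add: odd_real_root_power_cancel)
  from tendsto_diff[OF tendsto_const[of 1] this] show ?case by simp
qed

end

theorem theorem5:
  fixes M :: "'a measure"
    and W Y \<mu> :: "real \<Rightarrow> 'a \<Rightarrow> real ^ 3"
    and b y :: "real ^ 3"
    and \<alpha> \<epsilon> :: real
  assumes "brownian_motion M W"
    and "\<alpha> > 0" and "\<epsilon> > 0"
    and "y \<in> sphere 0 1"
    and "strong_solution M W b \<alpha> \<epsilon> y Y \<mu>"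
  shows "AE \<omega> in M. ((\<lambda>t. \<mu> t \<omega> \<bullet> b) \<longlongrightarrow> norm b) at_top"
proof (cases "b = 0")
  case False
  interpret brownian_motion M W by fact
  interpret spin_diffusion_field M W b y \<alpha> \<epsilon> Y \<mu>
    by unfold_locales (use assms False in auto)
  show ?thesis
    using \<mu>_inner_e_tendsto
  proof eventually_elim
    case (elim \<omega>)
    have "\<mu> t \<omega> \<bullet> b = norm b * (\<mu> t \<omega> \<bullet> e)" for t by (subst b_eq) simp
    then show ?case using tendsto_mult_left[OF elim, of "norm b"] by simp
  qed
qed simp

end
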